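(* Let $(R,\mathfrak{m},k)$ be a local ring, and let $I$ be an ideal of $R$ with $I\cap \mathfrak{m}^2 =\mathfrak{m} I$. If $R/I$ is a Koszul $R$-module, then $R\to R/I$ is a large homomorphism and $R \to R/\mathfrak{m} I$ is a Golod homomorphism.
   Context: All local rings $(R,\mathfrak{m},k)$ are commutative Noetherian with maximal ideal $\mathfrak{m}$ and residue field $k$. Quotients considered as local rings are by proper ideals. Let $M$ be a finitely generated $R$-module with minimal free resolution $F$. The complex $F$ is filtered by the subcomplexes $\mathcal{F}^pF$ with $(\mathcal{F}^pF)_i=\mathfrak{m}^{p-i}F_i$ (where $\mathfrak m^j=R$ for $j\le 0$), and $\operatorname{lin}^R(F)$ denotes the associated graded complex; it is a complex of graded free modules over $\operatorname{gr}_{\mathfrak m}(R)=\bigoplus_{i\ge0}\mathfrak m^i/\mathfrak m^{i+1}$ with $\operatorname{lin}^R(F)_i=\operatorname{gr}_{\mathfrak m}(F_i)(-i)$. The linearity defect is $\operatorname{ld}_R(M)=\sup\{i\mid \operatorname{H}_i(\operatorname{lin}^R(F))\neq0\}$. $M$ is called a Koszul module if $\operatorname{lin}^R(F)$ is acyclic (no homology in positive degrees), equivalently $\operatorname{ld}_R(M)=0$. A surjective local homomorphism $f:R\to S$ (with common residue field $k$) is large if the induced map $\operatorname{Tor}^R_*(k,k)\to\operatorname{Tor}^S_*(k,k)$ is surjective. With $\operatorname{P}^R_M(t)=\sum_{i\ge0}\dim_k\operatorname{Tor}^R_i(M,k)\,t^i$, the map $f$ is Golod if $\operatorname{P}^S_k(t)=\dfrac{\operatorname{P}^R_k(t)}{1-t(\operatorname{P}^R_S(t)-1)}$.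 *)

theory Defs
  imports
    "HOL-Algebra.QuotRing"
    "HOL-Algebra.Module"
    "HOL-Algebra.Ideal_Product"
    "HOL-Algebra.Ring_Divisibility"
    "HOL-Computational_Algebra.Formal_Power_Series"
begin

section \<open>Local rings\<close>

definition local_ring :: "('a, 'r) ring_scheme \<Rightarrow> bool" where
  "local_ring R \<longleftrightarrow> cring R \<and> noetherian_ring R \<and> (\<exists>!M. maximalideal M R)"

definition max_ideal :: "('a, 'r) ring_scheme \<Rightarrow> 'a set" where
  "max_ideal R = (THE M. maximalideal M R)"

definition residue_field :: "('a, 'r) ring_scheme \<Rightarrow> 'a set ring" where
  "residue_field R = R Quot max_ideal R"

definition residue_map :: "('a, 'r) ring_scheme \<Rightarrow> 'a \<Rightarrow> 'a set" where
  "residue_map R r = max_ideal R +>\<^bsub>R\<^esub> r"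

definition surj_local_hom ::
  "('a, 'r) ring_scheme \<Rightarrow> ('b, 's) ring_scheme \<Rightarrow> ('a \<Rightarrow> 'b) \<Rightarrow> bool" where
  "surj_local_hom R S f \<longleftrightarrow>
     local_ring R \<and> local_ring S \<and> f \<in> ring_hom R S \<and>
     f ` carrier R = carrier S \<and> f ` max_ideal R \<subseteq> max_ideal S"

(* The map of cosets [x] |-> N + f x in the additive group of C induced by f.  For f compatible
   with the cosets the image below is a singleton. *)
definition coset_map :: "('b, 's) ring_scheme \<Rightarrow> 'b set \<Rightarrow> ('a \<Rightarrow> 'b) \<Rightarrow> 'a set \<Rightarrow> 'b set" where
  "coset_map C N f X = the_elem ((\<lambda>x. N +>\<^bsub>C\<^esub> f x) ` X)"

definition residue_field_map :: "('b, 's) ring_scheme \<Rightarrow> ('a \<Rightarrow> 'b) \<Rightarrow> 'a set \<Rightarrow> 'b set" where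
  "residue_field_map S f = coset_map S (max_ideal S) f"


section \<open>Modules\<close>

(* The fields mult and one of a module record play no role in the locale module. *)

definition ring_as_module :: "('b, 's) ring_scheme \<Rightarrow> ('a \<Rightarrow> 'b) \<Rightarrow> ('a, 'b) module" where
  "ring_as_module S f =
     \<lparr>carrier = carrier S, monoid.mult = monoid.mult S, one = one S, zero = zero S, add = add S,
      smult = (\<lambda>r x. f r \<otimes>\<^bsub>S\<^esub> x)\<rparr>"

definition free_module :: "('a, 'r) ring_scheme \<Rightarrow> nat \<Rightarrow> ('a, nat \<Rightarrow> 'a) module" where
  "free_module R n =
     \<lparr>carrier = {..<n} \<rightarrow>\<^sub>E carrier R, monoid.mult = undefined, one = undefined,
      zero = (\<lambda>j\<in>{..<n}. \<zero>\<^bsub>R\<^esub>),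
      add = (\<lambda>x y. \<lambda>j\<in>{..<n}. x j \<oplus>\<^bsub>R\<^esub> y j),
      smult = (\<lambda>r x. \<lambda>j\<in>{..<n}. r \<otimes>\<^bsub>R\<^esub> x j)\<rparr>"

definition quot_module :: "('a, 'm) module \<Rightarrow> 'm set \<Rightarrow> ('a, 'm set) module" where
  "quot_module M N =
     \<lparr>carrier = a_rcosets\<^bsub>M\<^esub> N, monoid.mult = undefined, one = undefined,
      zero = N, add = set_add M,
      smult = (\<lambda>r X. \<Union>x\<in>X. N +>\<^bsub>M\<^esub> (r \<odot>\<^bsub>M\<^esub> x))\<rparr>"

definition ideal_times_module ::
  "('a, 'r) ring_scheme \<Rightarrow> 'a set \<Rightarrow> ('a, 'm) module \<Rightarrow> 'm set" where
  "ideal_times_module R J M =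
     \<Inter>{N. submodule N R M \<and> (\<forall>a\<in>J. \<forall>x\<in>carrier M. a \<odot>\<^bsub>M\<^esub> x \<in> N)}"

definition linear_maps ::
  "('a, 'r) ring_scheme \<Rightarrow> ('a, 'm) module \<Rightarrow> ('a, 'n) module \<Rightarrow> ('m \<Rightarrow> 'n) set" where
  "linear_maps R M N =
     {h \<in> carrier M \<rightarrow> carrier N.
        (\<forall>x\<in>carrier M. \<forall>y\<in>carrier M. h (x \<oplus>\<^bsub>M\<^esub> y) = h x \<oplus>\<^bsub>N\<^esub> h y) \<and>
        (\<forall>r\<in>carrier R. \<forall>x\<in>carrier M. h (r \<odot>\<^bsub>M\<^esub> x) = r \<odot>\<^bsub>N\<^esub> h x)}"

definition vdim :: "('a, 'r) ring_scheme \<Rightarrow> ('a, 'm) module \<Rightarrow> nat" where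
  "vdim K V =
     (THE n. \<exists>h \<in> linear_maps K (free_module K n) V.
               bij_betw h (carrier (free_module K n)) (carrier V))"


section \<open>Complexes and homology\<close>

(* A complex is a family of modules C i, i >= 0, with d i : C i -> C (i - 1) for i >= 1;
   d 0 is the zero map out of the complex, whatever its value. *)

definition cycles :: "(nat \<Rightarrow> ('a, 'm) module) \<Rightarrow> (nat \<Rightarrow> 'm \<Rightarrow> 'm) \<Rightarrow> nat \<Rightarrow> 'm set" where
  "cycles C d i = {x \<in> carrier (C i). i = 0 \<or> d i x = \<zero>\<^bsub>C (i - 1)\<^esub>}"

definition boundaries :: "(nat \<Rightarrow> ('a, 'm) module) \<Rightarrow> (nat \<Rightarrow> 'm \<Rightarrow> 'm) \<Rightarrow> nat \<Rightarrow> 'm set" where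
  "boundaries C d i = d (Suc i) ` carrier (C (Suc i))"

definition homology ::
  "(nat \<Rightarrow> ('a, 'm) module) \<Rightarrow> (nat \<Rightarrow> 'm \<Rightarrow> 'm) \<Rightarrow> nat \<Rightarrow> ('a, 'm set) module" where
  "homology C d i = quot_module ((C i)\<lparr>carrier := cycles C d i\<rparr>) (boundaries C d i)"


section \<open>Free resolutions\<close>

(* Complexes of finitely generated free modules: F_i = R^(rk F i), and for i >= 1 the differential
   F_i -> F_(i-1) is given by the matrix dif F i, with entry dif F i r c in row r and column c. *)
record 'a free_complex =
  rk :: "nat \<Rightarrow> nat"
  dif :: "nat \<Rightarrow> nat \<Rightarrow> nat \<Rightarrow> 'a"

definition mat_apply ::
  "('a, 'r) ring_scheme \<Rightarrow> nat \<Rightarrow> nat \<Rightarrow> (nat \<Rightarrow> nat \<Rightarrow> 'a) \<Rightarrow> (nat \<Rightarrow> 'a) \<Rightarrow> (nat \<Rightarrow> 'a)" where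
  "mat_apply R p q A x = (\<lambda>r\<in>{..<p}. \<Oplus>\<^bsub>R\<^esub>c\<in>{..<q}. A r c \<otimes>\<^bsub>R\<^esub> x c)"

definition fmod :: "('a, 'r) ring_scheme \<Rightarrow> 'a free_complex \<Rightarrow> nat \<Rightarrow> ('a, nat \<Rightarrow> 'a) module" where
  "fmod R F i = free_module R (rk F i)"

definition fdif ::
  "('a, 'r) ring_scheme \<Rightarrow> 'a free_complex \<Rightarrow> nat \<Rightarrow> (nat \<Rightarrow> 'a) \<Rightarrow> (nat \<Rightarrow> 'a)" where
  "fdif R F i = mat_apply R (rk F (i - 1)) (rk F i) (dif F i)"

definition free_resolution ::
  "('a, 'r) ring_scheme \<Rightarrow> ('a, 'm) module \<Rightarrow> 'a free_complex \<Rightarrow> ((nat \<Rightarrow> 'a) \<Rightarrow> 'm) \<Rightarrow> bool" where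
  "free_resolution R M F \<epsilon> \<longleftrightarrow>
     (\<forall>i\<ge>1. \<forall>r<rk F (i - 1). \<forall>c<rk F i. dif F i r c \<in> carrier R) \<and>
     (\<forall>i\<ge>1. cycles (fmod R F) (fdif R F) i = boundaries (fmod R F) (fdif R F) i) \<and>
     \<epsilon> \<in> linear_maps R (fmod R F 0) M \<and>
     \<epsilon> ` carrier (fmod R F 0) = carrier M \<and>
     {x \<in> carrier (fmod R F 0). \<epsilon> x = \<zero>\<^bsub>M\<^esub>} = boundaries (fmod R F) (fdif R F) 0"

definition minimal_complex :: "('a, 'r) ring_scheme \<Rightarrow> 'a free_complex \<Rightarrow> bool" where
  "minimal_complex R F \<longleftrightarrow>
     (\<forall>i\<ge>1. boundaries (fmod R F) (fdif R F) (i - 1)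
              \<subseteq> ideal_times_module R (max_ideal R) (fmod R F (i - 1)))"


section \<open>The linear part and Koszul modules\<close>

(* filt R F p i is m^(p-i) F_i; truncated subtraction accounts for m^j = R when j <= 0. *)
definition filt :: "('a, 'r) ring_scheme \<Rightarrow> 'a free_complex \<Rightarrow> nat \<Rightarrow> nat \<Rightarrow> (nat \<Rightarrow> 'a) set" where
  "filt R F p i =
     ideal_times_module R (max_ideal R [^]\<^bsub>ideals_set R\<^esub> (p - i)) (fmod R F i)"

(* lin F is the direct sum over p of the subquotient complexes filt p / filt (p + 1); lin_mod and
   lin_dif describe the summand with index p.  The negative p are omitted: there the filtration is
   constant and the subquotient is 0. *)
definition lin_mod ::
  "('a, 'r) ring_scheme \<Rightarrow> 'a free_complex \<Rightarrow> nat \<Rightarrow> nat \<Rightarrow> ('a, (nat \<Rightarrow> 'a) set) module" where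
  "lin_mod R F p i = quot_module ((fmod R F i)\<lparr>carrier := filt R F p i\<rparr>) (filt R F (p + 1) i)"

definition lin_dif ::
  "('a, 'r) ring_scheme \<Rightarrow> 'a free_complex \<Rightarrow> nat \<Rightarrow> nat \<Rightarrow> (nat \<Rightarrow> 'a) set \<Rightarrow> (nat \<Rightarrow> 'a) set" where
  "lin_dif R F p i = coset_map (fmod R F (i - 1)) (filt R F (p + 1) (i - 1)) (fdif R F i)"

(* Minimal free resolutions are unique up to isomorphism, so the choice of F does not matter. *)
definition koszul_module :: "('a, 'r) ring_scheme \<Rightarrow> ('a, 'm) module \<Rightarrow> bool" where
  "koszul_module R M \<longleftrightarrow>
     (\<exists>F \<epsilon>. free_resolution R M F \<epsilon> \<and> minimal_complex R F \<and>
        (\<forall>i\<ge>1. \<forall>p. let H = homology (lin_mod R F p) (lin_dif R F p) i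
                    in carrier H = {\<zero>\<^bsub>H\<^esub>}))"


section \<open>Tor and Poincare series\<close>

definition chosen_resolution ::
  "('a, 'r) ring_scheme \<Rightarrow> ('a, 'm) module \<Rightarrow> 'a free_complex \<times> ((nat \<Rightarrow> 'a) \<Rightarrow> 'm)" where
  "chosen_resolution R M = (SOME (F, \<epsilon>). free_resolution R M F \<epsilon>)"

(* The complex of A-modules obtained by tensoring F with A along h : R -> A. *)
definition base_change :: "('a \<Rightarrow> 'b) \<Rightarrow> 'a free_complex \<Rightarrow> 'b free_complex" where
  "base_change h F = \<lparr>rk = rk F, dif = (\<lambda>i r c. h (dif F i r c))\<rparr>"

(* The chosen resolution of M tensored with k. *)
definition res_tensor_k :: "('a, 'r) ring_scheme \<Rightarrow> ('a, 'm) module \<Rightarrow> 'a set free_complex" where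
  "res_tensor_k R M = base_change (residue_map R) (fst (chosen_resolution R M))"

(* Tor_i^R(M, k), for a finitely generated M, as a vector space over k. *)
definition Tor_k ::
  "('a, 'r) ring_scheme \<Rightarrow> ('a, 'm) module \<Rightarrow> nat \<Rightarrow> ('a set, (nat \<Rightarrow> 'a set) set) module" where
  "Tor_k R M i =
     homology (fmod (residue_field R) (res_tensor_k R M)) (fdif (residue_field R) (res_tensor_k R M)) i"

definition poincare_series :: "('a, 'r) ring_scheme \<Rightarrow> ('a, 'm) module \<Rightarrow> rat fps" where
  "poincare_series R M = Abs_fps (\<lambda>i. of_nat (vdim (residue_field R) (Tor_k R M i)))"

definition residue_module :: "('a, 'r) ring_scheme \<Rightarrow> ('a, 'a set) module" where
  "residue_module R = ring_as_module (residue_field R) (residue_map R)"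


section \<open>Large and Golod homomorphisms\<close>

(* The f-semilinear map R^q -> S^p with matrix A over S, i.e. the S-linear map from the
   base change of R^q to S, restricted to R^q. *)
definition semilin_apply ::
  "('b, 's) ring_scheme \<Rightarrow> nat \<Rightarrow> nat \<Rightarrow> (nat \<Rightarrow> nat \<Rightarrow> 'b) \<Rightarrow> ('a \<Rightarrow> 'b) \<Rightarrow> (nat \<Rightarrow> 'a) \<Rightarrow> (nat \<Rightarrow> 'b)" where
  "semilin_apply S p q A f x = mat_apply S p q A (\<lambda>j\<in>{..<q}. f (x j))"

(* A is a family of matrices over S defining a chain map F -> G over f : R -> S which lifts
   the map h : M -> N along the augmentations of F and G. *)
definition chain_lift ::
  "('a, 'r) ring_scheme \<Rightarrow> ('b, 's) ring_scheme \<Rightarrow> ('a \<Rightarrow> 'b) \<Rightarrow> ('m \<Rightarrow> 'n) \<Rightarrow>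
   'a free_complex \<times> ((nat \<Rightarrow> 'a) \<Rightarrow> 'm) \<Rightarrow> 'b free_complex \<times> ((nat \<Rightarrow> 'b) \<Rightarrow> 'n) \<Rightarrow>
   (nat \<Rightarrow> nat \<Rightarrow> nat \<Rightarrow> 'b) \<Rightarrow> bool" where
  "chain_lift R S f h F\<epsilon> G\<eta> A \<longleftrightarrow>
     (let F = fst F\<epsilon>; \<epsilon> = snd F\<epsilon>; G = fst G\<eta>; \<eta> = snd G\<eta>;
          \<phi> = (\<lambda>i. semilin_apply S (rk G i) (rk F i) (A i) f)
      in (\<forall>i. \<forall>r<rk G i. \<forall>c<rk F i. A i r c \<in> carrier S) \<and>
         (\<forall>i\<ge>1. \<forall>x\<in>carrier (fmod R F i). \<phi> (i - 1) (fdif R F i x) = fdif S G i (\<phi> i x)) \<and>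
         (\<forall>x\<in>carrier (fmod R F 0). \<eta> (\<phi> 0 x) = h (\<epsilon> x)))"

(* The map Tor_i^R(k, k) -> Tor_i^S(k, k) defined by a chain map with matrices A over S. *)
definition Tor_kk_map ::
  "('a, 'r) ring_scheme \<Rightarrow> ('b, 's) ring_scheme \<Rightarrow> ('a \<Rightarrow> 'b) \<Rightarrow> (nat \<Rightarrow> nat \<Rightarrow> nat \<Rightarrow> 'b) \<Rightarrow>
   nat \<Rightarrow> (nat \<Rightarrow> 'a set) set \<Rightarrow> (nat \<Rightarrow> 'b set) set" where
  "Tor_kk_map R S f A i =
     (let kF = res_tensor_k R (residue_module R); kG = res_tensor_k S (residue_module S); l = residue_field S
      in coset_map (fmod l kG i) (boundaries (fmod l kG) (fdif l kG) i)
           (semilin_apply l (rk kG i) (rk kF i) (\<lambda>r c. residue_map S (A i r c)) (residue_field_map S f)))"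

(* Any two chain maps lifting the map of residue fields are homotopic, so the choice of A does
   not matter. *)
definition large_hom ::
  "('a, 'r) ring_scheme \<Rightarrow> ('b, 's) ring_scheme \<Rightarrow> ('a \<Rightarrow> 'b) \<Rightarrow> bool" where
  "large_hom R S f \<longleftrightarrow>
     surj_local_hom R S f \<and>
     (\<exists>A. chain_lift R S f (residue_field_map S f)
            (chosen_resolution R (residue_module R)) (chosen_resolution S (residue_module S)) A \<and>
          (\<forall>i. Tor_kk_map R S f A i ` carrier (Tor_k R (residue_module R) i)
                 = carrier (Tor_k S (residue_module S) i)))"

definition golod_hom ::
  "('a, 'r) ring_scheme \<Rightarrow> ('b, 's) ring_scheme \<Rightarrow> ('a \<Rightarrow> 'b) \<Rightarrow> bool" where
  "golod_hom R S f \<longleftrightarrow>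
     surj_local_hom R S f \<and>
     poincare_series S (residue_module S) =
       poincare_series R (residue_module R) /
         (1 - fps_X * (poincare_series R (ring_as_module S f) - 1))"

end

theory Submission
 imports Defs
begin

text \<open>Let \<open>k = R / \<mm>\<close>, and write \<open>H(M)\<close> for \<open>Tor\<^sup>R(k, M)\<close>, the homology of a free resolution \<open>X\<close> of \<open>k\<close> with
 coefficients in \<open>M\<close>.  Let \<open>F\<close> be a minimal free resolution of \<open>R / I\<close> with acyclic linear part.  In the lowest
 internal degree acyclicity says that for a syzygy \<open>N \<subseteq> F\<^sub>j\<close> the map \<open>N / \<mm>N \<rightarrow> \<mm>F\<^sub>j / \<mm>\<^sup>2F\<^sub>j\<close> is injective.
 So \<open>\<mm>F\<^sub>j = N + W\<close> with \<open>W \<inter> N \<subseteq> \<mm>N\<close>, and an induction on the homological degree, simultaneous for all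
 syzygies, shows that \<open>H(\<mm>M) \<rightarrow> H(M)\<close> is zero for \<open>M = R / I\<close> and for \<open>M = I\<close> (\<open>linear_complex_null\<close>).

 The map for \<open>M = R / I\<close> controls the change of rings.  If a module \<open>E\<close> over \<open>T = R / I\<close> has the syzygy
 \<open>N \<subseteq> \<mm>T\<^sup>b\<close>, then \<open>H(N) \<rightarrow> H(T\<^sup>b)\<close> factors through \<open>H(\<mm>T\<^sup>b)\<close> and is zero.  The long exact sequences therefore
 split into short ones.  By induction along the syzygies this gives \<open>P\<^sup>R\<^sub>k = P\<^sup>T\<^sub>k \<cdot> P\<^sup>R\<^sub>T\<close>
 (\<open>betti_product_regular\<close>), and the surjectivity of the comparison map on Tor, that is, largeness
 (\<open>homology_surjective\<close>).

 For the Golod property let \<open>S = R / \<mm>I\<close> and let \<open>n\<close> be the minimal number of generators of \<open>I\<close>.  Because of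
 \<open>I \<inter> \<mm>\<^sup>2 = \<mm>I\<close> the \<open>k\<close>-space \<open>I / \<mm>I\<close> is a direct summand of the maximal ideal of \<open>S\<close>.  So over \<open>S\<close>, too, the
 maximal ideal of \<open>T\<close> maps to zero in homology (\<open>null_quotient\<close>), which gives \<open>P\<^sup>S\<^sub>k = P\<^sup>T\<^sub>k \<cdot> P\<^sup>S\<^sub>T\<close>, and
 \<open>P\<^sup>S\<^sub>T = 1 + ntP\<^sup>S\<^sub>k\<close> as the first syzygy of \<open>T\<close> is \<open>k\<^sup>n\<close>.  Since \<open>H(\<mm>I) \<rightarrow> H(I)\<close> is zero, the exact
 sequence \<open>0 \<rightarrow> I / \<mm>I \<rightarrow> S \<rightarrow> T \<rightarrow> 0\<close> determines \<open>P\<^sup>R\<^sub>S\<close> from \<open>P\<^sup>R\<^sub>k\<close> and \<open>P\<^sup>R\<^sub>T\<close> (\<open>betti_relations\<close>).  These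
 equations yield the Golod formula (\<open>golod_series\<close>).

 All complexes live over \<open>R\<close>.  A resolution over a quotient \<open>R / K\<close> is lifted to matrices over \<open>R\<close> that are exact
 modulo \<open>K\<close>, and homology with coefficients in a quotient \<open>B / A\<close> is described by its preimages in \<open>B\<close>; so maps
 between coefficient modules are inclusions of sets, and Betti numbers become relative dimensions of submodules.
 The Poincare series of the \<open>R\<close>-module \<open>S\<close>, which is defined with a resolution of \<open>S\<close>, is compared with \<open>H(S)\<close> by
 the symmetry of Tor (\<open>betti_balance\<close>).\<close>

section \<open>Notation\<close>

text \<open>Operations of a module with the module as a bracketed argument.\<close>

abbreviation (input) madd ("(_ \<oplus>[_]/ _)" [65, 0, 66] 65) where "x \<oplus>[M] y \<equiv> x \<oplus>\<^bsub>M\<^esub> y"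
abbreviation (input) msmult ("(_ \<odot>[_]/ _)" [71, 0, 70] 70) where "r \<odot>[M] x \<equiv> r \<odot>\<^bsub>M\<^esub> x"
abbreviation (input) mzero ("\<zero>[_]") where "\<zero>[M] \<equiv> \<zero>\<^bsub>M\<^esub>"
abbreviation (input) "fm \<equiv> free_module"

section \<open>Submodules, linear maps and spans\<close>

lemma (in module) submoduleI_smult:
 assumes "H \<subseteq> carrier M" "\<zero>[M] \<in> H"
  and "\<And>a b. a \<in> H ==> b \<in> H ==> a \<oplus>[M] b \<in> H"
  and "\<And>a x. a \<in> carrier R ==> x \<in> H ==> a \<odot>[M] x \<in> H"
 shows "submodule H R M"
proof (rule submoduleI)
 fix a assume a: "a \<in> H"
 then have "\<ominus>\<^bsub>M\<^esub> a = (\<ominus> \<one>) \<odot>[M] a"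
  using assms(1) smult_l_minus[of \<one> a] by auto
 then show "\<ominus>\<^bsub>M\<^esub> a \<in> H" using assms(4)[of "\<ominus> \<one>" a] a by simp
qed (use assms in auto)

context
 fixes R :: "('a, 'r) ring_scheme" and M :: "('a, 'm, 'x) module_scheme" and N
 assumes sub: "submodule N R M"
begin

interpretation submodule N R M by (rule sub)

lemma submodule_carrier: "x \<in> N ==> x \<in> carrier M"
 using subset by auto

lemma submodule_zero: "\<zero>[M] \<in> N"
 using one_closed by simp

lemma submodule_add: "x \<in> N ==> y \<in> N ==> x \<oplus>[M] y \<in> N"
 using m_closed by simp

lemma submodule_smult: "r \<in> carrier R ==> x \<in> N ==> r \<odot>[M] x \<in> N"
 by (rule smult_closed)

lemma submodule_neg: "x \<in> N ==> \<ominus>\<^bsub>M\<^esub> x \<in> N"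
 using m_inv_closed unfolding a_inv_def by simp

end

context module
begin

lemma submodule_cancel:
 assumes N: "submodule N R M" and "a \<in> N" "b \<in> carrier M" "a \<oplus>[M] b \<in> N"
 shows "b \<in> N"
proof -
 have "b = \<ominus>\<^bsub>M\<^esub> a \<oplus>[M] (a \<oplus>[M] b)"
  using submodule_carrier[OF N assms(2)] assms(3) by (simp add: M.r_neg1)
 then show ?thesis
  using submodule_add[OF N submodule_neg[OF N assms(2)] assms(4)] by simp
qed

lemma submodule_cancel2:
 assumes N: "submodule N R M" and "a \<in> N" "b \<in> carrier M" "b \<oplus>[M] a \<in> N"
 shows "b \<in> N"
 using submodule_cancel[OF assms(1-3)] assms(2-4) submodule_carrier[OF N] by (simp add: M.a_comm)

lemma ex_diff:
 assumes "x \<in> carrier M" "y \<in> carrier M"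
 obtains w where "w \<in> carrier M" "x = y \<oplus>[M] w"
proof
 show "\<ominus>\<^bsub>M\<^esub> y \<oplus>[M] x \<in> carrier M" "x = y \<oplus>[M] (\<ominus>\<^bsub>M\<^esub> y \<oplus>[M] x)"
  using assms by (simp_all add: M.r_neg2)
qed

lemma ex_diff_mem:
 assumes N: "submodule N R M" and "x \<in> N" "y \<in> N"
 obtains w where "w \<in> N" "x = y \<oplus>[M] w"
 using ex_diff submodule_cancel[OF N] assms submodule_carrier[OF N] by metis

lemma submodule_finsum:
 assumes N: "submodule N R M" and "finite I" "\<And>i. i \<in> I ==> f i \<in> N"
 shows "(\<Oplus>\<^bsub>M\<^esub>i\<in>I. f i) \<in> N"
 using assms(2,3)
proof (induction I rule: finite_induct)
 case empty then show ?case by (simp add: submodule_zero[OF N])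
next
 case (insert i I)
 then have "(\<Oplus>\<^bsub>M\<^esub>i\<in>insert i I. f i) = f i \<oplus>[M] (\<Oplus>\<^bsub>M\<^esub>i\<in>I. f i)"
  using submodule_carrier[OF N] by (intro M.finsum_insert) auto
 then show ?case using insert submodule_add[OF N] by simp
qed

end

lemma linear_mapsD:
 assumes "f \<in> linear_maps R M N"
 shows "x \<in> carrier M ==> f x \<in> carrier N"
  and "x \<in> carrier M ==> y \<in> carrier M ==> f (x \<oplus>[M] y) = f x \<oplus>[N] f y"
  and "r \<in> carrier R ==> x \<in> carrier M ==> f (r \<odot>[M] x) = r \<odot>[N] f x"
 using assms unfolding linear_maps_def by auto

lemma linear_mapsI:
 assumes "\<And>x. x \<in> carrier M ==> f x \<in> carrier N"
  and "\<And>x y. x \<in> carrier M ==> y \<in> carrier M ==> f (x \<oplus>[M] y) = f x \<oplus>[N] f y"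
  and "\<And>r x. r \<in> carrier R ==> x \<in> carrier M ==> f (r \<odot>[M] x) = r \<odot>[N] f x"
 shows "f \<in> linear_maps R M N"
 using assms unfolding linear_maps_def by auto

lemma linear_map_zero:
 assumes "module R M" "module R N" "f \<in> linear_maps R M N"
 shows "f \<zero>[M] = \<zero>[N]"
proof -
 interpret M: module R M by fact
 interpret N: module R N by fact
 have "f (\<zero>[R] \<odot>[M] \<zero>[M]) = \<zero>[R] \<odot>[N] f \<zero>[M]"
  by (intro linear_mapsD(3)[OF assms(3)]) auto
 moreover have "f \<zero>[M] \<in> carrier N" by (intro linear_mapsD(1)[OF assms(3)]) auto
 ultimately show ?thesis by simp
qed

lemma linear_map_finsum:
 assumes M: "module R M" and N: "module R N" and f: "f \<in> linear_maps R M N"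
  and "finite I" "\<And>i. i \<in> I ==> g i \<in> carrier M"
 shows "f (\<Oplus>\<^bsub>M\<^esub>i\<in>I. g i) = (\<Oplus>\<^bsub>N\<^esub>i\<in>I. f (g i))"
 using assms(4,5)
proof (induction I rule: finite_induct)
 interpret M: module R M by fact
 interpret N: module R N by fact
 {
  case empty then show ?case using linear_map_zero[OF M N f] by simp
 next
  case (insert i I)
  then have "(\<Oplus>\<^bsub>M\<^esub>j\<in>insert i I. g j) = g i \<oplus>[M] (\<Oplus>\<^bsub>M\<^esub>i\<in>I. g i)"
   by (intro M.M.finsum_insert) auto
  moreover have "(\<Oplus>\<^bsub>N\<^esub>i\<in>insert i I. f (g i)) = f (g i) \<oplus>[N] (\<Oplus>\<^bsub>N\<^esub>i\<in>I. f (g i))"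
   using insert linear_mapsD(1)[OF f] by (intro N.M.finsum_insert) auto
  moreover have "(\<Oplus>\<^bsub>M\<^esub>i\<in>I. g i) \<in> carrier M" using insert by (intro M.M.finsum_closed) auto
  ultimately show ?case using insert linear_mapsD[OF f] by simp
 }
qed

lemma linear_map_comp:
 assumes "f \<in> linear_maps R M N" "g \<in> linear_maps R N P"
 shows "(\<lambda>x. g (f x)) \<in> linear_maps R M P"
 by (rule linear_mapsI) (simp_all add: linear_mapsD[OF assms(1)] linear_mapsD[OF assms(2)])

lemma submodule_vimage:
 assumes M: "module R M" and N: "module R N" and f: "f \<in> linear_maps R M N"
  and A: "submodule A R M" and B: "submodule B R N"
 shows "submodule {x \<in> A. f x \<in> B} R M"
proof -
 interpret M: module R M by fact
 interpret N: module R N by fact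
 show ?thesis
  by (rule M.submoduleI_smult)
   (use submodule_carrier[OF A] submodule_zero[OF A] submodule_zero[OF B] linear_map_zero[OF M N f]
     linear_mapsD[OF f] submodule_add[OF A] submodule_add[OF B] submodule_smult[OF A]
     submodule_smult[OF B] in auto)
qed

text \<open>Sums of an image and a submodule cover images, sums of two submodules, and the boundaries of
 the complexes below.\<close>

lemma submodule_image_add:
 assumes M: "module R M" and N: "module R N" and f: "f \<in> linear_maps R M N"
  and A: "submodule A R M" and B: "submodule B R N"
 shows "submodule {y. \<exists>x\<in>A. \<exists>b\<in>B. y = f x \<oplus>[N] b} R N"
proof -
 interpret M: module R M by fact
 interpret N: module R N by fact
 note c = linear_mapsD(1)[OF f submodule_carrier[OF A]] submodule_carrier[OF B]
 show ?thesis
 proof (rule N.submoduleI_smult)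
  show "{y. \<exists>x\<in>A. \<exists>b\<in>B. y = f x \<oplus>[N] b} \<subseteq> carrier N" using c by auto
  show "\<zero>[N] \<in> {y. \<exists>x\<in>A. \<exists>b\<in>B. y = f x \<oplus>[N] b}"
   using submodule_zero[OF A] submodule_zero[OF B] linear_map_zero[OF M N f]
   by (auto intro!: bexI[of _ "\<zero>[M]"] bexI[of _ "\<zero>[N]"])
 next
  fix y y' assume "y \<in> {y. \<exists>x\<in>A. \<exists>b\<in>B. y = f x \<oplus>[N] b}" "y' \<in> {y. \<exists>x\<in>A. \<exists>b\<in>B. y = f x \<oplus>[N] b}"
  then obtain x b x' b' where h: "x \<in> A" "b \<in> B" "y = f x \<oplus>[N] b" "x' \<in> A" "b' \<in> B" "y' = f x' \<oplus>[N] b'"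
   by auto
  then have "y \<oplus>[N] y' = f (x \<oplus>[M] x') \<oplus>[N] (b \<oplus>[N] b')"
   using c linear_mapsD(2)[OF f] submodule_carrier[OF A] by (simp add: N.M.a_ac)
  then show "y \<oplus>[N] y' \<in> {y. \<exists>x\<in>A. \<exists>b\<in>B. y = f x \<oplus>[N] b}"
   using h submodule_add[OF A] submodule_add[OF B] by blast
 next
  fix r y assume r: "r \<in> carrier R" and "y \<in> {y. \<exists>x\<in>A. \<exists>b\<in>B. y = f x \<oplus>[N] b}"
  then obtain x b where h: "x \<in> A" "b \<in> B" "y = f x \<oplus>[N] b" by auto
  then have "r \<odot>[N] y = f (r \<odot>[M] x) \<oplus>[N] r \<odot>[N] b"
   using c r linear_mapsD(3)[OF f] submodule_carrier[OF A] by (simp add: N.smult_r_distr)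
  then show "r \<odot>[N] y \<in> {y. \<exists>x\<in>A. \<exists>b\<in>B. y = f x \<oplus>[N] b}"
   using h r submodule_smult[OF A] submodule_smult[OF B] by blast
 qed
qed

lemma submodule_Inter:
 assumes M: "module R M" and "\<And>N. N \<in> \<N> ==> submodule N R M" "\<N> \<noteq> {}"
 shows "submodule (\<Inter>\<N>) R M"
proof -
 interpret M: module R M by fact
 show ?thesis
 proof (rule M.submoduleI_smult)
  show "\<Inter>\<N> \<subseteq> carrier M" using assms(3) by (force dest: assms(2) intro: submodule_carrier)
 qed (auto intro: submodule_zero[OF assms(2)] submodule_add[OF assms(2)] submodule_smult[OF assms(2)])
qed

definition submodule_span :: "('a, 'r) ring_scheme => ('a, 'm) module => 'm set => 'm set" where
 "submodule_span R M S = \<Inter>{N. submodule N R M \<and> S \<subseteq> N}"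

lemma span_submodule:
 assumes "module R M" "S \<subseteq> carrier M"
 shows "submodule (submodule_span R M S) R M"
 unfolding submodule_span_def using assms module.carrier_is_submodule[OF assms(1)]
 by (intro submodule_Inter) auto

lemma span_incl: "S \<subseteq> submodule_span R M S"
 unfolding submodule_span_def by auto

lemma span_least: "submodule N R M ==> S \<subseteq> N ==> submodule_span R M S \<subseteq> N"
 unfolding submodule_span_def by auto

lemma span_mono: "S \<subseteq> T ==> submodule_span R M S \<subseteq> submodule_span R M T"
 unfolding submodule_span_def by auto

lemma id_linear: "(\<lambda>x. x) \<in> linear_maps R M M"
 by (rule linear_mapsI) auto

text \<open>Splitting a span.\<close>

lemma span_UnE:
 assumes M: "module R M" and A: "submodule A R M" and S: "S \<subseteq> carrier M"
  and x: "x \<in> submodule_span R M (A \<union> S)"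
 obtains t a where "t \<in> submodule_span R M S" "a \<in> A" "x = t \<oplus>[M] a"
proof -
 interpret M: module R M by fact
 let ?Q = "{y. \<exists>x\<in>submodule_span R M S. \<exists>b\<in>A. y = x \<oplus>[M] b}"
 have sS: "submodule (submodule_span R M S) R M" using span_submodule M S by auto
 have Q: "submodule ?Q R M"
  using submodule_image_add[OF M M id_linear sS A] by simp
 have "A \<subseteq> ?Q"
 proof
  fix a assume "a \<in> A"
  then have "\<zero>[M] \<in> submodule_span R M S" "a \<in> A" "a = \<zero>[M] \<oplus>[M] a"
   using submodule_zero[OF sS] submodule_carrier[OF A] by auto
  then show "a \<in> ?Q" by blast
 qed
 moreover have "S \<subseteq> ?Q"
 proof
  fix a assume a: "a \<in> S"
  then have "a \<in> submodule_span R M S" using span_incl[of S R M] by auto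
  then have "a \<in> submodule_span R M S" "a = a \<oplus>[M] \<zero>[M]" "\<zero>[M] \<in> A"
   using submodule_zero[OF A] a S by auto
  then show "a \<in> ?Q" by blast
 qed
 ultimately have "submodule_span R M (A \<union> S) \<subseteq> ?Q" by (intro span_least Q) auto
 then show ?thesis using x that by auto
qed

lemma span_insertE:
 assumes M: "module R M" and S: "S \<subseteq> carrier M" and v: "v \<in> carrier M"
  and x: "x \<in> submodule_span R M (insert v S)"
 obtains t r where "t \<in> submodule_span R M S" "r \<in> carrier R" "x = t \<oplus>[M] r \<odot>[M] v"
proof -
 interpret M: module R M by fact
 let ?Q = "{y. \<exists>t\<in>submodule_span R M S. \<exists>r\<in>carrier R. y = t \<oplus>[M] r \<odot>[M] v}"
 have sS: "submodule (submodule_span R M S) R M" using span_submodule M S by auto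
 note c = submodule_carrier[OF sS]
 have "submodule ?Q R M"
 proof (rule M.submoduleI_smult)
  show "?Q \<subseteq> carrier M" using c v by auto
  show "\<zero>[M] \<in> ?Q"
   using submodule_zero[OF sS] v by (auto intro!: bexI[of _ "\<zero>[M]"] bexI[of _ "\<zero>[R]"])
 next
  fix a b assume "a \<in> ?Q" "b \<in> ?Q"
  then obtain t r t' r' where h: "t \<in> submodule_span R M S" "r \<in> carrier R" "a = t \<oplus>[M] r \<odot>[M] v"
   "t' \<in> submodule_span R M S" "r' \<in> carrier R" "b = t' \<oplus>[M] r' \<odot>[M] v" by auto
  then have "a \<oplus>[M] b = (t \<oplus>[M] t') \<oplus>[M] (r \<oplus>[R] r') \<odot>[M] v"
   using c v by (simp add: M.smult_l_distr M.M.a_ac)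
  then show "a \<oplus>[M] b \<in> ?Q" using h submodule_add[OF sS] M.R.a_closed by blast
 next
  fix s b assume s: "s \<in> carrier R" and "b \<in> ?Q"
  then obtain t r where h: "t \<in> submodule_span R M S" "r \<in> carrier R" "b = t \<oplus>[M] r \<odot>[M] v" by auto
  then have "s \<odot>[M] b = s \<odot>[M] t \<oplus>[M] (s \<otimes>\<^bsub>R\<^esub> r) \<odot>[M] v"
   using c v s by (simp add: M.smult_r_distr M.smult_assoc1)
  then show "s \<odot>[M] b \<in> ?Q" using h s submodule_smult[OF sS] M.R.m_closed by blast
 qed
 moreover have "insert v S \<subseteq> ?Q"
 proof -
  have "v \<in> ?Q" using v submodule_zero[OF sS]
   by (auto intro!: bexI[of _ "\<zero>[M]"] bexI[of _ "\<one>\<^bsub>R\<^esub>"])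
  moreover have "s \<in> ?Q" if "s \<in> S" for s
   using that v S span_incl[of S R M] by (auto intro!: bexI[of _ s] bexI[of _ "\<zero>[R]"])
  ultimately show ?thesis by blast
 qed
 ultimately have "submodule_span R M (insert v S) \<subseteq> ?Q" by (rule span_least)
 then show ?thesis using x that by auto
qed

section \<open>Powers of a module and matrices\<close>

abbreviation tuples :: "nat => 'm set => (nat => 'm) set" where
 "tuples n N \<equiv> {..<n} \<rightarrow>\<^sub>E N"

abbreviation (input) vec where "vec R n \<equiv> tuples n (carrier R)"

text \<open>The tensor product of \<open>M\<close> with a free module of rank \<open>n\<close>.\<close>

definition pow :: "('a, 'm) module => nat => ('a, nat => 'm) module" where
 "pow M n =
  \<lparr>carrier = tuples n (carrier M), monoid.mult = undefined, one = undefined,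
   zero = (\<lambda>j\<in>{..<n}. \<zero>[M]),
   add = (\<lambda>x y. \<lambda>j\<in>{..<n}. x j \<oplus>[M] y j),
   smult = (\<lambda>r x. \<lambda>j\<in>{..<n}. r \<odot>[M] x j)\<rparr>"

definition reg :: "('a, 'r) ring_scheme => ('a, 'a) module" where
 "reg R = ring_as_module R (\<lambda>r. r)"

lemma free_pow: "fm R n = pow (reg R) n"
 unfolding free_module_def pow_def reg_def ring_as_module_def by simp

lemma power_module_simps [simp]:
 "carrier (pow M n) = tuples n (carrier M)"
 "\<zero>[pow M n] = (\<lambda>j\<in>{..<n}. \<zero>[M])"
 "x \<oplus>[pow M n] y = (\<lambda>j\<in>{..<n}. x j \<oplus>[M] y j)"
 "r \<odot>[pow M n] x = (\<lambda>j\<in>{..<n}. r \<odot>[M] x j)"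
 unfolding pow_def by auto

lemma regular_module_simps [simp]:
 "carrier (reg R) = carrier R" "\<zero>[reg R] = \<zero>[R]"
 "x \<oplus>[reg R] y = x \<oplus>[R] y" "r \<odot>[reg R] x = r \<otimes>\<^bsub>R\<^esub> x"
 unfolding reg_def ring_as_module_def by auto

lemma tuples_mem: "x \<in> tuples n N ==> j < n ==> x j \<in> N"
 by auto

lemma tuplesI [intro]: "(\<And>j. j < n ==> f j \<in> N) ==> (\<lambda>j\<in>{..<n}. f j) \<in> tuples n N"
 by auto

lemma tuples_eqI:
 assumes "x \<in> tuples n N" "y \<in> tuples n N'" "\<And>j. j < n ==> x j = y j"
 shows "x = y"
 using assms by (intro PiE_ext[of x "{..<n}" "\<lambda>_. UNIV" y]) auto

lemma tuples_mono: "N \<subseteq> N' ==> tuples n N \<subseteq> tuples n N'"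
 by (intro PiE_mono) auto

lemma pow_mod:
 assumes "module R M"
 shows "module R (pow M n)"
proof -
 interpret module R M by fact
 show ?thesis
 proof (rule moduleI[OF R.is_cring])
  show "abelian_group (pow M n)"
  proof (rule abelian_groupI)
   fix x assume "x \<in> carrier (pow M n)"
   then have x: "x \<in> tuples n (carrier M)" by simp
   have "(\<lambda>j\<in>{..<n}. \<ominus>\<^bsub>M\<^esub> x j) \<in> carrier (pow M n)" using tuples_mem[OF x] by auto
   moreover have "(\<lambda>j\<in>{..<n}. \<ominus>\<^bsub>M\<^esub> x j) \<oplus>[pow M n] x = \<zero>[pow M n]"
    using tuples_mem[OF x] M.l_neg by (simp cong: restrict_cong)
   ultimately show "\<exists>y\<in>carrier (pow M n). y \<oplus>[pow M n] x = \<zero>[pow M n]"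
    by blast
  next
   fix x assume "x \<in> carrier (pow M n)"
   then have x: "x \<in> tuples n (carrier M)" by simp
   then show "\<zero>[pow M n] \<oplus>[pow M n] x = x"
    using tuples_mem[OF x] by (intro tuples_eqI[OF _ x]) (auto intro!: tuplesI)
  next
   fix x y z
   assume "x \<in> carrier (pow M n)" "y \<in> carrier (pow M n)" "z \<in> carrier (pow M n)"
   then have "x j \<in> carrier M" "y j \<in> carrier M" "z j \<in> carrier M" if "j < n" for j
    using that by auto
   then show "x \<oplus>[pow M n] y \<oplus>[pow M n] z =
    x \<oplus>[pow M n] (y \<oplus>[pow M n] z)"
    by (auto simp: M.a_assoc intro!: restrict_ext)
  next
   fix x y assume "x \<in> carrier (pow M n)" "y \<in> carrier (pow M n)"
   then have c: "x j \<in> carrier M" "y j \<in> carrier M" if "j < n" for j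
    using that by auto
   then show "x \<oplus>[pow M n] y = y \<oplus>[pow M n] x"
    by (auto simp: M.a_comm intro!: restrict_ext)
   show "x \<oplus>[pow M n] y \<in> carrier (pow M n)" using c by auto
  qed auto
 next
  fix x assume "x \<in> carrier (pow M n)"
  then have x: "x \<in> tuples n (carrier M)" by simp
  then show "\<one>\<^bsub>R\<^esub> \<odot>[pow M n] x = x"
   using tuples_mem[OF x] by (intro tuples_eqI[OF _ x]) (auto intro!: tuplesI)
 next
  fix r x assume "r \<in> carrier R" "x \<in> carrier (pow M n)"
  then show "r \<odot>[pow M n] x \<in> carrier (pow M n)" by auto
 next
  fix r x y assume r: "r \<in> carrier R" "x \<in> carrier (pow M n)" "y \<in> carrier (pow M n)"
  then have "x j \<in> carrier M" "y j \<in> carrier M" if "j < n" for j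
   using that by auto
  then show "r \<odot>[pow M n] (x \<oplus>[pow M n] y) =
    r \<odot>[pow M n] x \<oplus>[pow M n] r \<odot>[pow M n] y"
   using r(1) by (auto simp: smult_r_distr intro!: restrict_ext)
 next
  fix r s x assume r: "r \<in> carrier R" "s \<in> carrier R" "x \<in> carrier (pow M n)"
  then have c: "x j \<in> carrier M" if "j < n" for j
   using that by auto
  then show "(r \<oplus>[R] s) \<odot>[pow M n] x =
    r \<odot>[pow M n] x \<oplus>[pow M n] s \<odot>[pow M n] x"
   using r(1,2) by (auto simp: smult_l_distr intro!: restrict_ext)
  show "(r \<otimes>\<^bsub>R\<^esub> s) \<odot>[pow M n] x = r \<odot>[pow M n] (s \<odot>[pow M n] x)"
   using r(1,2) c by (auto simp: smult_assoc1 intro!: restrict_ext)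
 qed
qed

lemma regular_module_module:
 assumes "cring R"
 shows "module R (reg R)"
proof -
 interpret cring R by fact
 show ?thesis
 proof (rule moduleI[OF is_cring])
  show "abelian_group (reg R)"
  proof (rule abelian_groupI)
   fix x assume "x \<in> carrier (reg R)"
   then show "\<exists>y\<in>carrier (reg R). y \<oplus>[reg R] x = \<zero>[reg R]"
    by (auto intro!: bexI[of _ "\<ominus>\<^bsub>R\<^esub> x"] simp: l_neg)
  qed (auto simp: a_ac)
 qed (auto simp: l_distr r_distr m_assoc)
qed

lemma submodule_tuples:
 assumes M: "module R M" and N: "submodule N R M"
 shows "submodule (tuples n N) R (pow M n)"
proof -
 interpret P: module R "pow M n" using pow_mod[OF M] .
 show ?thesis
 proof (rule P.submoduleI_smult)
  show "tuples n N \<subseteq> carrier (pow M n)"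
   using submodule_carrier[OF N] by auto
 qed (auto intro: submodule_zero[OF N] submodule_add[OF N] submodule_smult[OF N])
qed

lemma submodule_regular_iff_ideal:
 assumes "cring R"
 shows "submodule J R (reg R) \<longleftrightarrow> ideal J R"
proof -
 interpret cring R by fact
 interpret P: module R "reg R" using regular_module_module assms .
 show ?thesis
 proof
  assume J: "submodule J R (reg R)"
  show "ideal J R"
  proof (rule idealI[OF ring_axioms])
   show "subgroup J (add_monoid R)"
    using submodule.axioms(1)[OF J] unfolding subgroup_def
    by (simp add: reg_def ring_as_module_def m_inv_def)
   show "a \<in> J ==> x \<in> carrier R ==> x \<otimes>\<^bsub>R\<^esub> a \<in> J" for a x
    using submodule_smult[OF J] by simp
   then show "a \<in> J ==> x \<in> carrier R ==> a \<otimes>\<^bsub>R\<^esub> x \<in> J" for a x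
    using m_comm submodule_carrier[OF J] by auto
  qed
 next
  assume "ideal J R"
  then interpret ideal J R .
  show "submodule J R (reg R)"
   by (rule P.submoduleI_smult) (auto intro: I_l_closed)
 qed
qed

text \<open>The linear map \<open>M\<^sup>q \<rightarrow> M\<^sup>p\<close> given by a matrix over the ring.\<close>

definition matrix_map ::
 "('a, 'm) module => nat => nat => (nat => nat => 'a) => (nat => 'm) => (nat => 'm)" where
 "matrix_map M p q A x = (\<lambda>r\<in>{..<p}. \<Oplus>\<^bsub>M\<^esub>c\<in>{..<q}. A r c \<odot>[M] x c)"

lemma finsum_regular_module: "finsum (reg R) = finsum R"
 unfolding finsum_def reg_def ring_as_module_def by (intro ext) (simp add: finprod_def)

lemma mat_apply_eq_matrix_map: "mat_apply R p q A = matrix_map (reg R) p q A"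
 unfolding mat_apply_def matrix_map_def finsum_regular_module by simp

lemma matrix_map_tuples:
 assumes M: "module R M" and N: "submodule N R M"
  and A: "\<And>r c. r < p ==> c < q ==> A r c \<in> carrier R" and x: "x \<in> tuples q N"
 shows "matrix_map M p q A x \<in> tuples p N"
proof -
 interpret M: module R M by fact
 show ?thesis unfolding matrix_map_def
  using A x by (intro tuplesI M.submodule_finsum[OF N]) (auto intro: submodule_smult[OF N] tuples_mem)
qed

lemma matrix_map_linear:
 assumes M: "module R M" and A: "\<And>r c. r < p ==> c < q ==> A r c \<in> carrier R"
 shows "matrix_map M p q A \<in> linear_maps R (pow M q) (pow M p)"
proof -
 interpret M: module R M by fact
 show ?thesis
 proof (rule linear_mapsI)
  fix x assume "x \<in> carrier (pow M q)"
  then show "matrix_map M p q A x \<in> carrier (pow M p)"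
   using matrix_map_tuples[OF M M.carrier_is_submodule A, where x = x] by simp
 next
  fix x y assume "x \<in> carrier (pow M q)" "y \<in> carrier (pow M q)"
  then have h: "x \<in> tuples q (carrier M)" "y \<in> tuples q (carrier M)" by auto
  have "(\<Oplus>\<^bsub>M\<^esub>c\<in>{..<q}. A r c \<odot>[M] (x c \<oplus>[M] y c)) =
   (\<Oplus>\<^bsub>M\<^esub>c\<in>{..<q}. A r c \<odot>[M] x c) \<oplus>[M] (\<Oplus>\<^bsub>M\<^esub>c\<in>{..<q}. A r c \<odot>[M] y c)" if "r < p" for r
  proof -
   have "(\<Oplus>\<^bsub>M\<^esub>c\<in>{..<q}. A r c \<odot>[M] (x c \<oplus>[M] y c)) =
    (\<Oplus>\<^bsub>M\<^esub>c\<in>{..<q}. A r c \<odot>[M] x c \<oplus>[M] A r c \<odot>[M] y c)"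
    using A[OF that] tuples_mem[OF h(1)] tuples_mem[OF h(2)]
    by (intro M.M.finsum_cong') (auto simp: M.smult_r_distr)
   also have "\<dots> = (\<Oplus>\<^bsub>M\<^esub>c\<in>{..<q}. A r c \<odot>[M] x c) \<oplus>[M] (\<Oplus>\<^bsub>M\<^esub>c\<in>{..<q}. A r c \<odot>[M] y c)"
    using A[OF that] tuples_mem[OF h(1)] tuples_mem[OF h(2)] by (intro M.M.finsum_addf) auto
   finally show ?thesis .
  qed
  moreover have "(\<Oplus>\<^bsub>M\<^esub>c\<in>{..<q}. A r c \<odot>[M] (\<lambda>j\<in>{..<q}. x j \<oplus>[M] y j) c) =
   (\<Oplus>\<^bsub>M\<^esub>c\<in>{..<q}. A r c \<odot>[M] (x c \<oplus>[M] y c))" if "r < p" for r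
   using A[OF that] tuples_mem[OF h(1)] tuples_mem[OF h(2)] by (intro M.M.finsum_cong') auto
  ultimately show "matrix_map M p q A (x \<oplus>[pow M q] y) =
   matrix_map M p q A x \<oplus>[pow M p] matrix_map M p q A y"
   unfolding matrix_map_def by (auto intro!: restrict_ext)
 next
  fix s x assume s: "s \<in> carrier R" and "x \<in> carrier (pow M q)"
  then have x: "x \<in> tuples q (carrier M)" by auto
  have "(\<Oplus>\<^bsub>M\<^esub>c\<in>{..<q}. A r c \<odot>[M] (\<lambda>j\<in>{..<q}. s \<odot>[M] x j) c) =
   s \<odot>[M] (\<Oplus>\<^bsub>M\<^esub>c\<in>{..<q}. A r c \<odot>[M] x c)" if "r < p" for r
  proof -
   have "s \<odot>[M] (\<Oplus>\<^bsub>M\<^esub>c\<in>{..<q}. A r c \<odot>[M] x c) = (\<Oplus>\<^bsub>M\<^esub>c\<in>{..<q}. s \<odot>[M] (A r c \<odot>[M] x c))"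
    using A[OF that] tuples_mem[OF x] s by (intro M.finsum_smult_ldistr) auto
   also have "\<dots> = (\<Oplus>\<^bsub>M\<^esub>c\<in>{..<q}. A r c \<odot>[M] (\<lambda>j\<in>{..<q}. s \<odot>[M] x j) c)"
    using A[OF that] tuples_mem[OF x] s M.R.m_comm
    by (intro M.M.finsum_cong') (auto simp: M.smult_assoc1[symmetric])
   finally show ?thesis by simp
  qed
  then show "matrix_map M p q A (s \<odot>[pow M q] x) =
   s \<odot>[pow M p] matrix_map M p q A x"
   unfolding matrix_map_def by (auto intro!: restrict_ext)
 qed
qed

text \<open>The linear map \<open>f\<^sup>n : M\<^sup>n \<rightarrow> N\<^sup>n\<close>; matrices act naturally in the module.\<close>

definition tuple_map :: "nat => ('m => 'n) => (nat => 'm) => (nat => 'n)" where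
 "tuple_map n f x = (\<lambda>j\<in>{..<n}. f (x j))"

lemma tuple_map_apply [simp]: "j < n ==> tuple_map n f x j = f (x j)"
 unfolding tuple_map_def by simp

lemma tuple_map_tuples:
 "(\<And>a. a \<in> A ==> f a \<in> B) ==> x \<in> tuples n A ==> tuple_map n f x \<in> tuples n B"
 unfolding tuple_map_def by auto

lemma tuple_map_linear:
 assumes "f \<in> linear_maps R M N"
 shows "tuple_map n f \<in> linear_maps R (pow M n) (pow N n)"
proof (rule linear_mapsI)
 fix x y assume "x \<in> carrier (pow M n)" "y \<in> carrier (pow M n)"
 then have "x j \<in> carrier M" "y j \<in> carrier M" if "j < n" for j
  using that by auto
 then show "tuple_map n f (x \<oplus>[pow M n] y) = tuple_map n f x \<oplus>[pow N n] tuple_map n f y"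
  by (auto simp: tuple_map_def linear_mapsD(2)[OF assms] intro!: restrict_ext)
next
 fix r x assume "x \<in> carrier (pow M n)" and r: "r \<in> carrier R"
 then have x: "x j \<in> carrier M" if "j < n" for j
  using that by auto
 then show "tuple_map n f (r \<odot>[pow M n] x) = r \<odot>[pow N n] tuple_map n f x"
  using r by (auto simp: tuple_map_def linear_mapsD(3)[OF assms] intro!: restrict_ext)
qed (auto simp: tuple_map_def intro!: linear_mapsD(1)[OF assms])

lemma matrix_map_tuple_map:
 assumes M: "module R M" and N: "module R N" and f: "f \<in> linear_maps R M N"
  and A: "\<And>r c. r < p ==> c < q ==> A r c \<in> carrier R" and x: "x \<in> tuples q (carrier M)"
 shows "matrix_map N p q A (tuple_map q f x) = tuple_map p f (matrix_map M p q A x)"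
proof -
 interpret M: module R M by fact
 interpret N: module R N by fact
 have "(\<Oplus>\<^bsub>N\<^esub>c\<in>{..<q}. A r c \<odot>[N] tuple_map q f x c) = f (\<Oplus>\<^bsub>M\<^esub>c\<in>{..<q}. A r c \<odot>[M] x c)" if "r < p" for r
 proof -
  have "f (\<Oplus>\<^bsub>M\<^esub>c\<in>{..<q}. A r c \<odot>[M] x c) = (\<Oplus>\<^bsub>N\<^esub>c\<in>{..<q}. f (A r c \<odot>[M] x c))"
   using A[OF that] tuples_mem[OF x] by (intro linear_map_finsum[OF M N f]) auto
  also have "\<dots> = (\<Oplus>\<^bsub>N\<^esub>c\<in>{..<q}. A r c \<odot>[N] tuple_map q f x c)"
   using A[OF that] tuples_mem[OF x] linear_mapsD[OF f]
   by (intro N.M.finsum_cong') auto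
  finally show ?thesis by simp
 qed
 then show ?thesis unfolding matrix_map_def tuple_map_def[of p] by (auto intro!: restrict_ext)
qed

lemma free_module_simps [simp]:
 "carrier (fm R n) = vec R n"
 "\<zero>[fm R n] = (\<lambda>j\<in>{..<n}. \<zero>[R])"
 "x \<oplus>[fm R n] y = (\<lambda>j\<in>{..<n}. x j \<oplus>[R] y j)"
 "r \<odot>[fm R n] x = (\<lambda>j\<in>{..<n}. r \<otimes>\<^bsub>R\<^esub> x j)"
 unfolding free_module_def by auto

lemma (in cring) free_mod: "module R (fm R n)"
 unfolding free_pow by (intro pow_mod regular_module_module is_cring)

text \<open>The linear map from a free module that sends the basis to given elements.\<close>

definition lin_comb :: "('a, 'm) module => nat => (nat => 'm) => (nat => 'a) => 'm" where
 "lin_comb M n s x = (\<Oplus>\<^bsub>M\<^esub>j\<in>{..<n}. x j \<odot>[M] s j)"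

definition unit_vector :: "('a, 'r) ring_scheme => nat => nat => nat => 'a" where
 "unit_vector R n j = (\<lambda>i\<in>{..<n}. if i = j then \<one>\<^bsub>R\<^esub> else \<zero>[R])"

lemma (in cring) unit_vector_tuples: "unit_vector R n j \<in> vec R n"
 unfolding unit_vector_def by auto

lemma lin_comb_linear:
 assumes M: "module R M" and s: "\<And>j. j < n ==> s j \<in> carrier M"
 shows "lin_comb M n s \<in> linear_maps R (fm R n) M"
proof -
 interpret M: module R M by fact
 show ?thesis
 proof (rule linear_mapsI)
  fix x assume "x \<in> carrier (fm R n)"
  then show "lin_comb M n s x \<in> carrier M"
   unfolding lin_comb_def using s by (intro M.M.finsum_closed) auto
 next
  fix x y assume "x \<in> carrier (fm R n)" "y \<in> carrier (fm R n)"
  then have x: "x j \<in> carrier R" "y j \<in> carrier R" if "j < n" for j using that by auto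
  have "lin_comb M n s (x \<oplus>[fm R n] y) = (\<Oplus>\<^bsub>M\<^esub>j\<in>{..<n}. x j \<odot>[M] s j \<oplus>[M] y j \<odot>[M] s j)"
   unfolding lin_comb_def using s x by (intro M.M.finsum_cong') (auto simp: M.smult_l_distr)
  also have "\<dots> = lin_comb M n s x \<oplus>[M] lin_comb M n s y"
   unfolding lin_comb_def using s x by (intro M.M.finsum_addf) auto
  finally show "lin_comb M n s (x \<oplus>[fm R n] y) = lin_comb M n s x \<oplus>[M] lin_comb M n s y" .
 next
  fix r x assume r: "r \<in> carrier R" and "x \<in> carrier (fm R n)"
  then have x: "x j \<in> carrier R" if "j < n" for j using that by auto
  have "r \<odot>[M] lin_comb M n s x = (\<Oplus>\<^bsub>M\<^esub>j\<in>{..<n}. r \<odot>[M] (x j \<odot>[M] s j))"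
   unfolding lin_comb_def using s x r by (intro M.finsum_smult_ldistr) auto
  also have "\<dots> = lin_comb M n s (r \<odot>[fm R n] x)"
   unfolding lin_comb_def using s x r by (intro M.M.finsum_cong') (auto simp: M.smult_assoc1)
  finally show "lin_comb M n s (r \<odot>[fm R n] x) = r \<odot>[M] lin_comb M n s x" by simp
 qed
qed

lemma lin_comb_unit_vector:
 assumes M: "module R M" and s: "\<And>j. j < n ==> s j \<in> carrier M" and i: "i < n"
 shows "lin_comb M n s (unit_vector R n i) = s i"
proof -
 interpret M: module R M by fact
 have "lin_comb M n s (unit_vector R n i) = (\<Oplus>\<^bsub>M\<^esub>j\<in>{..<n}. if i = j then s j else \<zero>[M])"
  unfolding lin_comb_def unit_vector_def using s by (intro M.M.finsum_cong') auto
 also have "\<dots> = s i" using s i by (intro M.M.finsum_singleton) auto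
 finally show ?thesis .
qed

lemma free_module_decomp:
 assumes R: "cring R" and x: "x \<in> vec R n"
 shows "lin_comb (fm R n) n (unit_vector R n) x = x"
proof -
 interpret cring R by fact
 let ?F = "fm R n"
 interpret F: module R ?F by (rule free_mod)
 have e: "\<And>j. j < n ==> unit_vector R n j \<in> carrier ?F" using unit_vector_tuples by simp
 have ev: "(\<lambda>x. x i) \<in> linear_maps R ?F (reg R)" if "i < n" for i
  by (rule linear_mapsI) (use that in auto)
 have xc: "\<And>j. j < n ==> x j \<in> carrier R" using x by auto
 have "lin_comb ?F n (unit_vector R n) x i = x i" if i: "i < n" for i
 proof -
  have "lin_comb ?F n (unit_vector R n) x i =
   finsum (reg R) (\<lambda>j. (x j \<odot>[?F] unit_vector R n j) i) {..<n}"
   unfolding lin_comb_def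
   using e xc by (intro linear_map_finsum[OF F.module_axioms regular_module_module[OF R] ev[OF i]]) auto
  also have "\<dots> = (\<Oplus>\<^bsub>R\<^esub>j\<in>{..<n}. if i = j then x j else \<zero>[R])"
   unfolding finsum_regular_module using xc i by (intro finsum_cong') (auto simp: unit_vector_def)
  also have "\<dots> = x i" using xc i by (intro finsum_singleton) auto
  finally show ?thesis .
 qed
 moreover have "lin_comb ?F n (unit_vector R n) x \<in> vec R n"
  using linear_mapsD(1)[OF lin_comb_linear[OF F.module_axioms e]] x by simp
 ultimately show ?thesis using x by (intro tuples_eqI)
qed

lemma linear_map_free_eq:
 assumes M: "module R M" and g: "g \<in> linear_maps R (fm R n) M" and x: "x \<in> vec R n"
 shows "g x = lin_comb M n (\<lambda>j. g (unit_vector R n j)) x"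
proof -
 interpret M: module R M by fact
 let ?F = "fm R n"
 interpret F: module R ?F by (rule M.R.free_mod)
 have e: "\<And>j. j < n ==> unit_vector R n j \<in> carrier ?F" using M.R.unit_vector_tuples by simp
 have xc: "\<And>j. j < n ==> x j \<in> carrier R" using x by auto
 have "g x = g (lin_comb ?F n (unit_vector R n) x)"
  using free_module_decomp[OF M.R.is_cring x] by simp
 also have "\<dots> = (\<Oplus>\<^bsub>M\<^esub>j\<in>{..<n}. g (x j \<odot>[?F] unit_vector R n j))"
  unfolding lin_comb_def using e xc
  by (intro linear_map_finsum[OF F.module_axioms M g] F.smult_closed) auto
 also have "\<dots> = lin_comb M n (\<lambda>j. g (unit_vector R n j)) x"
  unfolding lin_comb_def using e xc linear_mapsD(1)[OF g] linear_mapsD(3)[OF g]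
  by (intro M.M.finsum_cong') (auto simp del: free_module_simps(4))
 finally show ?thesis .
qed

lemma span_image:
 assumes M: "module R M" and N: "module R N" and f: "f \<in> linear_maps R M N"
  and T: "T \<subseteq> carrier M" and y: "y \<in> submodule_span R N (f ` T)"
 obtains t where "t \<in> submodule_span R M T" "y = f t"
proof -
 interpret M: module R M by fact
 interpret N: module R N by fact
 have sT: "submodule (submodule_span R M T) R M" using span_submodule M T by auto
 have z: "submodule {\<zero>[N]} R N" by (rule N.submoduleI_smult) auto
 have fc: "f t \<in> carrier N" if "t \<in> submodule_span R M T" for t
  using linear_mapsD(1)[OF f submodule_carrier[OF sT that]] .
 have "{y. \<exists>x\<in>submodule_span R M T. \<exists>b\<in>{\<zero>[N]}. y = f x \<oplus>[N] b} = f ` submodule_span R M T"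
  using fc by auto
 then have "submodule (f ` submodule_span R M T) R N"
  using submodule_image_add[OF M N f sT z] by simp
 then have "submodule_span R N (f ` T) \<subseteq> f ` submodule_span R M T"
  using span_incl[of T R M] by (intro span_least) auto
 then show ?thesis using y that by auto
qed

lemma lin_comb_image:
 assumes M: "module R M" and s: "\<And>j. j < n ==> s j \<in> carrier M"
  and y: "y \<in> submodule_span R M (s ` {..<n})"
 obtains x where "x \<in> vec R n" "y = lin_comb M n s x"
proof -
 interpret M: module R M by fact
 let ?F = "fm R n"
 interpret F: module R ?F by (rule M.R.free_mod)
 have f: "lin_comb M n s \<in> linear_maps R ?F M" using lin_comb_linear[OF M s] .
 have e: "unit_vector R n ` {..<n} \<subseteq> carrier ?F" using M.R.unit_vector_tuples by auto
 have "s ` {..<n} = lin_comb M n s ` unit_vector R n ` {..<n}"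
  using lin_comb_unit_vector[OF M s] by (auto simp: image_image)
 then obtain t where "t \<in> submodule_span R ?F (unit_vector R n ` {..<n})" "y = lin_comb M n s t"
  using span_image[OF F.module_axioms M f e] y by metis
 then show ?thesis
  using that submodule_carrier[OF span_submodule[OF F.module_axioms e]] by auto
qed

lemma lin_comb_in_submodule:
 assumes M: "module R M" and N: "submodule N R M" and s: "\<And>j. j < n ==> s j \<in> N"
  and x: "x \<in> vec R n"
 shows "lin_comb M n s x \<in> N"
proof -
 interpret M: module R M by fact
 show ?thesis unfolding lin_comb_def
  using s x by (intro M.submodule_finsum[OF N]) (auto intro!: submodule_smult[OF N])
qed

section \<open>Noetherian modules\<close>

definition finitely_generated :: "('a, 'r) ring_scheme => ('a, 'm) module => 'm set => bool" where
 "finitely_generated R M N \<longleftrightarrow> (\<exists>S. finite S \<and> S \<subseteq> N \<and> N \<subseteq> submodule_span R M S)"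

definition noetherian_module :: "('a, 'r) ring_scheme => ('a, 'm) module => bool" where
 "noetherian_module R M \<longleftrightarrow> module R M \<and> (\<forall>N. submodule N R M \<longrightarrow> finitely_generated R M N)"

lemma finitely_generated_extension:
 assumes M: "module R M" and N: "module R N" and f: "f \<in> linear_maps R M N" and L: "submodule L R M"
  and im: "finitely_generated R N (f ` L)" and ker: "finitely_generated R M {x \<in> L. f x = \<zero>[N]}"
 shows "finitely_generated R M L"
proof -
 interpret M: module R M by fact
 interpret N: module R N by fact
 obtain T where T: "finite T" "T \<subseteq> f ` L" "f ` L \<subseteq> submodule_span R N T"
  using im unfolding finitely_generated_def by auto
 obtain U where U: "finite U" "U \<subseteq> L" "T = f ` U" using T(1,2) by (meson finite_subset_image)
 obtain V where V: "finite V" "V \<subseteq> {x \<in> L. f x = \<zero>[N]}" "{x \<in> L. f x = \<zero>[N]} \<subseteq> submodule_span R M V"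
  using ker unfolding finitely_generated_def by auto
 note Lc = submodule_carrier[OF L]
 have Uc: "U \<subseteq> carrier M" and UVc: "U \<union> V \<subseteq> carrier M" using U V Lc by auto
 have sub: "submodule (submodule_span R M (U \<union> V)) R M" using span_submodule[OF M UVc] .
 have "x \<in> submodule_span R M (U \<union> V)" if x: "x \<in> L" for x
 proof -
  have "f x \<in> submodule_span R N (f ` U)" using x T(3) U(3) by auto
  then obtain t where t: "t \<in> submodule_span R M U" "f x = f t"
   using span_image[OF M N f Uc] by metis
  have tL: "t \<in> L" using t(1) span_least[OF L U(2)] by auto
  obtain w where w: "w \<in> L" "x = t \<oplus>[M] w" using M.ex_diff_mem[OF L x tL] by metis
  have fc: "f t \<in> carrier N" "f w \<in> carrier N" using linear_mapsD(1)[OF f] Lc tL w by auto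
  have "f t = f t \<oplus>[N] f w" using t(2) w linear_mapsD(2)[OF f] Lc tL by metis
  then have "f w = \<zero>[N]" using fc by (metis N.M.add.l_cancel_one')
  then have "w \<in> submodule_span R M (U \<union> V)"
   using V(3) w span_mono[of V "U \<union> V" R M] by auto
  moreover have "t \<in> submodule_span R M (U \<union> V)" using t(1) span_mono[of U "U \<union> V" R M] by auto
  ultimately show ?thesis using w(2) submodule_add[OF sub] by simp
 qed
 then show ?thesis unfolding finitely_generated_def using U V
  by (intro exI[of _ "U \<union> V"]) auto
qed

lemma noetherian_power_module:
 assumes "noetherian_module R M"
 shows "noetherian_module R (pow M n)"
proof -
 have M: "module R M" and fg: "\<And>N. submodule N R M ==> finitely_generated R M N"
  using assms unfolding noetherian_module_def by auto
 interpret M: module R M by fact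
 let ?P = "pow M n"
 have P: "module R ?P" using pow_mod[OF M] .
 interpret P: module R ?P by fact
 have "finitely_generated R ?P N" if N: "submodule N R ?P" for N
 proof -
  have z: "submodule {\<zero>[M]} R M" by (rule M.submoduleI_smult) auto
  define L where "L k = {z \<in> N. \<forall>j<k. z j = \<zero>[M]}" for k
  have ev: "(\<lambda>x. x i) \<in> linear_maps R ?P M" if "i < n" for i
   by (rule linear_mapsI) (use that in auto)
  have LS: "L (Suc k) = {x \<in> L k. x k = \<zero>[M]}" for k
   unfolding L_def by (auto simp: less_Suc_eq)
  have Ls: "submodule (L k) R ?P" if "k \<le> n" for k using that
  proof (induction k)
   case 0 then show ?case using N by (simp add: L_def)
  next
   case (Suc k)
   then have "submodule {x \<in> L k. x k \<in> {\<zero>[M]}} R ?P"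
    by (intro submodule_vimage[OF P M ev _ z]) auto
   then show ?case unfolding LS by simp
  qed
  have "finitely_generated R ?P (L (n - d))" for d
  proof (induction d)
   case 0
   have "L n \<subseteq> {\<zero>[?P]}"
   proof
    fix x assume "x \<in> L n"
    then have "x \<in> tuples n (carrier M)" "\<And>j. j < n ==> x j = \<zero>[M]"
     using submodule_carrier[OF N] unfolding L_def by auto
    then have "x = (\<lambda>j\<in>{..<n}. \<zero>[M])" by (intro tuples_eqI[of x n "carrier M" _ "carrier M"]) auto
    then show "x \<in> {\<zero>[?P]}" by simp
   qed
   then show ?case
    unfolding finitely_generated_def using submodule_zero[OF span_submodule[OF P, of "{}"]]
    by (intro exI[of _ "{}"]) (auto simp del: power_module_simps)
  next
   case (Suc d)
   show ?case
   proof (cases "d < n")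
    case True
    define k where "k = n - Suc d"
    have k: "k < n" "n - d = Suc k" using True unfolding k_def by auto
    have Lk: "submodule (L k) R ?P" using Ls k by auto
    have "(\<lambda>x. x k) ` L k = {y. \<exists>x\<in>L k. \<exists>b\<in>{\<zero>[M]}. y = x k \<oplus>[M] b}"
     using linear_mapsD(1)[OF ev[OF k(1)] submodule_carrier[OF Lk]] by force
    then have "submodule ((\<lambda>x. x k) ` L k) R M"
     using submodule_image_add[OF P M ev[OF k(1)] Lk z] by simp
    then show ?thesis unfolding k_def[symmetric] using Suc k
     by (intro finitely_generated_extension[OF P M ev[OF k(1)] Lk fg]) (auto simp: LS)
   next
    case False then show ?thesis using Suc by simp
   qed
  qed
  from this[of n] show ?thesis unfolding L_def by simp
 qed
 then show ?thesis unfolding noetherian_module_def using P by auto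
qed

lemma noetherian_regular_module:
 assumes R: "cring R" and "noetherian_ring R"
 shows "noetherian_module R (reg R)"
proof -
 interpret cring R by fact
 interpret noetherian_ring R by fact
 let ?M = "reg R"
 have M: "module R ?M" using regular_module_module[OF R] .
 have "finitely_generated R ?M J" if J: "submodule J R ?M" for J
 proof -
  have "ideal J R" using J submodule_regular_iff_ideal[OF R] by simp
  then obtain A where A: "A \<subseteq> carrier R" "finite A" "J = genideal R A" using finetely_gen by metis
  have "submodule (submodule_span R ?M A) R ?M" using span_submodule[OF M] A(1) by simp
  then have "ideal (submodule_span R ?M A) R" using submodule_regular_iff_ideal[OF R] by simp
  then have "J \<subseteq> submodule_span R ?M A" using span_incl A(3) genideal_minimal by metis
  then show ?thesis unfolding finitely_generated_def
   using A genideal_self[OF A(1)] by auto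
 qed
 then show ?thesis using M unfolding noetherian_module_def by auto
qed

section \<open>Local rings\<close>

locale local_noetherian = cring R for R (structure) +
 fixes \<mm> :: "'a set"
 assumes noetherian: "noetherian_ring R"
  and maximal: "maximalideal \<mm> R"
  and unique: "maximalideal M R ==> M = \<mm>"
begin

lemma ideal_\<mm>: "ideal \<mm> R" using maximal by (rule maximalideal.axioms)

lemma \<mm>_carrier: "r \<in> \<mm> ==> r \<in> carrier R"
 using ideal.Icarr[OF ideal_\<mm>] .

lemma one_notin_\<mm>: "\<one> \<notin> \<mm>"
 using maximalideal.I_notcarr[OF maximal] ideal.one_imp_carrier[OF ideal_\<mm>] by auto

lemma unit_of_notin_\<mm>:
 assumes r: "r \<in> carrier R" "r \<notin> \<mm>"
 obtains s where "s \<in> carrier R" "s \<otimes> r = \<one>"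
proof (rule ccontr)
 interpret noetherian_ring R by (rule noetherian)
 assume no: "\<not> thesis"
 let ?P = "PIdl r"
 have "\<one> \<notin> ?P"
 proof
  assume "\<one> \<in> ?P"
  then obtain s where "s \<in> carrier R" "\<one> = s \<otimes> r" unfolding cgenideal_def by auto
  then show False using no that[of s] by simp
 qed
 then have PA: "ideal ?P R \<and> \<one> \<notin> ?P \<and> ?P \<subseteq> ?P" using cgenideal_ideal r(1) by auto
 let ?A = "{J. ideal J R \<and> \<one> \<notin> J \<and> ?P \<subseteq> J}"
 have "\<exists>J\<in>?A. \<forall>X\<in>?A. J \<subseteq> X \<longrightarrow> X = J"
 proof (rule subset_Zorn_nonempty)
  show "?A \<noteq> {}" using PA by auto
  fix C assume C: "C \<noteq> {}" "subset.chain ?A C"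
  then have "subset.chain {I. ideal I R} C" unfolding pred_on.chain_def by auto
  then have "\<Union>C \<in> C" using ideal_chain_is_trivial C(1) by auto
  then show "\<Union>C \<in> ?A" using C(2) unfolding pred_on.chain_def by auto
 qed
 then obtain J where J: "ideal J R" "\<one> \<notin> J" "?P \<subseteq> J"
  and Jm: "\<And>X. ideal X R ==> \<one> \<notin> X ==> ?P \<subseteq> X ==> J \<subseteq> X ==> X = J" by auto
 have "maximalideal J R"
 proof (rule maximalidealI[OF J(1)])
  show "carrier R \<noteq> J" using J(2) by auto
  fix X assume X: "ideal X R" "J \<subseteq> X" "X \<subseteq> carrier R"
  show "X = J \<or> X = carrier R"
   using Jm[of X] X J(3) ideal.one_imp_carrier[OF X(1)] by auto
 qed
 then have "J = \<mm>" by (rule unique)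
 then show False using J(3) cgenideal_self[OF r(1)] r(2) by auto
qed

lemma proper_subset_\<mm>:
 assumes J: "ideal J R" "J \<noteq> carrier R"
 shows "J \<subseteq> \<mm>"
proof
 fix r assume r: "r \<in> J"
 show "r \<in> \<mm>"
 proof (rule ccontr)
  assume "r \<notin> \<mm>"
  then obtain s where "s \<in> carrier R" "s \<otimes> r = \<one>"
   using unit_of_notin_\<mm>[of r] ideal.Icarr[OF J(1) r] by auto
  then show False using ideal.I_l_closed[OF J(1) r] ideal.one_imp_carrier[OF J(1)] J(2) by metis
 qed
qed

lemma max_ideal_eq: "max_ideal R = \<mm>"
 unfolding max_ideal_def using maximal by (rule the_equality) (rule unique)

lemma noetherian_free: "noetherian_module R (fm R n)"
 unfolding free_pow
 by (intro noetherian_power_module noetherian_regular_module is_cring noetherian)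

text \<open>If \<open>\<mm>B \<subseteq> D\<close> then \<open>B / D\<close> is a vector space, so the image of \<open>N\<close> in it has a complement.\<close>

lemma complement:
 fixes M :: "('a, 'm) module"
 assumes M: "module R M" and N: "submodule N R M" and B: "submodule B R M" and D: "submodule D R M"
  and P: "submodule P R M" and NB: "N \<subseteq> B" and DB: "D \<subseteq> B"
  and mB: "\<And>r x. r \<in> \<mm> ==> x \<in> B ==> r \<odot>[M] x \<in> D" and DN: "D \<inter> N \<subseteq> P"
 obtains W where "submodule W R M" "D \<subseteq> W" "W \<subseteq> B" "W \<inter> N \<subseteq> P"
  "\<And>x. x \<in> B ==> \<exists>n\<in>N. \<exists>w\<in>W. x = n \<oplus>[M] w"
proof -
 interpret M: module R M by fact
 let ?A = "{W. submodule W R M \<and> D \<subseteq> W \<and> W \<subseteq> B \<and> W \<inter> N \<subseteq> P}"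
 have "\<exists>W\<in>?A. \<forall>X\<in>?A. W \<subseteq> X \<longrightarrow> X = W"
 proof (rule subset_Zorn_nonempty)
  show "?A \<noteq> {}" using D DB DN by auto
  fix C assume C: "C \<noteq> {}" "subset.chain ?A C"
  have CA: "X \<in> ?A" if "X \<in> C" for X using that C(2) unfolding pred_on.chain_def by auto
  have "submodule (\<Union>C) R M"
  proof (rule M.submoduleI_smult)
   show "\<Union>C \<subseteq> carrier M" using CA submodule_carrier by (metis (no_types, lifting) Union_least mem_Collect_eq subsetI)
   show "\<zero>[M] \<in> \<Union>C" using C(1) CA submodule_zero[of _ R M] by blast
   fix a b assume "a \<in> \<Union>C" "b \<in> \<Union>C"
   then obtain X Y where XY: "X \<in> C" "Y \<in> C" "a \<in> X" "b \<in> Y" by auto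
   then have "X \<subseteq> Y \<or> Y \<subseteq> X" using C(2) XY(1,2) by (simp add: subset_chain_def)
   then obtain Z where "Z \<in> C" "a \<in> Z" "b \<in> Z" using XY by auto
   then show "a \<oplus>[M] b \<in> \<Union>C" using CA[of Z] submodule_add[of Z R M a b] by auto
  next
   fix r x assume "r \<in> carrier R" "x \<in> \<Union>C"
   then obtain X where "X \<in> C" "x \<in> X" "r \<in> carrier R" by auto
   then show "r \<odot>[M] x \<in> \<Union>C" using CA[of X] submodule_smult[of X R M r x] by auto
  qed
  moreover obtain X where "X \<in> C" using C(1) by auto
  then have "D \<subseteq> \<Union>C" using CA[of X] by auto
  moreover have "\<Union>C \<subseteq> B" "\<Union>C \<inter> N \<subseteq> P" using CA by auto
  ultimately show "\<Union>C \<in> ?A" by simp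
 qed
 then obtain W where "W \<in> ?A" and Wm: "\<forall>X\<in>?A. W \<subseteq> X \<longrightarrow> X = W" by (rule bexE)
 then have W: "submodule W R M" "D \<subseteq> W" "W \<subseteq> B" "W \<inter> N \<subseteq> P" by auto
 note Wc = submodule_carrier[OF W(1)] and Bc = submodule_carrier[OF B] and Nc = submodule_carrier[OF N]
 have "\<exists>n\<in>N. \<exists>w\<in>W. x = n \<oplus>[M] w" if x: "x \<in> B" for x
 proof (rule ccontr)
  assume no: "\<not> ?thesis"
  let ?X = "submodule_span R M (insert x W)"
  have xc: "x \<in> carrier M" using Bc x .
  have Xs: "submodule ?X R M" using Wc xc by (intro span_submodule[OF M]) auto
  have Xi: "insert x W \<subseteq> ?X" by (rule span_incl)
  have "?X \<subseteq> B" using x W(3) by (intro span_least B) auto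
  moreover have "?X \<inter> N \<subseteq> P"
  proof
   fix n assume n: "n \<in> ?X \<inter> N"
   obtain t r where t: "t \<in> submodule_span R M W" "r \<in> carrier R" "n = t \<oplus>[M] r \<odot>[M] x"
    using span_insertE[OF M _ xc, of W n] n Wc by blast
   have tW: "t \<in> W" using t(1) span_least[OF W(1) subset_refl] by auto
   have "r \<in> \<mm>"
   proof (rule ccontr)
    assume "r \<notin> \<mm>"
    then obtain s where s: "s \<in> carrier R" "s \<otimes> r = \<one>" using unit_of_notin_\<mm> t(2) by metis
    have rx: "r \<odot>[M] x = n \<oplus>[M] \<ominus>\<^bsub>M\<^esub> t"
     using t tW Wc xc by (simp add: M.M.a_assoc M.M.a_comm[of "r \<odot>[M] x"] M.M.r_neg1 M.M.r_neg2)
    have "x = s \<odot>[M] (r \<odot>[M] x)" using s t(2) xc by (simp add: M.smult_assoc1[symmetric])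
    also have "\<dots> = s \<odot>[M] n \<oplus>[M] s \<odot>[M] (\<ominus>\<^bsub>M\<^esub> t)"
     unfolding rx using s n Nc Wc tW by (intro M.smult_r_distr) auto
    finally show False using no n s submodule_smult[OF N] submodule_smult[OF W(1)] submodule_neg[OF W(1) tW]
     by blast
   qed
   then have "r \<odot>[M] x \<in> W" using mB x W(2) by auto
   then have "n \<in> W" using t tW submodule_add[OF W(1)] by auto
   then show "n \<in> P" using W(4) n by auto
  qed
  ultimately have "?X \<in> ?A" using Xs Xi W(2) by auto
  then have "?X = W" using Wm Xi by simp
  then have "x \<in> W" using Xi by auto
  then show False using no submodule_zero[OF N] xc by (metis M.M.l_zero)
 qed
 then show ?thesis using that W by blast
qed

end

section \<open>Relative dimension\<close>

definition generated_by :: "('a, 'r) ring_scheme => ('a, 'm) module => 'm set => 'm set => nat => bool" where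
 "generated_by R M A B n \<longleftrightarrow>
  (\<exists>S. finite S \<and> card S \<le> n \<and> S \<subseteq> B \<and> B \<subseteq> submodule_span R M (A \<union> S))"

text \<open>For \<open>A \<subseteq> B\<close> with \<open>\<mm>B \<subseteq> A\<close> this is the dimension of the vector space \<open>B / A\<close> over the
 residue field.  The definition as a minimal number of generators makes sense without this
 condition, which spares proofs that homology modules are vector spaces.\<close>

definition rdim :: "('a, 'r) ring_scheme => ('a, 'm) module => 'm set => 'm set => nat" where
 "rdim R M A B = (LEAST n. generated_by R M A B n)"

lemma generated_by_transfer:
 assumes M: "module R M" and N: "module R N" and f: "f \<in> linear_maps R M N"
  and A: "submodule A R M" and B: "submodule B R M" and A': "submodule A' R N" and B': "submodule B' R N"
  and AB: "A \<subseteq> B" "A' \<subseteq> B'" and fB: "\<And>x. x \<in> B ==> f x \<in> B'"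
  and surj: "\<And>y. y \<in> B' ==> \<exists>x\<in>B. \<exists>a\<in>A'. y = f x \<oplus>[N] a"
  and inj: "\<And>x. x \<in> B ==> f x \<in> A' \<longleftrightarrow> x \<in> A"
 shows "generated_by R M A B n \<longleftrightarrow> generated_by R N A' B' n"
proof
 interpret M: module R M by fact
 interpret N: module R N by fact
 note c = submodule_carrier[OF A] submodule_carrier[OF B] submodule_carrier[OF A'] submodule_carrier[OF B']
 {
  assume "generated_by R M A B n"
  then obtain S where S: "finite S" "card S \<le> n" "S \<subseteq> B" "B \<subseteq> submodule_span R M (A \<union> S)"
   unfolding generated_by_def by auto
  let ?T = "submodule_span R N (A' \<union> f ` S)"
  have "A' \<union> f ` S \<subseteq> carrier N" using c S(3) fB by auto
  then have T: "submodule ?T R N" by (rule span_submodule[OF N])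
  have Ti: "A' \<union> f ` S \<subseteq> ?T" by (rule span_incl)
  have "f x \<in> A'" if "x \<in> A" for x using that inj[of x] AB(1) by auto
  then have "A \<union> S \<subseteq> {x \<in> B. f x \<in> ?T}" using AB S(3) Ti by auto
  then have "B \<subseteq> {x \<in> B. f x \<in> ?T}"
   using S(4) span_least[OF submodule_vimage[OF M N f B T]] by blast
  then have "B' \<subseteq> ?T" using surj Ti submodule_add[OF T] by blast
  moreover have "card (f ` S) \<le> n" using S card_image_le[of S f] by auto
  ultimately show "generated_by R N A' B' n" unfolding generated_by_def
   using S fB by (intro exI[of _ "f ` S"]) auto
 next
  assume "generated_by R N A' B' n"
  then obtain S where S: "finite S" "card S \<le> n" "S \<subseteq> B'" "B' \<subseteq> submodule_span R N (A' \<union> S)"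
   unfolding generated_by_def by auto
  have "\<forall>s\<in>S. \<exists>x. x \<in> B \<and> (\<exists>a\<in>A'. s = f x \<oplus>[N] a)" using surj S(3) by blast
  then obtain g where g: "\<And>s. s \<in> S ==> g s \<in> B \<and> (\<exists>a\<in>A'. s = f (g s) \<oplus>[N] a)"
   by metis
  let ?T = "submodule_span R M (A \<union> g ` S)" and ?Q = "{y. \<exists>x\<in>submodule_span R M (A \<union> g ` S). \<exists>b\<in>A'. y = f x \<oplus>[N] b}"
  have "A \<union> g ` S \<subseteq> carrier M" using c g by auto
  then have T: "submodule ?T R M" by (rule span_submodule[OF M])
  have Ti: "A \<union> g ` S \<subseteq> ?T" by (rule span_incl)
  have TB: "?T \<subseteq> B" using AB g by (intro span_least B) auto
  have Q: "submodule ?Q R N" by (rule submodule_image_add[OF M N f T A'])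
  have "S \<subseteq> ?Q" using g Ti by blast
  moreover have "A' \<subseteq> ?Q"
  proof
   fix a assume "a \<in> A'"
   then have "a = f \<zero>[M] \<oplus>[N] a" using linear_map_zero[OF M N f] c by simp
   then show "a \<in> ?Q" using submodule_zero[OF T] \<open>a \<in> A'\<close> by blast
  qed
  ultimately have "B' \<subseteq> ?Q" using S(4) span_least[OF Q, of "A' \<union> S"] by blast
  have "B \<subseteq> ?T"
  proof
   fix b assume b: "b \<in> B"
   then have "f b \<in> ?Q" using subsetD[OF \<open>B' \<subseteq> ?Q\<close> fB] by simp
   then have "\<exists>t\<in>?T. \<exists>a\<in>A'. f b = f t \<oplus>[N] a" by (rule CollectD)
   then obtain t a where t: "t \<in> ?T" "a \<in> A'" "f b = f t \<oplus>[N] a" by (elim bexE)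
   obtain w where w: "w \<in> B" "b = t \<oplus>[M] w" using M.ex_diff_mem[OF B b, of t] t TB by blast
   have "f t \<in> carrier N" "f w \<in> carrier N" "a \<in> carrier N" using fB w t TB c by blast+
   moreover have "f b = f t \<oplus>[N] f w" using w t TB c linear_mapsD(2)[OF f] by blast
   ultimately have "f w = a" using t(3) N.M.add.l_cancel[of "f t" "f w" a] by metis
   then have "w \<in> ?T" using inj w t Ti by auto
   then show "b \<in> ?T" using w t submodule_add[OF T] by simp
  qed
  moreover have "card (g ` S) \<le> n" using S card_image_le[of S g] by auto
  ultimately show "generated_by R M A B n" unfolding generated_by_def
   using S g by (intro exI[of _ "g ` S"]) auto
 }
qed

lemma rdim_transfer:
 assumes M: "module R M" and N: "module R N" and f: "f \<in> linear_maps R M N"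
  and A: "submodule A R M" and B: "submodule B R M" and A': "submodule A' R N" and B': "submodule B' R N"
  and AB: "A \<subseteq> B" "A' \<subseteq> B'" and fB: "\<And>x. x \<in> B ==> f x \<in> B'"
  and surj: "\<And>y. y \<in> B' ==> \<exists>x\<in>B. \<exists>a\<in>A'. y = f x \<oplus>[N] a"
  and inj: "\<And>x. x \<in> B ==> f x \<in> A' \<longleftrightarrow> x \<in> A"
 shows "rdim R M A B = rdim R N A' B'"
proof -
 have "generated_by R M A B = generated_by R N A' B'"
  using generated_by_transfer[OF assms] by blast
 then show ?thesis unfolding rdim_def by simp
qed

lemma generated_by_noetherian:
 assumes "noetherian_module R M" "submodule B R M"
 shows "\<exists>n. generated_by R M A B n"
proof -
 obtain S where S: "finite S" "S \<subseteq> B" "B \<subseteq> submodule_span R M S"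
  using assms unfolding noetherian_module_def finitely_generated_def by blast
 then have "generated_by R M A B (card S)"
  unfolding generated_by_def using span_mono[of S "A \<union> S" R M] by blast
 then show ?thesis by blast
qed

lemma rdim_self:
 assumes "module R M" "submodule A R M"
 shows "rdim R M A A = 0"
proof -
 have "generated_by R M A A 0"
  unfolding generated_by_def using span_incl[of A R M] by (intro exI[of _ "{}"]) auto
 then show ?thesis unfolding rdim_def by simp
qed

lemma rdim_le: "generated_by R M A B n ==> rdim R M A B \<le> n"
 unfolding rdim_def by (rule Least_le)

context local_noetherian
begin

context
 fixes M :: "('a, 'm) module" and A B
 assumes M: "noetherian_module R M" and A: "submodule A R M" and B: "submodule B R M" and AB: "A \<subseteq> B"
begin

lemma generated_by_rdim: "generated_by R M A B (rdim R M A B)"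
 unfolding rdim_def using generated_by_noetherian[OF M B] by (rule LeastI_ex)

lemma rdim_eq_0: "rdim R M A B = 0 ==> A = B"
proof -
 assume "rdim R M A B = 0"
 then have "B \<subseteq> submodule_span R M A" using generated_by_rdim unfolding generated_by_def by auto
 then show "A = B" using span_least[OF A subset_refl] AB by blast
qed

text \<open>A minimal generating system gives a linear map from a free module; by minimality its values lie
 in \<open>A\<close> only for coefficients in \<open>\<mm>\<close>.\<close>

lemma minimal_generators:
 "\<exists>n g. n = rdim R M A B \<and> g \<in> linear_maps R (fm R n) M \<and>
  (\<forall>x\<in>vec R n. g x \<in> B) \<and>
  (\<forall>b\<in>B. \<exists>x\<in>vec R n. \<exists>a\<in>A. b = g x \<oplus>[M] a) \<and>
  (\<forall>x\<in>vec R n. g x \<in> A \<longrightarrow> x \<in> tuples n \<mm>)"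
proof -
 have MM: "module R M" using M unfolding noetherian_module_def by auto
 interpret M: module R M by fact
 obtain S where S: "finite S" "card S \<le> rdim R M A B" "S \<subseteq> B" "B \<subseteq> submodule_span R M (A \<union> S)"
  using generated_by_rdim unfolding generated_by_def by auto
 have min: "rdim R M A B \<le> card S'" if "finite S'" "S' \<subseteq> B" "B \<subseteq> submodule_span R M (A \<union> S')" for S'
  using that by (intro rdim_le) (auto simp: generated_by_def)
 then have cS: "card S = rdim R M A B" using S by (simp add: le_antisym)
 define n where "n = rdim R M A B"
 obtain s where s: "bij_betw s {..<n} S" using S(1) cS ex_bij_betw_nat_finite[OF S(1)]
  unfolding n_def by (metis atLeast0LessThan)
 have sS: "s ` {..<n} = S" "\<And>j. j < n ==> s j \<in> S" using s unfolding bij_betw_def by auto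
 have Sc: "S \<subseteq> carrier M" using S(3) submodule_carrier[OF B] by auto
 have sc: "\<And>j. j < n ==> s j \<in> carrier M" using sS Sc by auto
 let ?g = "lin_comb M n s"
 have g: "?g \<in> linear_maps R (fm R n) M" using lin_comb_linear[OF MM sc] .
 have gB: "?g x \<in> B" if "x \<in> vec R n" for x
  using lin_comb_in_submodule[OF MM B _ that] sS S(3) by auto
 have surj: "\<exists>x\<in>vec R n. \<exists>a\<in>A. b = ?g x \<oplus>[M] a" if "b \<in> B" for b
 proof -
  obtain t a where t: "t \<in> submodule_span R M S" "a \<in> A" "b = t \<oplus>[M] a"
   using span_UnE[OF MM A Sc, of b] \<open>b \<in> B\<close> S(4) by blast
  obtain x where "x \<in> vec R n" "t = ?g x"
   using lin_comb_image[OF MM sc, of n "\<lambda>j. j" t] t(1) sS by auto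
  then show ?thesis using t by auto
 qed
 have inj: "x \<in> tuples n \<mm>" if x: "x \<in> vec R n" and gx: "?g x \<in> A" for x
 proof -
  have "x j \<in> \<mm>" if j: "j < n" for j
  proof (rule ccontr)
   assume "x j \<notin> \<mm>"
   moreover have xj: "x j \<in> carrier R" using x j by auto
   ultimately obtain r where r: "r \<in> carrier R" "r \<otimes> x j = \<one>" using unit_of_notin_\<mm> by metis
   let ?S = "S - {s j}" and ?rest = "\<Oplus>\<^bsub>M\<^esub>i\<in>{..<n} - {j}. x i \<odot>[M] s i"
   have "A \<union> ?S \<subseteq> carrier M" using Sc submodule_carrier[OF A] by auto
   then have T: "submodule (submodule_span R M (A \<union> ?S)) R M" by (rule span_submodule[OF MM])
   note Ti = span_incl[of "A \<union> ?S" R M]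
   have "s i \<noteq> s j" if "i < n" "i \<noteq> j" for i
    using s that j unfolding bij_betw_def inj_on_def by auto
   then have "x i \<odot>[M] s i \<in> submodule_span R M (A \<union> ?S)" if "i \<in> {..<n} - {j}" for i
    using that sS x Ti by (intro submodule_smult[OF T]) auto
   then have rest: "?rest \<in> submodule_span R M (A \<union> ?S)"
    by (intro M.submodule_finsum[OF T]) auto
   have "?g x = (\<Oplus>\<^bsub>M\<^esub>i\<in>insert j ({..<n} - {j}). x i \<odot>[M] s i)"
    unfolding lin_comb_def using j by (simp add: insert_absorb)
   also have "\<dots> = x j \<odot>[M] s j \<oplus>[M] ?rest"
    using x sc j by (intro M.M.finsum_insert) auto
   finally have "x j \<odot>[M] s j \<oplus>[M] ?rest \<in> submodule_span R M (A \<union> ?S)" using gx Ti by auto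
   then have "x j \<odot>[M] s j \<in> submodule_span R M (A \<union> ?S)"
    using M.submodule_cancel2[OF T rest] xj sc[OF j] by auto
   then have "r \<odot>[M] (x j \<odot>[M] s j) \<in> submodule_span R M (A \<union> ?S)" using submodule_smult[OF T r(1)] by auto
   moreover have "r \<odot>[M] (x j \<odot>[M] s j) = s j"
    using r xj sc[OF j] by (simp add: M.smult_assoc1[symmetric])
   ultimately have "A \<union> S \<subseteq> submodule_span R M (A \<union> ?S)" using Ti by auto
   then have "B \<subseteq> submodule_span R M (A \<union> ?S)" using S(4) span_least[OF T] by blast
   then have "card S \<le> card ?S" using min[of ?S] S cS by auto
   then show False using S(1) sS(2)[OF j] card_Diff1_less[of S "s j"] by simp
  qed
  then show ?thesis using x by (auto simp: PiE_iff)
 qed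
 show ?thesis
  by (intro exI[of _ n] exI[of _ ?g] conjI ballI impI) (fact n_def g gB surj inj)+
qed

text \<open>Steinitz exchange.\<close>

lemma rdim_insert:
 assumes mB: "\<And>r x. r \<in> \<mm> ==> x \<in> B ==> r \<odot>[M] x \<in> A" and v: "v \<in> B" "v \<notin> A"
 shows "rdim R M A B = Suc (rdim R M (submodule_span R M (insert v A)) B)"
proof -
 have MM: "module R M" using M unfolding noetherian_module_def by auto
 interpret M: module R M by fact
 let ?A = "submodule_span R M (insert v A)"
 note Ac = submodule_carrier[OF A] and Bc = submodule_carrier[OF B]
 have vA: "insert v A \<subseteq> carrier M" using Ac Bc v by auto
 have A': "submodule ?A R M" by (rule span_submodule[OF MM vA])
 have Ai: "insert v A \<subseteq> ?A" by (rule span_incl)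
 have AB': "?A \<subseteq> B" using v AB by (intro span_least B) auto
 have "rdim R M A B \<le> Suc (rdim R M ?A B)"
 proof -
  have "generated_by R M ?A B (rdim R M ?A B)"
   unfolding rdim_def using generated_by_noetherian[OF M B] by (rule LeastI_ex)
  then obtain S where S: "finite S" "card S \<le> rdim R M ?A B" "S \<subseteq> B" "B \<subseteq> submodule_span R M (?A \<union> S)"
   unfolding generated_by_def by auto
  have "A \<union> insert v S \<subseteq> carrier M" using S(3) vA Bc by auto
  then have T: "submodule (submodule_span R M (A \<union> insert v S)) R M" by (rule span_submodule[OF MM])
  have "?A \<subseteq> submodule_span R M (A \<union> insert v S)" by (rule span_mono) auto
  moreover have "S \<subseteq> submodule_span R M (A \<union> insert v S)" using span_incl[of "A \<union> insert v S" R M] by auto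
  ultimately have "B \<subseteq> submodule_span R M (A \<union> insert v S)"
   using S(4) span_least[OF T, of "?A \<union> S"] by blast
  then have "generated_by R M A B (Suc (rdim R M ?A B))" unfolding generated_by_def
   using S v by (intro exI[of _ "insert v S"]) (auto simp: card_insert_if)
  then show ?thesis by (rule rdim_le)
 qed
 moreover have "Suc (rdim R M ?A B) \<le> rdim R M A B"
 proof -
  obtain S where S: "finite S" "card S \<le> rdim R M A B" "S \<subseteq> B" "B \<subseteq> submodule_span R M (A \<union> S)"
   using generated_by_rdim unfolding generated_by_def by auto
  have Sc: "S \<subseteq> carrier M" using S(3) Bc by auto
  let ?P = "\<lambda>U. U \<subseteq> S \<and> v \<in> submodule_span R M (A \<union> U)"
  have "?P S" using S(4) v by auto
  then obtain U where U: "?P U" and Umin: "\<And>U'. card U' < card U ==> \<not> ?P U'"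
   using ex_has_least_nat[of ?P S card] by (metis linorder_not_less)
  have finU: "finite U" using U S(1) finite_subset by auto
  have "U \<noteq> {}" using U v span_least[OF A, of A] by auto
  then obtain s where s: "s \<in> U" by auto
  let ?U = "U - {s}" and ?S = "S - {s}"
  have sB: "s \<in> B" "s \<in> carrier M" using s U S(3) Sc by auto
  have "card ?U < card U" using finU s by (rule card_Diff1_less)
  then have nv: "v \<notin> submodule_span R M (A \<union> ?U)" using Umin[of ?U] U by auto
  have "insert s (A \<union> ?U) = A \<union> U" using s by auto
  then have "v \<in> submodule_span R M (insert s (A \<union> ?U))" using U by simp
  moreover have AUc: "A \<union> ?U \<subseteq> carrier M" using Ac U Sc by auto
  ultimately obtain t r where t: "t \<in> submodule_span R M (A \<union> ?U)" "r \<in> carrier R" "v = t \<oplus>[M] r \<odot>[M] s"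
   using span_insertE[OF MM AUc sB(2)] by metis
  have AU: "submodule (submodule_span R M (A \<union> ?U)) R M" by (rule span_submodule[OF MM AUc])
  have "r \<notin> \<mm>"
  proof
   assume "r \<in> \<mm>"
   then have "r \<odot>[M] s \<in> submodule_span R M (A \<union> ?U)"
    using mB sB span_incl[of "A \<union> ?U" R M] by auto
   then show False using nv t submodule_add[OF AU] by auto
  qed
  then obtain q where q: "q \<in> carrier R" "q \<otimes> r = \<one>" using unit_of_notin_\<mm> t(2) by metis
  let ?T = "submodule_span R M (?A \<union> ?S)"
  have ASc: "?A \<union> ?S \<subseteq> carrier M" using submodule_carrier[OF A'] Sc by auto
  have T: "submodule ?T R M" by (rule span_submodule[OF MM ASc])
  have Ti: "?A \<union> ?S \<subseteq> ?T" by (rule span_incl)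
  have "A \<union> ?U \<subseteq> ?T" using Ti Ai U by auto
  then have "t \<in> ?T" using t(1) span_least[OF T] by blast
  moreover have "v \<in> ?T" using Ti Ai by auto
  ultimately have "r \<odot>[M] s \<in> ?T" using M.submodule_cancel[OF T, of t "r \<odot>[M] s"] t sB by auto
  then have "q \<odot>[M] (r \<odot>[M] s) \<in> ?T" using submodule_smult[OF T q(1)] by auto
  moreover have "q \<odot>[M] (r \<odot>[M] s) = s" using q t sB by (simp add: M.smult_assoc1[symmetric])
  ultimately have "A \<union> S \<subseteq> ?T" using Ti Ai by auto
  then have "B \<subseteq> ?T" using S(4) span_least[OF T] by blast
  then have "generated_by R M ?A B (card ?S)" unfolding generated_by_def
   using S by (intro exI[of _ ?S]) auto
  then have "rdim R M ?A B \<le> card ?S" by (rule rdim_le)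
  moreover have "card ?S < card S" using S(1) s U by (intro card_Diff1_less) auto
  ultimately show ?thesis using S(2) by auto
 qed
 ultimately show ?thesis by simp
qed

end

text \<open>Dimensions are additive because every exchange step enlarges the lower bound of \<open>A \<subseteq> C \<subseteq> B\<close>
 and of \<open>A \<subseteq> B\<close> by the same vector.\<close>

lemma rdim_additive:
 assumes M: "noetherian_module R M" and A: "submodule A R M" and C: "submodule C R M" and B: "submodule B R M"
  and AC: "A \<subseteq> C" and CB: "C \<subseteq> B" and mB: "\<And>r x. r \<in> \<mm> ==> x \<in> B ==> r \<odot>[M] x \<in> A"
 shows "rdim R M A B = rdim R M A C + rdim R M C B"
 using A AC mB
proof (induction "rdim R M A C" arbitrary: A)
 case 0
 then show ?case using rdim_eq_0[OF M \<open>submodule A R M\<close> C \<open>A \<subseteq> C\<close>] by simp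
next
 case (Suc k)
 have MM: "module R M" using M unfolding noetherian_module_def by auto
 have "A \<noteq> C" using Suc.hyps(2) rdim_self[OF MM C] by auto
 then obtain v where v: "v \<in> C" "v \<notin> A" using Suc.prems by auto
 let ?A = "submodule_span R M (insert v A)"
 have vA: "insert v A \<subseteq> carrier M"
  using submodule_carrier[OF C] v Suc.prems by auto
 have A': "submodule ?A R M" by (rule span_submodule[OF MM vA])
 have Ai: "insert v A \<subseteq> ?A" by (rule span_incl)
 have AC': "?A \<subseteq> C" using v Suc.prems by (intro span_least C) auto
 have 1: "rdim R M A C = Suc (rdim R M ?A C)"
  using Suc.prems v CB by (intro rdim_insert[OF M _ C]) auto
 have 2: "rdim R M A B = Suc (rdim R M ?A B)"
  using Suc.prems v CB by (intro rdim_insert[OF M _ B]) auto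
 have "rdim R M ?A B = rdim R M ?A C + rdim R M C B"
  using Suc.hyps(2) 1 A' AC' Suc.prems(3) Ai by (intro Suc.hyps(1)) auto
 then show ?case using 1 2 by simp
qed

end

section \<open>Homology of complexes with coefficients\<close>

text \<open>\<open>cdif X M i\<close> is the differential of the tensor product of \<open>X\<close> and \<open>M\<close>.  For submodules
 \<open>A \<subseteq> B\<close> of \<open>M\<close>, the complex with coefficients in \<open>B / A\<close> is described inside the complex with
 coefficients in \<open>M\<close>: \<open>cyc\<close> and \<open>bnd\<close> are the preimages of its cycles and boundaries.  All maps
 between coefficient modules then become inclusions.\<close>

definition cdif :: "'a free_complex => ('a, 'm) module => nat => (nat => 'm) => (nat => 'm)" where
 "cdif X M i = matrix_map M (rk X (i - 1)) (rk X i) (dif X i)"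

definition cyc :: "'a free_complex => ('a, 'm) module => 'm set => 'm set => nat => (nat => 'm) set" where
 "cyc X M A B i = {z \<in> tuples (rk X i) B. \<forall>j. i = Suc j \<longrightarrow> cdif X M i z \<in> tuples (rk X j) A}"

definition bnd :: "'a free_complex => ('a, 'm) module => 'm set => 'm set => nat => (nat => 'm) set" where
 "bnd X M A B i = {z. \<exists>y\<in>tuples (rk X (Suc i)) B. \<exists>w\<in>tuples (rk X i) A.
  z = cdif X M (Suc i) y \<oplus>[pow M (rk X i)] w}"

definition betti ::
 "('a, 'r) ring_scheme => 'a free_complex => ('a, 'm) module => 'm set => 'm set => nat => nat" where
 "betti R X M A B i = rdim R (pow M (rk X i)) (bnd X M A B i) (cyc X M A B i)"

abbreviation (input) rcyc where "rcyc R X J \<equiv> cyc X (reg R) J (carrier R)"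
abbreviation (input) rbnd where "rbnd R X J \<equiv> bnd X (reg R) J (carrier R)"
abbreviation (input) rbetti where "rbetti R X J \<equiv> betti R X (reg R) J (carrier R)"

definition matrices_over :: "('a, 'r) ring_scheme => 'a free_complex => bool" where
 "matrices_over R X \<longleftrightarrow> (\<forall>i. \<forall>r<rk X i. \<forall>c<rk X (Suc i). dif X (Suc i) r c \<in> carrier R)"

definition complex_mod :: "'a free_complex => ('a, 'm) module => 'm set => 'm set => bool" where
 "complex_mod X M A B \<longleftrightarrow>
  (\<forall>i. \<forall>y\<in>tuples (rk X (Suc (Suc i))) B. cdif X M (Suc i) (cdif X M (Suc (Suc i)) y) \<in> tuples (rk X i) A)"

lemma cyc_0 [simp]: "cyc X M A B 0 = tuples (rk X 0) B"
 unfolding cyc_def by auto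

lemma cyc_Suc: "cyc X M A B (Suc i) = {z \<in> tuples (rk X (Suc i)) B. cdif X M (Suc i) z \<in> tuples (rk X i) A}"
 unfolding cyc_def by auto

lemma cyc_tuples: "z \<in> cyc X M A B i ==> z \<in> tuples (rk X i) B"
 unfolding cyc_def by auto

lemma complex_mod_mono:
 "complex_mod X M A B ==> A \<subseteq> A' ==> B' \<subseteq> B ==> complex_mod X M A' B'"
 unfolding complex_mod_def using tuples_mono[of A A'] tuples_mono[of B' B] by blast

context
 fixes R :: "('a, 'r) ring_scheme" and X :: "'a free_complex" and M :: "('a, 'm) module"
 assumes X: "matrices_over R X" and M: "module R M"
begin

interpretation M: module R M by (rule M)

lemma cdif_linear:
 "cdif X M (Suc i) \<in> linear_maps R (pow M (rk X (Suc i))) (pow M (rk X i))"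
 unfolding cdif_def using matrix_map_linear[OF M] X unfolding matrices_over_def by simp

lemma cdif_tuples:
 "submodule N R M ==> z \<in> tuples (rk X (Suc i)) N ==> cdif X M (Suc i) z \<in> tuples (rk X i) N"
 unfolding cdif_def using matrix_map_tuples[OF M] X unfolding matrices_over_def by simp

lemma cdif_carrier:
 "z \<in> tuples (rk X (Suc i)) (carrier M) ==> cdif X M (Suc i) z \<in> tuples (rk X i) (carrier M)"
 using cdif_tuples[OF M.carrier_is_submodule] .

lemma cdif_add:
 assumes "x \<in> tuples (rk X (Suc i)) (carrier M)" "y \<in> tuples (rk X (Suc i)) (carrier M)"
 shows "cdif X M (Suc i) (x \<oplus>[pow M (rk X (Suc i))] y) =
  cdif X M (Suc i) x \<oplus>[pow M (rk X i)] cdif X M (Suc i) y"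
 by (rule linear_mapsD(2)[OF cdif_linear]) (use assms in \<open>simp_all only: power_module_simps\<close>)

lemma cdif_smult:
 assumes "r \<in> carrier R" "x \<in> tuples (rk X (Suc i)) (carrier M)"
 shows "cdif X M (Suc i) (r \<odot>[pow M (rk X (Suc i))] x) =
  r \<odot>[pow M (rk X i)] cdif X M (Suc i) x"
 by (rule linear_mapsD(3)[OF cdif_linear]) (use assms in \<open>simp_all only: power_module_simps\<close>)

lemma cdif_tuple_map:
 assumes N: "module R N" and f: "f \<in> linear_maps R M N" and z: "z \<in> tuples (rk X (Suc i)) (carrier M)"
 shows "cdif X N (Suc i) (tuple_map (rk X (Suc i)) f z) = tuple_map (rk X i) f (cdif X M (Suc i) z)"
 unfolding cdif_def using matrix_map_tuple_map[OF M N f _ z] X unfolding matrices_over_def by simp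

lemma bnd_submodule:
 assumes "submodule A R M" "submodule B R M"
 shows "submodule (bnd X M A B i) R (pow M (rk X i))"
 unfolding bnd_def
 by (rule submodule_image_add[OF pow_mod[OF M] pow_mod[OF M] cdif_linear])
  (use assms submodule_tuples[OF M] in auto)

lemma cyc_submodule:
 assumes A: "submodule A R M" and B: "submodule B R M"
 shows "submodule (cyc X M A B i) R (pow M (rk X i))"
proof (cases i)
 case 0 then show ?thesis using submodule_tuples[OF M B] by simp
next
 case (Suc j)
 show ?thesis unfolding Suc cyc_Suc
  by (rule submodule_vimage[OF pow_mod[OF M] pow_mod[OF M] cdif_linear])
   (use submodule_tuples[OF M] A B in auto)
qed

lemma bndI:
 "y \<in> tuples (rk X (Suc i)) B ==> w \<in> tuples (rk X i) A ==>
  cdif X M (Suc i) y \<oplus>[pow M (rk X i)] w \<in> bnd X M A B i"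
 unfolding bnd_def by auto

lemma bnd_lower:
 assumes A: "submodule A R M" and B: "submodule B R M" and w: "w \<in> tuples (rk X i) A"
 shows "w \<in> bnd X M A B i"
proof -
 let ?P = "pow M (rk X i)" and ?Q = "pow M (rk X (Suc i))"
 interpret P: module R ?P by (rule pow_mod[OF M])
 have Q: "module R ?Q" by (rule pow_mod[OF M])
 have "\<zero>[?Q] \<in> tuples (rk X (Suc i)) B" using submodule_zero[OF submodule_tuples[OF M B]] .
 then have "cdif X M (Suc i) \<zero>[?Q] \<oplus>[?P] w \<in> bnd X M A B i" using w by (rule bndI)
 moreover have "cdif X M (Suc i) \<zero>[?Q] = \<zero>[?P]"
  by (rule linear_map_zero[OF Q P.module_axioms cdif_linear])
 ultimately show ?thesis
  using submodule_carrier[OF submodule_tuples[OF M A] w] P.M.l_zero by metis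
qed

lemma bnd_image:
 assumes A: "submodule A R M" and B: "submodule B R M" and y: "y \<in> tuples (rk X (Suc i)) B"
 shows "cdif X M (Suc i) y \<in> bnd X M A B i"
proof -
 let ?P = "pow M (rk X i)"
 interpret P: module R ?P by (rule pow_mod[OF M])
 have "cdif X M (Suc i) y \<oplus>[?P] \<zero>[?P] \<in> bnd X M A B i"
  using submodule_zero[OF submodule_tuples[OF M A]] by (rule bndI[OF y])
 moreover have "cdif X M (Suc i) y \<in> carrier ?P"
  using submodule_carrier[OF submodule_tuples[OF M B]] cdif_tuples[OF B y] by auto
 ultimately show ?thesis using P.M.r_zero by metis
qed

lemma bnd_subset_cyc:
 assumes A: "submodule A R M" and B: "submodule B R M" and AB: "A \<subseteq> B" and cx: "complex_mod X M A B"
 shows "bnd X M A B i \<subseteq> cyc X M A B i"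
proof
 fix z assume "z \<in> bnd X M A B i"
 then obtain y w where yw: "y \<in> tuples (rk X (Suc i)) B" "w \<in> tuples (rk X i) A"
  "z = cdif X M (Suc i) y \<oplus>[pow M (rk X i)] w" unfolding bnd_def by auto
 have "cdif X M (Suc i) y \<in> cyc X M A B i"
 proof (cases i)
  case 0 then show ?thesis using cdif_tuples[OF B] yw by simp
 next
  case (Suc j)
  then have "cdif X M (Suc j) (cdif X M (Suc i) y) \<in> tuples (rk X j) A"
   using cx yw(1) unfolding complex_mod_def by simp
  then show ?thesis using cdif_tuples[OF B yw(1)] unfolding Suc cyc_Suc by simp
 qed
 moreover have "w \<in> cyc X M A B i"
 proof (cases i)
  case 0 then show ?thesis using yw tuples_mono[OF AB, of "rk X i"] by auto
 next
  case (Suc j)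
  then show ?thesis using cdif_tuples[OF A] yw(2) tuples_mono[OF AB, of "rk X i"] unfolding Suc cyc_Suc by auto
 qed
 ultimately show "z \<in> cyc X M A B i"
  unfolding yw(3) by (rule submodule_add[OF cyc_submodule[OF A B]])
qed

lemma bnd_mono:
 assumes "A \<subseteq> A'" "B \<subseteq> B'"
 shows "bnd X M A B i \<subseteq> bnd X M A' B' i"
 unfolding bnd_def using tuples_mono[OF assms(1), of "rk X i"] tuples_mono[OF assms(2), of "rk X (Suc i)"]
 by blast

end

text \<open>Let the homology with coefficients in \<open>M / A\<close> vanish.  Then the connecting map from the
 homology of \<open>M / N\<close> to that of \<open>N / A\<close> is injective.\<close>

lemma bnd_of_exact:
 assumes X: "matrices_over R X" and M: "module R M" and A: "submodule A R M" and N: "submodule N R M"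
  and AN: "A \<subseteq> N"
  and exact: "\<And>w. w \<in> cyc X M A (carrier M) (Suc i) ==> w \<in> bnd X M A (carrier M) (Suc i)"
  and z: "z \<in> tuples (rk X (Suc i)) (carrier M)" and dz: "cdif X M (Suc i) z \<in> bnd X M A N i"
 shows "z \<in> bnd X M N (carrier M) (Suc i)"
proof -
 let ?P = "pow M (rk X (Suc i))" and ?Q = "pow M (rk X i)"
 interpret M: module R M by (rule M)
 interpret P: module R ?P by (rule pow_mod[OF M])
 interpret Q: module R ?Q by (rule pow_mod[OF M])
 note cs = M.carrier_is_submodule
 obtain n k where nk: "n \<in> tuples (rk X (Suc i)) N" "k \<in> tuples (rk X i) A"
  "cdif X M (Suc i) z = cdif X M (Suc i) n \<oplus>[?Q] k" using dz unfolding bnd_def by blast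
 have nP: "n \<in> carrier ?P" using submodule_carrier[OF submodule_tuples[OF M N] nk(1)] .
 have zP: "z \<in> carrier ?P" using z by simp
 obtain w where w: "w \<in> carrier ?P" "z = n \<oplus>[?P] w" using P.ex_diff[OF zP nP] by metis
 note dc = cdif_carrier[OF X M, of _ i, folded power_module_simps(1)]
 have kQ: "k \<in> carrier ?Q" using submodule_carrier[OF submodule_tuples[OF M A] nk(2)] .
 have "cdif X M (Suc i) z = cdif X M (Suc i) n \<oplus>[?Q] cdif X M (Suc i) w"
  unfolding w(2) using nP w(1) by (intro cdif_add[OF X M]) simp_all
 then have "cdif X M (Suc i) w = k"
  using nk(3) dc[OF nP] dc[OF w(1)] kQ Q.M.add.l_cancel by metis
 then have "w \<in> cyc X M A (carrier M) (Suc i)"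
  unfolding cyc_Suc using w(1) nk(2) by simp
 then have "w \<in> bnd X M A (carrier M) (Suc i)" by (rule exact)
 then have "w \<in> bnd X M N (carrier M) (Suc i)" using bnd_mono[OF X M AN subset_refl] by blast
 moreover have "n \<in> bnd X M N (carrier M) (Suc i)" by (rule bnd_lower[OF X M N cs nk(1)])
 ultimately show ?thesis
  unfolding w(2) using submodule_add[OF bnd_submodule[OF X M N cs]] by simp
qed

lemma tuples_lift:
 assumes "\<And>b. b \<in> B ==> \<exists>x\<in>B'. \<exists>a\<in>A. b = p x \<oplus>[M] a" and z: "z \<in> tuples n B"
 obtains x a where "x \<in> tuples n B'" "a \<in> tuples n A" "z = tuple_map n p x \<oplus>[pow M n] a"
proof -
 have "\<forall>j. \<exists>x a. j < n \<longrightarrow> x \<in> B' \<and> a \<in> A \<and> z j = p x \<oplus>[M] a"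
  using assms tuples_mem[OF z] by meson
 then obtain x a where xa: "\<And>j. j < n ==> x j \<in> B' \<and> a j \<in> A \<and> z j = p (x j) \<oplus>[M] a j"
  by metis
 show ?thesis
 proof (rule that[of "\<lambda>j\<in>{..<n}. x j" "\<lambda>j\<in>{..<n}. a j"])
  show "z = tuple_map n p (\<lambda>j\<in>{..<n}. x j) \<oplus>[pow M n] (\<lambda>j\<in>{..<n}. a j)"
   using xa by (intro tuples_eqI[OF z, of _ UNIV]) auto
 qed (use xa in auto)
qed

text \<open>A linear map \<open>p\<close> inducing an isomorphism \<open>B' / A' \<rightarrow> B / A\<close> of coefficients induces an
 isomorphism in homology.\<close>

context
 fixes R :: "('a, 'r) ring_scheme" and X :: "'a free_complex" and M' :: "('a, 'n) module" and M :: "('a, 'm) module"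
  and p A' B' A B
 assumes X: "matrices_over R X" and M': "module R M'" and M: "module R M" and p: "p \<in> linear_maps R M' M"
  and A': "submodule A' R M'" and B': "submodule B' R M'" and A: "submodule A R M" and B: "submodule B R M"
  and AB: "A' \<subseteq> B'" "A \<subseteq> B" and pB: "\<And>x. x \<in> B' ==> p x \<in> B"
  and inj: "\<And>x. x \<in> B' ==> p x \<in> A \<longleftrightarrow> x \<in> A'"
  and surj: "\<And>b. b \<in> B ==> \<exists>x\<in>B'. \<exists>a\<in>A. b = p x \<oplus>[M] a"
begin

lemma tuple_map_mem_iff: "x \<in> tuples n B' ==> tuple_map n p x \<in> tuples n A \<longleftrightarrow> x \<in> tuples n A'"
 using inj by (auto simp: tuple_map_def PiE_iff)

lemma tuple_map_mem: "x \<in> tuples n B' ==> tuple_map n p x \<in> tuples n B"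
 using tuple_map_tuples[OF pB] .

lemma cdif_tuple_map_mem:
 assumes "x \<in> tuples (rk X (Suc j)) B'"
 shows "cdif X M (Suc j) (tuple_map (rk X (Suc j)) p x) = tuple_map (rk X j) p (cdif X M' (Suc j) x)"
 using cdif_tuple_map[OF X M' M p] submodule_carrier[OF submodule_tuples[OF M' B']] assms by simp

lemma tuple_map_cyc:
 assumes z: "z \<in> cyc X M' A' B' i"
 shows "tuple_map (rk X i) p z \<in> cyc X M A B i"
proof (cases i)
 case 0 then show ?thesis using z tuple_map_mem by simp
next
 case (Suc j)
 then have h: "z \<in> tuples (rk X (Suc j)) B'" "cdif X M' (Suc j) z \<in> tuples (rk X j) A'"
  using z unfolding Suc cyc_Suc by auto
 then have "tuple_map (rk X j) p (cdif X M' (Suc j) z) \<in> tuples (rk X j) A"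
  using tuple_map_mem_iff[of "cdif X M' (Suc j) z"] tuples_mono[OF AB(1), of "rk X j"] by blast
 then show ?thesis unfolding Suc cyc_Suc using tuple_map_mem[OF h(1)] cdif_tuple_map_mem[OF h(1)] by simp
qed

lemma tuple_map_bnd_iff:
 assumes zt: "z \<in> tuples (rk X i) B'"
 shows "tuple_map (rk X i) p z \<in> bnd X M A B i \<longleftrightarrow> z \<in> bnd X M' A' B' i"
proof
 let ?P = "pow M' (rk X i)" and ?Q = "pow M (rk X i)" and ?f = "tuple_map (rk X i) p"
 interpret P: module R ?P by (rule pow_mod[OF M'])
 interpret Q: module R ?Q by (rule pow_mod[OF M])
 have f: "?f \<in> linear_maps R ?P ?Q" by (rule tuple_map_linear[OF p])
 note A't = submodule_tuples[OF M' A'] and B't = submodule_tuples[OF M' B']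
  and At = submodule_tuples[OF M A] and Bt = submodule_tuples[OF M B]
 note cM' = submodule_carrier[OF B't] and cM = submodule_carrier[OF Bt] and cA = submodule_carrier[OF At]
 note pAB = tuple_map_mem_iff and pBB = tuple_map_mem and nat = cdif_tuple_map_mem
 {
   assume "z \<in> bnd X M' A' B' i"
   then obtain y w where yw: "y \<in> tuples (rk X (Suc i)) B'" "w \<in> tuples (rk X i) A'"
    "z = cdif X M' (Suc i) y \<oplus>[?P] w" unfolding bnd_def by auto
   have wB: "w \<in> tuples (rk X i) B'" using yw(2) tuples_mono[OF AB(1)] by blast
   have "?f z = cdif X M (Suc i) (tuple_map (rk X (Suc i)) p y) \<oplus>[?Q] ?f w"
    unfolding yw(3) nat[OF yw(1)]
    by (rule linear_mapsD(2)[OF f]) (use cM' cdif_tuples[OF X M' B' yw(1)] wB in auto)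
   also have "\<dots> \<in> bnd X M A B i" using pBB[OF yw(1)] pAB[OF wB] yw(2) by (intro bndI[OF X M]) auto
   finally show "?f z \<in> bnd X M A B i" .
  next
   assume "?f z \<in> bnd X M A B i"
   then obtain y w where yw: "y \<in> tuples (rk X (Suc i)) B" "w \<in> tuples (rk X i) A"
    "?f z = cdif X M (Suc i) y \<oplus>[?Q] w" unfolding bnd_def by auto
   obtain y' a where y': "y' \<in> tuples (rk X (Suc i)) B'" "a \<in> tuples (rk X (Suc i)) A"
    "y = tuple_map (rk X (Suc i)) p y' \<oplus>[pow M (rk X (Suc i))] a"
    using tuples_lift[OF surj yw(1)] by metis
   have dy': "cdif X M' (Suc i) y' \<in> tuples (rk X i) B'" by (rule cdif_tuples[OF X M' B' y'(1)])
   obtain u where u: "u \<in> tuples (rk X i) B'" "z = cdif X M' (Suc i) y' \<oplus>[?P] u"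
    using P.ex_diff_mem[OF B't zt dy'] by metis
   have da: "cdif X M (Suc i) a \<in> tuples (rk X i) A" by (rule cdif_tuples[OF X M A y'(2)])
   have "cdif X M (Suc i) y = ?f (cdif X M' (Suc i) y') \<oplus>[?Q] cdif X M (Suc i) a"
    unfolding y'(3) nat[OF y'(1), symmetric]
    by (rule cdif_add[OF X M]) (use pBB[OF y'(1)] y'(2) submodule_carrier[OF A] submodule_carrier[OF B] in \<open>auto simp: PiE_iff\<close>)
   moreover have "?f z = ?f (cdif X M' (Suc i) y') \<oplus>[?Q] ?f u"
    unfolding u(2) by (rule linear_mapsD(2)[OF f]) (use cM' dy' u in auto)
   ultimately have "?f (cdif X M' (Suc i) y') \<oplus>[?Q] ?f u = ?f (cdif X M' (Suc i) y') \<oplus>[?Q] (cdif X M (Suc i) a \<oplus>[?Q] w)"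
    using yw(3) cA da yw(2) cM[OF pBB[OF dy']] Q.M.a_assoc by metis
   then have "?f u = cdif X M (Suc i) a \<oplus>[?Q] w"
    using cM pBB[OF dy'] pBB[OF u(1)] cA da yw(2) Q.M.add.l_cancel Q.M.a_closed by metis
   then have "?f u \<in> tuples (rk X i) A" using submodule_add[OF At da yw(2)] by simp
   then show "z \<in> bnd X M' A' B' i"
    unfolding u(2) using pAB[OF u(1)] y'(1) by (intro bndI[OF X M']) auto
 }
qed

lemma cyc_lift:
 assumes z: "z \<in> cyc X M A B i"
 shows "\<exists>x\<in>cyc X M' A' B' i. \<exists>a\<in>tuples (rk X i) A. z = tuple_map (rk X i) p x \<oplus>[pow M (rk X i)] a"
proof -
 let ?Q = "pow M (rk X i)" and ?f = "tuple_map (rk X i) p"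
 note pAB = tuple_map_mem_iff and pBB = tuple_map_mem and nat = cdif_tuple_map_mem
 obtain x a where x: "x \<in> tuples (rk X i) B'" "a \<in> tuples (rk X i) A" "z = ?f x \<oplus>[?Q] a"
  using tuples_lift[OF surj cyc_tuples[OF z]] by metis
 have "x \<in> cyc X M' A' B' i"
 proof (cases i)
  case 0 then show ?thesis using x by simp
 next
  case (Suc j)
  have dx: "cdif X M' (Suc j) x \<in> tuples (rk X j) B'" using cdif_tuples[OF X M' B'] x Suc by auto
  interpret Qj: module R "pow M (rk X j)" by (rule pow_mod[OF M])
  have At': "submodule (tuples (rk X j) A) R (pow M (rk X j))" by (rule submodule_tuples[OF M A])
  have "cdif X M (Suc j) z = tuple_map (rk X j) p (cdif X M' (Suc j) x) \<oplus>[pow M (rk X j)] cdif X M (Suc j) a"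
   unfolding x(3) Suc using x(1) unfolding Suc nat[symmetric, OF x(1)[unfolded Suc]]
   by (intro cdif_add[OF X M]) (use pBB[OF x(1)] x(2) submodule_carrier[OF A] submodule_carrier[OF B] Suc in \<open>auto simp: PiE_iff\<close>)
  moreover have "cdif X M (Suc j) z \<in> tuples (rk X j) A" using z unfolding Suc cyc_Suc by auto
  moreover have "cdif X M (Suc j) a \<in> tuples (rk X j) A" using cdif_tuples[OF X M A] x(2) Suc by auto
  moreover have "tuple_map (rk X j) p (cdif X M' (Suc j) x) \<in> carrier (pow M (rk X j))"
   using pBB[OF dx] submodule_carrier[OF submodule_tuples[OF M B]] by auto
  ultimately have "tuple_map (rk X j) p (cdif X M' (Suc j) x) \<in> tuples (rk X j) A"
   using Qj.submodule_cancel2[OF At'] by simp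
  then show ?thesis using pAB[OF dx] x(1) unfolding Suc cyc_Suc by auto
 qed
 then show ?thesis using x(2,3) by blast
qed

lemma betti_transfer:
 assumes cx: "complex_mod X M' A' B'" "complex_mod X M A B"
 shows "betti R X M' A' B' i = betti R X M A B i"
 unfolding betti_def
proof (rule rdim_transfer[where f = "tuple_map (rk X i) p"])
 let ?P = "pow M' (rk X i)" and ?Q = "pow M (rk X i)"
 show "module R ?P" "module R ?Q" using pow_mod M M' by auto
 show "tuple_map (rk X i) p \<in> linear_maps R ?P ?Q" by (rule tuple_map_linear[OF p])
 show "submodule (bnd X M' A' B' i) R ?P" "submodule (cyc X M' A' B' i) R ?P"
  "submodule (bnd X M A B i) R ?Q" "submodule (cyc X M A B i) R ?Q"
  using bnd_submodule[OF X] cyc_submodule[OF X] M M' A A' B B' by auto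
 show "bnd X M' A' B' i \<subseteq> cyc X M' A' B' i" by (rule bnd_subset_cyc[OF X M' A' B' AB(1) cx(1)])
 show "bnd X M A B i \<subseteq> cyc X M A B i" by (rule bnd_subset_cyc[OF X M A B AB(2) cx(2)])
 show "tuple_map (rk X i) p z \<in> cyc X M A B i" if "z \<in> cyc X M' A' B' i" for z
  using tuple_map_cyc[OF that] .
 show "tuple_map (rk X i) p z \<in> bnd X M A B i \<longleftrightarrow> z \<in> bnd X M' A' B' i" if "z \<in> cyc X M' A' B' i" for z
  using tuple_map_bnd_iff[OF cyc_tuples[OF that]] .
 show "\<exists>x\<in>cyc X M' A' B' i. \<exists>a\<in>bnd X M A B i. z = tuple_map (rk X i) p x \<oplus>[?Q] a"
  if "z \<in> cyc X M A B i" for z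
  using cyc_lift[OF that] bnd_lower[OF X M A B] by blast
qed

end

section \<open>Free coefficient modules\<close>

lemma (in cring) regular: "module R (reg R)"
 by (rule regular_module_module[OF is_cring])

lemma (in cring) eval_linear: "l < b ==> (\<lambda>x. x l) \<in> linear_maps R (fm R b) (reg R)"
 by (rule linear_mapsI) auto

lemma (in cring) ideal_tuples:
 "ideal J R ==> submodule (tuples b J) R (fm R b)"
 unfolding free_pow using submodule_regular_iff_ideal[OF is_cring]
 by (intro submodule_tuples regular) auto

lemma (in cring) ideal_submodule: "ideal J R ==> submodule J R (reg R)"
 using submodule_regular_iff_ideal[OF is_cring] by simp

lemma (in cring) carrier_ideal: "ideal (carrier R) R"
 by (rule oneideal)

abbreviation column :: "nat => nat => (nat => nat => 'a) => nat => 'a" where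
 "column n l \<equiv> tuple_map n (\<lambda>x. x l)"

lemma tuples_tuples_iff:
 assumes "z \<in> tuples n (tuples b C)"
 shows "z \<in> tuples n (tuples b J) \<longleftrightarrow> (\<forall>l<b. column n l z \<in> tuples n J)"
 using assms by (auto simp: tuple_map_def PiE_iff)

lemma (in cring) bnd_free_iff:
 assumes X: "matrices_over R X" and J: "ideal J R" and z: "z \<in> tuples (rk X i) (vec R b)"
 shows "z \<in> bnd X (fm R b) (tuples b J) (vec R b) i \<longleftrightarrow>
  (\<forall>l<b. column (rk X i) l z \<in> rbnd R X J i)"
proof
 let ?F = "fm R b" and ?P = "pow (fm R b) (rk X i)" and ?Q = "pow (reg R) (rk X i)"
 assume "z \<in> bnd X ?F (tuples b J) (vec R b) i"
 then obtain y w where yw: "y \<in> tuples (rk X (Suc i)) (vec R b)" "w \<in> tuples (rk X i) (tuples b J)"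
  "z = cdif X ?F (Suc i) y \<oplus>[?P] w" unfolding bnd_def by auto
 have wc: "w \<in> tuples (rk X i) (vec R b)"
  using yw(2) ideal.Icarr[OF J] by (auto simp: PiE_iff)
 show "\<forall>l<b. column (rk X i) l z \<in> rbnd R X J i"
 proof (intro allI impI)
  fix l assume l: "l < b"
  have "column (rk X i) l z = column (rk X i) l (cdif X ?F (Suc i) y) \<oplus>[?Q] column (rk X i) l w"
   unfolding yw(3) using cdif_carrier[OF X free_mod, of y i b] yw(1) wc
   by (intro linear_mapsD(2)[OF tuple_map_linear[OF eval_linear[OF l]]]) auto
  also have "column (rk X i) l (cdif X ?F (Suc i) y) = cdif X (reg R) (Suc i) (column (rk X (Suc i)) l y)"
   using yw(1) by (intro cdif_tuple_map[OF X free_mod regular eval_linear[OF l], symmetric]) simp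
  finally have e: "column (rk X i) l z =
   cdif X (reg R) (Suc i) (column (rk X (Suc i)) l y) \<oplus>[?Q] column (rk X i) l w" .
  have "column (rk X (Suc i)) l y \<in> vec R (rk X (Suc i))" "column (rk X i) l w \<in> tuples (rk X i) J"
   using l by (auto intro!: tuple_map_tuples[OF _ yw(1)] tuple_map_tuples[OF _ yw(2)])
  then show "column (rk X i) l z \<in> rbnd R X J i"
   unfolding e by (rule bndI[OF X regular])
 qed
next
 let ?F = "fm R b" and ?P = "pow (fm R b) (rk X i)" and ?Q = "pow (reg R) (rk X i)"
 assume h: "\<forall>l<b. column (rk X i) l z \<in> rbnd R X J i"
 have "\<forall>l. \<exists>y w. l < b \<longrightarrow> y \<in> vec R (rk X (Suc i)) \<and> w \<in> tuples (rk X i) J \<and>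
  column (rk X i) l z = cdif X (reg R) (Suc i) y \<oplus>[?Q] w"
  using h unfolding bnd_def by blast
 then obtain y w where yw: "\<And>l. l < b ==> y l \<in> vec R (rk X (Suc i))"
  "\<And>l. l < b ==> w l \<in> tuples (rk X i) J"
  "\<And>l. l < b ==> column (rk X i) l z = cdif X (reg R) (Suc i) (y l) \<oplus>[?Q] w l" by metis
 let ?y = "\<lambda>c\<in>{..<rk X (Suc i)}. \<lambda>l\<in>{..<b}. y l c" and ?w = "\<lambda>c\<in>{..<rk X i}. \<lambda>l\<in>{..<b}. w l c"
 have y: "?y \<in> tuples (rk X (Suc i)) (vec R b)" using tuples_mem[OF yw(1)] by auto
 have w: "?w \<in> tuples (rk X i) (tuples b J)" using tuples_mem[OF yw(2)] by auto
 have e: "z = cdif X ?F (Suc i) ?y \<oplus>[?P] ?w"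
 proof (rule tuples_eqI[OF z])
  have wc: "?w \<in> tuples (rk X i) (vec R b)" using w ideal.Icarr[OF J] by (auto simp: PiE_iff)
  have dy: "cdif X ?F (Suc i) ?y \<in> tuples (rk X i) (vec R b)"
   using cdif_carrier[OF X free_mod, of ?y i b] y by simp
  then show sum: "cdif X ?F (Suc i) ?y \<oplus>[?P] ?w \<in> tuples (rk X i) (vec R b)"
   using wc by (auto simp: PiE_iff)
  fix r assume r: "r < rk X i"
  show "z r = (cdif X ?F (Suc i) ?y \<oplus>[?P] ?w) r"
  proof (rule tuples_eqI)
   show "z r \<in> vec R b" using z r by (rule tuples_mem)
   show "(cdif X ?F (Suc i) ?y \<oplus>[?P] ?w) r \<in> vec R b" using sum r by (rule tuples_mem)
   fix l assume l: "l < b"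
   have "column (rk X (Suc i)) l ?y = y l"
    using l by (intro tuples_eqI[OF _ yw(1)[OF l]]) (use tuples_mem[OF yw(1)[OF l]] in \<open>auto simp: tuple_map_def\<close>)
   moreover have "column (rk X i) l ?w = w l"
    using l by (intro tuples_eqI[OF _ yw(2)[OF l]]) (use tuples_mem[OF yw(2)[OF l]] in \<open>auto simp: tuple_map_def\<close>)
   moreover have "cdif X (reg R) (Suc i) (column (rk X (Suc i)) l ?y) = column (rk X i) l (cdif X ?F (Suc i) ?y)"
    by (rule cdif_tuple_map[OF X free_mod regular eval_linear[OF l]]) (use y in simp)
   ultimately have "column (rk X i) l z = column (rk X i) l (cdif X ?F (Suc i) ?y) \<oplus>[?Q] column (rk X i) l ?w"
    using yw(3)[OF l] by simp
   then have "column (rk X i) l z r = (column (rk X i) l (cdif X ?F (Suc i) ?y) \<oplus>[?Q] column (rk X i) l ?w) r" by simp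
   then show "z r l = (cdif X ?F (Suc i) ?y \<oplus>[?P] ?w) r l" using r l by simp
  qed
 qed
 show "z \<in> bnd X ?F (tuples b J) (vec R b) i"
  by (subst e) (rule bndI[OF X free_mod y w])
qed

lemma (in cring) cyc_free_iff:
 assumes X: "matrices_over R X" and J: "ideal J R" and C: "ideal C R" and z: "z \<in> tuples (rk X i) (vec R b)"
 shows "z \<in> cyc X (fm R b) (tuples b J) (tuples b C) i \<longleftrightarrow>
  (\<forall>l<b. column (rk X i) l z \<in> cyc X (reg R) J C i)"
proof (cases i)
 case 0 then show ?thesis using tuples_tuples_iff z by simp
next
 case (Suc j)
 let ?F = "fm R b"
 have zS: "z \<in> tuples (rk X (Suc j)) (vec R b)" using z Suc by simp
 have c: "cdif X (reg R) (Suc j) (column (rk X (Suc j)) l z) = column (rk X j) l (cdif X ?F (Suc j) z)"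
  if "l < b" for l
  using zS by (intro cdif_tuple_map[OF X free_mod regular eval_linear[OF that]]) simp
 have dz: "cdif X ?F (Suc j) z \<in> tuples (rk X j) (vec R b)"
  using cdif_carrier[OF X free_mod, of z j b] zS by simp
 show ?thesis unfolding Suc cyc_Suc mem_Collect_eq tuples_tuples_iff[OF zS] tuples_tuples_iff[OF dz]
  using c by metis
qed

section \<open>Resolutions of the residue field\<close>

lemma (in cring) linear_map_ideal_tuples:
 assumes p: "p \<in> linear_maps R (fm R n) (fm R b)" and L: "ideal L R"
  and x: "x \<in> tuples n L"
 shows "p x \<in> tuples b L"
proof -
 interpret F: module R "fm R b" by (rule free_mod)
 have xc: "x \<in> vec R n" using x ideal.Icarr[OF L] by (auto simp: PiE_iff)
 have s: "p (unit_vector R n j) \<in> vec R b" for j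
  using linear_mapsD(1)[OF p] unit_vector_tuples by simp
 have "p x = lin_comb (fm R b) n (\<lambda>j. p (unit_vector R n j)) x"
  by (rule linear_map_free_eq[OF free_mod p xc])
 also have "\<dots> \<in> tuples b L"
  unfolding lin_comb_def
 proof (rule F.submodule_finsum[OF ideal_tuples[OF L]])
  fix j assume "j \<in> {..<n}"
  then have "x j \<in> L" using x by auto
  then have "x j \<otimes> p (unit_vector R n j) l \<in> L" if "l < b" for l
   using tuples_mem[OF s that] by (intro ideal.I_r_closed[OF L])
  then show "x j \<odot>[fm R b] p (unit_vector R n j) \<in> tuples b L" by auto
 qed simp
 finally show ?thesis .
qed

lemma rdim_power:
 assumes loc: "local_noetherian R \<mm>"
  and M: "noetherian_module R M" and A: "submodule A R M" and B: "submodule B R M" and AB: "A \<subseteq> B"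
  and mB: "\<And>r x. r \<in> \<mm> ==> x \<in> B ==> r \<odot>[M] x \<in> A"
 shows "rdim R (pow M b) (tuples b A) (tuples b B) = b * rdim R M A B"
proof -
 interpret local_noetherian R \<mm> by (rule loc)
 have MM: "module R M" using M unfolding noetherian_module_def by auto
 interpret M: module R M by (rule MM)
 let ?P = "pow M b"
 have PN: "noetherian_module R ?P" by (rule noetherian_power_module[OF M])
 have P: "module R ?P" by (rule pow_mod[OF MM])
 note Ac = submodule_carrier[OF A] and Bc = submodule_carrier[OF B]
 \<comment> \<open>a filtration from \<open>A\<^sup>b\<close> to \<open>B\<^sup>b\<close> that enlarges one coordinate at a time\<close>
 define C where "C j = {z \<in> tuples b B. \<forall>l<b. j \<le> l \<longrightarrow> z l \<in> A}" for j
 have Cs: "submodule (C j) R ?P" for j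
 proof (rule module.submoduleI_smult[OF P])
  have "tuples b B \<subseteq> tuples b (carrier M)" using Bc by (intro tuples_mono) auto
  then show "C j \<subseteq> carrier ?P" unfolding C_def by auto
 qed (auto simp: C_def PiE_iff submodule_zero[OF A] submodule_zero[OF B] intro: submodule_add[OF A] submodule_add[OF B]
    submodule_smult[OF A] submodule_smult[OF B])
 have C0: "C 0 = tuples b A" and Cb: "C b = tuples b B" unfolding C_def using AB by (auto simp: PiE_def Pi_def extensional_def)
 have Cm: "C j \<subseteq> C (Suc j)" for j unfolding C_def by auto
 have C0m: "C 0 \<subseteq> C j" for j unfolding C_def by auto
 have kill: "r \<odot>[?P] x \<in> C 0" if "r \<in> \<mm>" "x \<in> C j" for r x j
  unfolding C0 using that mB unfolding C_def by (auto simp: PiE_iff)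
 have ev: "(\<lambda>x. x j) \<in> linear_maps R ?P M" if "j < b" for j
  by (rule linear_mapsI) (use that in auto)
 have step: "rdim R ?P (C j) (C (Suc j)) = rdim R M A B" if j: "j < b" for j
 proof (rule rdim_transfer[OF P MM ev[OF j] Cs Cs A B Cm AB])
  fix x assume x: "x \<in> C (Suc j)"
  then show "x j \<in> B" using j unfolding C_def by auto
  show "x j \<in> A \<longleftrightarrow> x \<in> C j"
   using x j unfolding C_def by (auto simp: Suc_le_eq le_less)
 next
  fix y assume y: "y \<in> B"
  let ?x = "\<lambda>l\<in>{..<b}. if l = j then y else \<zero>[M]"
  have "?x \<in> C (Suc j)" unfolding C_def using y submodule_zero[OF A] submodule_zero[OF B] by auto
  moreover have "y = ?x j \<oplus>[M] \<zero>[M]" using j y Bc by simp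
  ultimately show "\<exists>x\<in>C (Suc j). \<exists>a\<in>A. y = x j \<oplus>[M] a" using submodule_zero[OF A] by blast
 qed
 have "rdim R ?P (C 0) (C j) = j * rdim R M A B" if "j \<le> b" for j using that
 proof (induction j)
  case 0 then show ?case using rdim_self[OF P Cs] by simp
 next
  case (Suc j)
  have "rdim R ?P (C 0) (C (Suc j)) = rdim R ?P (C 0) (C j) + rdim R ?P (C j) (C (Suc j))"
   using kill by (intro rdim_additive[OF PN Cs Cs Cs C0m Cm])
  then show ?case using Suc step[of j] by simp
 qed
 from this[of b] show ?thesis unfolding C0 Cb by simp
qed

context local_noetherian
begin

lemma regular_noetherian: "noetherian_module R (reg R)"
 by (rule noetherian_regular_module[OF is_cring noetherian])

lemma carrier_sub: "submodule (carrier R) R (reg R)"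
 by (rule ideal_submodule[OF carrier_ideal])

lemma free_sub: "submodule (vec R b) R (fm R b)"
 by (rule ideal_tuples[OF carrier_ideal])

text \<open>A resolution of the residue field over \<open>R / K\<close>, with its matrices lifted to \<open>R\<close>.  The vector
 \<open>v\<close> is a preimage of \<open>1\<close> under the augmentation, which is thereby determined.\<close>

definition residue_resolution :: "'a set => 'a free_complex => (nat => 'a) => bool" where
 "residue_resolution K X v \<longleftrightarrow>
  ideal K R \<and> K \<subseteq> \<mm> \<and> matrices_over R X \<and>
  complex_mod X (reg R) K (carrier R) \<and>
  (\<forall>i. rcyc R X K (Suc i) \<subseteq> rbnd R X K (Suc i)) \<and>
  v \<in> vec R (rk X 0) \<and>
  (\<forall>z\<in>vec R (rk X 0). \<exists>r\<in>carrier R. \<exists>u\<in>rbnd R X K 0.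
    z = r \<odot>[fm R (rk X 0)] v \<oplus>[fm R (rk X 0)] u) \<and>
  (\<forall>r\<in>carrier R. r \<odot>[fm R (rk X 0)] v \<in> rbnd R X K 0 \<longleftrightarrow> r \<in> \<mm>)"

lemma cover:
 assumes N: "submodule N R (fm R b)" and L: "ideal L R" and LN: "tuples b L \<subseteq> N"
 shows "\<exists>n p. n = rdim R (fm R b) (tuples b L) N \<and>
  p \<in> linear_maps R (fm R n) (fm R b) \<and>
  (\<forall>x\<in>vec R n. p x \<in> N) \<and>
  (\<forall>y\<in>N. \<exists>x\<in>vec R n. \<exists>a\<in>tuples b L. y = p x \<oplus>[fm R b] a) \<and>
  (\<forall>x\<in>vec R n. p x \<in> tuples b L \<longrightarrow> x \<in> tuples n \<mm>)"
 by (rule minimal_generators[OF noetherian_free ideal_tuples[OF L] N LN])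

lemma vimage_submodule:
 assumes p: "p \<in> linear_maps R (fm R n) (fm R b)" and N: "submodule N R (fm R b)"
 shows "submodule {x \<in> vec R n. p x \<in> N} R (fm R n)"
 by (rule submodule_vimage[OF free_mod free_mod p free_sub N])

lemma tuples_subset_vimage:
 assumes p: "p \<in> linear_maps R (fm R n) (fm R b)" and L: "ideal L R"
 shows "tuples n L \<subseteq> {x \<in> vec R n. p x \<in> tuples b L}"
 using linear_map_ideal_tuples[OF p L] ideal.Icarr[OF L] by (auto simp: PiE_iff)

context
 fixes K X v
 assumes res: "residue_resolution K X v"
begin

lemma K: "ideal K R" and K_\<mm>: "K \<subseteq> \<mm>" and matrices: "matrices_over R X"
 and complex: "complex_mod X (reg R) K (carrier R)"
 and exact: "z \<in> rcyc R X K (Suc i) ==> z \<in> rbnd R X K (Suc i)"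
 and v: "v \<in> vec R (rk X 0)"
 and aug: "z \<in> vec R (rk X 0) ==> \<exists>r\<in>carrier R. \<exists>u\<in>rbnd R X K 0.
    z = r \<odot>[fm R (rk X 0)] v \<oplus>[fm R (rk X 0)] u"
 and aug_iff: "r \<in> carrier R ==>
  r \<odot>[fm R (rk X 0)] v \<in> rbnd R X K 0 \<longleftrightarrow> r \<in> \<mm>"
 using res unfolding residue_resolution_def by auto

lemma complex_free: "complex_mod X (fm R b) (tuples b K) (vec R b)"
 unfolding complex_mod_def
proof (intro allI ballI)
 let ?F = "fm R b"
 fix i y assume y: "y \<in> tuples (rk X (Suc (Suc i))) (vec R b)"
 let ?z = "cdif X ?F (Suc (Suc i)) y"
 have z: "?z \<in> tuples (rk X (Suc i)) (vec R b)"
  using cdif_carrier[OF matrices free_mod, of y "Suc i" b] y by simp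
 have w: "cdif X ?F (Suc i) ?z \<in> tuples (rk X i) (vec R b)"
  using cdif_carrier[OF matrices free_mod, of ?z i b] z by simp
 show "cdif X ?F (Suc i) ?z \<in> tuples (rk X i) (tuples b K)"
  unfolding tuples_tuples_iff[OF w]
 proof (intro allI impI)
  fix l assume l: "l < b"
  have "column (rk X i) l (cdif X ?F (Suc i) ?z) =
   cdif X (reg R) (Suc i) (cdif X (reg R) (Suc (Suc i)) (column (rk X (Suc (Suc i))) l y))"
   using y z by (simp add: cdif_tuple_map[OF matrices free_mod regular eval_linear[OF l]])
  moreover have "column (rk X (Suc (Suc i))) l y \<in> vec R (rk X (Suc (Suc i)))"
   using l by (auto intro!: tuple_map_tuples[OF _ y])
  ultimately show "column (rk X i) l (cdif X ?F (Suc i) ?z) \<in> tuples (rk X i) K"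
   using complex unfolding complex_mod_def by simp
 qed
qed

lemma exact_free:
 assumes z: "z \<in> cyc X (fm R b) (tuples b K) (vec R b) (Suc i)"
 shows "z \<in> bnd X (fm R b) (tuples b K) (vec R b) (Suc i)"
 using bnd_free_iff[OF matrices K cyc_tuples[OF z]] cyc_free_iff[OF matrices K carrier_ideal cyc_tuples[OF z]]
  exact z by blast

lemma \<mm>_tuples_bnd:
 assumes z: "z \<in> tuples (rk X 0) \<mm>"
 shows "z \<in> rbnd R X K 0"
proof -
 let ?n = "rk X 0"
 let ?F = "fm R ?n" and ?B = "rbnd R X K 0"
 interpret F: module R ?F by (rule free_mod)
 have B: "submodule ?B R ?F"
  unfolding free_pow
  by (rule bnd_submodule[OF matrices regular ideal_submodule[OF K] carrier_sub])
 have zc: "z \<in> vec R ?n" using z \<mm>_carrier by (auto simp: PiE_iff)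
 have "z = lin_comb ?F ?n (unit_vector R ?n) z" using free_module_decomp[OF is_cring zc] by simp
 also have "\<dots> \<in> ?B" unfolding lin_comb_def
 proof (rule F.submodule_finsum[OF B])
  fix c assume "c \<in> {..<?n}"
  then have zc: "z c \<in> \<mm>" "z c \<in> carrier R" using z \<mm>_carrier by auto
  obtain r u where ru: "r \<in> carrier R" "u \<in> ?B" "unit_vector R ?n c = r \<odot>[?F] v \<oplus>[?F] u"
   using aug[OF unit_vector_tuples] by blast
  have vc: "v \<in> carrier ?F" using v by simp
  have "z c \<odot>[?F] unit_vector R ?n c = (z c \<otimes> r) \<odot>[?F] v \<oplus>[?F] z c \<odot>[?F] u"
   unfolding ru(3) using zc ru vc submodule_carrier[OF B]
   by (simp only: F.smult_r_distr F.smult_assoc1 F.smult_closed)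
  moreover have "(z c \<otimes> r) \<odot>[?F] v \<in> ?B"
   using aug_iff[of "z c \<otimes> r"] ideal.I_r_closed[OF ideal_\<mm> zc(1) ru(1)] zc ru by blast
  ultimately show "z c \<odot>[?F] unit_vector R ?n c \<in> ?B"
   using submodule_add[OF B] submodule_smult[OF B zc(2) ru(2)] by metis
 qed simp
 finally show ?thesis .
qed

lemma \<mm>_tuples_bnd_free:
 assumes z: "z \<in> tuples (rk X 0) (tuples b \<mm>)"
 shows "z \<in> bnd X (fm R b) (tuples b K) (vec R b) 0"
proof -
 have zc: "z \<in> tuples (rk X 0) (vec R b)" using z \<mm>_carrier by (auto simp: PiE_iff)
 show ?thesis
  unfolding bnd_free_iff[OF matrices K zc]
 proof (intro allI impI \<mm>_tuples_bnd)
  fix l assume "l < b"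
  then show "column (rk X 0) l z \<in> tuples (rk X 0) \<mm>" by (intro tuple_map_tuples[OF _ z]) auto
 qed
qed

lemma bnd_of_cdif_bnd:
 assumes N: "submodule N R (fm R b)" and KN: "tuples b K \<subseteq> N"
  and z: "z \<in> tuples (rk X (Suc i)) (vec R b)"
  and dz: "cdif X (fm R b) (Suc i) z \<in> bnd X (fm R b) (tuples b K) N i"
 shows "z \<in> bnd X (fm R b) N (vec R b) (Suc i)"
 using bnd_of_exact[OF matrices free_mod ideal_tuples[OF K] N KN, of i z]
  exact_free z dz by simp

lemma bnd_of_cdif_bnd_regular:
 assumes N: "ideal N R" and KN: "K \<subseteq> N" and z: "z \<in> vec R (rk X (Suc i))"
  and dz: "cdif X (reg R) (Suc i) z \<in> bnd X (reg R) K N i"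
 shows "z \<in> rbnd R X N (Suc i)"
 using bnd_of_exact[OF matrices regular ideal_submodule[OF K] ideal_submodule[OF N] KN, of i z]
  exact z dz by simp

text \<open>The homology with coefficients in \<open>R\<^sup>b / N\<close> is annihilated by \<open>\<mm>\<close>: this holds in degree 0, and the
 connecting map to the homology of \<open>N\<close>, which is again the homology of a quotient of a free module,
 lowers the degree.\<close>

lemma homology_annihilated:
 assumes "submodule N R (fm R b)" "tuples b K \<subseteq> N" "r \<in> \<mm>"
  and "z \<in> cyc X (fm R b) N (vec R b) i"
 shows "r \<odot>[pow (fm R b) (rk X i)] z \<in> bnd X (fm R b) N (vec R b) i"
 using assms
proof (induction i arbitrary: b N z)
 case 0
 let ?F = "fm R b"
 have "r \<odot>[pow ?F (rk X 0)] z \<in> tuples (rk X 0) (tuples b \<mm>)"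
  using 0(3,4) ideal.I_r_closed[OF ideal_\<mm>] by (auto simp: PiE_iff)
 then show ?case
  using \<mm>_tuples_bnd_free bnd_mono[OF matrices free_mod 0(2) subset_refl] by blast
next
 case (Suc i)
 let ?F = "fm R b"
 let ?P = "pow ?F (rk X (Suc i))" and ?Q = "pow ?F (rk X i)"
 note FM = free_mod and N = Suc.prems(1) and KN = Suc.prems(2)
 have rc: "r \<in> carrier R" using Suc.prems(3) \<mm>_carrier by auto
 have zt: "z \<in> tuples (rk X (Suc i)) (vec R b)" using cyc_tuples[OF Suc.prems(4)] .
 obtain n p where p0: "p \<in> linear_maps R (fm R n) ?F" "\<forall>x\<in>vec R n. p x \<in> N"
  "\<forall>y\<in>N. \<exists>x\<in>vec R n. \<exists>a\<in>tuples b K. y = p x \<oplus>[?F] a"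
  using cover[OF N K KN] by blast
 note p = p0(1) p0(2,3)[rule_format]
 let ?N = "{x \<in> vec R n. p x \<in> tuples b K}"
 note N' = vimage_submodule[OF p(1) ideal_tuples[OF K]] and KN' = tuples_subset_vimage[OF p(1) K]
 let ?u = "cdif X ?F (Suc i) z"
 have u: "?u \<in> tuples (rk X i) N" using Suc.prems(4) unfolding cyc_Suc by auto
 have u_cyc: "?u \<in> cyc X ?F (tuples b K) N i"
 proof (cases i)
  case 0 then show ?thesis using u by simp
 next
  case (Suc j)
  then have "cdif X ?F (Suc j) ?u \<in> tuples (rk X j) (tuples b K)"
   using complex_free zt unfolding complex_mod_def by blast
  then show ?thesis using u unfolding Suc cyc_Suc by auto
 qed
 have N'sub: "?N \<subseteq> vec R n" by (rule Collect_subset)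
 have inj: "p x \<in> tuples b K \<longleftrightarrow> x \<in> ?N" if "x \<in> vec R n" for x using that by simp
 note tr = matrices FM FM p(1) N' free_sub ideal_tuples[OF K] N N'sub KN p(2) inj p(3)
 obtain x a where x: "x \<in> cyc X (fm R n) ?N (vec R n) i" "a \<in> tuples (rk X i) (tuples b K)"
  "?u = tuple_map (rk X i) p x \<oplus>[?Q] a"
  using cyc_lift[OF tr u_cyc] by blast
 interpret Q: module R ?Q by (rule pow_mod[OF FM])
 have rx: "r \<odot>[pow (fm R n) (rk X i)] x \<in> bnd X (fm R n) ?N (vec R n) i"
  by (rule Suc.IH[OF N' KN' Suc.prems(3) x(1)])
 have xt: "x \<in> tuples (rk X i) (vec R n)" using cyc_tuples[OF x(1)] .
 have rxt: "r \<odot>[pow (fm R n) (rk X i)] x \<in> tuples (rk X i) (vec R n)"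
  using submodule_smult[OF submodule_tuples[OF FM free_sub] rc xt] .
 have B: "submodule (bnd X ?F (tuples b K) N i) R ?Q"
  by (rule bnd_submodule[OF matrices FM ideal_tuples[OF K] N])
 have "tuple_map (rk X i) p (r \<odot>[pow (fm R n) (rk X i)] x) \<in> bnd X ?F (tuples b K) N i"
  using tuple_map_bnd_iff[OF tr rxt] rx by blast
 then have "r \<odot>[?Q] tuple_map (rk X i) p x \<in> bnd X ?F (tuples b K) N i"
  using linear_mapsD(3)[OF tuple_map_linear[OF p(1)] rc, of x "rk X i"] xt by simp
 moreover have "r \<odot>[?Q] a \<in> bnd X ?F (tuples b K) N i"
  by (rule bnd_lower[OF matrices FM ideal_tuples[OF K] N])
   (rule submodule_smult[OF submodule_tuples[OF FM ideal_tuples[OF K]] rc x(2)])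
 moreover have "tuple_map (rk X i) p x \<in> carrier ?Q" "a \<in> carrier ?Q"
  using xt x(2) ideal.Icarr[OF K] linear_mapsD(1)[OF p(1)] by (auto simp: PiE_iff tuple_map_def)
 ultimately have "r \<odot>[?Q] ?u \<in> bnd X ?F (tuples b K) N i"
  unfolding x(3) using submodule_add[OF B] Q.smult_r_distr[OF rc] by metis
 then have "cdif X ?F (Suc i) (r \<odot>[?P] z) \<in> bnd X ?F (tuples b K) N i"
  using cdif_smult[OF matrices FM rc] zt by simp
 moreover have "r \<odot>[?P] z \<in> tuples (rk X (Suc i)) (vec R b)"
  using submodule_smult[OF submodule_tuples[OF FM free_sub] rc zt] .
 ultimately show ?case by (intro bnd_of_cdif_bnd[OF N KN])
qed

end

end

section \<open>Dimension shifting\<close>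

context local_noetherian
begin

text \<open>Betti numbers of \<open>(R / J)\<^sup>b\<close>.\<close>

lemma betti_free_power:
 assumes res: "residue_resolution K X v" and J: "ideal J R" and KJ: "K \<subseteq> J"
 shows "betti R X (fm R b) (tuples b J) (vec R b) i =
  b * rbetti R X J i"
proof -
 let ?n = "rk X i" and ?F = "fm R b" and ?M = "reg R"
 let ?B = "bnd X ?M J (carrier R) i" and ?Z = "cyc X ?M J (carrier R) i"
 let ?P = "pow ?M ?n"
 note mat = matrices[OF res]
 note FM = free_mod and cs = free_sub and Js = ideal_tuples[OF J]
 have PN: "noetherian_module R ?P" by (rule noetherian_power_module[OF regular_noetherian])
 have P: "module R ?P" by (rule pow_mod[OF regular])
 have Bs: "submodule ?B R ?P" and Zs: "submodule ?Z R ?P"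
  using bnd_submodule[OF mat regular] cyc_submodule[OF mat regular] ideal_submodule[OF J] carrier_sub by auto
 have BZ: "?B \<subseteq> ?Z"
  using ideal.Icarr[OF J] KJ complex_mod_mono[OF complex[OF res], of J "carrier R"]
  by (intro bnd_subset_cyc[OF mat regular ideal_submodule[OF J] carrier_sub]) auto
 have FBZ: "bnd X ?F (tuples b J) (vec R b) i \<subseteq> cyc X ?F (tuples b J) (vec R b) i"
 proof (rule bnd_subset_cyc[OF mat FM Js cs])
  show "tuples b J \<subseteq> vec R b" using ideal.Icarr[OF J] by (intro tuples_mono) auto
  show "complex_mod X ?F (tuples b J) (vec R b)"
   by (rule complex_mod_mono[OF complex_free[OF res] tuples_mono[OF KJ] subset_refl])
 qed
 have kill1: "r \<odot>[?P] z \<in> ?B" if r: "r \<in> \<mm>" and z: "z \<in> ?Z" for r z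
 proof -
  \<comment> \<open>\<open>R\<close> and \<open>R\<^sup>1\<close> are different types; the annihilation is known for the latter\<close>
  have zt: "z \<in> vec R ?n" using cyc_tuples[OF z] .
  define z' where "z' = (\<lambda>c\<in>{..<?n}. \<lambda>l\<in>{..<1::nat}. z c)"
  have z': "z' \<in> tuples ?n (vec R 1)" unfolding z'_def using tuples_mem[OF zt] by auto
  have col: "column ?n 0 z' = z"
   using tuples_mem[OF zt] by (intro tuples_eqI[OF _ zt]) (auto simp: tuple_map_def z'_def)
  have rc: "r \<in> carrier R" using r \<mm>_carrier by auto
  have "z' \<in> cyc X (fm R 1) (tuples 1 J) (vec R 1) i"
   unfolding cyc_free_iff[OF mat J carrier_ideal z'] using z col by simp
  then have "r \<odot>[pow (fm R 1) ?n] z' \<in> bnd X (fm R 1) (tuples 1 J) (vec R 1) i"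
   by (rule homology_annihilated[OF res ideal_tuples[OF J] tuples_mono[OF KJ] r])
  moreover have "r \<odot>[pow (fm R 1) ?n] z' \<in> tuples ?n (vec R 1)"
   using submodule_smult[OF submodule_tuples[OF FM cs] rc z'] .
  ultimately have "column ?n 0 (r \<odot>[pow (fm R 1) ?n] z') \<in> ?B"
   using bnd_free_iff[OF mat J] by blast
  moreover have "column ?n 0 (r \<odot>[pow (fm R 1) ?n] z') = r \<odot>[?P] column ?n 0 z'"
   by (rule linear_mapsD(3)[OF tuple_map_linear[OF eval_linear] rc]) (use z' in auto)
  ultimately show ?thesis unfolding col by simp
 qed
 let ?flip = "\<lambda>z. \<lambda>c\<in>{..<?n}. \<lambda>l\<in>{..<b}. z l c"
 have "rdim R (pow ?P b) (tuples b ?B) (tuples b ?Z) =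
  rdim R (pow ?F ?n) (bnd X ?F (tuples b J) (vec R b) i) (cyc X ?F (tuples b J) (vec R b) i)"
 proof (rule rdim_transfer[where f = ?flip])
  show "?flip \<in> linear_maps R (pow ?P b) (pow ?F ?n)"
   by (rule linear_mapsI) (auto intro!: restrict_ext simp: PiE_iff)
  have flip: "?flip z \<in> tuples ?n (vec R b)" "\<And>l. l < b ==> column ?n l (?flip z) = z l"
   if "z \<in> tuples b ?Z" for z
  proof -
   have zl: "z l \<in> vec R ?n" if "l < b" for l using \<open>z \<in> tuples b ?Z\<close> that cyc_tuples by blast
   show "?flip z \<in> tuples ?n (vec R b)" using tuples_mem[OF zl] by auto
   show "column ?n l (?flip z) = z l" if "l < b" for l
    using that by (intro tuples_eqI[OF _ zl[OF that]]) (use tuples_mem[OF zl[OF that]] in \<open>auto simp: tuple_map_def\<close>)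
  qed
  fix z assume z: "z \<in> tuples b ?Z"
  show "?flip z \<in> cyc X ?F (tuples b J) (vec R b) i"
   unfolding cyc_free_iff[OF mat J carrier_ideal flip(1)[OF z]] using flip(2)[OF z] z by auto
  show "?flip z \<in> bnd X ?F (tuples b J) (vec R b) i \<longleftrightarrow> z \<in> tuples b ?B"
   unfolding bnd_free_iff[OF mat J flip(1)[OF z]] using flip(2)[OF z] z by (auto simp: PiE_iff)
 next
  fix y assume y: "y \<in> cyc X ?F (tuples b J) (vec R b) i"
  have yt: "y \<in> tuples ?n (vec R b)" using cyc_tuples[OF y] .
  let ?z = "\<lambda>l\<in>{..<b}. column ?n l y"
  have "\<forall>l<b. column ?n l y \<in> ?Z" using y cyc_free_iff[OF mat J carrier_ideal yt] by simp
  then have z: "?z \<in> tuples b ?Z" by auto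
  have "?flip ?z = y"
  proof (rule tuples_eqI[OF _ yt])
   show "?flip ?z \<in> tuples ?n UNIV" by auto
   show "?flip ?z j = y j" if "j < ?n" for j
    by (rule tuples_eqI[OF _ tuples_mem[OF yt that], of _ UNIV]) (use that in auto)
  qed
  moreover have "y \<oplus>[pow ?F ?n] \<zero>[pow ?F ?n] = y"
  proof -
   interpret Q: module R "pow ?F ?n" by (rule pow_mod[OF FM])
   show ?thesis by (rule Q.M.r_zero) (use yt in simp)
  qed
  ultimately show "\<exists>x\<in>tuples b ?Z. \<exists>a\<in>bnd X ?F (tuples b J) (vec R b) i. y = ?flip x \<oplus>[pow ?F ?n] a"
   using z submodule_zero[OF bnd_submodule[OF mat FM Js cs]] by metis
 qed (use pow_mod[OF P] pow_mod[OF FM] submodule_tuples[OF P] Bs Zs tuples_mono[OF BZ] FBZ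
   bnd_submodule[OF mat FM Js cs] cyc_submodule[OF mat FM Js cs] in auto)
 then show ?thesis
  unfolding betti_def using rdim_power[OF local_noetherian_axioms PN Bs Zs BZ kill1] by simp
qed

text \<open>The condition says that, for \<open>T = R / L\<close>, the inclusion of \<open>\<mm>T\<close> into \<open>T\<close> induces zero maps in homology.\<close>

definition max_ideal_null :: "'a set => 'a free_complex => bool" where
 "max_ideal_null L X \<longleftrightarrow>
  (\<forall>i. cyc X (reg R) L \<mm> i \<subseteq> rbnd R X L i)"

lemma max_ideal_null_free:
 assumes res: "residue_resolution K X v" and L: "ideal L R" and Z: "max_ideal_null L X"
  and z: "z \<in> cyc X (fm R b) (tuples b L) (tuples b \<mm>) i"
 shows "z \<in> bnd X (fm R b) (tuples b L) (vec R b) i"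
proof -
 have zc: "z \<in> tuples (rk X i) (vec R b)" using cyc_tuples[OF z] \<mm>_carrier by (auto simp: PiE_iff)
 show ?thesis
  using z Z unfolding cyc_free_iff[OF matrices[OF res] L ideal_\<mm> zc] bnd_free_iff[OF matrices[OF res] L zc]
   max_ideal_null_def by blast
qed

lemma max_ideal_null_self:
 assumes res: "residue_resolution K X v"
 shows "max_ideal_null K X"
 unfolding max_ideal_null_def
proof (intro allI subsetI)
 fix i z assume z: "z \<in> cyc X (reg R) K \<mm> i"
 show "z \<in> rbnd R X K i"
 proof (cases i)
  case 0 then show ?thesis using z \<mm>_tuples_bnd[OF res] by simp
 next
  case (Suc j)
  have "\<mm> \<subseteq> carrier R" using \<mm>_carrier by auto
  then have "z \<in> rcyc R X K (Suc j)"
   using z tuples_mono[of \<mm> "carrier R" "rk X (Suc j)"] unfolding Suc cyc_Suc by blast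
  then show ?thesis unfolding Suc by (rule exact[OF res])
 qed
qed

text \<open>Let \<open>T = R / L\<close>.  For a \<open>T\<close>-module \<open>M\<close> with syzygy \<open>0 \<rightarrow> N \<rightarrow> T\<^sup>b \<rightarrow> M \<rightarrow> 0\<close> such that
 \<open>N \<subseteq> \<mm>T\<^sup>b\<close>, the homology of \<open>N\<close> maps to zero in that of \<open>T\<^sup>b\<close> because this map factors through the
 homology of \<open>\<mm>T\<^sup>b\<close>; so the long exact sequence splits into short ones.  The module \<open>N\<close> is written
 again as a quotient of a free module.\<close>

lemma betti_shift:
 assumes res: "residue_resolution K X v" and L: "ideal L R" and KL: "K \<subseteq> L" and Z: "max_ideal_null L X"
  and N: "submodule N R (fm R b)" and LN: "tuples b L \<subseteq> N" and N\<mm>: "N \<subseteq> tuples b \<mm>"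
  and p: "p \<in> linear_maps R (fm R n) (fm R b)"
  and pN: "\<And>x. x \<in> vec R n ==> p x \<in> N"
  and surj: "\<And>y. y \<in> N ==> \<exists>x\<in>vec R n. \<exists>a\<in>tuples b L. y = p x \<oplus>[fm R b] a"
 shows "betti R X (fm R b) N (vec R b) (Suc i) =
  b * rbetti R X L (Suc i) +
  betti R X (fm R n) {x \<in> vec R n. p x \<in> tuples b L} (vec R n) i"
proof -
 let ?F = "fm R b" and ?L = "tuples b L" and ?R = "vec R b"
 let ?P = "pow ?F (rk X (Suc i))" and ?Q = "pow ?F (rk X i)"
 note mat = matrices[OF res] and FM = free_mod and cs = free_sub
 have Ls: "submodule ?L R ?F" by (rule ideal_tuples[OF L])
 have NR: "N \<subseteq> ?R" using submodule_carrier[OF N] unfolding free_module_simps(1) by (rule subsetI)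
 have LR: "?L \<subseteq> ?R" using submodule_carrier[OF Ls] unfolding free_module_simps(1) by (rule subsetI)
 have KbL: "tuples b K \<subseteq> ?L" by (rule tuples_mono[OF KL])
 have cx: "complex_mod X ?F A B" if "?L \<subseteq> A" "B \<subseteq> ?R" for A B
  by (rule complex_mod_mono[OF complex_free[OF res] subset_trans[OF KbL that(1)] that(2)])
 have P: "module R ?P" and Q: "module R ?Q" using pow_mod[OF FM] by auto
 interpret P: module R ?P by (rule P)
 interpret Q: module R ?Q by (rule Q)
 have PN: "noetherian_module R ?P" by (rule noetherian_power_module[OF noetherian_free])
 let ?A = "bnd X ?F N ?R (Suc i)" and ?Z = "cyc X ?F N ?R (Suc i)"
 let ?B = "bnd X ?F ?L N i" and ?C = "{z \<in> cyc X ?F N ?R (Suc i). cdif X ?F (Suc i) z \<in> bnd X ?F ?L N i}"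
 have As: "submodule ?A R ?P" and Zs: "submodule ?Z R ?P" and Bs: "submodule ?B R ?Q"
  using bnd_submodule[OF mat FM] cyc_submodule[OF mat FM] N cs Ls by auto
 have Cs: "submodule ?C R ?P" by (rule submodule_vimage[OF P Q cdif_linear[OF mat FM] Zs Bs])
 have cdadd: "cdif X ?F (Suc i) (x \<oplus>[?P] y) = cdif X ?F (Suc i) x \<oplus>[?Q] cdif X ?F (Suc i) y"
  if "x \<in> carrier ?P" "y \<in> carrier ?P" for x y
  using that by (intro cdif_add[OF mat FM]) simp_all
 have cdc: "cdif X ?F (Suc i) x \<in> carrier ?Q" if "x \<in> carrier ?P" for x
  using linear_mapsD(1)[OF cdif_linear[OF mat FM] that] .
 have Ncarr: "x \<in> carrier ?P" if "x \<in> tuples (rk X (Suc i)) N" for x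
  using submodule_carrier[OF submodule_tuples[OF FM N] that] .
 have Zcarr: "x \<in> carrier ?P" if "x \<in> ?Z" for x using submodule_carrier[OF Zs that] .
 have Lcarr: "x \<in> carrier ?Q" if "x \<in> tuples (rk X i) ?L" for x
  using submodule_carrier[OF submodule_tuples[OF FM Ls] that] .
 have AZ: "?A \<subseteq> ?Z" using cx LN by (intro bnd_subset_cyc[OF mat FM N cs NR]) auto
 have AC: "?A \<subseteq> ?C"
 proof
  fix z assume z: "z \<in> ?A"
  then obtain y w where yw: "y \<in> tuples (rk X (Suc (Suc i))) ?R" "w \<in> tuples (rk X (Suc i)) N"
   "z = cdif X ?F (Suc (Suc i)) y \<oplus>[?P] w" unfolding bnd_def by blast
  have dy: "cdif X ?F (Suc (Suc i)) y \<in> carrier ?P" using cdif_carrier[OF mat FM, of y "Suc i" b] yw(1) by simp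
  have "cdif X ?F (Suc i) (cdif X ?F (Suc (Suc i)) y) \<in> tuples (rk X i) ?L"
   using cx[of ?L ?R] yw(1) unfolding complex_mod_def by blast
  then have "cdif X ?F (Suc i) (cdif X ?F (Suc (Suc i)) y) \<in> ?B" by (rule bnd_lower[OF mat FM Ls N])
  moreover have "cdif X ?F (Suc i) w \<in> ?B" by (rule bnd_image[OF mat FM Ls N yw(2)])
  ultimately have "cdif X ?F (Suc i) z \<in> ?B"
   unfolding yw(3) cdadd[OF dy Ncarr[OF yw(2)]] by (rule submodule_add[OF Bs])
  then show "z \<in> ?C" using z AZ by blast
 qed
 have "rdim R ?P ?A ?Z = rdim R ?P ?A ?C + rdim R ?P ?C ?Z"
 proof (rule rdim_additive[OF PN As Cs Zs AC])
  show "r \<odot>[?P] x \<in> ?A" if "r \<in> \<mm>" "x \<in> ?Z" for r x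
   by (rule homology_annihilated[OF res N subset_trans[OF KbL LN] that])
 qed blast
 moreover have "rdim R ?P (bnd X ?F ?L ?R (Suc i)) (cyc X ?F ?L ?R (Suc i)) = rdim R ?P ?A ?C"
 proof (rule rdim_transfer[OF P P id_linear])
  show "bnd X ?F ?L ?R (Suc i) \<subseteq> cyc X ?F ?L ?R (Suc i)"
   using cx by (intro bnd_subset_cyc[OF mat FM Ls cs LR]) auto
  fix z assume z: "z \<in> cyc X ?F ?L ?R (Suc i)"
  then have zt: "z \<in> tuples (rk X (Suc i)) ?R" "cdif X ?F (Suc i) z \<in> tuples (rk X i) ?L"
   unfolding cyc_Suc by auto
  then have "cdif X ?F (Suc i) z \<in> tuples (rk X i) N" using tuples_mono[OF LN] by blast
  then have "z \<in> ?Z" unfolding cyc_Suc using zt(1) by blast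
  then show "z \<in> ?C" using bnd_lower[OF mat FM Ls N zt(2)] by blast
  show "z \<in> ?A \<longleftrightarrow> z \<in> bnd X ?F ?L ?R (Suc i)"
  proof
   assume "z \<in> bnd X ?F ?L ?R (Suc i)"
   then show "z \<in> ?A" using bnd_mono[OF mat FM LN subset_refl] by blast
  next
   assume "z \<in> ?A"
   then obtain y w where yw: "y \<in> tuples (rk X (Suc (Suc i))) ?R" "w \<in> tuples (rk X (Suc i)) N"
    "z = cdif X ?F (Suc (Suc i)) y \<oplus>[?P] w" unfolding bnd_def by blast
   have dy: "cdif X ?F (Suc (Suc i)) y \<in> carrier ?P" using cdif_carrier[OF mat FM, of y "Suc i" b] yw(1) by simp
   have "cdif X ?F (Suc i) (cdif X ?F (Suc (Suc i)) y) \<in> tuples (rk X i) ?L"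
    using cx[of ?L ?R] yw(1) unfolding complex_mod_def by blast
   then have "cdif X ?F (Suc i) w \<in> tuples (rk X i) ?L"
    using zt(2) Q.submodule_cancel[OF submodule_tuples[OF FM Ls] _ cdc[OF Ncarr[OF yw(2)]]]
    unfolding yw(3) cdadd[OF dy Ncarr[OF yw(2)]] by blast
   then have "w \<in> cyc X ?F ?L (tuples b \<mm>) (Suc i)"
    using yw(2) tuples_mono[OF N\<mm>] unfolding cyc_Suc by blast
   then have "w \<in> bnd X ?F ?L ?R (Suc i)" by (rule max_ideal_null_free[OF res L Z])
   then show "z \<in> bnd X ?F ?L ?R (Suc i)"
    unfolding yw(3) using bnd_image[OF mat FM Ls cs yw(1)] submodule_add[OF bnd_submodule[OF mat FM Ls cs]] by blast
  qed
 next
  fix z assume z: "z \<in> ?C"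
  then obtain n l where nl: "n \<in> tuples (rk X (Suc i)) N" "l \<in> tuples (rk X i) ?L"
   "cdif X ?F (Suc i) z = cdif X ?F (Suc i) n \<oplus>[?Q] l" unfolding bnd_def by blast
  have zP: "z \<in> carrier ?P" and nP: "n \<in> carrier ?P" using z Zcarr Ncarr[OF nl(1)] by blast+
  obtain w where w: "w \<in> carrier ?P" "z = n \<oplus>[?P] w" using P.ex_diff[OF zP nP] by metis
  have "cdif X ?F (Suc i) w = l"
   using nl(3) unfolding w(2) cdadd[OF nP w(1)] using cdc[OF nP] cdc[OF w(1)] Lcarr[OF nl(2)] Q.M.add.l_cancel by metis
  then have "w \<in> cyc X ?F ?L ?R (Suc i)" using w(1) nl(2) unfolding cyc_Suc by simp
  moreover have "n \<in> ?A" by (rule bnd_lower[OF mat FM N cs nl(1)])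
  moreover have "z = w \<oplus>[?P] n" using w(2) P.M.a_comm[OF nP w(1)] by (rule trans)
  ultimately show "\<exists>x\<in>cyc X ?F ?L ?R (Suc i). \<exists>a\<in>?A. z = x \<oplus>[?P] a" by blast
 qed (use bnd_submodule[OF mat FM] cyc_submodule[OF mat FM] Ls cs As Cs AC in auto)
 moreover have "rdim R ?P (bnd X ?F ?L ?R (Suc i)) (cyc X ?F ?L ?R (Suc i)) =
  b * rbetti R X L (Suc i)"
  using betti_free_power[OF res L KL, of b "Suc i"] unfolding betti_def .
 moreover have "rdim R ?P ?C ?Z = rdim R ?Q ?B (cyc X ?F ?L N i)"
 proof (rule rdim_transfer[OF P Q cdif_linear[OF mat FM] Cs Zs Bs])
  show "submodule (cyc X ?F ?L N i) R ?Q" by (rule cyc_submodule[OF mat FM Ls N])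
  show "?B \<subseteq> cyc X ?F ?L N i" by (rule bnd_subset_cyc[OF mat FM Ls N LN cx[OF subset_refl NR]])
  fix z assume z: "z \<in> ?Z"
  then have zt: "z \<in> tuples (rk X (Suc i)) ?R" "cdif X ?F (Suc i) z \<in> tuples (rk X i) N" unfolding cyc_Suc by auto
  show "cdif X ?F (Suc i) z \<in> cyc X ?F ?L N i"
  proof (cases i)
   case 0 then show ?thesis using zt by simp
  next
   case (Suc j)
   have "cdif X ?F (Suc j) (cdif X ?F (Suc i) z) \<in> tuples (rk X j) ?L"
    using cx[of ?L ?R] zt(1) unfolding Suc complex_mod_def by blast
   then show ?thesis using zt unfolding Suc cyc_Suc by simp
  qed
  show "cdif X ?F (Suc i) z \<in> ?B \<longleftrightarrow> z \<in> ?C" using z by blast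
 next
  fix u assume u: "u \<in> cyc X ?F ?L N i"
  then have "u \<in> cyc X ?F ?L (tuples b \<mm>) i"
   using tuples_mono[OF N\<mm>, of "rk X i"] unfolding cyc_def by blast
  then have "u \<in> bnd X ?F ?L ?R i" by (rule max_ideal_null_free[OF res L Z])
  then obtain z l where zl: "z \<in> tuples (rk X (Suc i)) ?R" "l \<in> tuples (rk X i) ?L"
   "u = cdif X ?F (Suc i) z \<oplus>[?Q] l" unfolding bnd_def by blast
  have zP: "z \<in> carrier ?P" using zl(1) by simp
  have "l \<in> tuples (rk X i) N" using zl(2) tuples_mono[OF LN] by blast
  then have "cdif X ?F (Suc i) z \<in> tuples (rk X i) N"
   using cyc_tuples[OF u] Q.submodule_cancel2[OF submodule_tuples[OF FM N] _ cdc[OF zP]] unfolding zl(3) by blast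
  then have "z \<in> ?Z" using zl(1) unfolding cyc_Suc by simp
  moreover have "l \<in> ?B" by (rule bnd_lower[OF mat FM Ls N zl(2)])
  ultimately show "\<exists>x\<in>?Z. \<exists>a\<in>?B. u = cdif X ?F (Suc i) x \<oplus>[?Q] a" using zl(3) by blast
 qed blast
 moreover have "betti R X (fm R n) {x \<in> vec R n. p x \<in> ?L} (vec R n) i = betti R X ?F ?L N i"
 proof (rule betti_transfer[OF mat FM FM p vimage_submodule[OF p Ls] cs Ls N _ LN pN _ surj])
  show "complex_mod X (fm R n) {x \<in> vec R n. p x \<in> ?L} (vec R n)"
   by (rule complex_mod_mono[OF complex_free[OF res] subset_trans[OF tuples_mono[OF KL] tuples_subset_vimage[OF p L]] subset_refl])
  show "complex_mod X ?F ?L N" by (rule cx[OF subset_refl NR])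
 qed auto
 ultimately show ?thesis unfolding betti_def by simp
qed

end

section \<open>The product formula for Betti numbers\<close>

context local_noetherian
begin

lemma rdim_residue: "rdim R (reg R) \<mm> (carrier R) = 1"
proof -
 let ?M = "reg R"
 have m: "submodule \<mm> R ?M" by (rule ideal_submodule[OF ideal_\<mm>])
 have sub: "\<mm> \<subseteq> carrier R" using \<mm>_carrier by auto
 have "\<mm> \<union> {\<one>} \<subseteq> carrier ?M" using sub by simp
 then have S: "submodule (submodule_span R ?M (\<mm> \<union> {\<one>})) R ?M" by (rule span_submodule[OF regular])
 have "carrier R \<subseteq> submodule_span R ?M (\<mm> \<union> {\<one>})"
 proof
  fix r assume r: "r \<in> carrier R"
  have "\<one> \<in> submodule_span R ?M (\<mm> \<union> {\<one>})" using span_incl[of "\<mm> \<union> {\<one>}" R ?M] by auto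
  then show "r \<in> submodule_span R ?M (\<mm> \<union> {\<one>})" using submodule_smult[OF S r] r by fastforce
 qed
 then have "generated_by R ?M \<mm> (carrier R) 1"
  unfolding generated_by_def by (intro exI[of _ "{\<one>}"]) auto
 then have "rdim R ?M \<mm> (carrier R) \<le> 1" by (rule rdim_le)
 moreover have "rdim R ?M \<mm> (carrier R) \<noteq> 0"
  using rdim_eq_0[OF regular_noetherian m carrier_sub sub] one_notin_\<mm> one_closed by blast
 ultimately show ?thesis by simp
qed

lemma bnd_0_eq:
 assumes res: "residue_resolution K X v" and N: "submodule N R (fm R b)" and KN: "tuples b K \<subseteq> N"
  and N\<mm>: "N \<subseteq> tuples b \<mm>"
 shows "bnd X (fm R b) N (vec R b) 0 = bnd X (fm R b) (tuples b K) (vec R b) 0"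
proof
 let ?F = "fm R b"
 note mat = matrices[OF res] and FM = free_mod and cs = free_sub
 have Ks: "submodule (tuples b K) R ?F" by (rule ideal_tuples[OF K[OF res]])
 show "bnd X ?F N (vec R b) 0 \<subseteq> bnd X ?F (tuples b K) (vec R b) 0"
 proof
  fix z assume "z \<in> bnd X ?F N (vec R b) 0"
  then obtain y w where yw: "y \<in> tuples (rk X (Suc 0)) (vec R b)" "w \<in> tuples (rk X 0) N"
   "z = cdif X ?F (Suc 0) y \<oplus>[pow ?F (rk X 0)] w" unfolding bnd_def by blast
  have "w \<in> bnd X ?F (tuples b K) (vec R b) 0"
   using \<mm>_tuples_bnd_free[OF res] yw(2) tuples_mono[OF N\<mm>] by blast
  then show "z \<in> bnd X ?F (tuples b K) (vec R b) 0"
   unfolding yw(3) using bnd_image[OF mat FM Ks cs yw(1)] submodule_add[OF bnd_submodule[OF mat FM Ks cs]] by blast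
 qed
 show "bnd X ?F (tuples b K) (vec R b) 0 \<subseteq> bnd X ?F N (vec R b) 0"
  by (rule bnd_mono[OF mat FM KN subset_refl])
qed

lemma betti_residue_0:
 assumes res: "residue_resolution K X v"
 shows "rbetti R X K 0 = 1"
proof -
 let ?M = "reg R" and ?F = "fm R (rk X 0)"
 note mat = matrices[OF res]
 note Ks = ideal_submodule[OF K[OF res]]
 interpret F: module R ?F by (rule free_mod)
 have v: "v \<in> carrier ?F" using v[OF res] by simp
 have "rdim R ?M \<mm> (carrier R) = rdim R ?F (bnd X ?M K (carrier R) 0) (vec R (rk X 0))"
 proof (rule rdim_transfer[OF regular free_mod, where f = "\<lambda>r. r \<odot>[?F] v"])
  show "(\<lambda>r. r \<odot>[?F] v) \<in> linear_maps R ?M ?F"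
   by (rule linear_mapsI)
    (use v in \<open>simp_all only: regular_module_simps F.smult_l_distr F.smult_assoc1 F.smult_closed\<close>)
  show B: "submodule (bnd X ?M K (carrier R) 0) R ?F"
   using bnd_submodule[OF mat regular Ks carrier_sub, of 0] unfolding free_pow .
  show "bnd X ?M K (carrier R) 0 \<subseteq> vec R (rk X 0)"
   using submodule_carrier[OF B] unfolding free_module_simps(1) by (rule subsetI)
  show "r \<odot>[?F] v \<in> bnd X ?M K (carrier R) 0 \<longleftrightarrow> r \<in> \<mm>" if "r \<in> carrier R" for r
   using aug_iff[OF res that] .
  show "\<exists>x\<in>carrier R. \<exists>a\<in>bnd X ?M K (carrier R) 0. y = x \<odot>[?F] v \<oplus>[?F] a" if "y \<in> vec R (rk X 0)" for y
   using aug[OF res that] .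
  show "r \<odot>[?F] v \<in> vec R (rk X 0)" if "r \<in> carrier R" for r
   using F.smult_closed[OF that v] by simp
 qed (use \<mm>_carrier ideal_submodule[OF ideal_\<mm>] carrier_sub free_sub in auto)
 then show ?thesis unfolding betti_def rdim_residue cyc_0 free_pow by simp
qed

lemma betti_exact:
 assumes res: "residue_resolution K X v"
 shows "rbetti R X K (Suc i) = 0"
proof -
 let ?M = "reg R"
 note mat = matrices[OF res]
 note Ks = ideal_submodule[OF K[OF res]]
 have "bnd X ?M K (carrier R) (Suc i) = cyc X ?M K (carrier R) (Suc i)"
  using bnd_subset_cyc[OF mat regular Ks carrier_sub _ complex[OF res]] exact[OF res]
   ideal.Icarr[OF K[OF res]] by blast
 then show ?thesis unfolding betti_def
  using rdim_self[OF pow_mod[OF regular] cyc_submodule[OF mat regular Ks carrier_sub]] by simp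
qed

lemma betti_0:
 assumes res: "residue_resolution K X v" and N: "submodule N R (fm R b)" and KN: "tuples b K \<subseteq> N"
  and N\<mm>: "N \<subseteq> tuples b \<mm>"
 shows "betti R X (fm R b) N (vec R b) 0 = b"
 using betti_free_power[OF res K[OF res] subset_refl, of b 0] betti_residue_0[OF res]
 unfolding betti_def cyc_0 bnd_0_eq[OF assms] by simp

lemma betti_regular_eq_free:
 assumes "residue_resolution K X v" "ideal J R" "K \<subseteq> J"
 shows "rbetti R X J i = betti R X (fm R 1) (tuples 1 J) (vec R 1) i"
 using betti_free_power[OF assms, of 1 i] by simp

lemma betti_regular_0:
 assumes res: "residue_resolution K X v" and J: "ideal J R" "K \<subseteq> J" "J \<subseteq> \<mm>"
 shows "rbetti R X J 0 = 1"
 unfolding betti_regular_eq_free[OF res J(1,2)]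
 by (rule betti_0[OF res ideal_tuples[OF J(1)] tuples_mono[OF J(2)] tuples_mono[OF J(3)]])

text \<open>Over \<open>T = R / L\<close> a module and its syzygy have the same Betti numbers up to a shift; over \<open>R / K\<close>
 the Betti numbers of \<open>T\<close> enter at every step.\<close>

theorem betti_product:
 assumes resX: "residue_resolution K X v" and resY: "residue_resolution L Y w" and KL: "K \<subseteq> L"
  and Z: "max_ideal_null L X"
  and "submodule N R (fm R b)" "tuples b L \<subseteq> N" "N \<subseteq> tuples b \<mm>"
 shows "betti R X (fm R b) N (vec R b) i =
  (\<Sum>j\<le>i. betti R Y (fm R b) N (vec R b) j * rbetti R X L (i - j))"
 using assms(5-7)
proof (induction i arbitrary: b N)
 case 0
 have "tuples b K \<subseteq> N" by (rule subset_trans[OF tuples_mono[OF KL] 0(2)])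
 then show ?case
  using betti_0[OF resX, of N b] betti_0[OF resY, of N b] 0 betti_regular_0[OF resX K[OF resY] KL K_\<mm>[OF resY]] by simp
next
 case (Suc i)
 note L = K[OF resY]
 obtain n p where p0: "p \<in> linear_maps R (fm R n) (fm R b)"
  "\<forall>x\<in>vec R n. p x \<in> N"
  "\<forall>y\<in>N. \<exists>x\<in>vec R n. \<exists>a\<in>tuples b L. y = p x \<oplus>[fm R b] a"
  "\<forall>x\<in>vec R n. p x \<in> tuples b L \<longrightarrow> x \<in> tuples n \<mm>"
  using cover[OF Suc.prems(1) L Suc.prems(2)] by blast
 note p = p0(1) p0(2-4)[rule_format]
 let ?N = "{x \<in> vec R n. p x \<in> tuples b L}"
 have "?N \<subseteq> tuples n \<mm>"
 proof
  fix x assume "x \<in> ?N"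
  then show "x \<in> tuples n \<mm>" by (elim CollectE conjE) (rule p(4))
 qed
 note N' = vimage_submodule[OF p(1) ideal_tuples[OF L]] tuples_subset_vimage[OF p(1) L] this
 note X = betti_shift[OF resX L KL Z Suc.prems p(1-3)]
 note Y = betti_shift[OF resY L subset_refl max_ideal_null_self[OF resY] Suc.prems p(1-3)]
 have Y0: "betti R Y (fm R b) N (vec R b) 0 = b"
  by (rule betti_0[OF resY Suc.prems])
 have "betti R X (fm R b) N (vec R b) (Suc i) =
  b * rbetti R X L (Suc i) +
  (\<Sum>j\<le>i. betti R Y (fm R n) ?N (vec R n) j * rbetti R X L (i - j))"
  using X[where i = i] Suc.IH[OF N'] by (rule trans[OF _ arg_cong2[OF refl]])
 then show ?case
  unfolding sum.atMost_Suc_shift Y0 by (simp add: Y betti_exact[OF resY])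
qed

lemma max_ideal_null_complement:
 assumes res: "residue_resolution K X v" and L: "ideal L R" and KL: "K \<subseteq> L"
  and W: "submodule W R (reg R)" "W \<subseteq> \<mm>" "W \<inter> L \<subseteq> K"
  and sum: "\<And>x. x \<in> \<mm> ==> \<exists>n\<in>L. \<exists>w\<in>W. x = n \<oplus>[reg R] w"
 shows "max_ideal_null L X"
 unfolding max_ideal_null_def
proof (intro allI subsetI)
 let ?M = "reg R"
 note mat = matrices[OF res]
 note Ls = ideal_submodule[OF L] and cs = carrier_sub
 have KLb: "bnd X ?M K (carrier R) i \<subseteq> bnd X ?M L (carrier R) i" for i
  by (rule bnd_mono[OF mat regular KL subset_refl])
 fix i z assume z: "z \<in> cyc X ?M L \<mm> i"
 show "z \<in> bnd X ?M L (carrier R) i"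
 proof (cases i)
  case 0 then show ?thesis using z \<mm>_tuples_bnd[OF res] KLb by auto
 next
  case (Suc j)
  let ?P = "pow ?M (rk X (Suc j))" and ?Q = "pow ?M (rk X j)"
  interpret Q: module R ?Q by (rule pow_mod[OF regular])
  have zt: "z \<in> tuples (rk X (Suc j)) \<mm>" "cdif X ?M (Suc j) z \<in> tuples (rk X j) L" using z unfolding Suc cyc_Suc by auto
  obtain n w where "n \<in> tuples (rk X (Suc j)) L" "w \<in> tuples (rk X (Suc j)) W"
   "z = tuple_map (rk X (Suc j)) (\<lambda>x. x) n \<oplus>[?P] w" using tuples_lift[OF sum zt(1)] by metis
  then have nw: "n \<in> tuples (rk X (Suc j)) L" "w \<in> tuples (rk X (Suc j)) W" "z = n \<oplus>[?P] w"
   by (auto simp: tuple_map_def)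
  have nc: "n \<in> vec R (rk X (Suc j))" and wc: "w \<in> vec R (rk X (Suc j))"
   using nw submodule_carrier[OF submodule_tuples[OF regular Ls]] submodule_carrier[OF submodule_tuples[OF regular W(1)]] by auto
  have dn: "cdif X ?M (Suc j) n \<in> tuples (rk X j) L" by (rule cdif_tuples[OF mat regular Ls nw(1)])
  have dw: "cdif X ?M (Suc j) w \<in> tuples (rk X j) W" by (rule cdif_tuples[OF mat regular W(1) nw(2)])
  have "cdif X ?M (Suc j) z = cdif X ?M (Suc j) n \<oplus>[?Q] cdif X ?M (Suc j) w"
   unfolding nw(3) using nc wc by (intro cdif_add[OF mat regular]) simp_all
  then have "cdif X ?M (Suc j) w \<in> tuples (rk X j) L"
   using zt(2) Q.submodule_cancel[OF submodule_tuples[OF regular Ls] dn]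
    submodule_carrier[OF submodule_tuples[OF regular W(1)] dw] by simp
  then have "cdif X ?M (Suc j) w \<in> tuples (rk X j) K" using dw W(3) by (auto simp: PiE_iff)
  then have "w \<in> bnd X ?M K (carrier R) (Suc j)" using wc by (intro exact[OF res]) (simp add: cyc_Suc)
  then have "w \<in> bnd X ?M L (carrier R) (Suc j)" using KLb by auto
  then show ?thesis
   unfolding Suc nw(3) using bnd_lower[OF mat regular Ls cs nw(1)] submodule_add[OF bnd_submodule[OF mat regular Ls cs]] by blast
 qed
qed

end

section \<open>Koszul modules\<close>

context local_noetherian
begin

definition exact_complex :: "'a free_complex => bool" where
 "exact_complex F \<longleftrightarrow> matrices_over R F \<and>
  complex_mod F (reg R) {\<zero>} (carrier R) \<and>
  (\<forall>i. \<forall>x\<in>vec R (rk F (Suc i)). cdif F (reg R) (Suc i) x \<in> tuples (rk F i) {\<zero>} \<longrightarrow>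
    (\<exists>y\<in>vec R (rk F (Suc (Suc i))). x = cdif F (reg R) (Suc (Suc i)) y))"

text \<open>A minimal exact complex whose linear part has no homology in the lowest possible internal degree.\<close>

definition linear_complex :: "'a free_complex => bool" where
 "linear_complex F \<longleftrightarrow> exact_complex F \<and>
  (\<forall>i. \<forall>x\<in>vec R (rk F (Suc i)). cdif F (reg R) (Suc i) x \<in> tuples (rk F i) \<mm>) \<and>
  (\<forall>i. \<forall>x\<in>vec R (rk F (Suc i)).
    cdif F (reg R) (Suc i) x \<in> tuples (rk F i) (\<mm> \<cdot>\<^bsub>R\<^esub> \<mm>) \<longrightarrow> x \<in> tuples (rk F (Suc i)) \<mm>)"

lemma exact_complexD:
 assumes "exact_complex F"
 shows "matrices_over R F" "complex_mod F (reg R) {\<zero>} (carrier R)"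
  and "x \<in> vec R (rk F (Suc i)) ==> cdif F (reg R) (Suc i) x \<in> tuples (rk F i) {\<zero>} ==>
   \<exists>y\<in>vec R (rk F (Suc (Suc i))). x = cdif F (reg R) (Suc (Suc i)) y"
 using assms unfolding exact_complex_def by (elim conjE; meson)+

lemma linear_complexD:
 assumes "linear_complex F"
 shows "exact_complex F"
  and "x \<in> vec R (rk F (Suc i)) ==> cdif F (reg R) (Suc i) x \<in> tuples (rk F i) \<mm>"
  and "x \<in> vec R (rk F (Suc i)) ==>
   cdif F (reg R) (Suc i) x \<in> tuples (rk F i) (\<mm> \<cdot>\<^bsub>R\<^esub> \<mm>) ==> x \<in> tuples (rk F (Suc i)) \<mm>"
 using assms unfolding linear_complex_def by (elim conjE; meson)+

definition syzygy :: "'a free_complex => nat => (nat => 'a) set" where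
 "syzygy F j = cdif F (reg R) (Suc j) ` vec R (rk F (Suc j))"

lemma zero_tuples_free: "x \<in> tuples b {\<zero>} \<longleftrightarrow> x = \<zero>[fm R b]"
proof
 assume x: "x \<in> tuples b {\<zero>}"
 show "x = \<zero>[fm R b]" by (rule tuples_eqI[OF x, of _ UNIV]) (use x in auto)
qed auto

lemma image_submodule:
 assumes M: "module R M" and N: "module R N" and f: "f \<in> linear_maps R M N" and A: "submodule A R M"
 shows "submodule (f ` A) R N"
proof -
 interpret N: module R N by (rule N)
 have z: "submodule {\<zero>[N]} R N" by (rule N.submoduleI_smult) auto
 have "f x \<in> carrier N" if "x \<in> A" for x using linear_mapsD(1)[OF f submodule_carrier[OF A that]] .
 then have "f ` A = {y. \<exists>x\<in>A. \<exists>b\<in>{\<zero>[N]}. y = f x \<oplus>[N] b}" by auto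
 then show ?thesis using submodule_image_add[OF M N f A z] by simp
qed

lemma tuples_image:
 assumes "z \<in> tuples n (f ` A)"
 obtains u where "u \<in> tuples n A" "z = tuple_map n f u"
proof -
 have "\<forall>j. \<exists>x. j < n \<longrightarrow> x \<in> A \<and> z j = f x" using tuples_mem[OF assms] by blast
 then obtain u where u: "\<And>j. j < n ==> u j \<in> A \<and> z j = f (u j)" by metis
 show ?thesis
 proof (rule that[of "\<lambda>j\<in>{..<n}. u j"])
  show "z = tuple_map n f (\<lambda>j\<in>{..<n}. u j)"
   by (rule tuples_eqI[OF assms, of _ UNIV]) (use u in \<open>auto simp: tuple_map_def\<close>)
 qed (use u in auto)
qed

lemma ideal_prod_image:
 assumes q: "q \<in> linear_maps R (fm R n) (reg R)" and im: "q ` vec R n = I"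
 shows "\<mm> \<cdot>\<^bsub>R\<^esub> I \<subseteq> q ` tuples n \<mm>"
proof
 have "submodule (q ` tuples n \<mm>) R (reg R)"
  by (rule image_submodule[OF free_mod regular q ideal_tuples[OF ideal_\<mm>]])
 then have qm: "ideal (q ` tuples n \<mm>) R" using submodule_regular_iff_ideal[OF is_cring] by blast
 fix x assume "x \<in> \<mm> \<cdot>\<^bsub>R\<^esub> I"
 then show "x \<in> q ` tuples n \<mm>"
 proof (induction x rule: ideal_prod.induct)
  case (prod r y)
  then obtain x where x: "x \<in> vec R n" "y = q x" using im by blast
  have "r \<otimes> y = q (r \<odot>[fm R n] x)"
   using linear_mapsD(3)[OF q \<mm>_carrier[OF prod(1)], of x] x by simp
  moreover have "r \<odot>[fm R n] x \<in> tuples n \<mm>"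
   using x(1) ideal.I_r_closed[OF ideal_\<mm> prod(1)] by (auto simp: PiE_iff)
  ultimately show ?case by blast
 next
  case (sum s1 s2)
  then show ?case using additive_subgroup.a_closed[OF ideal.axioms(1)[OF qm]] by blast
 qed
qed

context
 fixes F
 assumes F: "exact_complex F"
begin

lemma dif_linear:
 "cdif F (reg R) (Suc j) \<in> linear_maps R (fm R (rk F (Suc j))) (fm R (rk F j))"
 using cdif_linear[OF exact_complexD(1)[OF F] regular] unfolding free_pow .

lemma syzygy_submodule: "submodule (syzygy F j) R (fm R (rk F j))"
 unfolding syzygy_def by (rule image_submodule[OF free_mod free_mod dif_linear free_sub])

lemma syzygy_subset: "syzygy F j \<subseteq> vec R (rk F j)"
 using submodule_carrier[OF syzygy_submodule] unfolding free_module_simps(1) by (rule subsetI)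

lemma zero_subset_syzygy: "tuples (rk F j) {\<zero>} \<subseteq> syzygy F j"
 unfolding subset_iff zero_tuples_free using submodule_zero[OF syzygy_submodule] by blast

lemma dif_syzygy:
 "x \<in> vec R (rk F (Suc j)) ==> cdif F (reg R) (Suc j) x \<in> syzygy F j"
 unfolding syzygy_def by (rule imageI)

lemma dif_zero_iff:
 assumes "x \<in> vec R (rk F (Suc j))"
 shows "cdif F (reg R) (Suc j) x \<in> tuples (rk F j) {\<zero>} \<longleftrightarrow> x \<in> syzygy F (Suc j)"
proof
 assume "cdif F (reg R) (Suc j) x \<in> tuples (rk F j) {\<zero>}"
 then have "\<exists>y\<in>vec R (rk F (Suc (Suc j))). x = cdif F (reg R) (Suc (Suc j)) y"
  by (rule exact_complexD(3)[OF F assms])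
 then obtain y where "y \<in> vec R (rk F (Suc (Suc j)))" "x = cdif F (reg R) (Suc (Suc j)) y"
  by (elim bexE)
 then show "x \<in> syzygy F (Suc j)" unfolding syzygy_def by simp
next
 assume "x \<in> syzygy F (Suc j)"
 then obtain y where "y \<in> vec R (rk F (Suc (Suc j)))" "x = cdif F (reg R) (Suc (Suc j)) y"
  unfolding syzygy_def by (elim imageE)
 then show "cdif F (reg R) (Suc j) x \<in> tuples (rk F j) {\<zero>}"
  using exact_complexD(2)[OF F] unfolding complex_mod_def by simp
qed

lemma dif_onto_syzygy:
 assumes "y \<in> syzygy F j"
 shows "\<exists>x\<in>vec R (rk F (Suc j)). \<exists>a\<in>tuples (rk F j) {\<zero>}.
  y = cdif F (reg R) (Suc j) x \<oplus>[fm R (rk F j)] a"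
proof -
 let ?E = "fm R (rk F j)"
 interpret E: module R ?E by (rule free_mod)
 have "y = y \<oplus>[?E] \<zero>[?E]" using submodule_carrier[OF syzygy_submodule assms] E.M.r_zero by metis
 moreover have "\<zero>[?E] \<in> tuples (rk F j) {\<zero>}" using zero_tuples_free by blast
 ultimately show ?thesis using assms unfolding syzygy_def by blast
qed

text \<open>The differential induces an isomorphism from \<open>F\<^sub>j\<^sub>+\<^sub>1\<close> modulo its syzygy to the syzygy in \<open>F\<^sub>j\<close>.\<close>

lemmas syzygy_iso = free_mod free_mod dif_linear syzygy_submodule free_sub
 ideal_tuples[OF zeroideal] syzygy_submodule syzygy_subset zero_subset_syzygy dif_syzygy dif_zero_iff dif_onto_syzygy

end

context
 fixes F X v
 assumes F: "linear_complex F" and res: "residue_resolution {\<zero>} X v"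
begin

abbreviation (input) dF :: "nat => (nat => 'a) => nat => 'a" where
 "dF j \<equiv> cdif F (reg R) (Suc j)"

lemma Fex: "exact_complex F" by (rule linear_complexD(1)[OF F])

lemma syzygy_\<mm>: "syzygy F j \<subseteq> tuples (rk F j) \<mm>"
 unfolding syzygy_def using linear_complexD(2)[OF F] by (rule image_subsetI)

text \<open>For \<open>M = F\<^sub>j / N\<close> with \<open>N\<close> the next syzygy, the inclusion of \<open>\<mm>M\<close> into \<open>M\<close> is zero in homology.
 Linearity says that \<open>N / \<mm>N\<close> embeds into \<open>\<mm>F\<^sub>j / \<mm>\<^sup>2F\<^sub>j\<close>, so modulo \<open>\<mm>N\<close> the module \<open>N\<close> is a direct
 summand of \<open>\<mm>F\<^sub>j\<close>.  Hence the connecting map takes a class of \<open>\<mm>M\<close> to a class that comes from \<open>\<mm>N\<close>, and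
 such a class vanishes in the homology of \<open>N\<close> by induction.\<close>

lemma linear_complex_null:
 "cyc X (fm R (rk F j)) (syzygy F j) (tuples (rk F j) \<mm>) i
  \<subseteq> bnd X (fm R (rk F j)) (syzygy F j) (vec R (rk F j)) i"
proof (induction i arbitrary: j)
 case 0
 let ?E = "fm R (rk F j)"
 have "bnd X ?E (tuples (rk F j) {\<zero>}) (vec R (rk F j)) 0 \<subseteq> bnd X ?E (syzygy F j) (vec R (rk F j)) 0"
  by (rule bnd_mono[OF matrices[OF res] free_mod zero_subset_syzygy[OF Fex] subset_refl])
 then show ?case using \<mm>_tuples_bnd_free[OF res] by auto
next
 case (Suc i)
 let ?E = "fm R (rk F j)" and ?N = "syzygy F j" and ?E' = "fm R (rk F (Suc j))" and ?N' = "syzygy F (Suc j)"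
 let ?Z = "tuples (rk F j) {\<zero>}" and ?R = "vec R (rk F j)" and ?R' = "vec R (rk F (Suc j))"
 note mat = matrices[OF res] and FM = free_mod and cs = free_sub
 note N = syzygy_submodule[OF Fex, of j] and N' = syzygy_submodule[OF Fex, of "Suc j"]
 note ZN = zero_subset_syzygy[OF Fex, of j]
 have zs: "submodule ?Z R ?E" by (rule ideal_tuples[OF zeroideal])
 let ?P = "dF j ` tuples (rk F (Suc j)) \<mm>"
 have P: "submodule ?P R ?E" by (rule image_submodule[OF FM FM dif_linear[OF Fex] ideal_tuples[OF ideal_\<mm>]])
 have m2: "ideal (\<mm> \<cdot>\<^bsub>R\<^esub> \<mm>) R" by (rule ideal_prod_is_ideal[OF ideal_\<mm> ideal_\<mm>])
 have "tuples (rk F j) (\<mm> \<cdot>\<^bsub>R\<^esub> \<mm>) \<subseteq> tuples (rk F j) \<mm>"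
  using ideal_prod_inter[OF ideal_\<mm> ideal_\<mm>] by (intro tuples_mono) auto
 moreover have "r \<odot>[?E] x \<in> tuples (rk F j) (\<mm> \<cdot>\<^bsub>R\<^esub> \<mm>)" if "r \<in> \<mm>" "x \<in> tuples (rk F j) \<mm>" for r x
  using that by (auto intro!: ideal_prod.prod)
 moreover have "tuples (rk F j) (\<mm> \<cdot>\<^bsub>R\<^esub> \<mm>) \<inter> ?N \<subseteq> ?P"
 proof
  fix y assume y: "y \<in> tuples (rk F j) (\<mm> \<cdot>\<^bsub>R\<^esub> \<mm>) \<inter> ?N"
  then obtain x where x: "x \<in> vec R (rk F (Suc j))" "y = dF j x" unfolding syzygy_def by (elim IntE imageE)
  then have "x \<in> tuples (rk F (Suc j)) \<mm>" using linear_complexD(3)[OF F x(1)] y by simp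
  then show "y \<in> ?P" unfolding x(2) by (rule imageI)
 qed
 ultimately obtain W where W: "submodule W R ?E" "W \<subseteq> tuples (rk F j) \<mm>" "W \<inter> ?N \<subseteq> ?P"
  "\<And>x. x \<in> tuples (rk F j) \<mm> ==> \<exists>n\<in>?N. \<exists>w\<in>W. x = n \<oplus>[?E] w"
  using complement[OF FM N ideal_tuples[OF ideal_\<mm>] ideal_tuples[OF m2] P syzygy_\<mm>] by metis
 show ?case
 proof
  fix z assume z: "z \<in> cyc X ?E ?N (tuples (rk F j) \<mm>) (Suc i)"
  let ?A = "pow ?E (rk X (Suc i))" and ?B = "pow ?E (rk X i)"
  interpret A: module R ?A by (rule pow_mod[OF FM])
  interpret B: module R ?B by (rule pow_mod[OF FM])
  note Nt = submodule_tuples[OF FM N] and Wt = submodule_tuples[OF FM W(1)]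
  have zt: "z \<in> tuples (rk X (Suc i)) (tuples (rk F j) \<mm>)" "cdif X ?E (Suc i) z \<in> tuples (rk X i) ?N"
   using z unfolding cyc_Suc by auto
  obtain n w where "n \<in> tuples (rk X (Suc i)) ?N" "w \<in> tuples (rk X (Suc i)) W"
   "z = tuple_map (rk X (Suc i)) (\<lambda>x. x) n \<oplus>[?A] w" using tuples_lift[OF W(4) zt(1)] by metis
  moreover from this(1) have "tuple_map (rk X (Suc i)) (\<lambda>x. x) n = n"
   by (intro tuples_eqI[of _ _ UNIV n]) (auto simp: tuple_map_def)
  ultimately have nw: "n \<in> tuples (rk X (Suc i)) ?N" "w \<in> tuples (rk X (Suc i)) W" "z = n \<oplus>[?A] w" by auto
  have nc: "n \<in> carrier ?A" and wc: "w \<in> carrier ?A"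
   using submodule_carrier[OF Nt nw(1)] submodule_carrier[OF Wt nw(2)] .
  have dn: "cdif X ?E (Suc i) n \<in> tuples (rk X i) ?N" by (rule cdif_tuples[OF mat FM N nw(1)])
  have dw: "cdif X ?E (Suc i) w \<in> tuples (rk X i) W" by (rule cdif_tuples[OF mat FM W(1) nw(2)])
  have dz: "cdif X ?E (Suc i) z = cdif X ?E (Suc i) n \<oplus>[?B] cdif X ?E (Suc i) w"
   unfolding nw(3) using nc wc by (intro cdif_add[OF mat FM]) simp_all
  then have "cdif X ?E (Suc i) w \<in> tuples (rk X i) ?N"
   using zt(2) B.submodule_cancel[OF Nt dn submodule_carrier[OF Wt dw]] by simp
  then have "cdif X ?E (Suc i) w \<in> tuples (rk X i) ?P" using dw W(3) by (auto simp: PiE_iff)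
  then obtain u where u: "u \<in> tuples (rk X i) (tuples (rk F (Suc j)) \<mm>)" "cdif X ?E (Suc i) w = tuple_map (rk X i) (dF j) u"
   by (rule tuples_image)
  have uR: "u \<in> tuples (rk X i) ?R'" using u(1) \<mm>_carrier by (auto simp: PiE_iff)
  note tr = mat syzygy_iso[OF Fex]
  have "u \<in> cyc X ?E' ?N' (tuples (rk F (Suc j)) \<mm>) i"
  proof (cases i)
   case 0 then show ?thesis using u(1) by simp
  next
   case (Suc k)
   have "cdif X ?E (Suc k) (cdif X ?E (Suc i) w) \<in> tuples (rk X k) ?Z"
    using complex_free[OF res, of "rk F j"] wc unfolding complex_mod_def Suc by simp
   moreover have "cdif X ?E (Suc k) (tuple_map (rk X (Suc k)) (dF j) u) = tuple_map (rk X k) (dF j) (cdif X ?E' (Suc k) u)"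
    by (rule cdif_tuple_map_mem[OF tr uR[unfolded Suc]])
   ultimately have "tuple_map (rk X k) (dF j) (cdif X ?E' (Suc k) u) \<in> tuples (rk X k) ?Z"
    unfolding u(2) unfolding Suc by (simp only:)
   moreover have "cdif X ?E' (Suc k) u \<in> tuples (rk X k) ?R'"
    using cdif_tuples[OF mat FM cs] uR unfolding Suc by blast
   ultimately have "cdif X ?E' (Suc k) u \<in> tuples (rk X k) ?N'" using tuple_map_mem_iff[OF tr] by blast
   then show ?thesis using u(1) unfolding Suc cyc_Suc by blast
  qed
  then have "u \<in> bnd X ?E' ?N' ?R' i" using Suc.IH by blast
  then have "tuple_map (rk X i) (dF j) u \<in> bnd X ?E ?Z ?N i" using tuple_map_bnd_iff[OF tr uR] by blast
  then have "cdif X ?E (Suc i) z \<in> bnd X ?E ?Z ?N i"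
   unfolding dz u(2)[symmetric] using bnd_image[OF mat FM zs N nw(1)] submodule_add[OF bnd_submodule[OF mat FM zs N]] by blast
  moreover have "z \<in> tuples (rk X (Suc i)) ?R" using zt(1) \<mm>_carrier by (auto simp: PiE_iff)
  ultimately show "z \<in> bnd X ?E ?N ?R (Suc i)" by (intro bnd_of_cdif_bnd[OF res N ZN])
 qed
qed

text \<open>Transport to an ideal \<open>I\<close> such that \<open>R / I\<close> is resolved by the complex.\<close>

lemma linear_complex_max_ideal_null:
 assumes I: "ideal I R" and e: "e \<in> linear_maps R (fm R (rk F 0)) (reg R)"
  and ker: "\<And>x. x \<in> vec R (rk F 0) ==> e x \<in> I \<longleftrightarrow> x \<in> syzygy F 0"
  and one: "\<exists>x\<in>vec R (rk F 0). \<exists>a\<in>I. \<one> = e x \<oplus> a"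
 shows "max_ideal_null I X"
 unfolding max_ideal_null_def
proof (intro allI subsetI)
 let ?M = "reg R" and ?E = "fm R (rk F 0)" and ?N = "syzygy F 0" and ?R = "vec R (rk F 0)"
 note mat = matrices[OF res] and FM = free_mod and cs = free_sub
 note Is = ideal_submodule[OF I]
 have Ic: "I \<subseteq> carrier R" using ideal.Icarr[OF I] by blast
 have Nsub: "?N \<subseteq> ?R" by (rule syzygy_subset[OF Fex])
 obtain x1 a1 where x1: "x1 \<in> ?R" "a1 \<in> I" "\<one> = e x1 \<oplus> a1" using one by blast
 have ec: "e x \<in> carrier R" if "x \<in> ?R" for x using linear_mapsD(1)[OF e] that by simp
 have split: "r = e (r \<odot>[?E] x1) \<oplus> r \<otimes> a1" "r \<odot>[?E] x1 \<in> ?R" "r \<otimes> a1 \<in> I" if r: "r \<in> carrier R" for r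
 proof -
  have a1c: "a1 \<in> carrier R" using x1 Ic by blast
  have "e (r \<odot>[?E] x1) = r \<otimes> e x1" using linear_mapsD(3)[OF e r, of x1] x1(1) by simp
  then have "e (r \<odot>[?E] x1) \<oplus> r \<otimes> a1 = r \<otimes> (e x1 \<oplus> a1)" using r a1c ec[OF x1(1)] by (simp only: r_distr)
  also have "\<dots> = r" using r x1(3) r_one by metis
  finally show "r = e (r \<odot>[?E] x1) \<oplus> r \<otimes> a1" by (rule sym)
  show "r \<odot>[?E] x1 \<in> ?R" using x1(1) r by (auto simp: PiE_iff)
  show "r \<otimes> a1 \<in> I" using ideal.I_l_closed[OF I x1(2) r] .
 qed
 have surj: "\<exists>x\<in>?R. \<exists>a\<in>I. r = e x \<oplus>[?M] a" if "r \<in> carrier R" for r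
  using split[OF that] unfolding regular_module_simps by blast
 have surj\<mm>: "\<exists>x\<in>tuples (rk F 0) \<mm>. \<exists>a\<in>I. r = e x \<oplus>[?M] a" if "r \<in> \<mm>" for r
 proof -
  have "r \<odot>[?E] x1 \<in> tuples (rk F 0) \<mm>" using x1(1) ideal.I_r_closed[OF ideal_\<mm> that] by (auto simp: PiE_iff)
  then show ?thesis using split[OF \<mm>_carrier[OF that]] unfolding regular_module_simps by blast
 qed
 note tr = mat FM regular e syzygy_submodule[OF Fex] cs Is carrier_sub Nsub Ic ec ker surj
 fix i z assume z: "z \<in> cyc X ?M I \<mm> i"
 let ?P = "pow ?M (rk X i)"
 obtain u a where ua: "u \<in> tuples (rk X i) (tuples (rk F 0) \<mm>)" "a \<in> tuples (rk X i) I"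
  "z = tuple_map (rk X i) e u \<oplus>[?P] a" using tuples_lift[OF surj\<mm> cyc_tuples[OF z]] by metis
 have uR: "u \<in> tuples (rk X i) ?R" using ua(1) \<mm>_carrier by (auto simp: PiE_iff)
 have eu: "tuple_map (rk X i) e u \<in> vec R (rk X i)" by (rule tuple_map_mem[OF tr uR])
 have "u \<in> cyc X ?E ?N (tuples (rk F 0) \<mm>) i"
 proof (cases i)
  case 0 then show ?thesis using ua(1) by simp
 next
  case (Suc k)
  let ?Q = "pow ?M (rk X k)"
  interpret Q: module R ?Q by (rule pow_mod[OF regular])
  have uRk: "u \<in> tuples (rk X (Suc k)) ?R" using uR Suc by simp
  have dz: "cdif X ?M (Suc k) z \<in> tuples (rk X k) I" using z unfolding Suc cyc_Suc by blast
  have da: "cdif X ?M (Suc k) a \<in> tuples (rk X k) I" using cdif_tuples[OF mat regular Is] ua(2) Suc by blast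
  have deu: "cdif X ?M (Suc k) (tuple_map (rk X i) e u) \<in> vec R (rk X k)"
   using cdif_tuples[OF mat regular carrier_sub] eu Suc by blast
  have "a \<in> vec R (rk X i)" using ua(2) tuples_mono[OF Ic] by blast
  then have "cdif X ?M (Suc k) z = cdif X ?M (Suc k) (tuple_map (rk X i) e u) \<oplus>[?Q] cdif X ?M (Suc k) a"
   unfolding ua(3) using eu unfolding Suc by (intro cdif_add[OF mat regular]) (simp_all only: regular_module_simps)
  then have "cdif X ?M (Suc k) (tuple_map (rk X i) e u) \<in> tuples (rk X k) I"
   using Q.submodule_cancel2[OF submodule_tuples[OF regular Is] da] deu dz by simp
  then have "tuple_map (rk X k) e (cdif X ?E (Suc k) u) \<in> tuples (rk X k) I"
   using cdif_tuple_map_mem[OF tr uRk] unfolding Suc by simp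
  then have "cdif X ?E (Suc k) u \<in> tuples (rk X k) ?N"
   using tuple_map_mem_iff[OF tr cdif_tuples[OF mat FM cs uRk]] by blast
  then show ?thesis using ua(1) unfolding Suc cyc_Suc by blast
 qed
 then have "u \<in> bnd X ?E ?N ?R i" using linear_complex_null by blast
 then have "tuple_map (rk X i) e u \<in> bnd X ?M I (carrier R) i" using tuple_map_bnd_iff[OF tr uR] by blast
 then show "z \<in> bnd X ?M I (carrier R) i"
  unfolding ua(3) using bnd_lower[OF mat regular Is carrier_sub ua(2)]
   submodule_add[OF bnd_submodule[OF mat regular Is carrier_sub]] by blast
qed

lemma linear_complex_cycle_in_ideal:
 assumes I: "ideal I R" and q: "q \<in> linear_maps R (fm R (rk F (Suc 0))) (reg R)"
  and ker: "\<And>x. x \<in> vec R (rk F (Suc 0)) ==> q x = \<zero> \<longleftrightarrow> x \<in> syzygy F (Suc 0)"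
  and im: "q ` vec R (rk F (Suc 0)) = I"
  and z: "z \<in> cyc X (reg R) {\<zero>} (\<mm> \<cdot>\<^bsub>R\<^esub> I) i"
 shows "z \<in> bnd X (reg R) {\<zero>} I i"
proof -
 let ?M = "reg R" and ?E = "fm R (rk F (Suc 0))" and ?N = "syzygy F (Suc 0)" and ?R = "vec R (rk F (Suc 0))"
 note mat = matrices[OF res] and FM = free_mod and cs = free_sub
 note Is = ideal_submodule[OF I] and zs = ideal_submodule[OF zeroideal]
 have Nsub: "?N \<subseteq> ?R" by (rule syzygy_subset[OF Fex])
 have Zsub: "{\<zero>} \<subseteq> I" using submodule_zero[OF Is] by simp
 have qI: "q x \<in> I" if "x \<in> ?R" for x using im that by blast
 have surj: "\<exists>x\<in>?R. \<exists>a\<in>{\<zero>}. r = q x \<oplus>[?M] a" if r: "r \<in> I" for r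
 proof -
  obtain x where "x \<in> ?R" "r = q x" using im r by blast
  moreover have "r \<oplus> \<zero> = r" using ideal.Icarr[OF I r] by simp
  ultimately show ?thesis unfolding regular_module_simps
   by (intro bexI[of _ x] bexI[of _ \<zero>]) simp_all
 qed
 have ker': "q x \<in> {\<zero>} \<longleftrightarrow> x \<in> ?N" if "x \<in> ?R" for x using ker[OF that] by simp
 note tr = mat FM regular q syzygy_submodule[OF Fex] cs zs Is Nsub Zsub qI ker' surj
 have "\<mm> \<cdot>\<^bsub>R\<^esub> I \<subseteq> q ` tuples (rk F (Suc 0)) \<mm>" by (rule ideal_prod_image[OF q im])
 then have "z \<in> tuples (rk X i) (q ` tuples (rk F (Suc 0)) \<mm>)" using cyc_tuples[OF z] tuples_mono by blast
 then obtain u where u: "u \<in> tuples (rk X i) (tuples (rk F (Suc 0)) \<mm>)" "z = tuple_map (rk X i) q u" by (rule tuples_image)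
 have uR: "u \<in> tuples (rk X i) ?R" using u(1) \<mm>_carrier by (auto simp: PiE_iff)
 have "u \<in> cyc X ?E ?N (tuples (rk F (Suc 0)) \<mm>) i"
 proof (cases i)
  case 0 then show ?thesis using u(1) by simp
 next
  case (Suc k)
  have uRk: "u \<in> tuples (rk X (Suc k)) ?R" using uR Suc by simp
  have "cdif X ?M (Suc k) z \<in> tuples (rk X k) {\<zero>}" using z unfolding Suc cyc_Suc by blast
  then have "tuple_map (rk X k) q (cdif X ?E (Suc k) u) \<in> tuples (rk X k) {\<zero>}"
   using cdif_tuple_map_mem[OF tr uRk] unfolding u(2) Suc by simp
  then have "cdif X ?E (Suc k) u \<in> tuples (rk X k) ?N"
   using tuple_map_mem_iff[OF tr cdif_tuples[OF mat FM cs uRk]] by blast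
  then show ?thesis using u(1) unfolding Suc cyc_Suc by blast
 qed
 then have "u \<in> bnd X ?E ?N ?R i" using linear_complex_null by blast
 then show ?thesis unfolding u(2) using tuple_map_bnd_iff[OF tr uR] by blast
qed

end

end

section \<open>Relations between Betti numbers\<close>

context local_noetherian
begin

lemma betti_shift_exact:
 assumes res: "residue_resolution K X v" and J: "ideal J R" "K \<subseteq> J" "J \<subseteq> \<mm>"
  and g: "g \<in> linear_maps R (fm R n) (reg R)"
  and gJ: "\<And>x. x \<in> vec R n ==> g x \<in> J"
  and surj: "\<And>y. y \<in> J ==> \<exists>x\<in>vec R n. y = g x"
 shows "rbetti R X J (Suc i) =
  betti R X (fm R n) {x \<in> vec R n. g x \<in> K} (vec R n) i"
proof -
 \<comment> \<open>the ideal is treated as a submodule of \<open>R\<^sup>1\<close>\<close>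
 define p where "p x = (\<lambda>l\<in>{..<1::nat}. g x)" for x
 have p: "p \<in> linear_maps R (fm R n) (fm R 1)"
  unfolding p_def by (rule linear_mapsI) (use linear_mapsD[OF g] in auto)
 have pJ: "p x \<in> tuples 1 J" if "x \<in> vec R n" for x unfolding p_def using gJ[OF that] by auto
 have pK: "p x \<in> tuples 1 K \<longleftrightarrow> g x \<in> K" for x unfolding p_def by auto
 have psurj: "\<exists>x\<in>vec R n. \<exists>a\<in>tuples 1 K. y = p x \<oplus>[fm R 1] a" if y: "y \<in> tuples 1 J" for y
 proof -
  have y0: "y 0 \<in> J" using y by auto
  then obtain x where x: "x \<in> vec R n" "y 0 = g x" using surj by blast
  have "y = p x \<oplus>[fm R 1] \<zero>[fm R 1]"
   by (rule tuples_eqI[OF y, of _ UNIV]) (use x y0 ideal.Icarr[OF J(1)] in \<open>auto simp: p_def\<close>)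
  then show ?thesis using x(1) submodule_zero[OF ideal_tuples[OF K[OF res], of 1]] by blast
 qed
 have "betti R X (fm R 1) (tuples 1 J) (vec R 1) (Suc i) =
  1 * rbetti R X K (Suc i) +
  betti R X (fm R n) {x \<in> vec R n. p x \<in> tuples 1 K} (vec R n) i"
  by (rule betti_shift[OF res K[OF res] subset_refl max_ideal_null_self[OF res] ideal_tuples[OF J(1)]
    tuples_mono[OF J(2)] tuples_mono[OF J(3)] p pJ psurj])
 then show ?thesis unfolding betti_regular_eq_free[OF res J(1,2)] betti_exact[OF res] pK by simp
qed

lemma betti_product_regular:
 assumes resX: "residue_resolution K X v" and resY: "residue_resolution L Y w" and KL: "K \<subseteq> L"
  and Z: "max_ideal_null L X"
 shows "rbetti R X \<mm> i =
  (\<Sum>j\<le>i. rbetti R Y \<mm> j * rbetti R X L (i - j))"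
proof -
 have X: "rbetti R X \<mm> j = betti R X (fm R 1) (tuples 1 \<mm>) (vec R 1) j"
  and Y: "rbetti R Y \<mm> j = betti R Y (fm R 1) (tuples 1 \<mm>) (vec R 1) j" for j
  using betti_regular_eq_free[OF resX ideal_\<mm> K_\<mm>[OF resX]] betti_regular_eq_free[OF resY ideal_\<mm> K_\<mm>[OF resY]] by auto
 show ?thesis unfolding X Y
  by (rule betti_product[OF resX resY KL Z ideal_tuples[OF ideal_\<mm>] tuples_mono[OF K_\<mm>[OF resY]] subset_refl])
qed

context
 fixes I X v
 assumes I: "ideal I R" "I \<subseteq> \<mm>" and res: "residue_resolution {\<zero>} X v"
  and Z2: "\<And>z i. z \<in> cyc X (reg R) {\<zero>} (\<mm> \<cdot>\<^bsub>R\<^esub> I) i ==> z \<in> bnd X (reg R) {\<zero>} I i"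
begin

text \<open>The inclusion of \<open>\<mm>I\<close> into \<open>I\<close> is zero in homology, so the exact sequence
 \<open>I / \<mm>I \<rightarrow> R / \<mm>I \<rightarrow> R / I\<close> induces short exact sequences
 \<open>0 \<rightarrow> H\<^sub>i\<^sub>+\<^sub>1(R / I) \<rightarrow> H\<^sub>i(I / \<mm>I) \<rightarrow> H\<^sub>i(R / \<mm>I) \<rightarrow> 0\<close> in positive degrees.\<close>

lemma betti_extension:
 "betti R X (reg R) (\<mm> \<cdot>\<^bsub>R\<^esub> I) I (Suc i) =
  rbetti R X I (Suc (Suc i)) + rbetti R X (\<mm> \<cdot>\<^bsub>R\<^esub> I) (Suc i)"
proof -
 let ?M = "reg R" and ?J = "\<mm> \<cdot>\<^bsub>R\<^esub> I"
 let ?P = "pow ?M (rk X (Suc i))" and ?Q = "pow ?M (rk X i)" and ?P' = "pow ?M (rk X (Suc (Suc i)))"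
 note mat = matrices[OF res] and cs = carrier_sub
 have J: "ideal ?J R" by (rule ideal_prod_is_ideal[OF ideal_\<mm> I(1)])
 note Is = ideal_submodule[OF I(1)] and Js = ideal_submodule[OF J] and zs = ideal_submodule[OF zeroideal]
 have JI: "?J \<subseteq> I" using ideal_prod_inter[OF ideal_\<mm> I(1)] by blast
 have IR: "I \<subseteq> carrier R" and JR: "?J \<subseteq> carrier R" using ideal.Icarr[OF I(1)] ideal.Icarr[OF J] by blast+
 have zJ: "{\<zero>} \<subseteq> ?J" using submodule_zero[OF Js] by simp
 have zI: "{\<zero>} \<subseteq> I" using zJ JI by blast
 have cx: "complex_mod X ?M A B" if "{\<zero>} \<subseteq> A" "B \<subseteq> carrier R" for A B
  by (rule complex_mod_mono[OF complex[OF res] that])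
 have dd: "cdif X ?M (Suc k) (cdif X ?M (Suc (Suc k)) y) \<in> tuples (rk X k) {\<zero>}"
  if "y \<in> vec R (rk X (Suc (Suc k)))" for k y
  using complex[OF res] that unfolding complex_mod_def by blast
 interpret P: module R ?P by (rule pow_mod[OF regular])
 interpret Q: module R ?Q by (rule pow_mod[OF regular])
 interpret P': module R ?P' by (rule pow_mod[OF regular])
 have PN: "noetherian_module R ?P" by (rule noetherian_power_module[OF regular_noetherian])
 note cdadd = cdif_add[OF mat regular, unfolded regular_module_simps(1)]
 note cdc = cdif_tuples[OF mat regular cs] and cdI = cdif_tuples[OF mat regular Is] and cdJ = cdif_tuples[OF mat regular Js]
 have up: "x \<in> vec R k" if "x \<in> tuples k I" for k x using that tuples_mono[OF IR] by blast
 have upJ: "x \<in> vec R k" "x \<in> tuples k I" if "x \<in> tuples k ?J" for k x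
  using that tuples_mono[OF JR] tuples_mono[OF JI] by blast+
 let ?A = "bnd X ?M ?J I (Suc i)" and ?Z = "cyc X ?M ?J I (Suc i)"
  and ?A' = "bnd X ?M ?J (carrier R) (Suc i)" and ?Z' = "cyc X ?M ?J (carrier R) (Suc i)"
 let ?C = "{z \<in> ?Z. z \<in> ?A'}"
 have As: "submodule ?A R ?P" and Zs: "submodule ?Z R ?P" and As': "submodule ?A' R ?P" and Zs': "submodule ?Z' R ?P"
  using bnd_submodule[OF mat regular] cyc_submodule[OF mat regular] Js Is cs by auto
 have Cs: "submodule ?C R ?P" by (rule submodule_vimage[OF P.module_axioms P.module_axioms id_linear Zs As'])
 have AZ: "?A \<subseteq> ?Z" by (rule bnd_subset_cyc[OF mat regular Js Is JI cx[OF zJ IR]])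
 have AZ': "?A' \<subseteq> ?Z'" by (rule bnd_subset_cyc[OF mat regular Js cs JR cx[OF zJ subset_refl]])
 have AA': "?A \<subseteq> ?A'" by (rule bnd_mono[OF mat regular subset_refl IR])
 have ZZ': "?Z \<subseteq> ?Z'" unfolding cyc_Suc using tuples_mono[OF IR, of "rk X (Suc i)"] by blast
 have AC: "?A \<subseteq> ?C" using AZ AA' by blast
 have "rdim R ?P ?A ?Z = rdim R ?P ?A ?C + rdim R ?P ?C ?Z"
 proof (rule rdim_additive[OF PN As Cs Zs AC])
  fix r z assume r: "r \<in> \<mm>" and z: "z \<in> ?Z"
  have "r \<odot>[?P] z \<in> tuples (rk X (Suc i)) ?J"
   using cyc_tuples[OF z] r by (auto intro!: ideal_prod.prod)
  then show "r \<odot>[?P] z \<in> ?A" by (rule bnd_lower[OF mat regular Js Is])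
 qed blast
 moreover have "rdim R ?P ?C ?Z = rdim R ?P ?A' ?Z'"
 proof (rule rdim_transfer[OF P.module_axioms P.module_axioms id_linear Cs Zs As' Zs' _ AZ'])
  fix z assume z: "z \<in> ?Z'"
  then have zt: "z \<in> vec R (rk X (Suc i))" "cdif X ?M (Suc i) z \<in> tuples (rk X i) ?J" unfolding cyc_Suc by auto
  have "cdif X ?M (Suc i) z \<in> cyc X ?M {\<zero>} ?J i"
   using zt(2) dd zt(1) by (cases i) (auto simp: cyc_Suc)
  then have "cdif X ?M (Suc i) z \<in> bnd X ?M {\<zero>} I i" by (rule Z2)
  then obtain y a where ya: "y \<in> tuples (rk X (Suc i)) I" "a \<in> tuples (rk X i) {\<zero>}"
   "cdif X ?M (Suc i) z = cdif X ?M (Suc i) y \<oplus>[?Q] a" unfolding bnd_def by blast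
  have yP: "y \<in> carrier ?P" and zP: "z \<in> carrier ?P" using up[OF ya(1)] zt(1) by auto
  obtain w where w: "w \<in> carrier ?P" "z = y \<oplus>[?P] w" using P.ex_diff[OF zP yP] by metis
  have wt: "w \<in> vec R (rk X (Suc i))" using w(1) by simp
  have aQ: "a \<in> carrier ?Q" "a \<in> tuples (rk X i) ?J" using ya(2) tuples_mono[OF zJ] upJ(1) by auto
  have "cdif X ?M (Suc i) z = cdif X ?M (Suc i) y \<oplus>[?Q] cdif X ?M (Suc i) w"
   unfolding w(2) by (rule cdadd[OF up[OF ya(1)] wt])
  moreover have "cdif X ?M (Suc i) y \<in> carrier ?Q" "cdif X ?M (Suc i) w \<in> carrier ?Q"
   using cdc[OF up[OF ya(1)]] cdc[OF wt] by simp_all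
  ultimately have "cdif X ?M (Suc i) w = a" using ya(3) aQ(1) Q.M.add.l_cancel by metis
  then have "w \<in> bnd X ?M {\<zero>} (carrier R) (Suc i)" using wt ya(2) by (intro exact[OF res]) (simp add: cyc_Suc)
  then have "w \<in> ?A'" using bnd_mono[OF mat regular zJ subset_refl] by blast
  moreover have "cdif X ?M (Suc i) y \<in> tuples (rk X i) ?J"
   using Q.submodule_cancel2[OF submodule_tuples[OF regular Js] aQ(2)] zt(2) cdc[OF up[OF ya(1)]] unfolding ya(3) by simp
  then have "y \<in> ?Z" using ya(1) unfolding cyc_Suc by blast
  ultimately show "\<exists>x\<in>?Z. \<exists>a\<in>?A'. z = x \<oplus>[?P] a" using w(2) by blast
 qed (use ZZ' in blast)+
 moreover have "rdim R ?P' (bnd X ?M I (carrier R) (Suc (Suc i))) (cyc X ?M I (carrier R) (Suc (Suc i))) = rdim R ?P ?A ?C"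
 proof (rule rdim_transfer[OF P'.module_axioms P.module_axioms cdif_linear[OF mat regular] _ _ As Cs _ AC])
  show "submodule (bnd X ?M I (carrier R) (Suc (Suc i))) R ?P'" "submodule (cyc X ?M I (carrier R) (Suc (Suc i))) R ?P'"
   using bnd_submodule[OF mat regular Is cs] cyc_submodule[OF mat regular Is cs] by auto
  show "bnd X ?M I (carrier R) (Suc (Suc i)) \<subseteq> cyc X ?M I (carrier R) (Suc (Suc i))"
   by (rule bnd_subset_cyc[OF mat regular Is cs IR cx[OF zI subset_refl]])
  fix w assume "w \<in> cyc X ?M I (carrier R) (Suc (Suc i))"
  then have w: "w \<in> vec R (rk X (Suc (Suc i)))" "cdif X ?M (Suc (Suc i)) w \<in> tuples (rk X (Suc i)) I"
   unfolding cyc_Suc by auto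
  have "cdif X ?M (Suc i) (cdif X ?M (Suc (Suc i)) w) \<in> tuples (rk X i) ?J" using dd[OF w(1)] tuples_mono[OF zJ] by blast
  then have "cdif X ?M (Suc (Suc i)) w \<in> ?Z" using w(2) unfolding cyc_Suc by blast
  then show "cdif X ?M (Suc (Suc i)) w \<in> ?C" using bnd_image[OF mat regular Js cs w(1)] by blast
  show "cdif X ?M (Suc (Suc i)) w \<in> ?A \<longleftrightarrow> w \<in> bnd X ?M I (carrier R) (Suc (Suc i))"
  proof
   assume "w \<in> bnd X ?M I (carrier R) (Suc (Suc i))"
   then obtain x n where xn: "x \<in> tuples (rk X (Suc (Suc (Suc i)))) (carrier R)" "n \<in> tuples (rk X (Suc (Suc i))) I"
    "w = cdif X ?M (Suc (Suc (Suc i))) x \<oplus>[?P'] n" unfolding bnd_def by blast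
   have "cdif X ?M (Suc (Suc i)) w = cdif X ?M (Suc (Suc i)) (cdif X ?M (Suc (Suc (Suc i))) x) \<oplus>[?P] cdif X ?M (Suc (Suc i)) n"
    unfolding xn(3) by (rule cdadd[OF cdc[OF xn(1)] up[OF xn(2)]])
   moreover have "cdif X ?M (Suc (Suc i)) (cdif X ?M (Suc (Suc (Suc i))) x) \<in> ?A"
    by (rule bnd_lower[OF mat regular Js Is subsetD[OF tuples_mono[OF zJ] dd[OF xn(1)]]])
   moreover have "cdif X ?M (Suc (Suc i)) n \<in> ?A" by (rule bnd_image[OF mat regular Js Is xn(2)])
   ultimately show "cdif X ?M (Suc (Suc i)) w \<in> ?A" using submodule_add[OF As] by simp
  next
   assume "cdif X ?M (Suc (Suc i)) w \<in> ?A"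
   then obtain y u where yu: "y \<in> tuples (rk X (Suc (Suc i))) I" "u \<in> tuples (rk X (Suc i)) ?J"
    "cdif X ?M (Suc (Suc i)) w = cdif X ?M (Suc (Suc i)) y \<oplus>[?P] u" unfolding bnd_def by blast
   have zt: "submodule (tuples (rk X i) {\<zero>}) R ?Q" by (rule submodule_tuples[OF regular zs])
   have "cdif X ?M (Suc i) (cdif X ?M (Suc (Suc i)) w) = cdif X ?M (Suc i) (cdif X ?M (Suc (Suc i)) y) \<oplus>[?Q] cdif X ?M (Suc i) u"
    unfolding yu(3) by (rule cdadd[OF cdc[OF up[OF yu(1)]] upJ(1)[OF yu(2)]])
   then have "cdif X ?M (Suc i) u \<in> tuples (rk X i) {\<zero>}"
    using Q.submodule_cancel[OF zt dd[OF up[OF yu(1)]]] dd[OF w(1)] cdc[OF upJ(1)[OF yu(2)]] by simp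
   then have "u \<in> cyc X ?M {\<zero>} ?J (Suc i)" using yu(2) unfolding cyc_Suc by blast
   then have "u \<in> bnd X ?M {\<zero>} I (Suc i)" by (rule Z2)
   moreover have "cdif X ?M (Suc (Suc i)) y \<in> bnd X ?M {\<zero>} I (Suc i)" by (rule bnd_image[OF mat regular zs Is yu(1)])
   ultimately have "cdif X ?M (Suc (Suc i)) w \<in> bnd X ?M {\<zero>} I (Suc i)"
    unfolding yu(3) using submodule_add[OF bnd_submodule[OF mat regular zs Is]] by blast
   then show "w \<in> bnd X ?M I (carrier R) (Suc (Suc i))"
    by (rule bnd_of_cdif_bnd_regular[OF res I(1) zI w(1)])
  qed
 next
  fix c assume c: "c \<in> ?C"
  then obtain w u where wu: "w \<in> vec R (rk X (Suc (Suc i)))" "u \<in> tuples (rk X (Suc i)) ?J"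
   "c = cdif X ?M (Suc (Suc i)) w \<oplus>[?P] u" unfolding bnd_def by blast
  have "c \<in> tuples (rk X (Suc i)) I" using c cyc_tuples by blast
  then have "cdif X ?M (Suc (Suc i)) w \<in> tuples (rk X (Suc i)) I"
   using P.submodule_cancel2[OF submodule_tuples[OF regular Is] upJ(2)[OF wu(2)]] cdc[OF wu(1)] unfolding wu(3) by simp
  then have "w \<in> cyc X ?M I (carrier R) (Suc (Suc i))" using wu(1) unfolding cyc_Suc by blast
  moreover have "u \<in> ?A" by (rule bnd_lower[OF mat regular Js Is wu(2)])
  ultimately show "\<exists>x\<in>cyc X ?M I (carrier R) (Suc (Suc i)). \<exists>a\<in>?A. c = cdif X ?M (Suc (Suc i)) x \<oplus>[?P] a"
   using wu(3) by blast
 qed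
 ultimately show ?thesis unfolding betti_def by simp
qed

text \<open>As \<open>I / \<mm>I\<close> is a vector space over the residue field, its homology is known.\<close>

lemma betti_relations:
 assumes resS: "residue_resolution (\<mm> \<cdot>\<^bsub>R\<^esub> I) S w"
 obtains n where
  "rbetti R X I 1 = n"
  "\<And>i. n * rbetti R X \<mm> (Suc i) =
   rbetti R X I (Suc (Suc i)) + rbetti R X (\<mm> \<cdot>\<^bsub>R\<^esub> I) (Suc i)"
  "\<And>i. rbetti R S I (Suc i) = n * rbetti R S \<mm> i"
proof -
 let ?M = "reg R" and ?J = "\<mm> \<cdot>\<^bsub>R\<^esub> I"
 have J: "ideal ?J R" by (rule ideal_prod_is_ideal[OF ideal_\<mm> I(1)])
 note Is = ideal_submodule[OF I(1)] and Js = ideal_submodule[OF J] and zs = ideal_submodule[OF zeroideal] and cs = carrier_sub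
 have JI: "?J \<subseteq> I" using ideal_prod_inter[OF ideal_\<mm> I(1)] by blast
 have IR: "I \<subseteq> carrier R" using ideal.Icarr[OF I(1)] by blast
 have zI: "{\<zero>} \<subseteq> I" using submodule_zero[OF Is] by simp
 have zJ: "{\<zero>} \<subseteq> ?J" using submodule_zero[OF Js] by simp
 obtain n g where g0: "g \<in> linear_maps R (fm R n) ?M"
  "\<forall>x\<in>vec R n. g x \<in> I"
  "\<forall>y\<in>I. \<exists>x\<in>vec R n. \<exists>a\<in>{\<zero>}. y = g x \<oplus>[?M] a"
  "\<forall>x\<in>vec R n. g x \<in> {\<zero>} \<longrightarrow> x \<in> tuples n \<mm>"
  using minimal_generators[OF regular_noetherian zs Is zI] by blast
 note g = g0(1) g0(2-4)[rule_format]
 have surj: "\<exists>x\<in>vec R n. y = g x" if y: "y \<in> I" for y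
 proof -
  obtain x where x: "x \<in> vec R n" "y = g x \<oplus>[?M] \<zero>" using g(3)[OF y] by blast
  have "g x \<in> carrier R" using g(2)[OF x(1)] IR by blast
  then show ?thesis using x by auto
 qed
 have im: "g ` vec R n = I" using g(2) surj by blast
 have m: "g x \<in> ?J \<longleftrightarrow> x \<in> tuples n \<mm>" if x: "x \<in> vec R n" for x
 proof
  interpret M: module R ?M by (rule regular)
  interpret F: module R "fm R n" by (rule free_mod)
  {
   assume "g x \<in> ?J"
   then obtain y where y: "y \<in> tuples n \<mm>" "g x = g y" using ideal_prod_image[OF g(1) im] by blast
   have yc: "y \<in> vec R n" using y(1) \<mm>_carrier by (auto simp: PiE_iff)
   have xF: "x \<in> carrier (fm R n)" and yF: "y \<in> carrier (fm R n)" using x yc by simp_all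
   obtain d where d: "d \<in> carrier (fm R n)" "x = y \<oplus>[fm R n] d" using F.ex_diff[OF xF yF] by metis
   have "g x = g y \<oplus>[?M] g d" unfolding d(2) by (rule linear_mapsD(2)[OF g(1) yF d(1)])
   then have "g d = \<zero>[?M]"
    using y(2) linear_mapsD(1)[OF g(1) yF] linear_mapsD(1)[OF g(1) d(1)] M.M.add.l_cancel_one' by metis
   then have "d \<in> tuples n \<mm>" using g(4)[of d] d(1) by simp
   then show "x \<in> tuples n \<mm>" unfolding d(2) by (rule submodule_add[OF ideal_tuples[OF ideal_\<mm>] y(1)])
  next
   assume x\<mm>: "x \<in> tuples n \<mm>"
   have "g x = lin_comb ?M n (\<lambda>j. g (unit_vector R n j)) x" by (rule linear_map_free_eq[OF regular g(1) x])
   also have "\<dots> \<in> ?J" unfolding lin_comb_def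
   proof (rule M.submodule_finsum[OF Js])
    fix j assume "j \<in> {..<n}"
    then have "x j \<in> \<mm>" using x\<mm> by auto
    then show "x j \<odot>[?M] g (unit_vector R n j) \<in> ?J"
     unfolding regular_module_simps using g(2)[OF unit_vector_tuples] by (rule ideal_prod.prod)
   qed simp
   finally show "g x \<in> ?J" .
  }
 qed
 have "tuples n \<mm> \<subseteq> vec R n" using \<mm>_carrier by (intro tuples_mono) blast
 then have sub: "x \<in> vec R n" if "x \<in> tuples n \<mm>" for x using that by (rule subsetD)
 have vim: "{x \<in> vec R n. g x \<in> ?J} = tuples n \<mm>"
 proof (intro equalityI subsetI)
  fix x assume "x \<in> {x \<in> vec R n. g x \<in> ?J}"
  then show "x \<in> tuples n \<mm>" using m[of x] by simp
 next
  fix x assume "x \<in> tuples n \<mm>"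
  then show "x \<in> {x \<in> vec R n. g x \<in> ?J}" using m[OF sub] sub[of x] by simp
 qed
 show ?thesis
 proof (rule that)
  have "betti R X ?M I (carrier R) (Suc 0) = betti R X (fm R n) {x \<in> vec R n. g x \<in> {\<zero>}} (vec R n) 0"
   by (rule betti_shift_exact[OF res I(1) zI I(2) g(1,2) surj])
  also have "\<dots> = n"
  proof (rule betti_0[OF res])
   show "submodule {x \<in> vec R n. g x \<in> {\<zero>}} R (fm R n)"
    by (rule submodule_vimage[OF free_mod regular g(1) free_sub zs])
   show "{x \<in> vec R n. g x \<in> {\<zero>}} \<subseteq> tuples n \<mm>" using g(4) by blast
   show "tuples n {\<zero>} \<subseteq> {x \<in> vec R n. g x \<in> {\<zero>}}"
   proof
    fix x assume "x \<in> tuples n {\<zero>}"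
    then have "x = \<zero>[fm R n]" using zero_tuples_free by blast
    then show "x \<in> {x \<in> vec R n. g x \<in> {\<zero>}}"
     using linear_map_zero[OF free_mod regular g(1)] by auto
   qed
  qed
  finally show "betti R X ?M I (carrier R) 1 = n" by simp
 next
  fix i
  have "betti R S ?M I (carrier R) (Suc i) = betti R S (fm R n) {x \<in> vec R n. g x \<in> ?J} (vec R n) i"
   by (rule betti_shift_exact[OF resS I(1) JI I(2) g(1,2) surj])
  then show "betti R S ?M I (carrier R) (Suc i) = n * betti R S ?M \<mm> (carrier R) i"
   unfolding vim using betti_free_power[OF resS ideal_\<mm> K_\<mm>[OF resS]] by simp
  let ?i = "Suc i"
  have "n * betti R X ?M \<mm> (carrier R) ?i = betti R X (fm R n) (tuples n \<mm>) (vec R n) ?i"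
   using betti_free_power[OF res ideal_\<mm> K_\<mm>[OF res]] by simp
  also have "\<dots> = betti R X ?M ?J I ?i"
  proof (rule betti_transfer[OF matrices[OF res] free_mod regular g(1) ideal_tuples[OF ideal_\<mm>]
     free_sub Js Is _ JI g(2) m])
   show "tuples n \<mm> \<subseteq> vec R n" using \<mm>_carrier by (intro tuples_mono) blast
   show "\<exists>x\<in>vec R n. \<exists>a\<in>?J. b = g x \<oplus>[?M] a" if "b \<in> I" for b using g(3)[OF that] zJ by blast
   show "complex_mod X (fm R n) (tuples n \<mm>) (vec R n)"
    by (rule complex_mod_mono[OF complex_free[OF res] tuples_mono[OF K_\<mm>[OF res]] subset_refl])
   show "complex_mod X ?M ?J I" by (rule complex_mod_mono[OF complex[OF res] zJ IR])
  qed
  finally show "n * betti R X ?M \<mm> (carrier R) (Suc i) = betti R X ?M I (carrier R) (Suc (Suc i)) + betti R X ?M ?J (carrier R) (Suc i)"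
   unfolding betti_extension .
 qed
qed

end

section \<open>Poincare series\<close>

text \<open>In terms of power series in \<open>x\<close> the assumptions read \<open>A = GT\<close>, \<open>C = GU\<close>, \<open>U = 1 + nxC\<close> and
 \<open>T = 1 + nxA - x(S - 1)\<close>.  Hence \<open>C(1 - nxG) = G\<close> and \<open>A(1 - nxG) = G(1 - x(S - 1))\<close>.\<close>

lemma golod_series:
 fixes a c g t u s :: "nat => nat"
 assumes a: "\<And>i. a i = (\<Sum>j\<le>i. g j * t (i - j))" and c: "\<And>i. c i = (\<Sum>j\<le>i. g j * u (i - j))"
  and u: "u 0 = 1" "\<And>i. u (Suc i) = n * c i" and t: "t 0 = 1" "t 1 = n" and s: "s 0 = 1" and a0: "a 0 = 1"
  and ext: "\<And>i. n * a (Suc i) = t (Suc (Suc i)) + s (Suc i)"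
 shows "Abs_fps (\<lambda>i. of_nat (c i) :: rat) =
  Abs_fps (\<lambda>i. of_nat (a i)) / (1 - fps_X * (Abs_fps (\<lambda>i. of_nat (s i)) - 1))"
proof -
 define A C G T U S where "A = Abs_fps (\<lambda>i. of_nat (a i) :: rat)" and "C = Abs_fps (\<lambda>i. of_nat (c i) :: rat)"
  and "G = Abs_fps (\<lambda>i. of_nat (g i) :: rat)" and "T = Abs_fps (\<lambda>i. of_nat (t i) :: rat)"
  and "U = Abs_fps (\<lambda>i. of_nat (u i) :: rat)" and "S = Abs_fps (\<lambda>i. of_nat (s i) :: rat)"
 have A: "A = G * T" unfolding A_def G_def T_def
  by (rule fps_ext) (simp add: fps_mult_nth a atMost_atLeast0)
 have C: "C = G * U" unfolding C_def G_def U_def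
  by (rule fps_ext) (simp add: fps_mult_nth c atMost_atLeast0)
 have U: "U = 1 + of_nat n * (fps_X * C)"
 proof (rule fps_ext)
  fix i show "fps_nth U i = fps_nth (1 + of_nat n * (fps_X * C)) i"
   unfolding U_def C_def by (cases i) (simp_all add: u fps_of_nat[symmetric])
 qed
 have S: "fps_X * (S - 1) = of_nat n * (fps_X * A) - T + 1"
 proof (rule fps_ext)
  fix i
  consider "i = 0" | "i = 1" | j where "i = Suc (Suc j)" by (metis One_nat_def not0_implies_Suc)
  then show "fps_nth (fps_X * (S - 1)) i = fps_nth (of_nat n * (fps_X * A) - T + 1) i"
  proof cases
   case (3 j)
   have "(of_nat n * of_nat (a (Suc j)) :: rat) = of_nat (t (Suc (Suc j))) + of_nat (s (Suc j))"
    using ext[of j] by (metis of_nat_add of_nat_mult)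
   then show ?thesis unfolding S_def A_def T_def 3 by (simp add: fps_of_nat[symmetric])
  qed (use t s a0 in \<open>simp_all add: S_def A_def T_def fps_of_nat[symmetric]\<close>)
 qed
 let ?D = "1 - fps_X * (S - 1)"
 have "C * ?D = G * U * T - of_nat n * (fps_X * C) * A" unfolding S C by (simp add: algebra_simps)
 also have "\<dots> = A" unfolding U A by (simp add: algebra_simps)
 finally have "C * ?D = A" .
 moreover have "fps_nth ?D 0 = 1" by simp
 then have "?D \<noteq> 0" by (metis fps_zero_nth zero_neq_one)
 ultimately have "C = A / ?D" by (metis nonzero_mult_div_cancel_right)
 then show ?thesis unfolding A_def C_def S_def .
qed

end

section \<open>Chain maps and large homomorphisms\<close>

context local_noetherian
begin

text \<open>The columnwise form of solvability: a system over \<open>R\<^sup>b\<close> consists of \<open>b\<close> systems over \<open>R\<close>.\<close>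

lemma tuples_of_columns:
 assumes "\<And>l. l < b ==> x l \<in> tuples n A"
 obtains z where "z \<in> tuples n (tuples b A)" "\<And>l. l < b ==> column n l z = x l"
proof
 let ?z = "\<lambda>c\<in>{..<n}. \<lambda>l\<in>{..<b}. x l c"
 show "?z \<in> tuples n (tuples b A)" using tuples_mem[OF assms] by auto
 show "column n l ?z = x l" if "l < b" for l
  by (rule tuples_eqI[OF _ assms[OF that], of _ UNIV]) (use that in \<open>auto simp: tuple_map_def\<close>)
qed

context
 fixes I X v Y w \<Phi>
 assumes I: "ideal I R" and resX: "residue_resolution {\<zero>} X v" and resY: "residue_resolution I Y w"
  and null: "max_ideal_null I X"
  and \<Phi>: "\<And>i r c. r < rk Y i ==> c < rk X i ==> \<Phi> i r c \<in> carrier R"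
  and chain: "\<And>i x. x \<in> vec R (rk X (Suc i)) ==> \<exists>u\<in>tuples (rk Y i) I.
   matrix_map (reg R) (rk Y i) (rk X i) (\<Phi> i) (cdif X (reg R) (Suc i) x) =
   cdif Y (reg R) (Suc i) (matrix_map (reg R) (rk Y (Suc i)) (rk X (Suc i)) (\<Phi> (Suc i)) x)
    \<oplus>[pow (reg R) (rk Y i)] u"
  and aug_surj: "\<And>y. y \<in> vec R (rk Y 0) ==>
   \<exists>x\<in>vec R (rk X 0). \<exists>u\<in>rbnd R Y I 0.
    y = matrix_map (reg R) (rk Y 0) (rk X 0) (\<Phi> 0) x \<oplus>[pow (reg R) (rk Y 0)] u"
begin

abbreviation chain_map :: "nat => nat => (nat => nat => 'a) => nat => nat => 'a" where
 "chain_map b i \<equiv> matrix_map (fm R b) (rk Y i) (rk X i) (\<Phi> i)"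

lemma chain_map_linear:
 "chain_map b i \<in> linear_maps R (pow (fm R b) (rk X i)) (pow (fm R b) (rk Y i))"
 by (rule matrix_map_linear[OF free_mod \<Phi>])

lemma chain_map_tuples:
 "submodule N R (fm R b) ==> x \<in> tuples (rk X i) N ==> chain_map b i x \<in> tuples (rk Y i) N"
 by (rule matrix_map_tuples[OF free_mod _ \<Phi>])

lemma column_chain_map:
 "l < b ==> x \<in> tuples (rk X i) (vec R b) ==>
  column (rk Y i) l (chain_map b i x) = matrix_map (reg R) (rk Y i) (rk X i) (\<Phi> i) (column (rk X i) l x)"
 by (rule matrix_map_tuple_map[OF free_mod regular eval_linear \<Phi>, symmetric]) auto

lemma tuple_map_chain_map:
 assumes "p \<in> linear_maps R (fm R n) (fm R b)" "x \<in> tuples (rk X i) (vec R n)"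
 shows "chain_map b i (tuple_map (rk X i) p x) = tuple_map (rk Y i) p (chain_map n i x)"
 by (rule matrix_map_tuple_map[OF free_mod free_mod assms(1) \<Phi>]) (use assms(2) in auto)

lemma chain_free:
 assumes x: "x \<in> tuples (rk X (Suc i)) (vec R b)"
 shows "\<exists>u\<in>tuples (rk Y i) (tuples b I).
  chain_map b i (cdif X (fm R b) (Suc i) x) =
  cdif Y (fm R b) (Suc i) (chain_map b (Suc i) x) \<oplus>[pow (fm R b) (rk Y i)] u"
proof -
 let ?F = "fm R b" and ?M = "reg R"
 let ?Q = "pow ?F (rk Y i)"
 note FM = free_mod and cs = free_sub
 interpret Q: module R ?Q by (rule pow_mod[OF FM])
 interpret C: module R "pow ?M (rk Y i)" by (rule pow_mod[OF regular])
 have dx: "cdif X ?F (Suc i) x \<in> tuples (rk X i) (vec R b)"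
  by (rule cdif_tuples[OF matrices[OF resX] FM cs x])
 have \<Phi>x: "chain_map b (Suc i) x \<in> tuples (rk Y (Suc i)) (vec R b)" by (rule chain_map_tuples[OF cs x])
 have d\<Phi>x: "cdif Y ?F (Suc i) (chain_map b (Suc i) x) \<in> tuples (rk Y i) (vec R b)"
  by (rule cdif_tuples[OF matrices[OF resY] FM cs \<Phi>x])
 have \<Phi>dx: "chain_map b i (cdif X ?F (Suc i) x) \<in> tuples (rk Y i) (vec R b)" by (rule chain_map_tuples[OF cs dx])
 obtain u where u: "u \<in> carrier ?Q" "chain_map b i (cdif X ?F (Suc i) x) = cdif Y ?F (Suc i) (chain_map b (Suc i) x) \<oplus>[?Q] u"
  using Q.ex_diff[of "chain_map b i (cdif X ?F (Suc i) x)" "cdif Y ?F (Suc i) (chain_map b (Suc i) x)"] \<Phi>dx d\<Phi>x by auto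
 have ut: "u \<in> tuples (rk Y i) (vec R b)" using u(1) by simp
 have "u \<in> tuples (rk Y i) (tuples b I)" unfolding tuples_tuples_iff[OF ut]
 proof (intro allI impI)
  fix l assume l: "l < b"
  note ev = tuple_map_linear[OF eval_linear[OF l]]
  have xl: "column (rk X (Suc i)) l x \<in> vec R (rk X (Suc i))" by (rule tuple_map_tuples[OF _ x]) (use l in auto)
  obtain u' where u': "u' \<in> tuples (rk Y i) I"
   "matrix_map ?M (rk Y i) (rk X i) (\<Phi> i) (cdif X ?M (Suc i) (column (rk X (Suc i)) l x)) =
   cdif Y ?M (Suc i) (matrix_map ?M (rk Y (Suc i)) (rk X (Suc i)) (\<Phi> (Suc i)) (column (rk X (Suc i)) l x))
    \<oplus>[pow ?M (rk Y i)] u'" using chain[OF xl] by blast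
  have "column (rk Y i) l (chain_map b i (cdif X ?F (Suc i) x)) =
    matrix_map ?M (rk Y i) (rk X i) (\<Phi> i) (cdif X ?M (Suc i) (column (rk X (Suc i)) l x))"
   using column_chain_map[OF l dx] cdif_tuple_map[OF matrices[OF resX] FM regular eval_linear[OF l]] x by simp
  moreover have "column (rk Y i) l (cdif Y ?F (Suc i) (chain_map b (Suc i) x)) =
    cdif Y ?M (Suc i) (matrix_map ?M (rk Y (Suc i)) (rk X (Suc i)) (\<Phi> (Suc i)) (column (rk X (Suc i)) l x))"
   unfolding column_chain_map[OF l x, symmetric]
   by (rule cdif_tuple_map[OF matrices[OF resY] FM regular eval_linear[OF l], symmetric]) (use \<Phi>x in simp)
  moreover have "column (rk Y i) l (chain_map b i (cdif X ?F (Suc i) x)) =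
   column (rk Y i) l (cdif Y ?F (Suc i) (chain_map b (Suc i) x)) \<oplus>[pow ?M (rk Y i)] column (rk Y i) l u"
   unfolding u(2) using d\<Phi>x u(1) by (intro linear_mapsD(2)[OF ev]) simp_all
  ultimately have e: "cdif Y ?M (Suc i) (matrix_map ?M (rk Y (Suc i)) (rk X (Suc i)) (\<Phi> (Suc i)) (column (rk X (Suc i)) l x))
    \<oplus>[pow ?M (rk Y i)] u' = column (rk Y i) l (cdif Y ?F (Suc i) (chain_map b (Suc i) x)) \<oplus>[pow ?M (rk Y i)] column (rk Y i) l u"
   using u'(2) by simp
  have "column (rk Y i) l (cdif Y ?F (Suc i) (chain_map b (Suc i) x)) \<in> carrier (pow ?M (rk Y i))"
   "column (rk Y i) l u \<in> carrier (pow ?M (rk Y i))"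
   using linear_mapsD(1)[OF ev] d\<Phi>x u(1) by (metis power_module_simps(1) free_module_simps(1))+
  moreover have "u' \<in> carrier (pow ?M (rk Y i))"
   using submodule_carrier[OF submodule_tuples[OF regular ideal_submodule[OF I]] u'(1)] .
  ultimately have "column (rk Y i) l u = u'"
   using e C.M.add.l_cancel
    \<open>column (rk Y i) l (cdif Y ?F (Suc i) (chain_map b (Suc i) x)) =
     cdif Y ?M (Suc i) (matrix_map ?M (rk Y (Suc i)) (rk X (Suc i)) (\<Phi> (Suc i)) (column (rk X (Suc i)) l x))\<close> by metis
  then show "column (rk Y i) l u \<in> tuples (rk Y i) I" using u'(1) by simp
 qed
 then show ?thesis using u(2) by blast
qed

text \<open>Surjectivity in homology with coefficients in \<open>M = R\<^sup>b / N\<close>.  Both connecting maps to the homology of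
 the syzygy \<open>N / IR\<^sup>b\<close> of the \<open>R / I\<close>-module \<open>M\<close> are compatible with the chain map; the one for \<open>Y\<close> is
 injective, and the one for \<open>X\<close> is surjective because \<open>N\<close> maps to zero in homology.\<close>

lemma homology_surjective:
 assumes "submodule N R (fm R b)" "tuples b I \<subseteq> N" "N \<subseteq> tuples b \<mm>"
  and "y \<in> cyc Y (fm R b) N (vec R b) i"
 shows "\<exists>x\<in>cyc X (fm R b) N (vec R b) i. \<exists>u\<in>bnd Y (fm R b) N (vec R b) i.
  y = chain_map b i x \<oplus>[pow (fm R b) (rk Y i)] u"
 using assms
proof (induction i arbitrary: b N y)
 case 0
 let ?F = "fm R b" and ?M = "reg R" and ?R = "vec R b"
 let ?Q = "pow ?F (rk Y 0)"
 note FM = free_mod and cs = free_sub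
 interpret Q: module R ?Q by (rule pow_mod[OF FM])
 interpret C: module R "pow ?M (rk Y 0)" by (rule pow_mod[OF regular])
 have y: "y \<in> tuples (rk Y 0) ?R" using 0 by simp
 let ?sol = "\<lambda>l x u. x \<in> vec R (rk X 0) \<and> u \<in> bnd Y ?M I (carrier R) 0 \<and>
  column (rk Y 0) l y = matrix_map ?M (rk Y 0) (rk X 0) (\<Phi> 0) x \<oplus>[pow ?M (rk Y 0)] u"
 have "\<forall>l. \<exists>x u. l < b \<longrightarrow> ?sol l x u"
 proof
  fix l
  have "column (rk Y 0) l y \<in> vec R (rk Y 0)" if "l < b"
   by (rule tuple_map_tuples[OF _ y]) (use that in auto)
  then have "l < b ==> \<exists>x u. ?sol l x u" using aug_surj[of "column (rk Y 0) l y"] by blast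
  then show "\<exists>x u. l < b \<longrightarrow> ?sol l x u" by (cases "l < b") auto
 qed
 then have "\<exists>x' u'. \<forall>l. l < b \<longrightarrow> ?sol l (x' l) (u' l)" by (simp only: choice_iff)
 then obtain x' u' where xu: "\<And>l. l < b ==> x' l \<in> vec R (rk X 0)" "\<And>l. l < b ==> u' l \<in> bnd Y ?M I (carrier R) 0"
  "\<And>l. l < b ==> column (rk Y 0) l y = matrix_map ?M (rk Y 0) (rk X 0) (\<Phi> 0) (x' l) \<oplus>[pow ?M (rk Y 0)] u' l"
  by metis
 obtain x where x: "x \<in> tuples (rk X 0) ?R" "\<And>l. l < b ==> column (rk X 0) l x = x' l"
  using tuples_of_columns[of b x' "rk X 0" "carrier R"] xu(1) by blast
 have \<Phi>x: "chain_map b 0 x \<in> tuples (rk Y 0) ?R" by (rule chain_map_tuples[OF cs x(1)])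
 obtain u where u: "u \<in> carrier ?Q" "y = chain_map b 0 x \<oplus>[?Q] u" using Q.ex_diff[of y "chain_map b 0 x"] y \<Phi>x by auto
 have ut: "u \<in> tuples (rk Y 0) ?R" using u(1) by simp
 have "u \<in> bnd Y ?F (tuples b I) ?R 0" unfolding bnd_free_iff[OF matrices[OF resY] I ut]
 proof (intro allI impI)
  fix l assume l: "l < b"
  note ev = tuple_map_linear[OF eval_linear[OF l]]
  have "column (rk Y 0) l y = column (rk Y 0) l (chain_map b 0 x) \<oplus>[pow ?M (rk Y 0)] column (rk Y 0) l u"
   unfolding u(2) using \<Phi>x u(1) by (intro linear_mapsD(2)[OF ev]) simp_all
  moreover have e: "column (rk Y 0) l (chain_map b 0 x) = matrix_map ?M (rk Y 0) (rk X 0) (\<Phi> 0) (x' l)"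
   using column_chain_map[OF l x(1)] x(2)[OF l] by simp
  moreover have "column (rk Y 0) l (chain_map b 0 x) \<in> carrier (pow ?M (rk Y 0))"
   "column (rk Y 0) l u \<in> carrier (pow ?M (rk Y 0))"
   using linear_mapsD(1)[OF ev] \<Phi>x u(1) by (metis power_module_simps(1) free_module_simps(1))+
  moreover have "u' l \<in> carrier (pow ?M (rk Y 0))"
   using submodule_carrier[OF bnd_submodule[OF matrices[OF resY] regular ideal_submodule[OF I] carrier_sub] xu(2)[OF l]] .
  ultimately have "column (rk Y 0) l u = u' l" using xu(3)[OF l] C.M.add.l_cancel by metis
  then show "column (rk Y 0) l u \<in> bnd Y ?M I (carrier R) 0" using xu(2)[OF l] by simp
 qed
 then have "u \<in> bnd Y ?F N ?R 0" using bnd_mono[OF matrices[OF resY] FM 0(2) subset_refl] by blast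
 then show ?case using x(1) u(2) by auto
next
 case (Suc i)
 let ?F = "fm R b" and ?R = "vec R b" and ?I = "tuples b I"
 let ?P = "pow ?F (rk Y (Suc i))" and ?Q = "pow ?F (rk Y i)" and ?O = "pow ?F (rk X i)"
 note FM = free_mod and cs = free_sub and N = Suc.prems(1) and IN = Suc.prems(2) and N\<mm> = Suc.prems(3)
 note matX = matrices[OF resX] and matY = matrices[OF resY] and Is = ideal_tuples[OF I]
 interpret P: module R ?P by (rule pow_mod[OF FM])
 interpret Q: module R ?Q by (rule pow_mod[OF FM])
 interpret O: module R ?O by (rule pow_mod[OF FM])
 have yt: "y \<in> tuples (rk Y (Suc i)) ?R" and dyN: "cdif Y ?F (Suc i) y \<in> tuples (rk Y i) N"
  using Suc.prems(4) unfolding cyc_Suc by auto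
 have Nc: "N \<subseteq> ?R" using submodule_carrier[OF N] unfolding free_module_simps(1) by (rule subsetI)
 have dy: "cdif Y ?F (Suc i) y \<in> cyc Y ?F ?I N i"
 proof (cases i)
  case 0 then show ?thesis using dyN by simp
 next
  case (Suc k)
  have "cdif Y ?F (Suc k) (cdif Y ?F (Suc i) y) \<in> tuples (rk Y k) ?I"
   using complex_free[OF resY, of b] yt unfolding Suc complex_mod_def by blast
  then show ?thesis using dyN unfolding Suc cyc_Suc by blast
 qed
 obtain n p where p0: "p \<in> linear_maps R (fm R n) ?F"
  "\<forall>x\<in>vec R n. p x \<in> N"
  "\<forall>y\<in>N. \<exists>x\<in>vec R n. \<exists>a\<in>?I. y = p x \<oplus>[?F] a"
  "\<forall>x\<in>vec R n. p x \<in> ?I \<longrightarrow> x \<in> tuples n \<mm>"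
  using cover[OF N I IN] by blast
 note p = p0(1) p0(2-4)[rule_format]
 let ?N = "{x \<in> vec R n. p x \<in> ?I}" and ?R' = "vec R n" and ?F' = "fm R n"
 note N' = vimage_submodule[OF p(1) Is] and IN' = tuples_subset_vimage[OF p(1) I]
 have N'sub: "?N \<subseteq> ?R'" by (rule Collect_subset)
 have inj: "p x \<in> ?I \<longleftrightarrow> x \<in> ?N" if "x \<in> ?R'" for x using that by simp
 note trX = matX FM FM p(1) N' cs Is N N'sub IN p(2) inj p(3)
 note trY = matY FM FM p(1) N' cs Is N N'sub IN p(2) inj p(3)
 have N'\<mm>: "?N \<subseteq> tuples n \<mm>" using p(4) by (intro subsetI) (elim CollectE conjE)
 obtain s a where s: "s \<in> cyc Y ?F' ?N ?R' i" "a \<in> tuples (rk Y i) ?I"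
  "cdif Y ?F (Suc i) y = tuple_map (rk Y i) p s \<oplus>[?Q] a"
  using cyc_lift[OF trY dy] by blast
 obtain x' u' where xu: "x' \<in> cyc X ?F' ?N ?R' i" "u' \<in> bnd Y ?F' ?N ?R' i"
  "s = chain_map n i x' \<oplus>[pow ?F' (rk Y i)] u'"
  using Suc.IH[OF N' IN' N'\<mm> s(1)] by blast
 have x't: "x' \<in> tuples (rk X i) ?R'" using cyc_tuples[OF xu(1)] .
 have u't: "u' \<in> tuples (rk Y i) ?R'"
  using submodule_carrier[OF bnd_submodule[OF matY FM N' cs] xu(2)] by simp
 have pu': "tuple_map (rk Y i) p u' \<in> bnd Y ?F ?I N i" using tuple_map_bnd_iff[OF trY u't] xu(2) by blast
 have px': "tuple_map (rk X i) p x' \<in> cyc X ?F ?I N i" by (rule tuple_map_cyc[OF trX xu(1)])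
 then have "tuple_map (rk X i) p x' \<in> cyc X ?F ?I (tuples b \<mm>) i"
  using tuples_mono[OF N\<mm>, of "rk X i"] unfolding cyc_def by blast
 then have "tuple_map (rk X i) p x' \<in> bnd X ?F ?I ?R i" by (rule max_ideal_null_free[OF resX I null])
 then obtain x l where xl: "x \<in> tuples (rk X (Suc i)) ?R" "l \<in> tuples (rk X i) ?I"
  "tuple_map (rk X i) p x' = cdif X ?F (Suc i) x \<oplus>[?O] l" unfolding bnd_def by blast
 have dx: "cdif X ?F (Suc i) x \<in> tuples (rk X i) ?R" by (rule cdif_tuples[OF matX FM cs xl(1)])
 have lN: "l \<in> tuples (rk X i) N" using xl(2) tuples_mono[OF IN] by blast
 have "cdif X ?F (Suc i) x \<in> tuples (rk X i) N"
  using O.submodule_cancel2[OF submodule_tuples[OF FM N] lN] dx cyc_tuples[OF px'] unfolding xl(3) by simp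
 then have xc: "x \<in> cyc X ?F N ?R (Suc i)" using xl(1) unfolding cyc_Suc by blast
 obtain w where w: "w \<in> tuples (rk Y i) ?I"
  "chain_map b i (cdif X ?F (Suc i) x) = cdif Y ?F (Suc i) (chain_map b (Suc i) x) \<oplus>[?Q] w"
  using chain_free[OF xl(1)] by blast
 have \<Phi>x: "chain_map b (Suc i) x \<in> tuples (rk Y (Suc i)) ?R" by (rule chain_map_tuples[OF cs xl(1)])
 obtain t where t: "t \<in> carrier ?P" "y = chain_map b (Suc i) x \<oplus>[?P] t"
  using P.ex_diff[of y "chain_map b (Suc i) x"] yt \<Phi>x by auto
 have tt: "t \<in> tuples (rk Y (Suc i)) ?R" using t(1) by simp
 let ?d\<Phi>x = "cdif Y ?F (Suc i) (chain_map b (Suc i) x)"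
 have B: "submodule (bnd Y ?F ?I N i) R ?Q" by (rule bnd_submodule[OF matY FM Is N])
 have wB: "w \<in> bnd Y ?F ?I N i" by (rule bnd_lower[OF matY FM Is N w(1)])
 have aB: "a \<in> bnd Y ?F ?I N i" by (rule bnd_lower[OF matY FM Is N s(2)])
 have lB: "chain_map b i l \<in> bnd Y ?F ?I N i" by (rule bnd_lower[OF matY FM Is N chain_map_tuples[OF Is xl(2)]])
 note Bc = submodule_carrier[OF B]
 have d\<Phi>xc: "?d\<Phi>x \<in> carrier ?Q" using cdif_tuples[OF matY FM cs \<Phi>x] by simp
 have dtc: "cdif Y ?F (Suc i) t \<in> carrier ?Q" using cdif_tuples[OF matY FM cs tt] by simp
 have "cdif Y ?F (Suc i) y = ?d\<Phi>x \<oplus>[?Q] cdif Y ?F (Suc i) t"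
  unfolding t(2) using \<Phi>x tt by (intro cdif_add[OF matY FM]) simp_all
 moreover have "cdif Y ?F (Suc i) y = ?d\<Phi>x \<oplus>[?Q] (w \<oplus>[?Q] chain_map b i l \<oplus>[?Q] tuple_map (rk Y i) p u' \<oplus>[?Q] a)"
 proof -
  have "tuple_map (rk Y i) p s = tuple_map (rk Y i) p (chain_map n i x') \<oplus>[?Q] tuple_map (rk Y i) p u'"
   unfolding xu(3) using chain_map_tuples[OF cs x't] u't
   by (intro linear_mapsD(2)[OF tuple_map_linear[OF p(1)]]) simp_all
  also have "tuple_map (rk Y i) p (chain_map n i x') = chain_map b i (tuple_map (rk X i) p x')"
   by (rule tuple_map_chain_map[OF p(1) x't, symmetric])
  also have "\<dots> = chain_map b i (cdif X ?F (Suc i) x) \<oplus>[?Q] chain_map b i l"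
   unfolding xl(3) using dx submodule_carrier[OF submodule_tuples[OF FM Is] xl(2)]
   by (intro linear_mapsD(2)[OF chain_map_linear]) simp_all
  finally have "cdif Y ?F (Suc i) y = ?d\<Phi>x \<oplus>[?Q] w \<oplus>[?Q] chain_map b i l \<oplus>[?Q] tuple_map (rk Y i) p u' \<oplus>[?Q] a"
   unfolding s(3) w(2) by simp
  then show ?thesis
   using d\<Phi>xc Bc[OF wB] Bc[OF lB] Bc[OF pu'] Bc[OF aB] by (simp only: Q.M.a_assoc Q.M.a_closed)
 qed
 ultimately have "cdif Y ?F (Suc i) t = w \<oplus>[?Q] chain_map b i l \<oplus>[?Q] tuple_map (rk Y i) p u' \<oplus>[?Q] a"
  using d\<Phi>xc dtc Bc[OF wB] Bc[OF lB] Bc[OF pu'] Bc[OF aB] Q.M.add.l_cancel Q.M.a_closed by metis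
 also have "\<dots> \<in> bnd Y ?F ?I N i" using wB lB pu' aB submodule_add[OF B] by metis
 finally have "t \<in> bnd Y ?F N ?R (Suc i)" by (rule bnd_of_cdif_bnd[OF resY N IN tt])
 then show ?case using xc t(2) by blast
qed

text \<open>The case \<open>M = k\<close>.\<close>

lemma I_\<mm>: "tuples n I \<subseteq> tuples n \<mm>"
 using K_\<mm>[OF resY] by (rule tuples_mono)

lemma residue_chain_linear:
 "matrix_map (reg R) (rk Y i) (rk X i) (\<Phi> i) \<in> linear_maps R (fm R (rk X i)) (fm R (rk Y i))"
 unfolding free_pow by (rule matrix_map_linear[OF regular \<Phi>])

lemma residue_chain_cyc:
 assumes x: "x \<in> rcyc R X \<mm> i"
 shows "matrix_map (reg R) (rk Y i) (rk X i) (\<Phi> i) x \<in> rcyc R Y \<mm> i"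
proof -
 let ?M = "reg R"
 have \<Phi>x: "matrix_map ?M (rk Y i) (rk X i) (\<Phi> i) x \<in> vec R (rk Y i)"
  using linear_mapsD(1)[OF residue_chain_linear, of x i] cyc_tuples[OF x] by simp
 show ?thesis
 proof (cases i)
  case 0 then show ?thesis using \<Phi>x by simp
 next
  case (Suc j)
  let ?Q = "fm R (rk Y j)"
  let ?z = "cdif Y ?M (Suc j) (matrix_map ?M (rk Y (Suc j)) (rk X (Suc j)) (\<Phi> (Suc j)) x)"
  interpret Q: module R ?Q by (rule free_mod)
  have x': "x \<in> vec R (rk X (Suc j))" "cdif X ?M (Suc j) x \<in> tuples (rk X j) \<mm>"
   using x unfolding Suc cyc_Suc by blast+
  obtain u where u: "u \<in> tuples (rk Y j) I" "matrix_map ?M (rk Y j) (rk X j) (\<Phi> j) (cdif X ?M (Suc j) x) = ?z \<oplus>[?Q] u"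
   using chain[OF x'(1)] unfolding free_pow by blast
  have "?z \<in> tuples (rk Y j) \<mm>"
  proof (rule Q.submodule_cancel2[OF ideal_tuples[OF ideal_\<mm>]])
   show "u \<in> tuples (rk Y j) \<mm>" using u(1) I_\<mm> by blast
   show "?z \<in> carrier ?Q"
    using cdif_tuples[OF matrices[OF resY] regular carrier_sub] \<Phi>x unfolding Suc by simp
   show "?z \<oplus>[?Q] u \<in> tuples (rk Y j) \<mm>" unfolding u(2)[symmetric]
    by (rule matrix_map_tuples[OF regular ideal_submodule[OF ideal_\<mm>] \<Phi> x'(2)])
  qed
  then show ?thesis using \<Phi>x unfolding Suc cyc_Suc by blast
 qed
qed

lemma residue_chain_bnd:
 assumes x: "x \<in> rbnd R X \<mm> i"
 shows "matrix_map (reg R) (rk Y i) (rk X i) (\<Phi> i) x \<in> rbnd R Y \<mm> i"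
proof -
 let ?M = "reg R" and ?P = "fm R (rk X i)" and ?Q = "fm R (rk Y i)"
 let ?\<Phi> = "\<lambda>i. matrix_map ?M (rk Y i) (rk X i) (\<Phi> i)" and ?B = "bnd Y ?M \<mm> (carrier R) i"
 note ms = ideal_submodule[OF ideal_\<mm>] and cs = carrier_sub
 have B: "submodule ?B R ?Q"
  unfolding free_pow by (rule bnd_submodule[OF matrices[OF resY] regular ms cs])
 obtain y t where yt: "y \<in> vec R (rk X (Suc i))" "t \<in> tuples (rk X i) \<mm>" "x = cdif X ?M (Suc i) y \<oplus>[?P] t"
  using x unfolding bnd_def free_pow by blast
 have c: "cdif X ?M (Suc i) y \<in> carrier ?P" "t \<in> carrier ?P"
  using cdif_tuples[OF matrices[OF resX] regular cs yt(1)] submodule_carrier[OF ideal_tuples[OF ideal_\<mm>] yt(2)] by simp_all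
 obtain u where u: "u \<in> tuples (rk Y i) I" "?\<Phi> i (cdif X ?M (Suc i) y) = cdif Y ?M (Suc i) (?\<Phi> (Suc i) y) \<oplus>[?Q] u"
  using chain[OF yt(1)] unfolding free_pow by blast
 have low: "t \<in> ?B" if "t \<in> tuples (rk Y i) \<mm>" for t by (rule bnd_lower[OF matrices[OF resY] regular ms cs that])
 have "?\<Phi> (Suc i) y \<in> vec R (rk Y (Suc i))" using linear_mapsD(1)[OF residue_chain_linear, of y "Suc i"] yt(1) by simp
 then have "cdif Y ?M (Suc i) (?\<Phi> (Suc i) y) \<in> ?B" by (rule bnd_image[OF matrices[OF resY] regular ms cs])
 moreover have "u \<in> ?B" by (rule low[OF subsetD[OF I_\<mm> u(1)]])
 moreover have "?\<Phi> i t \<in> ?B" by (rule low[OF matrix_map_tuples[OF regular ms \<Phi> yt(2)]])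
 ultimately show ?thesis
  unfolding yt(3) linear_mapsD(2)[OF residue_chain_linear c] u(2) using submodule_add[OF B] by blast
qed

lemma residue_homology_surjective:
 assumes y: "y \<in> rcyc R Y \<mm> i"
 shows "\<exists>x\<in>rcyc R X \<mm> i. \<exists>u\<in>rbnd R Y \<mm> i.
  y = matrix_map (reg R) (rk Y i) (rk X i) (\<Phi> i) x \<oplus>[fm R (rk Y i)] u"
proof -
 let ?M = "reg R" and ?F = "fm R 1" and ?N = "tuples 1 \<mm>" and ?R = "vec R 1"
 let ?P = "pow ?F (rk Y i)"
 note mX = matrices[OF resX] and mY = matrices[OF resY]
 have yt: "y \<in> vec R (rk Y i)" by (rule cyc_tuples[OF y])
 obtain y1 where y1: "y1 \<in> tuples (rk Y i) ?R" "\<And>l. l < 1 ==> column (rk Y i) l y1 = y"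
  by (rule tuples_of_columns[of 1 "\<lambda>_. y" "rk Y i" "carrier R"]) (use yt that in auto)
 have "y1 \<in> cyc Y ?F ?N ?R i"
  unfolding cyc_free_iff[OF mY ideal_\<mm> carrier_ideal y1(1)] using y1(2) y by simp
 from homology_surjective[OF ideal_tuples[OF ideal_\<mm>] I_\<mm> subset_refl this]
 obtain x1 u1 where x1: "x1 \<in> cyc X ?F ?N ?R i" and u1: "u1 \<in> bnd Y ?F ?N ?R i"
  and eq: "y1 = chain_map 1 i x1 \<oplus>[?P] u1" by (elim bexE) (rule that)
 have x1t: "x1 \<in> tuples (rk X i) ?R" by (rule cyc_tuples[OF x1])
 have B: "submodule (bnd Y ?F ?N ?R i) R ?P"
  by (rule bnd_submodule[OF mY free_mod ideal_tuples[OF ideal_\<mm>] free_sub])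
 have u1c: "u1 \<in> carrier ?P" by (rule submodule_carrier[OF B u1])
 have c1: "chain_map 1 i x1 \<in> carrier ?P" using chain_map_tuples[OF free_sub x1t] by simp
 have "column (rk X i) 0 x1 \<in> cyc X ?M \<mm> (carrier R) i"
  using x1 unfolding cyc_free_iff[OF mX ideal_\<mm> carrier_ideal x1t] by simp
 moreover have u1t: "u1 \<in> tuples (rk Y i) ?R" using u1c by simp
 have "column (rk Y i) 0 u1 \<in> bnd Y ?M \<mm> (carrier R) i"
  using u1 unfolding bnd_free_iff[OF mY ideal_\<mm> u1t] by simp
 moreover have "y = matrix_map ?M (rk Y i) (rk X i) (\<Phi> i) (column (rk X i) 0 x1) \<oplus>[fm R (rk Y i)] column (rk Y i) 0 u1"
  using y1(2)[of 0] linear_mapsD(2)[OF tuple_map_linear[OF eval_linear] c1 u1c, of 0] column_chain_map[OF _ x1t, of 0]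
  unfolding eq free_pow by simp
 ultimately show ?thesis by blast
qed

end

end

section \<open>Balancing\<close>

context local_noetherian
begin

context
 fixes X v
 assumes res: "residue_resolution {\<zero>} X v"
begin

definition times_v :: "nat => (nat => 'a) => nat => nat => 'a" where
 "times_v b x = (\<lambda>c\<in>{..<rk X 0}. v c \<odot>[fm R b] x)"

lemma v_mem: "c < rk X 0 ==> v c \<in> carrier R"
 using v[OF res] by auto

lemma times_v_linear: "times_v b \<in> linear_maps R (fm R b) (pow (fm R b) (rk X 0))"
proof -
 interpret F: module R "fm R b" by (rule free_mod)
 show ?thesis
 proof (rule linear_mapsI)
  fix x assume "x \<in> carrier (fm R b)"
  then show "times_v b x \<in> carrier (pow (fm R b) (rk X 0))"
   unfolding times_v_def power_module_simps using v_mem by (intro tuplesI F.smult_closed)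
 next
  fix x y assume xy: "x \<in> carrier (fm R b)" "y \<in> carrier (fm R b)"
  show "times_v b (x \<oplus>[fm R b] y) = times_v b x \<oplus>[pow (fm R b) (rk X 0)] times_v b y"
   unfolding times_v_def power_module_simps using F.smult_r_distr[OF v_mem xy] by (intro restrict_ext) simp
 next
  fix r x assume r: "r \<in> carrier R" and x: "x \<in> carrier (fm R b)"
  have "v c \<odot>[fm R b] (r \<odot>[fm R b] x) = r \<odot>[fm R b] (v c \<odot>[fm R b] x)" if "c < rk X 0" for c
   using F.smult_assoc1[OF v_mem[OF that] r x] F.smult_assoc1[OF r v_mem[OF that] x] m_comm[OF r v_mem[OF that]] by metis
  then show "times_v b (r \<odot>[fm R b] x) = r \<odot>[pow (fm R b) (rk X 0)] times_v b x"
   unfolding times_v_def power_module_simps by (intro restrict_ext) simp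
 qed
qed

lemma times_v_tuples: "submodule N R (fm R b) ==> x \<in> N ==> times_v b x \<in> tuples (rk X 0) N"
 unfolding times_v_def using v_mem by (intro tuplesI submodule_smult)

lemma times_v_natural:
 assumes "p \<in> linear_maps R (fm R n) (fm R b)" "x \<in> vec R n"
 shows "times_v b (p x) = tuple_map (rk X 0) p (times_v n x)"
 unfolding times_v_def tuple_map_def
 using linear_mapsD(3)[OF assms(1) v_mem, of _ x] assms(2) by (intro restrict_ext) (simp del: free_module_simps(4))

lemma column_times_v:
 assumes "l < b" "x \<in> vec R b"
 shows "column (rk X 0) l (times_v b x) = x l \<odot>[fm R (rk X 0)] v"
 unfolding times_v_def tuple_map_def free_module_simps
 using assms tuples_mem[OF assms(2) assms(1)] v_mem m_comm by (intro restrict_ext) simp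

lemma times_v_bnd_iff:
 assumes x: "x \<in> vec R b"
 shows "times_v b x \<in> bnd X (fm R b) (tuples b {\<zero>}) (vec R b) 0 \<longleftrightarrow> x \<in> tuples b \<mm>"
proof -
 have xl: "x l \<in> carrier R" if "l < b" for l using tuples_mem[OF x that] .
 have t: "times_v b x \<in> tuples (rk X 0) (vec R b)" by (rule times_v_tuples[OF free_sub x])
 have "times_v b x \<in> bnd X (fm R b) (tuples b {\<zero>}) (vec R b) 0 \<longleftrightarrow> (\<forall>l<b. x l \<in> \<mm>)"
  unfolding bnd_free_iff[OF matrices[OF res] zeroideal t] using column_times_v[OF _ x] aug_iff[OF res xl] by simp
 also have "\<dots> \<longleftrightarrow> x \<in> tuples b \<mm>" using x by (auto simp: PiE_iff)
 finally show ?thesis .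
qed

lemma times_v_onto:
 assumes z: "z \<in> tuples (rk X 0) (vec R b)"
 shows "\<exists>x\<in>vec R b. \<exists>u\<in>bnd X (fm R b) (tuples b {\<zero>}) (vec R b) 0.
  z = times_v b x \<oplus>[pow (fm R b) (rk X 0)] u"
proof -
 let ?F = "fm R b" and ?M = "reg R"
 let ?Q = "pow ?F (rk X 0)" and ?C = "fm R (rk X 0)"
 interpret Q: module R ?Q by (rule pow_mod[OF free_mod])
 interpret C: module R ?C by (rule free_mod)
 have zl: "column (rk X 0) l z \<in> vec R (rk X 0)" if "l < b" for l
  by (rule tuple_map_tuples[OF _ z]) (use that in auto)
 let ?sol = "\<lambda>l r. r \<in> carrier R \<and> (\<exists>u\<in>bnd X ?M {\<zero>} (carrier R) 0. column (rk X 0) l z = r \<odot>[?C] v \<oplus>[?C] u)"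
 have "\<exists>r. l < b \<longrightarrow> ?sol l r" for l
 proof (cases "l < b")
  case True then show ?thesis using aug[OF res zl[OF True]] by blast
 qed auto
 then have "\<exists>x'. \<forall>l. l < b \<longrightarrow> ?sol l (x' l)" by (intro choice) blast
 then obtain x' where x': "\<And>l. l < b ==> ?sol l (x' l)" by blast
 define x where "x = (\<lambda>l\<in>{..<b}. x' l)"
 have x: "x \<in> vec R b" unfolding x_def using x' by auto
 have tx: "times_v b x \<in> tuples (rk X 0) (vec R b)" by (rule times_v_tuples[OF free_sub x])
 obtain u where u: "u \<in> carrier ?Q" "z = times_v b x \<oplus>[?Q] u" using Q.ex_diff[of z "times_v b x"] z tx by auto
 have ut: "u \<in> tuples (rk X 0) (vec R b)" using u(1) by simp
 have "u \<in> bnd X ?F (tuples b {\<zero>}) (vec R b) 0" unfolding bnd_free_iff[OF matrices[OF res] zeroideal ut]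
 proof (intro allI impI)
  fix l assume l: "l < b"
  note ev = tuple_map_linear[OF eval_linear[OF l]]
  obtain u' where u': "u' \<in> bnd X ?M {\<zero>} (carrier R) 0" "column (rk X 0) l z = x' l \<odot>[?C] v \<oplus>[?C] u'" using x'[OF l] by blast
  have "column (rk X 0) l z = column (rk X 0) l (times_v b x) \<oplus>[pow ?M (rk X 0)] column (rk X 0) l u"
   unfolding u(2) using tx u(1) by (intro linear_mapsD(2)[OF ev]) simp_all
  moreover have "column (rk X 0) l (times_v b x) = x' l \<odot>[?C] v" using column_times_v[OF l x] l unfolding x_def by simp
  moreover have "x' l \<odot>[?C] v \<in> carrier ?C" using x'[OF l] v[OF res] by (intro C.smult_closed) auto
  moreover have "column (rk X 0) l u \<in> carrier ?C"
   using linear_mapsD(1)[OF ev] u(1) unfolding free_pow by (metis free_pow)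
  moreover have "u' \<in> carrier ?C"
   using submodule_carrier[OF bnd_submodule[OF matrices[OF res] regular ideal_submodule[OF zeroideal] carrier_sub] u'(1)]
   unfolding free_pow .
  ultimately have "column (rk X 0) l u = u'"
   using u'(2) C.M.add.l_cancel unfolding free_pow[symmetric] by metis
  then show "column (rk X 0) l u \<in> bnd X ?M {\<zero>} (carrier R) 0" using u'(1) by simp
 qed
 then show ?thesis using x u(2) by blast
qed

context
 fixes F
 assumes F: "exact_complex F"
begin

lemma times_v_bnd_syzygy_iff:
 assumes x: "x \<in> vec R (rk F j)"
 shows "times_v (rk F j) x \<in> bnd X (fm R (rk F j)) (syzygy F j) (vec R (rk F j)) 0 \<longleftrightarrow>
  x \<in> rbnd R F \<mm> j"
proof
 let ?E = "fm R (rk F j)" and ?N = "syzygy F j" and ?R = "vec R (rk F j)" and ?Z = "tuples (rk F j) {\<zero>}"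
 let ?Q = "pow ?E (rk X 0)" and ?d = "cdif F (reg R) (Suc j)"
 note mat = matrices[OF res] and FM = free_mod and cs = free_sub
 note N = syzygy_submodule[OF F, of j] and ZN = zero_subset_syzygy[OF F, of j] and zs = ideal_tuples[OF zeroideal]
 interpret E: module R ?E by (rule FM)
 interpret Q: module R ?Q by (rule pow_mod[OF FM])
 note tl = linear_mapsD[OF times_v_linear[of "rk F j"]]
 have B0: "submodule (bnd X ?E ?Z ?R 0) R ?Q" by (rule bnd_submodule[OF mat FM zs cs])
 {
  assume "x \<in> rbnd R F \<mm> j"
  then obtain y m where ym: "y \<in> vec R (rk F (Suc j))" "m \<in> tuples (rk F j) \<mm>" "x = ?d y \<oplus>[?E] m"
   unfolding bnd_def free_pow[symmetric] by blast
  have mR: "m \<in> ?R" using ym(2) \<mm>_carrier by (auto simp: PiE_iff)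
  have dN: "?d y \<in> ?N" by (rule dif_syzygy[OF F ym(1)])
  have "times_v (rk F j) x = times_v (rk F j) (?d y) \<oplus>[?Q] times_v (rk F j) m"
   unfolding ym(3) by (rule tl(2)) (use submodule_carrier[OF N dN] mR in auto)
  moreover have "times_v (rk F j) (?d y) \<in> bnd X ?E ?N ?R 0"
   by (rule bnd_lower[OF mat FM N cs times_v_tuples[OF N dN]])
  moreover have "times_v (rk F j) m \<in> bnd X ?E ?N ?R 0"
   using times_v_bnd_iff[OF mR] ym(2) bnd_mono[OF mat FM ZN subset_refl] by blast
  ultimately show "times_v (rk F j) x \<in> bnd X ?E ?N ?R 0" using submodule_add[OF bnd_submodule[OF mat FM N cs]] by simp
 next
  assume "times_v (rk F j) x \<in> bnd X ?E ?N ?R 0"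
  then obtain y n where yn: "y \<in> tuples (rk X (Suc 0)) ?R" "n \<in> tuples (rk X 0) ?N"
   "times_v (rk F j) x = cdif X ?E (Suc 0) y \<oplus>[?Q] n" unfolding bnd_def by blast
  obtain n' where n': "n' \<in> tuples (rk X 0) (vec R (rk F (Suc j)))" "n = tuple_map (rk X 0) ?d n'"
   using tuples_image[OF yn(2)[unfolded syzygy_def]] by blast
  obtain t u where tu: "t \<in> vec R (rk F (Suc j))"
   "u \<in> bnd X (fm R (rk F (Suc j))) (tuples (rk F (Suc j)) {\<zero>}) (vec R (rk F (Suc j))) 0"
   "n' = times_v (rk F (Suc j)) t \<oplus>[pow (fm R (rk F (Suc j))) (rk X 0)] u"
   using times_v_onto[OF n'(1)] by blast
  have uc: "u \<in> carrier (pow (fm R (rk F (Suc j))) (rk X 0))"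
   using submodule_carrier[OF bnd_submodule[OF mat FM zs cs] tu(2)] .
  then have ut: "u \<in> tuples (rk X 0) (vec R (rk F (Suc j)))" by simp
  have "u \<in> bnd X (fm R (rk F (Suc j))) (syzygy F (Suc j)) (vec R (rk F (Suc j))) 0"
   using tu(2) bnd_mono[OF mat FM zero_subset_syzygy[OF F] subset_refl] by blast
  then have "tuple_map (rk X 0) ?d u \<in> bnd X ?E ?Z ?N 0"
   using tuple_map_bnd_iff[OF mat syzygy_iso[OF F] ut] by blast
  then have du: "tuple_map (rk X 0) ?d u \<in> bnd X ?E ?Z ?R 0"
   using bnd_mono[OF mat FM subset_refl syzygy_subset[OF F]] by blast
  have dt: "?d t \<in> ?R" using dif_syzygy[OF F tu(1)] syzygy_subset[OF F] by blast
  obtain m where m: "m \<in> carrier ?E" "x = ?d t \<oplus>[?E] m" using E.ex_diff[of x "?d t"] x dt by auto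
  have tvt: "times_v (rk F (Suc j)) t \<in> carrier (pow (fm R (rk F (Suc j))) (rk X 0))"
   using times_v_tuples[OF cs tu(1)] by simp
  have "n = tuple_map (rk X 0) ?d (times_v (rk F (Suc j)) t) \<oplus>[?Q] tuple_map (rk X 0) ?d u"
   unfolding n'(2) tu(3) by (rule linear_mapsD(2)[OF tuple_map_linear[OF dif_linear[OF F]] tvt uc])
  also have "tuple_map (rk X 0) ?d (times_v (rk F (Suc j)) t) = times_v (rk F j) (?d t)"
   by (rule times_v_natural[OF dif_linear[OF F] tu(1), symmetric])
  finally have n: "n = times_v (rk F j) (?d t) \<oplus>[?Q] tuple_map (rk X 0) ?d u" .
  have "times_v (rk F j) x = times_v (rk F j) (?d t) \<oplus>[?Q] times_v (rk F j) m"
   unfolding m(2) by (rule tl(2)) (use dt m in auto)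
  moreover have c: "times_v (rk F j) (?d t) \<in> carrier ?Q" "times_v (rk F j) m \<in> carrier ?Q" "cdif X ?E (Suc 0) y \<in> carrier ?Q"
   "tuple_map (rk X 0) ?d u \<in> carrier ?Q"
   using tl(1) dt m(1) cdif_tuples[OF mat FM cs yn(1)] submodule_carrier[OF B0 du] by simp_all
  moreover have "times_v (rk F j) x = times_v (rk F j) (?d t) \<oplus>[?Q] (cdif X ?E (Suc 0) y \<oplus>[?Q] tuple_map (rk X 0) ?d u)"
   unfolding yn(3) n using c by (simp only: Q.M.a_ac Q.M.a_closed)
  ultimately have "times_v (rk F j) m = cdif X ?E (Suc 0) y \<oplus>[?Q] tuple_map (rk X 0) ?d u"
   using Q.M.add.l_cancel Q.M.a_closed by metis
  then have "times_v (rk F j) m \<in> bnd X ?E ?Z ?R 0"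
   using bnd_image[OF mat FM zs cs yn(1)] du submodule_add[OF B0] by simp
  then have "m \<in> tuples (rk F j) \<mm>" using times_v_bnd_iff m(1) by simp
  then show "x \<in> rbnd R F \<mm> j"
   unfolding m(2) bnd_def free_pow[symmetric] using tu(1) by blast
 }
qed

lemma complex_residue: "complex_mod F (reg R) \<mm> (carrier R)"
 using complex_mod_mono[OF exact_complexD(2)[OF F], of \<mm> "carrier R"] submodule_zero[OF ideal_submodule[OF ideal_\<mm>]] by simp

lemma residue_bnd_cyc:
 shows "submodule (rbnd R F \<mm> j) R (fm R (rk F j))"
  and "submodule (rcyc R F \<mm> j) R (fm R (rk F j))"
  and "rbnd R F \<mm> j \<subseteq> rcyc R F \<mm> j"
proof -
 note FF = exact_complexD(1)[OF F] and ms = ideal_submodule[OF ideal_\<mm>] and cs = carrier_sub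
 show "submodule (rbnd R F \<mm> j) R (fm R (rk F j))"
  unfolding free_pow by (rule bnd_submodule[OF FF regular ms cs])
 show "submodule (rcyc R F \<mm> j) R (fm R (rk F j))"
  unfolding free_pow by (rule cyc_submodule[OF FF regular ms cs])
 show "rbnd R F \<mm> j \<subseteq> rcyc R F \<mm> j"
  using \<mm>_carrier by (intro bnd_subset_cyc[OF FF regular ms cs _ complex_residue]) blast
qed

lemma betti_balance_0:
 "rbetti R F \<mm> 0 =
  betti R X (fm R (rk F 0)) (syzygy F 0) (vec R (rk F 0)) 0"
 unfolding betti_def free_pow[of R "rk F 0", symmetric]
proof (rule rdim_transfer[OF free_mod _ times_v_linear residue_bnd_cyc(1,2)])
 let ?E = "fm R (rk F 0)" and ?N = "syzygy F 0" and ?R = "vec R (rk F 0)"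
 note mat = matrices[OF res] and FM = free_mod and cs = free_sub
 note N = syzygy_submodule[OF F, of 0]
 show "module R (pow ?E (rk X 0))" by (rule pow_mod[OF FM])
 show "submodule (bnd X ?E ?N ?R 0) R (pow ?E (rk X 0))" by (rule bnd_submodule[OF mat FM N cs])
 show "submodule (cyc X ?E ?N ?R 0) R (pow ?E (rk X 0))" by (rule cyc_submodule[OF mat FM N cs])
 show "bnd X ?E ?N ?R 0 \<subseteq> cyc X ?E ?N ?R 0"
  using complex_mod_mono[OF complex_free[OF res] zero_subset_syzygy[OF F] subset_refl]
  by (intro bnd_subset_cyc[OF mat FM N cs syzygy_subset[OF F]])
 fix x assume "x \<in> rcyc R F \<mm> 0"
 then have x: "x \<in> ?R" by simp
 show "times_v (rk F 0) x \<in> cyc X ?E ?N ?R 0" using times_v_tuples[OF cs x] by simp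
 show "times_v (rk F 0) x \<in> bnd X ?E ?N ?R 0 \<longleftrightarrow> x \<in> rbnd R F \<mm> 0"
  by (rule times_v_bnd_syzygy_iff[OF x])
next
 fix y assume "y \<in> cyc X (fm R (rk F 0)) (syzygy F 0) (vec R (rk F 0)) 0"
 then have "y \<in> tuples (rk X 0) (vec R (rk F 0))" by simp
 then obtain x a where "x \<in> vec R (rk F 0)"
  "a \<in> bnd X (fm R (rk F 0)) (tuples (rk F 0) {\<zero>}) (vec R (rk F 0)) 0"
  "y = times_v (rk F 0) x \<oplus>[pow (fm R (rk F 0)) (rk X 0)] a" using times_v_onto by blast
 moreover from this(2) have "a \<in> bnd X (fm R (rk F 0)) (syzygy F 0) (vec R (rk F 0)) 0"
  by (rule subsetD[OF bnd_mono[OF matrices[OF res] free_mod zero_subset_syzygy[OF F] subset_refl]])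
 ultimately show "\<exists>x\<in>rcyc R F \<mm> 0. \<exists>a\<in>bnd X (fm R (rk F 0)) (syzygy F 0) (vec R (rk F 0)) 0.
  y = times_v (rk F 0) x \<oplus>[pow (fm R (rk F 0)) (rk X 0)] a"
  unfolding cyc_0 by blast
qed (rule residue_bnd_cyc(3))

text \<open>The connecting map identifies the homology of \<open>F\<^sub>j / N\<close> in degree \<open>i + 1\<close> with a submodule of that of
 \<open>N\<close> in degree \<open>i\<close>, and with all of it if \<open>i > 0\<close>.\<close>

lemma betti_syzygy:
 "betti R X (fm R (rk F j)) (syzygy F j) (vec R (rk F j)) (Suc i) =
  rdim R (pow (fm R (rk F j)) (rk X i))
   (bnd X (fm R (rk F j)) (tuples (rk F j) {\<zero>}) (syzygy F j) i)
   {u \<in> tuples (rk X i) (syzygy F j). u \<in> bnd X (fm R (rk F j)) (tuples (rk F j) {\<zero>}) (vec R (rk F j)) i}"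
 unfolding betti_def
proof (rule rdim_transfer[OF pow_mod[OF free_mod] pow_mod[OF free_mod]
   cdif_linear[OF matrices[OF res] free_mod]])
 let ?E = "fm R (rk F j)" and ?N = "syzygy F j" and ?R = "vec R (rk F j)" and ?Z = "tuples (rk F j) {\<zero>}"
 let ?P = "pow ?E (rk X (Suc i))" and ?Q = "pow ?E (rk X i)"
 note mat = matrices[OF res] and FM = free_mod and cs = free_sub
 note N = syzygy_submodule[OF F, of j] and ZN = zero_subset_syzygy[OF F, of j] and zs = ideal_tuples[OF zeroideal]
 note NR = syzygy_subset[OF F, of j]
 interpret Q: module R ?Q by (rule pow_mod[OF FM])
 let ?B = "{u \<in> tuples (rk X i) ?N. u \<in> bnd X ?E ?Z ?R i}"
 have B0: "submodule (bnd X ?E ?Z ?R i) R ?Q" by (rule bnd_submodule[OF mat FM zs cs])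
 show "submodule (bnd X ?E ?N ?R (Suc i)) R ?P" "submodule (cyc X ?E ?N ?R (Suc i)) R ?P" "submodule (bnd X ?E ?Z ?N i) R ?Q"
  using bnd_submodule[OF mat FM] cyc_submodule[OF mat FM] N cs zs by auto
 show "submodule ?B R ?Q"
  by (rule submodule_vimage[OF Q.module_axioms Q.module_axioms id_linear submodule_tuples[OF FM N] B0])
 show "bnd X ?E ?N ?R (Suc i) \<subseteq> cyc X ?E ?N ?R (Suc i)"
  using complex_mod_mono[OF complex_free[OF res] ZN subset_refl] by (intro bnd_subset_cyc[OF mat FM N cs NR])
 show "bnd X ?E ?Z ?N i \<subseteq> ?B"
 proof
  fix z assume z: "z \<in> bnd X ?E ?Z ?N i"
  have "bnd X ?E ?Z ?N i \<subseteq> cyc X ?E ?Z ?N i"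
   using complex_mod_mono[OF complex_free[OF res] subset_refl NR] by (intro bnd_subset_cyc[OF mat FM zs N ZN])
  then have "z \<in> tuples (rk X i) ?N" using z cyc_tuples by blast
  then show "z \<in> ?B" using z bnd_mono[OF mat FM subset_refl NR] by blast
 qed
 fix z assume z: "z \<in> cyc X ?E ?N ?R (Suc i)"
 then have zt: "z \<in> tuples (rk X (Suc i)) ?R" "cdif X ?E (Suc i) z \<in> tuples (rk X i) ?N" unfolding cyc_Suc by auto
 show "cdif X ?E (Suc i) z \<in> ?B" using zt bnd_image[OF mat FM zs cs zt(1)] by blast
 show "cdif X ?E (Suc i) z \<in> bnd X ?E ?Z ?N i \<longleftrightarrow> z \<in> bnd X ?E ?N ?R (Suc i)"
 proof
  assume "cdif X ?E (Suc i) z \<in> bnd X ?E ?Z ?N i"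
  then show "z \<in> bnd X ?E ?N ?R (Suc i)" by (rule bnd_of_cdif_bnd[OF res N ZN zt(1)])
 next
  assume "z \<in> bnd X ?E ?N ?R (Suc i)"
  then obtain y n where yn: "y \<in> tuples (rk X (Suc (Suc i))) ?R" "n \<in> tuples (rk X (Suc i)) ?N"
   "z = cdif X ?E (Suc (Suc i)) y \<oplus>[?P] n" unfolding bnd_def by blast
  have "cdif X ?E (Suc i) z = cdif X ?E (Suc i) (cdif X ?E (Suc (Suc i)) y) \<oplus>[?Q] cdif X ?E (Suc i) n"
   unfolding yn(3) using cdif_tuples[OF mat FM cs yn(1)] submodule_carrier[OF submodule_tuples[OF FM N] yn(2)]
   by (intro cdif_add[OF mat FM]) simp_all
  moreover have "cdif X ?E (Suc i) (cdif X ?E (Suc (Suc i)) y) \<in> tuples (rk X i) ?Z"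
   using complex_free[OF res, of "rk F j"] yn(1) unfolding complex_mod_def by blast
  then have "cdif X ?E (Suc i) (cdif X ?E (Suc (Suc i)) y) \<in> bnd X ?E ?Z ?N i" by (rule bnd_lower[OF mat FM zs N])
  moreover have "cdif X ?E (Suc i) n \<in> bnd X ?E ?Z ?N i" by (rule bnd_image[OF mat FM zs N yn(2)])
  ultimately show "cdif X ?E (Suc i) z \<in> bnd X ?E ?Z ?N i" using submodule_add[OF bnd_submodule[OF mat FM zs N]] by simp
 qed
next
 let ?E = "fm R (rk F j)" and ?N = "syzygy F j" and ?R = "vec R (rk F j)" and ?Z = "tuples (rk F j) {\<zero>}"
 let ?Q = "pow ?E (rk X i)"
 note mat = matrices[OF res] and FM = free_mod and cs = free_sub
 note N = syzygy_submodule[OF F, of j] and ZN = zero_subset_syzygy[OF F, of j] and zs = ideal_tuples[OF zeroideal]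
 interpret Q: module R ?Q by (rule pow_mod[OF FM])
 fix u assume "u \<in> {u \<in> tuples (rk X i) ?N. u \<in> bnd X ?E ?Z ?R i}"
 then obtain z a where za: "z \<in> tuples (rk X (Suc i)) ?R" "a \<in> tuples (rk X i) ?Z" "u = cdif X ?E (Suc i) z \<oplus>[?Q] a"
  and uN: "u \<in> tuples (rk X i) ?N" unfolding bnd_def by blast
 have "a \<in> tuples (rk X i) ?N" using za(2) tuples_mono[OF ZN] by blast
 then have "cdif X ?E (Suc i) z \<in> tuples (rk X i) ?N"
  using Q.submodule_cancel2[OF submodule_tuples[OF FM N]] cdif_tuples[OF mat FM cs za(1)] uN unfolding za(3) by simp
 then have "z \<in> cyc X ?E ?N ?R (Suc i)" using za(1) unfolding cyc_Suc by blast
 moreover have "a \<in> bnd X ?E ?Z ?N i" by (rule bnd_lower[OF mat FM zs N za(2)])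
 ultimately show "\<exists>x\<in>cyc X ?E ?N ?R (Suc i). \<exists>a\<in>bnd X ?E ?Z ?N i. u = cdif X ?E (Suc i) x \<oplus>[?Q] a" using za(3) by blast
qed

lemma betti_balance_1:
 "rbetti R F \<mm> (Suc j) =
  betti R X (fm R (rk F j)) (syzygy F j) (vec R (rk F j)) (Suc 0)"
 unfolding betti_syzygy unfolding betti_def free_pow[of R "rk F (Suc j)", symmetric]
proof (rule rdim_transfer[OF free_mod _ linear_map_comp[OF dif_linear[OF F] times_v_linear] residue_bnd_cyc(1,2)])
 let ?E = "fm R (rk F j)" and ?N = "syzygy F j" and ?R = "vec R (rk F j)" and ?Z = "tuples (rk F j) {\<zero>}"
 let ?E' = "fm R (rk F (Suc j))" and ?R' = "vec R (rk F (Suc j))"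
 let ?Q = "pow ?E (rk X 0)" and ?d = "cdif F (reg R) (Suc j)"
 note mat = matrices[OF res] and FM = free_mod and cs = free_sub
 note N = syzygy_submodule[OF F, of j] and ZN = zero_subset_syzygy[OF F, of j] and zs = ideal_tuples[OF zeroideal]
 note NR = syzygy_subset[OF F, of j]
 interpret Q: module R ?Q by (rule pow_mod[OF FM])
 show "module R ?Q" by (rule Q.module_axioms)
 let ?B = "{u \<in> tuples (rk X 0) ?N. u \<in> bnd X ?E ?Z ?R 0}"
 have B0: "submodule (bnd X ?E ?Z ?R 0) R ?Q" by (rule bnd_submodule[OF mat FM zs cs])
 show A2: "submodule (bnd X ?E ?Z ?N 0) R ?Q" by (rule bnd_submodule[OF mat FM zs N])
 show "submodule ?B R ?Q"
  by (rule submodule_vimage[OF Q.module_axioms Q.module_axioms id_linear submodule_tuples[OF FM N] B0])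
 have AB: "bnd X ?E ?Z ?N 0 \<subseteq> bnd X ?E ?Z ?R 0" by (rule bnd_mono[OF mat FM subset_refl NR])
 show "bnd X ?E ?Z ?N 0 \<subseteq> ?B"
 proof
  fix z assume z: "z \<in> bnd X ?E ?Z ?N 0"
  have "bnd X ?E ?Z ?N 0 \<subseteq> cyc X ?E ?Z ?N 0"
   using complex_mod_mono[OF complex_free[OF res] subset_refl NR] by (intro bnd_subset_cyc[OF mat FM zs N ZN])
  then have "z \<in> tuples (rk X 0) ?N" using z cyc_tuples by blast
  then show "z \<in> ?B" using z AB by blast
 qed
 show "rbnd R F \<mm> (Suc j) \<subseteq> rcyc R F \<mm> (Suc j)" by (rule residue_bnd_cyc(3))
 have key: "times_v (rk F j) (?d x) \<in> bnd X ?E ?Z ?N 0 \<longleftrightarrow> x \<in> rbnd R F \<mm> (Suc j)" if x: "x \<in> ?R'" for x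
  unfolding times_v_natural[OF dif_linear[OF F] x]
  using tuple_map_bnd_iff[OF mat syzygy_iso[OF F] times_v_tuples[OF cs x]] times_v_bnd_syzygy_iff[OF x] by blast
 {
  fix x assume "x \<in> rcyc R F \<mm> (Suc j)"
  then have x: "x \<in> ?R'" "?d x \<in> tuples (rk F j) \<mm>" unfolding cyc_Suc by auto
  have dx: "?d x \<in> ?N" by (rule dif_syzygy[OF F x(1)])
  have "?d x \<in> ?R" using dx NR by blast
  then show "times_v (rk F j) (?d x) \<in> ?B" using times_v_tuples[OF N dx] times_v_bnd_iff x(2) by blast
  show "times_v (rk F j) (?d x) \<in> bnd X ?E ?Z ?N 0 \<longleftrightarrow> x \<in> rbnd R F \<mm> (Suc j)" by (rule key[OF x(1)])
 }
 fix u assume u: "u \<in> ?B"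
 then have "u \<in> tuples (rk X 0) (?d ` ?R')" unfolding syzygy_def by blast
 then obtain z where z: "z \<in> tuples (rk X 0) ?R'" "u = tuple_map (rk X 0) ?d z" by (rule tuples_image)
 obtain x a where xa: "x \<in> ?R'" "a \<in> bnd X ?E' (tuples (rk F (Suc j)) {\<zero>}) ?R' 0"
  "z = times_v (rk F (Suc j)) x \<oplus>[pow ?E' (rk X 0)] a" using times_v_onto[OF z(1)] by blast
 have ac: "a \<in> carrier (pow ?E' (rk X 0))" using submodule_carrier[OF bnd_submodule[OF mat FM zs cs] xa(2)] .
 then have at: "a \<in> tuples (rk X 0) ?R'" by simp
 have "a \<in> bnd X ?E' (syzygy F (Suc j)) ?R' 0" using xa(2) bnd_mono[OF mat FM zero_subset_syzygy[OF F] subset_refl] by blast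
 then have da: "tuple_map (rk X 0) ?d a \<in> bnd X ?E ?Z ?N 0" using tuple_map_bnd_iff[OF mat syzygy_iso[OF F] at] by blast
 have tvx: "times_v (rk F (Suc j)) x \<in> carrier (pow ?E' (rk X 0))" using times_v_tuples[OF cs xa(1)] by simp
 have e: "u = times_v (rk F j) (?d x) \<oplus>[?Q] tuple_map (rk X 0) ?d a"
  unfolding z(2) xa(3) times_v_natural[OF dif_linear[OF F] xa(1)]
  by (rule linear_mapsD(2)[OF tuple_map_linear[OF dif_linear[OF F]] tvx ac])
 have dx: "?d x \<in> ?R" using dif_syzygy[OF F xa(1)] NR by blast
 have "times_v (rk F j) (?d x) \<in> carrier ?Q" using times_v_tuples[OF cs dx] by simp
 then have "times_v (rk F j) (?d x) \<in> bnd X ?E ?Z ?R 0"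
  using Q.submodule_cancel2[OF B0 subsetD[OF AB da]] u unfolding e by blast
 then have "?d x \<in> tuples (rk F j) \<mm>" using times_v_bnd_iff[OF dx] by blast
 then have "x \<in> rcyc R F \<mm> (Suc j)" using xa(1) unfolding cyc_Suc by blast
 then show "\<exists>x\<in>rcyc R F \<mm> (Suc j). \<exists>a\<in>bnd X ?E ?Z ?N 0. u = times_v (rk F j) (?d x) \<oplus>[?Q] a"
  using da e by blast
qed

lemma betti_syzygy_step:
 "betti R X (fm R (rk F j)) (syzygy F j) (vec R (rk F j)) (Suc (Suc i)) =
  betti R X (fm R (rk F (Suc j))) (syzygy F (Suc j)) (vec R (rk F (Suc j))) (Suc i)"
proof -
 let ?E = "fm R (rk F j)" and ?N = "syzygy F j" and ?R = "vec R (rk F j)" and ?Z = "tuples (rk F j) {\<zero>}"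
 note mat = matrices[OF res] and FM = free_mod and cs = free_sub
 note N = syzygy_submodule[OF F, of j] and zs = ideal_tuples[OF zeroideal]
 note NR = syzygy_subset[OF F, of j] and ZN = zero_subset_syzygy[OF F]
 have ZR: "?Z \<subseteq> ?R" by (intro tuples_mono) auto
 have "{u \<in> tuples (rk X (Suc i)) ?N. u \<in> bnd X ?E ?Z ?R (Suc i)} = cyc X ?E ?Z ?N (Suc i)"
 proof (intro equalityI subsetI)
  fix u assume u: "u \<in> {u \<in> tuples (rk X (Suc i)) ?N. u \<in> bnd X ?E ?Z ?R (Suc i)}"
  have "bnd X ?E ?Z ?R (Suc i) \<subseteq> cyc X ?E ?Z ?R (Suc i)"
   by (rule bnd_subset_cyc[OF mat FM zs cs ZR complex_free[OF res]])
  then show "u \<in> cyc X ?E ?Z ?N (Suc i)" using u unfolding cyc_Suc by blast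
 next
  fix u assume u: "u \<in> cyc X ?E ?Z ?N (Suc i)"
  then have "u \<in> cyc X ?E ?Z ?R (Suc i)" using tuples_mono[OF NR, of "rk X (Suc i)"] unfolding cyc_Suc by blast
  then show "u \<in> {u \<in> tuples (rk X (Suc i)) ?N. u \<in> bnd X ?E ?Z ?R (Suc i)}"
   using exact_free[OF res] cyc_tuples[OF u] by blast
 qed
 then have "betti R X ?E ?N ?R (Suc (Suc i)) = betti R X ?E ?Z ?N (Suc i)"
  unfolding betti_syzygy unfolding betti_def by simp
 also have "\<dots> = betti R X (fm R (rk F (Suc j))) (syzygy F (Suc j)) (vec R (rk F (Suc j))) (Suc i)"
 proof (rule betti_transfer[OF mat syzygy_iso[OF F], symmetric])
  show "complex_mod X (fm R (rk F (Suc j))) (syzygy F (Suc j)) (vec R (rk F (Suc j)))"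
   by (rule complex_mod_mono[OF complex_free[OF res] ZN subset_refl])
  show "complex_mod X ?E ?Z ?N" by (rule complex_mod_mono[OF complex_free[OF res] subset_refl NR])
 qed
 finally show ?thesis .
qed

lemma betti_balance_syzygy:
 "rbetti R F \<mm> (j + Suc i) =
  betti R X (fm R (rk F j)) (syzygy F j) (vec R (rk F j)) (Suc i)"
proof (induction i arbitrary: j)
 case 0 then show ?case using betti_balance_1 by simp
next
 case (Suc i) then show ?case using betti_syzygy_step[of j i] Suc.IH[of "Suc j"] by simp
qed

text \<open>Tor can be computed from a resolution of either argument.\<close>

theorem betti_balance:
 assumes J: "ideal J R" and e: "e \<in> linear_maps R (fm R (rk F 0)) (reg R)"
  and ker: "\<And>x. x \<in> vec R (rk F 0) ==> e x \<in> J \<longleftrightarrow> x \<in> syzygy F 0"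
  and surj: "\<And>r. r \<in> carrier R ==> \<exists>x\<in>vec R (rk F 0). \<exists>a\<in>J. r = e x \<oplus> a"
 shows "rbetti R F \<mm> i = rbetti R X J i"
proof -
 have "rbetti R F \<mm> i =
  betti R X (fm R (rk F 0)) (syzygy F 0) (vec R (rk F 0)) i"
  using betti_balance_0 betti_balance_syzygy[of 0] by (cases i) auto
 also have "\<dots> = rbetti R X J i"
 proof (rule betti_transfer[OF matrices[OF res] free_mod regular e syzygy_submodule[OF F] free_sub
    ideal_submodule[OF J] carrier_sub syzygy_subset[OF F]])
  show "J \<subseteq> carrier R" using ideal.Icarr[OF J] by blast
  show "complex_mod X (fm R (rk F 0)) (syzygy F 0) (vec R (rk F 0))"
   by (rule complex_mod_mono[OF complex_free[OF res] zero_subset_syzygy[OF F] subset_refl])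
  show "complex_mod X (reg R) J (carrier R)"
   by (rule complex_mod_mono[OF complex[OF res] _ subset_refl]) (use submodule_zero[OF ideal_submodule[OF J]] in simp)
  show "e x \<in> carrier R" if "x \<in> vec R (rk F 0)" for x using linear_mapsD(1)[OF e] that by simp
  show "\<exists>x\<in>vec R (rk F 0). \<exists>a\<in>J. b = e x \<oplus>[reg R] a" if "b \<in> carrier R" for b
   using surj[OF that] by simp
 qed (rule ker)
 finally show ?thesis .
qed

end

end

end

section \<open>Homology modules as quotients\<close>

text \<open>Computation in a quotient module with representatives; cosets of \<open>Z / N\<close> are cosets in the ambient module \<open>M\<close>.\<close>

lemma quot_module_facts:
 fixes M :: "('a, 'm) module"
 assumes M: "module R M" and Z: "submodule Z R M" and N: "submodule N R M" and NZ: "N \<subseteq> Z"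
 defines "Q \<equiv> quot_module (M\<lparr>carrier := Z\<rparr>) N"
 shows "carrier Q = (\<lambda>x. N +>\<^bsub>M\<^esub> x) ` Z" and "\<zero>[Q] = N"
  and "\<And>x y. x \<in> Z ==> y \<in> Z ==> (N +>\<^bsub>M\<^esub> x) \<oplus>[Q] (N +>\<^bsub>M\<^esub> y) = N +>\<^bsub>M\<^esub> (x \<oplus>[M] y)"
  and "\<And>r x. r \<in> carrier R ==> x \<in> Z ==> r \<odot>[Q] (N +>\<^bsub>M\<^esub> x) = N +>\<^bsub>M\<^esub> (r \<odot>[M] x)"
  and "\<And>x y. x \<in> Z ==> y \<in> Z ==> N +>\<^bsub>M\<^esub> x = N +>\<^bsub>M\<^esub> y \<longleftrightarrow> (\<exists>n\<in>N. x = y \<oplus>[M] n)"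
  and "\<And>x. x \<in> N ==> N +>\<^bsub>M\<^esub> x = N"
proof -
 interpret M: module R M by fact
 note Zc = submodule_carrier[OF Z] and Nc = submodule_carrier[OF N]
 have coset: "N +>\<^bsub>M\<^esub> x = {n \<oplus>[M] x | n. n \<in> N}" for x unfolding a_r_coset_def' by auto
 have coset': "N +>\<^bsub>M\<lparr>carrier := Z\<rparr>\<^esub> x = N +>\<^bsub>M\<^esub> x" for x unfolding a_r_coset_def' by simp
 show "carrier Q = (\<lambda>x. N +>\<^bsub>M\<^esub> x) ` Z"
  unfolding Q_def quot_module_def A_RCOSETS_def' a_r_coset_def' by auto
 show "\<zero>[Q] = N" unfolding Q_def quot_module_def by simp
 show eq: "N +>\<^bsub>M\<^esub> x = N +>\<^bsub>M\<^esub> y \<longleftrightarrow> (\<exists>n\<in>N. x = y \<oplus>[M] n)" if xy: "x \<in> Z" "y \<in> Z" for x y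
 proof
  assume "N +>\<^bsub>M\<^esub> x = N +>\<^bsub>M\<^esub> y"
  moreover have "x \<in> N +>\<^bsub>M\<^esub> x" unfolding coset using submodule_zero[OF N] Zc[OF xy(1)] by force
  ultimately obtain n where "n \<in> N" "x = n \<oplus>[M] y" unfolding coset by auto
  then show "\<exists>n\<in>N. x = y \<oplus>[M] n" using Nc Zc[OF xy(2)] M.M.a_comm by metis
 next
  assume "\<exists>n\<in>N. x = y \<oplus>[M] n"
  then obtain n where n: "n \<in> N" "x = y \<oplus>[M] n" by auto
  note yc = Zc[OF xy(2)]
  have "m \<oplus>[M] x = (m \<oplus>[M] n) \<oplus>[M] y" if "m \<in> N" for m
   unfolding n(2) using yc Nc[OF n(1)] Nc[OF that] by (simp add: M.M.a_ac)
  moreover have "m \<oplus>[M] y = (m \<oplus>[M] \<ominus>\<^bsub>M\<^esub> n) \<oplus>[M] x" if "m \<in> N" for m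
  proof -
   have "(m \<oplus>[M] \<ominus>\<^bsub>M\<^esub> n) \<oplus>[M] x = m \<oplus>[M] (\<ominus>\<^bsub>M\<^esub> n \<oplus>[M] (n \<oplus>[M] y))"
    unfolding n(2) using yc Nc[OF n(1)] Nc[OF that] by (simp add: M.M.a_assoc M.M.a_comm[of y])
   also have "\<dots> = m \<oplus>[M] y" using yc Nc[OF n(1)] by (simp add: M.M.r_neg1)
   finally show ?thesis by simp
  qed
  moreover have "m \<oplus>[M] n \<in> N" "m \<oplus>[M] \<ominus>\<^bsub>M\<^esub> n \<in> N" if "m \<in> N" for m
   using submodule_add[OF N that] submodule_neg[OF N] n(1) by simp_all
  ultimately show "N +>\<^bsub>M\<^esub> x = N +>\<^bsub>M\<^esub> y"
   unfolding coset by (intro equalityI subsetI; elim CollectE exE conjE; intro CollectI; metis)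
 qed
 show "N +>\<^bsub>M\<^esub> x = N" if x: "x \<in> N" for x
 proof -
  have "\<zero>[M] \<in> Z" "x \<in> Z" using submodule_zero[OF Z] x NZ by auto
  then have "N +>\<^bsub>M\<^esub> x = N +>\<^bsub>M\<^esub> \<zero>[M]" using eq[of x "\<zero>[M]"] x Nc by auto
  also have "\<dots> = (\<lambda>n. n) ` N"
   unfolding coset Setcompr_eq_image using Nc by (intro image_cong) simp_all
  also have "\<dots> = N" by simp
  finally show ?thesis .
 qed
 show "(N +>\<^bsub>M\<^esub> x) \<oplus>[Q] (N +>\<^bsub>M\<^esub> y) = N +>\<^bsub>M\<^esub> (x \<oplus>[M] y)" if xy: "x \<in> Z" "y \<in> Z" for x y
 proof -
  note xc = Zc[OF xy(1)] and yc = Zc[OF xy(2)]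
  have Qadd: "(N +>\<^bsub>M\<^esub> x) \<oplus>[Q] (N +>\<^bsub>M\<^esub> y) = {a \<oplus>[M] b | a b. a \<in> N +>\<^bsub>M\<^esub> x \<and> b \<in> N +>\<^bsub>M\<^esub> y}"
   unfolding Q_def quot_module_def set_add_def' by auto
  have 1: "(m \<oplus>[M] x) \<oplus>[M] (n \<oplus>[M] y) = (m \<oplus>[M] n) \<oplus>[M] (x \<oplus>[M] y)" if "m \<in> N" "n \<in> N" for m n
   using xc yc Nc[OF that(1)] Nc[OF that(2)] by (simp add: M.M.a_ac)
  have 2: "n \<oplus>[M] (x \<oplus>[M] y) = (n \<oplus>[M] x) \<oplus>[M] (\<zero>[M] \<oplus>[M] y)" if "n \<in> N" for n
   using xc yc Nc[OF that] by (simp add: M.M.a_assoc)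
  show ?thesis
  proof (intro equalityI subsetI)
   fix z assume "z \<in> (N +>\<^bsub>M\<^esub> x) \<oplus>[Q] (N +>\<^bsub>M\<^esub> y)"
   then obtain m n where "m \<in> N" "n \<in> N" "z = (m \<oplus>[M] x) \<oplus>[M] (n \<oplus>[M] y)" unfolding Qadd unfolding coset by auto
   then show "z \<in> N +>\<^bsub>M\<^esub> (x \<oplus>[M] y)" unfolding coset using 1 submodule_add[OF N] by blast
  next
   fix z assume "z \<in> N +>\<^bsub>M\<^esub> (x \<oplus>[M] y)"
   then obtain n where "n \<in> N" "z = n \<oplus>[M] (x \<oplus>[M] y)" unfolding coset by auto
   then show "z \<in> (N +>\<^bsub>M\<^esub> x) \<oplus>[Q] (N +>\<^bsub>M\<^esub> y)" unfolding Qadd unfolding coset using 2 submodule_zero[OF N] by blast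
  qed
 qed
 show "r \<odot>[Q] (N +>\<^bsub>M\<^esub> x) = N +>\<^bsub>M\<^esub> (r \<odot>[M] x)" if r: "r \<in> carrier R" and x: "x \<in> Z" for r x
 proof -
  have "r \<odot>[Q] (N +>\<^bsub>M\<^esub> x) = (\<Union>y\<in>N +>\<^bsub>M\<^esub> x. N +>\<^bsub>M\<^esub> (r \<odot>[M] y))"
   unfolding Q_def quot_module_def coset' by (simp add: coset')
  moreover have "N +>\<^bsub>M\<^esub> (r \<odot>[M] y) = N +>\<^bsub>M\<^esub> (r \<odot>[M] x)" if y: "y \<in> N +>\<^bsub>M\<^esub> x" for y
  proof -
   obtain n where n: "n \<in> N" "y = n \<oplus>[M] x" using y unfolding coset by auto
   have "r \<odot>[M] y = r \<odot>[M] x \<oplus>[M] r \<odot>[M] n"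
    unfolding n(2) using r Nc[OF n(1)] Zc[OF x] by (simp add: M.smult_r_distr M.M.a_comm)
   moreover have "y \<in> Z" unfolding n(2) using n(1) NZ x submodule_add[OF Z] by blast
   ultimately show ?thesis using eq[of "r \<odot>[M] y" "r \<odot>[M] x"] submodule_smult[OF Z r] submodule_smult[OF N r n(1)] x by blast
  qed
  moreover have "x \<in> N +>\<^bsub>M\<^esub> x" unfolding coset using submodule_zero[OF N] Zc[OF x] by force
  ultimately show ?thesis by blast
 qed
qed

lemma coset_map_eq:
 assumes "X \<noteq> {}" "\<And>x. x \<in> X ==> N +>\<^bsub>C\<^esub> f x = Y"
 shows "coset_map C N f X = Y"
proof -
 have "(\<lambda>x. N +>\<^bsub>C\<^esub> f x) ` X = {Y}" using assms by auto
 then show ?thesis unfolding coset_map_def by simp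
qed

section \<open>Restriction of scalars\<close>

lemma ring_as_module_simps [simp]:
 "carrier (ring_as_module S f) = carrier S" "\<zero>[ring_as_module S f] = \<zero>[S]"
 "x \<oplus>[ring_as_module S f] y = x \<oplus>[S] y" "r \<odot>[ring_as_module S f] x = f r \<otimes>\<^bsub>S\<^esub> x"
 unfolding ring_as_module_def by auto

lemma ring_as_module_module:
 assumes R: "cring R" and S: "cring S" and f: "f \<in> ring_hom R S"
 shows "module R (ring_as_module S f)"
proof -
 interpret R: cring R by (rule R)
 interpret S: cring S by (rule S)
 show ?thesis
 proof (rule moduleI[OF R])
  show "abelian_group (ring_as_module S f)"
  proof (rule abelian_groupI)
   fix x assume "x \<in> carrier (ring_as_module S f)"
   then show "\<exists>y\<in>carrier (ring_as_module S f). y \<oplus>[ring_as_module S f] x = \<zero>[ring_as_module S f]"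
    by (auto intro!: bexI[of _ "\<ominus>\<^bsub>S\<^esub> x"] simp: S.l_neg)
  qed (auto simp: S.a_ac)
 qed (use ring_hom_closed[OF f] ring_hom_add[OF f] ring_hom_mult[OF f] ring_hom_one[OF f] in
   \<open>auto simp: S.l_distr S.r_distr S.m_assoc\<close>)
qed

lemma mat_apply_restrict:
 fixes S :: "('c, 's) ring_scheme"
 assumes "\<And>r c. r < p ==> c < q ==> B r c = f (A r c)" "cring S"
  and "\<And>r c. r < p ==> c < q ==> B r c \<in> carrier S" "x \<in> tuples q (carrier S)"
 shows "mat_apply S p q B x = matrix_map (ring_as_module S f) p q A x"
proof -
 interpret S: cring S by fact
 have "finsum (ring_as_module S f) g I = finsum S g I" for g :: "nat => 'c" and I
  unfolding finsum_def ring_as_module_def by (simp add: finprod_def)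
 moreover have "(\<Oplus>\<^bsub>S\<^esub>c\<in>{..<q}. B r c \<otimes>\<^bsub>S\<^esub> x c) = (\<Oplus>\<^bsub>S\<^esub>c\<in>{..<q}. f (A r c) \<otimes>\<^bsub>S\<^esub> x c)" if "r < p" for r
  using assms(1,3)[OF that] tuples_mem[OF assms(4)] by (intro S.finsum_cong') auto
 ultimately show ?thesis unfolding mat_apply_def matrix_map_def by (intro restrict_ext) simp
qed

lemma ring_hom_linear: "f \<in> ring_hom R S ==> f \<in> linear_maps R (reg R) (ring_as_module S f)"
 by (rule linear_mapsI) (auto simp: ring_hom_closed ring_hom_add ring_hom_mult)

text \<open>Matrices commute with the reduction of scalars.\<close>

lemma mat_apply_tuple_map:
 assumes R: "cring R" and S: "cring S" and f: "f \<in> ring_hom R S"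
  and AB: "\<And>r c. r < p ==> c < q ==> A r c \<in> carrier R" "\<And>r c. r < p ==> c < q ==> B r c = f (A r c)"
  and x: "x \<in> vec R q"
 shows "mat_apply S p q B (tuple_map q f x) = tuple_map p f (matrix_map (reg R) p q A x)"
proof -
 have "mat_apply S p q B (tuple_map q f x) = matrix_map (ring_as_module S f) p q A (tuple_map q f x)"
  using AB ring_hom_closed[OF f] tuple_map_tuples[OF ring_hom_closed[OF f] x]
  by (intro mat_apply_restrict S) auto
 also have "\<dots> = tuple_map p f (matrix_map (reg R) p q A x)"
  using x by (intro matrix_map_tuple_map[OF regular_module_module[OF R] ring_as_module_module[OF R S f] ring_hom_linear[OF f] AB(1)]) auto
 finally show ?thesis .
qed

section \<open>Vector spaces over the residue field\<close>

context local_noetherian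
begin

lemma rdim_residue_power: "rdim R (fm R n) (tuples n \<mm>) (vec R n) = n"
proof -
 have "rdim R (fm R n) (tuples n \<mm>) (vec R n) = n * rdim R (reg R) \<mm> (carrier R)"
  unfolding free_pow
  using \<mm>_carrier ideal.I_r_closed[OF ideal_\<mm>]
  by (intro rdim_power[OF local_noetherian_axioms regular_noetherian ideal_submodule[OF ideal_\<mm>] carrier_sub]) auto
 then show ?thesis unfolding rdim_residue by simp
qed

context
 fixes l :: "('l, 'k) ring_scheme" and \<rho>
 assumes l: "cring l" and \<rho>: "\<rho> \<in> ring_hom R l" and \<rho>_surj: "\<rho> ` carrier R = carrier l"
  and \<rho>_ker: "\<And>r. r \<in> carrier R ==> \<rho> r = \<zero>[l] \<longleftrightarrow> r \<in> \<mm>"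
begin

interpretation l: cring l by (rule l)

lemma \<rho>_tuples_surj:
 assumes "x \<in> tuples n (carrier l)"
 obtains r where "r \<in> vec R n" "tuple_map n \<rho> r = x"
proof -
 have "x \<in> tuples n (\<rho> ` carrier R)" using assms unfolding \<rho>_surj .
 then obtain r where "r \<in> vec R n" "x = tuple_map n \<rho> r" by (rule tuples_image)
 then show ?thesis using that by simp
qed

lemma \<rho>_eq_iff:
 assumes "r \<in> carrier R" "s \<in> carrier R"
 shows "\<rho> (r \<oplus> s) = \<rho> r \<longleftrightarrow> s \<in> \<mm>"
proof -
 note c = ring_hom_closed[OF \<rho> assms(1)] ring_hom_closed[OF \<rho> assms(2)]
 have "\<rho> r \<oplus>[l] \<rho> s = \<rho> r \<oplus>[l] \<zero>[l] \<longleftrightarrow> \<rho> s = \<zero>[l]"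
  using l.add.l_cancel[OF _ c(2) l.zero_closed c(1)] by (intro iffI) simp_all
 then show ?thesis using ring_hom_add[OF \<rho> assms] c \<rho>_ker[OF assms(2)] by simp
qed

lemma tuple_map_\<rho>_eq_iff:
 assumes r: "r \<in> vec R n" and s: "s \<in> vec R n"
 shows "tuple_map n \<rho> (r \<oplus>[fm R n] s) = tuple_map n \<rho> r \<longleftrightarrow> s \<in> tuples n \<mm>"
proof -
 have "tuple_map n \<rho> (r \<oplus>[fm R n] s) = tuple_map n \<rho> r \<longleftrightarrow> (\<forall>j<n. \<rho> (r j \<oplus> s j) = \<rho> (r j))"
  unfolding tuple_map_def fun_eq_iff by (auto simp: restrict_def)
 also have "\<dots> \<longleftrightarrow> (\<forall>j<n. s j \<in> \<mm>)" using \<rho>_eq_iff[OF tuples_mem[OF r] tuples_mem[OF s]] by simp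
 also have "\<dots> \<longleftrightarrow> s \<in> tuples n \<mm>" using s by (auto simp: PiE_iff)
 finally show ?thesis .
qed

text \<open>A vector space over the residue field given as a quotient \<open>B / A\<close> has as dimension the relative
 dimension.  A basis yields a linear map from \<open>R\<^sup>n\<close> to \<open>B\<close> under which \<open>A\<close> pulls back to \<open>\<mm>R\<^sup>n\<close>.\<close>

lemma vdim_eq_rdim:
 fixes V :: "('l, 'w) module" and M :: "('a, 'm) module"
 assumes M: "noetherian_module R M" and A: "submodule A R M" and B: "submodule B R M" and AB: "A \<subseteq> B"
  and mB: "\<And>r x. r \<in> \<mm> ==> x \<in> B ==> r \<odot>[M] x \<in> A"
  and q_surj: "q ` B = carrier V"
  and q_add: "\<And>x y. x \<in> B ==> y \<in> B ==> q (x \<oplus>[M] y) = q x \<oplus>[V] q y"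
  and q_smult: "\<And>r x. r \<in> carrier R ==> x \<in> B ==> q (r \<odot>[M] x) = \<rho> r \<odot>[V] q x"
  and q_eq: "\<And>x y. x \<in> B ==> y \<in> B ==> q x = q y \<longleftrightarrow> (\<exists>a\<in>A. x = y \<oplus>[M] a)"
 shows "vdim l V = rdim R M A B"
proof -
 have MM: "module R M" using M unfolding noetherian_module_def by auto
 interpret M: module R M by (rule MM)
 note Ac = submodule_carrier[OF A] and Bc = submodule_carrier[OF B]
 have ex: "\<exists>h\<in>linear_maps l (fm l (rdim R M A B)) V. bij_betw h (carrier (fm l (rdim R M A B))) (carrier V)"
 proof -
  obtain n g where n: "n = rdim R M A B" and g0: "g \<in> linear_maps R (fm R n) M"
   "\<forall>x\<in>vec R n. g x \<in> B" "\<forall>b\<in>B. \<exists>x\<in>vec R n. \<exists>a\<in>A. b = g x \<oplus>[M] a"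
   "\<forall>x\<in>vec R n. g x \<in> A \<longrightarrow> x \<in> tuples n \<mm>"
   using minimal_generators[OF M A B AB] by blast
  note g = g0(1) g0(2-4)[rule_format]
  interpret F: module R "fm R n" by (rule free_mod)
  have gm: "g x \<in> A" if "x \<in> tuples n \<mm>" for x
  proof -
   have xc: "x \<in> vec R n" using that \<mm>_carrier by (auto simp: PiE_iff)
   have "g x = lin_comb M n (\<lambda>j. g (unit_vector R n j)) x" by (rule linear_map_free_eq[OF MM g(1) xc])
   also have "\<dots> \<in> A" unfolding lin_comb_def
    using mB[OF tuples_mem[OF that] g(2)[OF unit_vector_tuples]] by (intro M.submodule_finsum[OF A]) auto
   finally show ?thesis .
  qed
  have qg: "q (g x) = q (g y) \<longleftrightarrow> tuple_map n \<rho> x = tuple_map n \<rho> y"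
   if x: "x \<in> vec R n" and y: "y \<in> vec R n" for x y
  proof -
   obtain d where d: "d \<in> vec R n" "x = y \<oplus>[fm R n] d"
    using F.ex_diff[of x y] x y by auto
   have "g x = g y \<oplus>[M] g d" unfolding d(2) using y d(1) by (intro linear_mapsD(2)[OF g(1)]) auto
   then have "q (g x) = q (g y) \<longleftrightarrow> g d \<in> A"
    using q_eq[OF g(2)[OF x] g(2)[OF y]] Ac Bc[OF g(2)[OF y]] Bc[OF g(2)[OF d(1)]] M.M.add.l_cancel by metis
   also have "\<dots> \<longleftrightarrow> d \<in> tuples n \<mm>" using gm g(4)[OF d(1)] by blast
   also have "\<dots> \<longleftrightarrow> tuple_map n \<rho> x = tuple_map n \<rho> y" unfolding d(2) using tuple_map_\<rho>_eq_iff[OF y d(1)] by simp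
   finally show ?thesis .
  qed
  define lift where "lift x = (SOME r. r \<in> vec R n \<and> tuple_map n \<rho> r = x)" for x
  have lift: "lift x \<in> vec R n" "tuple_map n \<rho> (lift x) = x" if "x \<in> tuples n (carrier l)" for x
   using someI_ex[of "\<lambda>r. r \<in> vec R n \<and> tuple_map n \<rho> r = x"] \<rho>_tuples_surj[OF that] unfolding lift_def by metis+
  define h where "h x = q (g (lift x))" for x
  have h: "h (tuple_map n \<rho> r) = q (g r)" if r: "r \<in> vec R n" for r
  proof -
   have "tuple_map n \<rho> r \<in> tuples n (carrier l)" using tuple_map_tuples[OF ring_hom_closed[OF \<rho>] r] .
   then show ?thesis unfolding h_def using qg[OF lift(1) r] lift(2) by simp
  qed
  have "h \<in> linear_maps l (fm l n) V"
  proof (rule linear_mapsI)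
   fix x assume "x \<in> carrier (fm l n)"
   then show "h x \<in> carrier V" unfolding h_def using g(2)[OF lift(1)] q_surj by auto
  next
   fix x y assume "x \<in> carrier (fm l n)" "y \<in> carrier (fm l n)"
   then have xy: "x \<in> tuples n (carrier l)" "y \<in> tuples n (carrier l)" by auto
   note lx = lift[OF xy(1)] and ly = lift[OF xy(2)]
   have s: "lift x \<oplus>[fm R n] lift y \<in> vec R n" using lx(1) ly(1) F.M.a_closed[of "lift x" "lift y"] by simp
   have e: "tuple_map n \<rho> (lift x \<oplus>[fm R n] lift y) = x \<oplus>[fm l n] y"
   proof -
    have "tuple_map n \<rho> (lift x \<oplus>[fm R n] lift y) = tuple_map n \<rho> (lift x) \<oplus>[fm l n] tuple_map n \<rho> (lift y)"
     unfolding tuple_map_def using ring_hom_add[OF \<rho> tuples_mem[OF lx(1)] tuples_mem[OF ly(1)]] by (auto intro!: restrict_ext)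
    then show ?thesis using lx(2) ly(2) by simp
   qed
   have "h (x \<oplus>[fm l n] y) = q (g (lift x \<oplus>[fm R n] lift y))" unfolding e[symmetric] by (rule h[OF s])
   also have "\<dots> = q (g (lift x) \<oplus>[M] g (lift y))" using linear_mapsD(2)[OF g(1), of "lift x" "lift y"] lx ly by simp
   also have "\<dots> = h x \<oplus>[V] h y" unfolding h_def by (rule q_add[OF g(2)[OF lx(1)] g(2)[OF ly(1)]])
   finally show "h (x \<oplus>[fm l n] y) = h x \<oplus>[V] h y" .
  next
   fix k x assume k: "k \<in> carrier l" and "x \<in> carrier (fm l n)"
   then have x: "x \<in> tuples n (carrier l)" by auto
   note lx = lift[OF x]
   obtain r where r: "r \<in> carrier R" "\<rho> r = k" using k unfolding \<rho>_surj[symmetric] by blast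
   have s: "r \<odot>[fm R n] lift x \<in> vec R n" using r(1) lx(1) F.smult_closed[of r "lift x"] by simp
   have e: "tuple_map n \<rho> (r \<odot>[fm R n] lift x) = k \<odot>[fm l n] x"
   proof -
    have "tuple_map n \<rho> (r \<odot>[fm R n] lift x) = k \<odot>[fm l n] tuple_map n \<rho> (lift x)"
     unfolding tuple_map_def using ring_hom_mult[OF \<rho> r(1) tuples_mem[OF lx(1)]] r(2) by (auto intro!: restrict_ext)
    then show ?thesis using lx(2) by simp
   qed
   have "h (k \<odot>[fm l n] x) = q (g (r \<odot>[fm R n] lift x))" unfolding e[symmetric] by (rule h[OF s])
   also have "\<dots> = q (r \<odot>[M] g (lift x))" using linear_mapsD(3)[OF g(1) r(1), of "lift x"] lx by simp
   also have "\<dots> = k \<odot>[V] h x" unfolding h_def using q_smult[OF r(1) g(2)[OF lx(1)]] r(2) by simp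
   finally show "h (k \<odot>[fm l n] x) = k \<odot>[V] h x" .
  qed
  moreover have "bij_betw h (tuples n (carrier l)) (carrier V)"
   unfolding bij_betw_def
  proof
   show "inj_on h (tuples n (carrier l))"
   proof (rule inj_onI)
    fix x y assume x: "x \<in> tuples n (carrier l)" and y: "y \<in> tuples n (carrier l)" and "h x = h y"
    then have "tuple_map n \<rho> (lift x) = tuple_map n \<rho> (lift y)" unfolding h_def using qg[OF lift(1)[OF x] lift(1)[OF y]] by simp
    then show "x = y" using lift(2)[OF x] lift(2)[OF y] by simp
   qed
   have "v \<in> h ` tuples n (carrier l)" if v: "v \<in> carrier V" for v
   proof -
    obtain b where b: "b \<in> B" "v = q b" using v q_surj by auto
    obtain x a where x: "x \<in> vec R n" "a \<in> A" "b = g x \<oplus>[M] a" using g(3)[OF b(1)] by blast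
    have "q b = q (g x)" using q_eq[OF b(1) g(2)[OF x(1)]] x by blast
    then have "v = h (tuple_map n \<rho> x)" using h[OF x(1)] b by simp
    then show ?thesis using imageI[OF tuple_map_tuples[OF ring_hom_closed[OF \<rho>] x(1)]] by simp
   qed
   moreover have "h x \<in> carrier V" if "x \<in> tuples n (carrier l)" for x
    unfolding h_def using g(2)[OF lift(1)[OF that]] q_surj by auto
   ultimately show "h ` tuples n (carrier l) = carrier V" by blast
  qed
  ultimately show ?thesis unfolding n by auto
 qed
 have un: "m = rdim R M A B"
  if ex_h: "\<exists>h\<in>linear_maps l (fm l m) V. bij_betw h (carrier (fm l m)) (carrier V)" for m
 proof -
  obtain h where h: "h \<in> linear_maps l (fm l m) V" "bij_betw h (tuples m (carrier l)) (carrier V)" using ex_h by auto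
  let ?MB = "M\<lparr>carrier := B\<rparr>" and ?L = "pow (ring_as_module l \<rho>) m"
  have MB: "module R ?MB" using submodule.submodule_is_module[OF B MM] .
  have L: "module R ?L" by (rule pow_mod[OF ring_as_module_module[OF is_cring l \<rho>]])
  interpret L: module R ?L by (rule L)
  interpret Fl: module l "fm l m" by (rule l.free_mod)
  \<comment> \<open>the coordinates of the class of an element of \<open>B\<close>\<close>
  define \<phi> where "\<phi> b = inv_into (tuples m (carrier l)) h (q b)" for b
  have qV: "q b \<in> carrier V" if "b \<in> B" for b using that q_surj by blast
  have \<phi>: "\<phi> b \<in> tuples m (carrier l)" "h (\<phi> b) = q b" if "b \<in> B" for b
   unfolding \<phi>_def using h(2) qV[OF that] inv_into_into[of "q b" h "tuples m (carrier l)"] f_inv_into_f[of "q b" h "tuples m (carrier l)"]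
   unfolding bij_betw_def by auto
  have \<phi>I: "\<phi> b = x" if "b \<in> B" "x \<in> tuples m (carrier l)" "h x = q b" for b x
   using h(2) \<phi>[OF that(1)] that(2,3) unfolding bij_betw_def inj_on_def by metis
  have \<phi>_lin: "\<phi> \<in> linear_maps R ?MB ?L"
  proof (rule linear_mapsI)
   fix x assume "x \<in> carrier ?MB" then show "\<phi> x \<in> carrier ?L" using \<phi>(1) by simp
  next
   fix x y assume "x \<in> carrier ?MB" "y \<in> carrier ?MB"
   then have xy: "x \<in> B" "y \<in> B" by auto
   have "\<phi> (x \<oplus>[M] y) = \<phi> x \<oplus>[fm l m] \<phi> y"
   proof (rule \<phi>I)
    show "x \<oplus>[M] y \<in> B" by (rule submodule_add[OF B xy])
    show "\<phi> x \<oplus>[fm l m] \<phi> y \<in> tuples m (carrier l)" using Fl.M.a_closed[of "\<phi> x" "\<phi> y"] \<phi>(1) xy by simp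
    show "h (\<phi> x \<oplus>[fm l m] \<phi> y) = q (x \<oplus>[M] y)"
     using linear_mapsD(2)[OF h(1), of "\<phi> x" "\<phi> y"] \<phi> xy q_add[OF xy] by simp
   qed
   then show "\<phi> (x \<oplus>[?MB] y) = \<phi> x \<oplus>[?L] \<phi> y" by simp
  next
   fix r x assume r: "r \<in> carrier R" and "x \<in> carrier ?MB"
   then have x: "x \<in> B" by auto
   have \<rho>r: "\<rho> r \<in> carrier l" by (rule ring_hom_closed[OF \<rho> r])
   have "\<phi> (r \<odot>[M] x) = \<rho> r \<odot>[fm l m] \<phi> x"
   proof (rule \<phi>I)
    show "r \<odot>[M] x \<in> B" by (rule submodule_smult[OF B r x])
    show "\<rho> r \<odot>[fm l m] \<phi> x \<in> tuples m (carrier l)" using Fl.smult_closed[OF \<rho>r, of "\<phi> x"] \<phi>(1) x by simp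
    show "h (\<rho> r \<odot>[fm l m] \<phi> x) = q (r \<odot>[M] x)"
     using linear_mapsD(3)[OF h(1) \<rho>r, of "\<phi> x"] \<phi> x q_smult[OF r x] by simp
   qed
   then show "\<phi> (r \<odot>[?MB] x) = r \<odot>[?L] \<phi> x" by simp
  qed
  have "\<exists>b. b \<in> B \<and> \<phi> b = unit_vector l m j" for j
  proof -
   have u: "unit_vector l m j \<in> tuples m (carrier l)" by (rule l.unit_vector_tuples)
   then have "h (unit_vector l m j) \<in> q ` B" using h(2) q_surj unfolding bij_betw_def by auto
   then obtain b where "b \<in> B" "h (unit_vector l m j) = q b" by blast
   then show ?thesis using \<phi>I[OF _ u] by blast
  qed
  then obtain s where s: "\<And>j. s j \<in> B" "\<And>j. \<phi> (s j) = unit_vector l m j" by metis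
  let ?g = "lin_comb ?MB m s"
  have g: "?g \<in> linear_maps R (fm R m) ?MB" by (rule lin_comb_linear[OF MB]) (use s in simp)
  have gM: "?g \<in> linear_maps R (fm R m) M"
   by (rule linear_mapsI) (use linear_mapsD[OF g] Bc in auto)
  have gB: "?g x \<in> B" if "x \<in> vec R m" for x using linear_mapsD(1)[OF g] that by simp
  have \<phi>g: "\<phi> (?g x) = tuple_map m \<rho> x" if x: "x \<in> vec R m" for x
  proof -
   have 1: "(\<lambda>x. \<phi> (?g x)) \<in> linear_maps R (fm R m) ?L" by (rule linear_map_comp[OF g \<phi>_lin])
   have 2: "tuple_map m \<rho> \<in> linear_maps R (fm R m) ?L"
    unfolding free_pow by (rule tuple_map_linear[OF ring_hom_linear[OF \<rho>]])
   have "\<phi> (?g (unit_vector R m j)) = tuple_map m \<rho> (unit_vector R m j)" if "j < m" for j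
   proof -
    have "?g (unit_vector R m j) = s j" by (rule lin_comb_unit_vector[OF MB _ that]) (use s in simp)
    moreover have "tuple_map m \<rho> (unit_vector R m j) = unit_vector l m j"
     unfolding tuple_map_def unit_vector_def using ring_hom_one[OF \<rho>] \<rho>_ker[OF zero_closed] additive_subgroup.zero_closed[OF ideal.axioms(1)[OF ideal_\<mm>]]
     by (auto intro!: restrict_ext)
    ultimately show ?thesis using s(2) by simp
   qed
   note u = this
   have uc: "tuple_map m \<rho> (unit_vector R m j) \<in> carrier ?L" for j
    using linear_mapsD(1)[OF 2] unit_vector_tuples by simp
   have "(\<Oplus>\<^bsub>?L\<^esub>j\<in>{..<m}. x j \<odot>[?L] \<phi> (?g (unit_vector R m j))) =
    (\<Oplus>\<^bsub>?L\<^esub>j\<in>{..<m}. x j \<odot>[?L] tuple_map m \<rho> (unit_vector R m j))"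
   proof (rule L.M.finsum_cong'[OF refl])
    show "(\<lambda>j. x j \<odot>[?L] tuple_map m \<rho> (unit_vector R m j)) \<in> {..<m} \<rightarrow> carrier ?L"
     using tuples_mem[OF x] by (intro funcsetI L.smult_closed uc) simp
   qed (simp only: u lessThan_iff)
   then have "lin_comb ?L m (\<lambda>j. \<phi> (?g (unit_vector R m j))) x = lin_comb ?L m (\<lambda>j. tuple_map m \<rho> (unit_vector R m j)) x"
    unfolding lin_comb_def[of ?L] .
   then show ?thesis using linear_map_free_eq[OF L 1 x] linear_map_free_eq[OF L 2 x] by simp
  qed
  have Aiff: "b \<in> A \<longleftrightarrow> \<phi> b = \<zero>[?L]" if b: "b \<in> B" for b
  proof -
   have z: "\<zero>[M] \<in> B" by (rule submodule_zero[OF B])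
   have "\<phi> \<zero>[M] = \<zero>[?L]" using linear_map_zero[OF MB L \<phi>_lin] by simp
   then have "\<phi> b = \<zero>[?L] \<longleftrightarrow> \<phi> b = \<phi> \<zero>[M]" by simp
   also have "\<dots> \<longleftrightarrow> q b = q \<zero>[M]" using \<phi>(2)[OF b] \<phi>(2)[OF z] unfolding \<phi>_def by metis
   also have "\<dots> \<longleftrightarrow> b \<in> A" using q_eq[OF b z] Ac by auto
   finally show ?thesis by simp
  qed
  have "rdim R (fm R m) (tuples m \<mm>) (vec R m) = rdim R M A B"
  proof (rule rdim_transfer[OF free_mod MM gM ideal_tuples[OF ideal_\<mm>] free_sub A B _ AB])
   show "tuples m \<mm> \<subseteq> vec R m" using \<mm>_carrier by (intro tuples_mono) blast
   fix x assume x: "x \<in> vec R m"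
   show "?g x \<in> B" by (rule gB[OF x])
   have "?g x \<in> A \<longleftrightarrow> (\<forall>j<m. \<rho> (x j) = \<zero>[l])"
    unfolding Aiff[OF gB[OF x]] \<phi>g[OF x] by (auto simp: tuple_map_def fun_eq_iff restrict_def)
   also have "\<dots> \<longleftrightarrow> x \<in> tuples m \<mm>" using \<rho>_ker[OF tuples_mem[OF x]] x by (auto simp: PiE_iff)
   finally show "?g x \<in> A \<longleftrightarrow> x \<in> tuples m \<mm>" .
  next
   fix b assume b: "b \<in> B"
   obtain x where x: "x \<in> vec R m" "tuple_map m \<rho> x = \<phi> b" using \<rho>_tuples_surj[OF \<phi>(1)[OF b]] .
   have "q b = q (?g x)" using \<phi>(2)[OF b] \<phi>(2)[OF gB[OF x(1)]] \<phi>g[OF x(1)] x(2) by simp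
   then obtain a where "a \<in> A" "b = ?g x \<oplus>[M] a" using q_eq[OF b gB[OF x(1)]] by blast
   then show "\<exists>x\<in>vec R m. \<exists>a\<in>A. b = ?g x \<oplus>[M] a" using x(1) by blast
  qed
  then show "m = rdim R M A B" unfolding rdim_residue_power .
 qed
 show ?thesis unfolding vdim_def by (rule the_equality) (rule ex, rule un)
qed

end

end

section \<open>Existence of free resolutions\<close>

lemma (in cring) mat_apply_eq_lin_comb:
 assumes sc: "\<And>j. j < q ==> s j \<in> carrier (fm R n)" and x: "x \<in> vec R q"
 shows "mat_apply R n q (\<lambda>r c. s c r) x = lin_comb (fm R n) q s x"
proof (rule tuples_eqI)
 let ?F = "fm R n" and ?A = "\<lambda>r c. s c r"
 have F: "module R ?F" by (rule free_mod)
 interpret F: module R ?F by (rule F)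
 have A: "?A r c \<in> carrier R" if "r < n" "c < q" for r c using sc[OF that(2)] that(1) by auto
 show "lin_comb ?F q s x \<in> vec R n" using linear_mapsD(1)[OF lin_comb_linear[OF F sc]] x by simp
 show "mat_apply R n q ?A x \<in> tuples n UNIV" unfolding mat_apply_def by auto
 fix r assume r: "r < n"
 have "lin_comb ?F q s x r = finsum (reg R) (\<lambda>j. (x j \<odot>[?F] s j) r) {..<q}"
  unfolding lin_comb_def
  using tuples_mem[OF x] sc by (intro linear_map_finsum[OF F regular eval_linear[OF r]] F.smult_closed) simp_all
 also have "\<dots> = (\<Oplus>\<^bsub>R\<^esub>j\<in>{..<q}. s j r \<otimes>\<^bsub>R\<^esub> x j)"
  unfolding finsum_regular_module using tuples_mem[OF x] A[OF r] r m_comm by (intro finsum_cong') auto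
 finally show "mat_apply R n q ?A x r = lin_comb ?F q s x r" unfolding mat_apply_def using r by simp
qed

lemma submodule_image_of_matrix:
 assumes R: "cring R" "noetherian_ring R" and N: "submodule N R (fm R n)"
 shows "\<exists>q A. (\<forall>r<n. \<forall>c<q. A r c \<in> carrier R) \<and> mat_apply R n q A ` vec R q = N"
proof -
 interpret cring R by (rule R(1))
 let ?F = "fm R n"
 have F: "module R ?F" by (rule free_mod)
 interpret F: module R ?F by (rule F)
 have "noetherian_module R ?F"
  unfolding free_pow by (intro noetherian_power_module noetherian_regular_module R)
 then obtain S where S: "finite S" "S \<subseteq> N" "N \<subseteq> submodule_span R ?F S"
  using N unfolding noetherian_module_def finitely_generated_def by blast
 define q where "q = card S"
 obtain s where s: "bij_betw s {..<q} S"
  using ex_bij_betw_nat_finite[OF S(1)] unfolding q_def by (metis atLeast0LessThan)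
 have sS: "s ` {..<q} = S" "\<And>j. j < q ==> s j \<in> N" using s S(2) unfolding bij_betw_def by auto
 have sc: "\<And>j. j < q ==> s j \<in> carrier ?F" using sS(2) submodule_carrier[OF N] by blast
 let ?A = "\<lambda>r c. s c r"
 have A: "?A r c \<in> carrier R" if "r < n" "c < q" for r c using sc[OF that(2)] that(1) by auto
 note eq = mat_apply_eq_lin_comb[OF sc]
 have "mat_apply R n q ?A ` vec R q = lin_comb ?F q s ` vec R q"
  using eq by (intro image_cong) auto
 also have "\<dots> = N"
 proof
  show "lin_comb ?F q s ` vec R q \<subseteq> N" using lin_comb_in_submodule[OF F N sS(2)] by auto
  show "N \<subseteq> lin_comb ?F q s ` vec R q"
  proof
   fix y assume "y \<in> N"
   then have "y \<in> submodule_span R ?F (s ` {..<q})" using S(3) sS(1) by auto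
   then show "y \<in> lin_comb ?F q s ` vec R q" using lin_comb_image[OF F sc, of q "\<lambda>j. j" y] by auto
  qed
 qed
 finally have "mat_apply R n q ?A ` vec R q = N" .
 moreover have "\<forall>r<n. \<forall>c<q. ?A r c \<in> carrier R" using A by blast
 ultimately show ?thesis by (intro exI[of _ q] exI[of _ ?A] conjI)
qed

text \<open>A resolution is built by choosing in each step generators of the kernel.\<close>

lemma free_resolution_exists:
 assumes R: "cring R" "noetherian_ring R" and M: "module R M" and e: "\<epsilon> \<in> linear_maps R (fm R n) M"
  and surj: "\<epsilon> ` carrier (fm R n) = carrier M"
 shows "\<exists>F \<epsilon>. free_resolution R M F \<epsilon>"
proof -
 interpret cring R by (rule R(1))
 interpret M: module R M by (rule M)
 let ?ker = "\<lambda>n q A. {x \<in> vec R q. mat_apply R n q A x = \<zero>[fm R n]}"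
 define gen where "gen s = (SOME (q, A). (\<forall>r<fst s. \<forall>c<q. A r c \<in> carrier R) \<and>
  mat_apply R (fst s) q A ` vec R q = snd s)" for s :: "nat \<times> (nat => 'a) set"
 define st where "st = rec_nat (n, {x \<in> vec R n. \<epsilon> x = \<zero>[M]})
  (\<lambda>_ s. (fst (gen s), ?ker (fst s) (fst (gen s)) (snd (gen s))))"
 have st: "st 0 = (n, {x \<in> vec R n. \<epsilon> x = \<zero>[M]})"
  "\<And>i. st (Suc i) = (fst (gen (st i)), ?ker (fst (st i)) (fst (gen (st i))) (snd (gen (st i))))"
  unfolding st_def by simp_all
 have gen: "(\<forall>r<fst s. \<forall>c<fst (gen s). snd (gen s) r c \<in> carrier R) \<and>
   mat_apply R (fst s) (fst (gen s)) (snd (gen s)) ` vec R (fst (gen s)) = snd s"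
  if "submodule (snd s) R (fm R (fst s))" for s
 proof -
  have "\<exists>p. case p of (q, A) => (\<forall>r<fst s. \<forall>c<q. A r c \<in> carrier R) \<and> mat_apply R (fst s) q A ` vec R q = snd s"
   using submodule_image_of_matrix[OF R that] by auto
  from someI_ex[OF this] show ?thesis unfolding gen_def split_def by simp
 qed
 have zM: "submodule {\<zero>[M]} R M" by (rule M.submoduleI_smult) auto
 have cs: "submodule (vec R b) R (fm R b)" for b by (rule ideal_tuples[OF carrier_ideal])
 have sub: "submodule (snd (st i)) R (fm R (fst (st i)))" for i
 proof (induction i)
  case 0
  show ?case unfolding st using submodule_vimage[OF free_mod M e cs zM] by simp
 next
  case (Suc i)
  let ?n = "fst (st i)" and ?q = "fst (gen (st i))" and ?A = "snd (gen (st i))"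
  have lin: "mat_apply R ?n ?q ?A \<in> linear_maps R (fm R ?q) (fm R ?n)"
   unfolding mat_apply_eq_matrix_map free_pow using gen[OF Suc] by (intro matrix_map_linear regular) simp
  interpret F: module R "fm R ?n" by (rule free_mod)
  have z: "submodule {\<zero>[fm R ?n]} R (fm R ?n)" by (rule F.submoduleI_smult) auto
  show ?case unfolding st using submodule_vimage[OF free_mod free_mod lin cs z]
   by (simp del: free_module_simps(2))
 qed
 define F where "F = \<lparr>rk = (\<lambda>i. fst (st i)), dif = (\<lambda>i. snd (gen (st (i - 1))))\<rparr>"
 have rk: "rk F i = fst (st i)" "dif F (Suc i) = snd (gen (st i))" for i unfolding F_def by simp_all
 have rkS: "rk F (Suc i) = fst (gen (st i))" for i unfolding rk st by simp
 have im: "fdif R F (Suc i) ` vec R (rk F (Suc i)) = snd (st i)" for i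
  unfolding fdif_def rk(2) rkS using gen[OF sub[of i]] by (simp add: rk)
 have "free_resolution R M F \<epsilon>"
  unfolding free_resolution_def
 proof (intro conjI allI impI)
  fix i :: nat and r c assume i: "1 \<le> i" "r < rk F (i - 1)" "c < rk F i"
  then obtain j where j: "i = Suc j" by (cases i) auto
  show "dif F i r c \<in> carrier R" using i gen[OF sub[of j]] unfolding j rkS rk(2) by (simp add: rk)
 next
  fix i :: nat assume "1 \<le> i"
  then obtain j where j: "i = Suc j" by (cases i) auto
  have "cycles (fmod R F) (fdif R F) (Suc j) = snd (st (Suc j))"
   unfolding cycles_def fmod_def fdif_def st by (simp add: rk rkS st del: free_module_simps(2))
  then show "cycles (fmod R F) (fdif R F) i = boundaries (fmod R F) (fdif R F) i"
   unfolding j boundaries_def fmod_def by (simp add: im)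
 next
  show "\<epsilon> \<in> linear_maps R (fmod R F 0) M" "\<epsilon> ` carrier (fmod R F 0) = carrier M"
   using e surj unfolding fmod_def rk st by simp_all
  show "{x \<in> carrier (fmod R F 0). \<epsilon> x = \<zero>[M]} = boundaries (fmod R F) (fdif R F) 0"
   unfolding boundaries_def fmod_def free_module_simps(1) im by (simp add: rk st)
 qed
 then show ?thesis by blast
qed

lemma chosen_resolution:
 assumes "\<exists>F \<epsilon>. free_resolution R M F \<epsilon>"
 shows "free_resolution R M (fst (chosen_resolution R M)) (snd (chosen_resolution R M))"
proof -
 have "\<exists>p. case p of (F, \<epsilon>) => free_resolution R M F \<epsilon>" using assms by auto
 from someI_ex[OF this] show ?thesis unfolding chosen_resolution_def split_def by simp
qed

lemma free_resolution_ring_as_module: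
 assumes R: "cring R" "noetherian_ring R" and S: "cring S" and f: "f \<in> ring_hom R S" "f ` carrier R = carrier S"
 shows "\<exists>F \<epsilon>. free_resolution R (ring_as_module S f) F \<epsilon>"
proof (rule free_resolution_exists[OF R ring_as_module_module[OF R(1) S f(1)]])
 interpret cring R by (rule R(1))
 show "(\<lambda>x. f (x 0)) \<in> linear_maps R (fm R 1) (ring_as_module S f)"
  using linear_map_comp[OF eval_linear ring_hom_linear[OF f(1)], of 0 1] by simp
 show "(\<lambda>x. f (x 0)) ` carrier (fm R 1) = carrier (ring_as_module S f)"
 proof (intro equalityI subsetI)
  fix y assume "y \<in> carrier (ring_as_module S f)"
  then obtain r where r: "r \<in> carrier R" "y = f r" using f(2) by auto
  let ?x = "\<lambda>j\<in>{..<1::nat}. r"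
  have "?x \<in> carrier (fm R 1)" using r by auto
  from imageI[OF this, of "\<lambda>x. f (x 0)"] show "y \<in> (\<lambda>x. f (x 0)) ` carrier (fm R 1)" using r by simp
 qed (use ring_hom_closed[OF f(1)] in auto)
qed

section \<open>Reduction of complexes along a surjection\<close>

text \<open>Let \<open>p : R \<rightarrow> T\<close> be surjective with kernel \<open>K\<close>, and \<open>X\<close> a family of matrices over \<open>R\<close> that lifts the
 matrices of \<open>G\<close> over \<open>T\<close>.  The cycles and boundaries of \<open>G\<close> are the images of those of \<open>X\<close> modulo \<open>K\<close>,
 so that complexes over all quotients of \<open>R\<close> can be treated as matrices over \<open>R\<close>.\<close>

definition (in local_noetherian) reduction ::
 "('t, 's) ring_scheme => ('a => 't) => 'a set => 'a free_complex => 't free_complex => bool" where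
 "reduction T p K X G \<longleftrightarrow> cring T \<and> p \<in> ring_hom R T \<and> p ` carrier R = carrier T \<and> ideal K R \<and>
  (\<forall>r\<in>carrier R. p r = \<zero>[T] \<longleftrightarrow> r \<in> K) \<and> rk X = rk G \<and>
  (\<forall>i. \<forall>r<rk G i. \<forall>c<rk G (Suc i). dif X (Suc i) r c \<in> carrier R \<and> p (dif X (Suc i) r c) = dif G (Suc i) r c)"

context local_noetherian
begin

context
 fixes T :: "('t, 's) ring_scheme" and p :: "'a => 't" and K :: "'a set" and X :: "'a free_complex" and G :: "'t free_complex"
 assumes red: "reduction T p K X G"
begin

lemma red_T: "cring T" and red_p: "p \<in> ring_hom R T" and red_p_surj: "p ` carrier R = carrier T"
  and red_K: "ideal K R" and red_ker: "\<And>r. r \<in> carrier R ==> p r = \<zero>[T] \<longleftrightarrow> r \<in> K"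
  and red_rk: "rk X = rk G" and red_X: "\<And>i r c. r < rk G i ==> c < rk G (Suc i) ==> dif X (Suc i) r c \<in> carrier R"
  and red_pX: "\<And>i r c. r < rk G i ==> c < rk G (Suc i) ==> p (dif X (Suc i) r c) = dif G (Suc i) r c"
 using red unfolding reduction_def by auto

lemma reduction_matrices: "matrices_over R X"
 unfolding matrices_over_def red_rk using red_X by blast

lemma reduction_fdif:
 assumes x: "x \<in> vec R (rk G (Suc i))"
 shows "fdif T G (Suc i) (tuple_map (rk G (Suc i)) p x) = tuple_map (rk G i) p (cdif X (reg R) (Suc i) x)"
 unfolding fdif_def cdif_def red_rk diff_Suc_1
 by (rule mat_apply_tuple_map[OF is_cring red_T red_p red_X red_pX[symmetric] x])

lemma reduction_lift:
 assumes "x \<in> tuples n (carrier T)"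
 shows "\<exists>r\<in>vec R n. x = tuple_map n p r"
proof -
 have "x \<in> tuples n (p ` carrier R)" using assms unfolding red_p_surj .
 then show ?thesis using tuples_image by blast
qed

lemma reduction_closed: "x \<in> vec R n ==> tuple_map n p x \<in> tuples n (carrier T)"
 using tuple_map_tuples[OF ring_hom_closed[OF red_p]] .

lemma reduction_zero:
 assumes "x \<in> vec R n"
 shows "tuple_map n p x = \<zero>[fm T n] \<longleftrightarrow> x \<in> tuples n K"
proof -
 have "tuple_map n p x = \<zero>[fm T n] \<longleftrightarrow> (\<forall>j<n. p (x j) = \<zero>[T])"
  unfolding tuple_map_def free_module_simps fun_eq_iff by (auto simp: restrict_def)
 also have "\<dots> \<longleftrightarrow> (\<forall>j<n. x j \<in> K)" using red_ker[OF tuples_mem[OF assms]] by blast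
 also have "\<dots> \<longleftrightarrow> x \<in> tuples n K" using assms by (auto simp: PiE_iff)
 finally show ?thesis .
qed

lemma reduction_add:
 assumes x: "x \<in> vec R n" and y: "y \<in> vec R n"
 shows "tuple_map n p (x \<oplus>[fm R n] y) = tuple_map n p x \<oplus>[fm T n] tuple_map n p y"
 unfolding tuple_map_def free_module_simps
 using ring_hom_add[OF red_p tuples_mem[OF x] tuples_mem[OF y]] by (intro restrict_ext) simp

lemma reduction_smult:
 assumes r: "r \<in> carrier R" and x: "x \<in> vec R n"
 shows "tuple_map n p (r \<odot>[fm R n] x) = p r \<odot>[fm T n] tuple_map n p x"
 unfolding tuple_map_def free_module_simps
 using ring_hom_mult[OF red_p r tuples_mem[OF x]] by (intro restrict_ext) simp

lemma reduction_homology: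
 shows "cycles (fmod T G) (fdif T G) i = tuple_map (rk G i) p ` rcyc R X K i"
  and "boundaries (fmod T G) (fdif T G) i = tuple_map (rk G i) p ` rbnd R X K i"
  and "submodule (cycles (fmod T G) (fdif T G) i) T (fm T (rk G i))"
  and "submodule (boundaries (fmod T G) (fdif T G) i) T (fm T (rk G i))"
  and "complex_mod X (reg R) K (carrier R) ==> boundaries (fmod T G) (fdif T G) i \<subseteq> cycles (fmod T G) (fdif T G) i"
proof -
 let ?M = "reg R"
 interpret l: cring T by (rule red_T)
 note mat = reduction_matrices
 note ms = ideal_submodule[OF red_K] and cs = carrier_sub
 note fr = reduction_fdif and z = reduction_zero
 note surj = reduction_lift and cl = reduction_closed
 have dX: "cdif X ?M (Suc j) x \<in> vec R (rk G j)" if "x \<in> vec R (rk G (Suc j))" for j x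
  using cdif_tuples[OF mat regular cs] that unfolding red_rk by blast
 have KR: "x \<in> vec R n" if "x \<in> tuples n K" for n x using that ideal.Icarr[OF red_K] by (auto simp: PiE_iff)
 show Z: "cycles (fmod T G) (fdif T G) i = tuple_map (rk G i) p ` cyc X ?M K (carrier R) i"
 proof (cases i)
  case 0
  have "tuples (rk G 0) (carrier T) = tuple_map (rk G 0) p ` vec R (rk G 0)"
  proof (intro equalityI subsetI)
   fix x assume "x \<in> tuples (rk G 0) (carrier T)"
   from surj[OF this] show "x \<in> tuple_map (rk G 0) p ` vec R (rk G 0)" by auto
  next
   fix x assume "x \<in> tuple_map (rk G 0) p ` vec R (rk G 0)"
   then obtain r where "r \<in> vec R (rk G 0)" "x = tuple_map (rk G 0) p r" by (rule imageE)
   then show "x \<in> tuples (rk G 0) (carrier T)" using cl by simp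
  qed
  then show ?thesis unfolding 0 cycles_def fmod_def cyc_0 red_rk by simp
 next
  case (Suc j)
  have k: "tuple_map (rk G (Suc j)) p x \<in> cycles (fmod T G) (fdif T G) (Suc j) \<longleftrightarrow> x \<in> cyc X ?M K (carrier R) (Suc j)"
   if x: "x \<in> vec R (rk G (Suc j))" for x
   unfolding cycles_def fmod_def cyc_Suc red_rk diff_Suc_1 using fr[OF x] z[OF dX[OF x]] cl[OF x] x
   by (simp del: free_module_simps(2))
  show ?thesis unfolding Suc
  proof (intro equalityI subsetI)
   fix y assume y: "y \<in> cycles (fmod T G) (fdif T G) (Suc j)"
   then have "y \<in> tuples (rk G (Suc j)) (carrier T)" unfolding cycles_def fmod_def by simp
   then obtain x where "x \<in> vec R (rk G (Suc j))" "y = tuple_map (rk G (Suc j)) p x" using surj by blast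
   then show "y \<in> tuple_map (rk G (Suc j)) p ` cyc X ?M K (carrier R) (Suc j)" using k y by blast
  next
   fix y assume "y \<in> tuple_map (rk G (Suc j)) p ` cyc X ?M K (carrier R) (Suc j)"
   then obtain x where x: "x \<in> cyc X ?M K (carrier R) (Suc j)" "y = tuple_map (rk G (Suc j)) p x" by blast
   then show "y \<in> cycles (fmod T G) (fdif T G) (Suc j)" using k[of x] cyc_tuples[OF x(1)] unfolding red_rk by blast
  qed
 qed
 show B: "boundaries (fmod T G) (fdif T G) i = tuple_map (rk G i) p ` bnd X ?M K (carrier R) i"
 proof (intro equalityI subsetI)
  fix y assume "y \<in> boundaries (fmod T G) (fdif T G) i"
  then obtain x where x: "x \<in> tuples (rk G (Suc i)) (carrier T)" "y = fdif T G (Suc i) x"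
   unfolding boundaries_def fmod_def by auto
  obtain r where r: "r \<in> vec R (rk G (Suc i))" "x = tuple_map (rk G (Suc i)) p r" using surj[OF x(1)] by blast
  have "cdif X ?M (Suc i) r \<in> bnd X ?M K (carrier R) i"
   using r(1) by (intro bnd_image[OF mat regular ms cs]) (simp add: red_rk)
  then show "y \<in> tuple_map (rk G i) p ` bnd X ?M K (carrier R) i" unfolding x(2) r(2) fr[OF r(1)] by (rule imageI)
 next
  fix y assume "y \<in> tuple_map (rk G i) p ` bnd X ?M K (carrier R) i"
  then obtain b where b: "b \<in> bnd X ?M K (carrier R) i" "y = tuple_map (rk G i) p b" by blast
  then obtain r w where rw: "r \<in> vec R (rk G (Suc i))" "w \<in> tuples (rk G i) K"
   "b = cdif X ?M (Suc i) r \<oplus>[fm R (rk G i)] w" unfolding bnd_def red_rk free_pow[symmetric] by blast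
  interpret Fl: module T "fm T (rk G i)" by (rule l.free_mod)
  have "tuple_map (rk G i) p w = \<zero>[fm T (rk G i)]" using z[OF KR[OF rw(2)]] rw(2) by blast
  then have "y = fdif T G (Suc i) (tuple_map (rk G (Suc i)) p r) \<oplus>[fm T (rk G i)] \<zero>[fm T (rk G i)]"
   unfolding b(2) rw(3) fr[OF rw(1)] reduction_add[OF dX[OF rw(1)] KR[OF rw(2)]] by simp
  also have "\<dots> = fdif T G (Suc i) (tuple_map (rk G (Suc i)) p r)"
   using cl[OF dX[OF rw(1)]] unfolding fr[OF rw(1)] by (intro Fl.M.r_zero) simp
  finally show "y \<in> boundaries (fmod T G) (fdif T G) i"
   unfolding boundaries_def fmod_def using cl[OF rw(1)] by simp
 qed
 have img: "submodule (tuple_map (rk G i) p ` N) T (fm T (rk G i))"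
  if N: "submodule N R (fm R (rk G i))" for N
 proof -
  interpret Fl: module T "fm T (rk G i)" by (rule l.free_mod)
  have Nc: "x \<in> vec R (rk G i)" if "x \<in> N" for x using submodule_carrier[OF N that] by simp
  show ?thesis
  proof (rule Fl.submoduleI_smult)
   show "tuple_map (rk G i) p ` N \<subseteq> carrier (fm T (rk G i))" using cl[OF Nc] by auto
   have "\<zero>[fm R (rk G i)] \<in> tuples (rk G i) K" by (rule submodule_zero[OF ideal_tuples[OF red_K]])
   then show "\<zero>[fm T (rk G i)] \<in> tuple_map (rk G i) p ` N"
    using z[OF Nc[OF submodule_zero[OF N]]] submodule_zero[OF N] by (metis image_eqI)
  next
   fix a b assume "a \<in> tuple_map (rk G i) p ` N" "b \<in> tuple_map (rk G i) p ` N"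
   then obtain x y where xy: "x \<in> N" "y \<in> N" "a = tuple_map (rk G i) p x" "b = tuple_map (rk G i) p y" by blast
   show "a \<oplus>[fm T (rk G i)] b \<in> tuple_map (rk G i) p ` N"
    unfolding xy(3,4) reduction_add[OF Nc[OF xy(1)] Nc[OF xy(2)], symmetric] by (rule imageI[OF submodule_add[OF N xy(1,2)]])
  next
   fix k b assume k: "k \<in> carrier T" and "b \<in> tuple_map (rk G i) p ` N"
   then obtain x where x: "x \<in> N" "b = tuple_map (rk G i) p x" by blast
   obtain r where r: "r \<in> carrier R" "k = p r" using k red_p_surj by blast
   have "k \<odot>[fm T (rk G i)] b = tuple_map (rk G i) p (r \<odot>[fm R (rk G i)] x)"
    unfolding x(2) r(2) using reduction_smult[OF r(1) Nc[OF x(1)]] by simp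
   then show "k \<odot>[fm T (rk G i)] b \<in> tuple_map (rk G i) p ` N"
    using submodule_smult[OF N r(1) x(1)] by blast
  qed
 qed
 have Zs: "submodule (cyc X ?M K (carrier R) i) R (fm R (rk G i))"
  using cyc_submodule[OF mat regular ms cs, of i] unfolding red_rk free_pow .
 have Bs: "submodule (bnd X ?M K (carrier R) i) R (fm R (rk G i))"
  using bnd_submodule[OF mat regular ms cs, of i] unfolding red_rk free_pow .
 show "submodule (cycles (fmod T G) (fdif T G) i) T (fm T (rk G i))" unfolding Z by (rule img[OF Zs])
 show "submodule (boundaries (fmod T G) (fdif T G) i) T (fm T (rk G i))" unfolding B by (rule img[OF Bs])
 assume "complex_mod X ?M K (carrier R)"
 then have "bnd X ?M K (carrier R) i \<subseteq> cyc X ?M K (carrier R) i"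
  using ideal.Icarr[OF red_K] by (intro bnd_subset_cyc[OF mat regular ms cs]) auto
 then show "boundaries (fmod T G) (fdif T G) i \<subseteq> cycles (fmod T G) (fdif T G) i" unfolding Z B by (rule image_mono)
qed

text \<open>Cycles and boundaries modulo \<open>K\<close> contain all tuples over \<open>K\<close>, hence are full preimages.\<close>

lemma reduction_mem_iff:
 assumes N: "submodule N R (fm R n)" and KN: "tuples n K \<subseteq> N" and x: "x \<in> vec R n"
 shows "tuple_map n p x \<in> tuple_map n p ` N \<longleftrightarrow> x \<in> N"
proof
 assume "tuple_map n p x \<in> tuple_map n p ` N"
 then obtain b where b: "b \<in> N" "tuple_map n p x = tuple_map n p b" by blast
 interpret F: module R "fm R n" by (rule free_mod)
 interpret Ft: module T "fm T n" by (rule cring.free_mod[OF red_T])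
 have bc: "b \<in> vec R n" using submodule_carrier[OF N b(1)] by simp
 obtain d where d: "d \<in> carrier (fm R n)" "x = b \<oplus>[fm R n] d"
  using F.ex_diff[of x b] x bc unfolding free_module_simps(1) by metis
 have dc: "d \<in> vec R n" using d(1) by simp
 have m: "tuple_map n p b \<in> carrier (fm T n)" "tuple_map n p d \<in> carrier (fm T n)"
  using reduction_closed bc dc by simp_all
 have "tuple_map n p b \<oplus>[fm T n] tuple_map n p d = tuple_map n p b \<oplus>[fm T n] \<zero>[fm T n]"
  unfolding Ft.M.r_zero[OF m(1)] using reduction_add[OF bc dc] b(2) d(2) by simp
 then have "tuple_map n p d = \<zero>[fm T n]"
  using m Ft.M.add.l_cancel Ft.M.zero_closed by metis
 then have "d \<in> N" using reduction_zero[OF dc] KN by blast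
 then show "x \<in> N" unfolding d(2) by (rule submodule_add[OF N b(1)])
qed (rule imageI)

lemma reduction_iff:
 assumes x: "x \<in> vec R (rk G i)"
 shows "tuple_map (rk G i) p x \<in> cycles (fmod T G) (fdif T G) i \<longleftrightarrow> x \<in> rcyc R X K i"
  and "tuple_map (rk G i) p x \<in> boundaries (fmod T G) (fdif T G) i \<longleftrightarrow> x \<in> rbnd R X K i"
proof -
 note ms = ideal_submodule[OF red_K] and cs = carrier_sub
 have "submodule (rcyc R X K i) R (fm R (rk G i))"
  "submodule (rbnd R X K i) R (fm R (rk G i))"
  using cyc_submodule[OF reduction_matrices regular ms cs, of i] bnd_submodule[OF reduction_matrices regular ms cs, of i]
  unfolding red_rk free_pow .
 moreover have "tuples (rk G i) K \<subseteq> rbnd R X K i"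
  using bnd_lower[OF reduction_matrices regular ms cs] unfolding red_rk by blast
 moreover have "tuples (rk G i) K \<subseteq> rcyc R X K i"
 proof
  fix w assume w: "w \<in> tuples (rk G i) K"
  have "tuples (rk G i) K \<subseteq> vec R (rk G i)" using ideal.Icarr[OF red_K] by (intro tuples_mono) blast
  then show "w \<in> rcyc R X K i"
   using w cdif_tuples[OF reduction_matrices regular ms] unfolding cyc_def red_rk by blast
 qed
 ultimately show "tuple_map (rk G i) p x \<in> cycles (fmod T G) (fdif T G) i \<longleftrightarrow> x \<in> rcyc R X K i"
  "tuple_map (rk G i) p x \<in> boundaries (fmod T G) (fdif T G) i \<longleftrightarrow> x \<in> rbnd R X K i"
  unfolding reduction_homology(1,2) using reduction_mem_iff x by simp_all
qed

lemma reduction_exact: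
 assumes ex: "\<And>i. cycles (fmod T G) (fdif T G) (Suc i) = boundaries (fmod T G) (fdif T G) (Suc i)"
 shows "complex_mod X (reg R) K (carrier R)"
  and "x \<in> rcyc R X K (Suc i) ==> x \<in> rbnd R X K (Suc i)"
proof -
 show "complex_mod X (reg R) K (carrier R)" unfolding complex_mod_def
 proof (intro allI ballI)
  fix i y assume y: "y \<in> vec R (rk X (Suc (Suc i)))"
  let ?z = "cdif X (reg R) (Suc (Suc i)) y"
  have z: "?z \<in> vec R (rk G (Suc i))"
   using cdif_tuples[OF reduction_matrices regular carrier_sub y] unfolding red_rk .
  have "?z \<in> rbnd R X K (Suc i)"
   by (rule bnd_image[OF reduction_matrices regular ideal_submodule[OF red_K] carrier_sub y])
  then have "?z \<in> rcyc R X K (Suc i)"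
   using reduction_iff[OF z] ex by blast
  then show "cdif X (reg R) (Suc i) ?z \<in> tuples (rk X i) K" unfolding cyc_Suc by blast
 qed
 assume x: "x \<in> rcyc R X K (Suc i)"
 show "x \<in> rbnd R X K (Suc i)"
  using x reduction_iff[OF cyc_tuples[OF x, unfolded red_rk]] ex by blast
qed

end

end

section \<open>Resolutions over a quotient of a local ring\<close>

lemma (in local_noetherian) residue_field_facts:
 shows "cring (residue_field R)" and "residue_map R \<in> ring_hom R (residue_field R)"
  and "residue_map R ` carrier R = carrier (residue_field R)"
  and "\<And>r. r \<in> carrier R ==> residue_map R r = \<zero>[residue_field R] \<longleftrightarrow> r \<in> \<mm>"
  and "module R (residue_module R)"
proof -
 interpret I: ideal \<mm> R by (rule ideal_\<mm>)
 have map: "residue_map R = (+>) \<mm>" by (rule ext) (simp add: residue_map_def max_ideal_eq)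
 show l: "cring (residue_field R)" unfolding residue_field_def max_ideal_eq by (rule I.quotient_is_cring[OF is_cring])
 show h: "residue_map R \<in> ring_hom R (residue_field R)"
  unfolding map unfolding residue_field_def max_ideal_eq by (rule I.rcos_ring_hom)
 show "residue_map R ` carrier R = carrier (residue_field R)"
  unfolding map unfolding residue_field_def max_ideal_eq FactRing_def A_RCOSETS_def' by auto
 show "residue_map R r = \<zero>[residue_field R] \<longleftrightarrow> r \<in> \<mm>" if "r \<in> carrier R" for r
 proof -
  have "\<mm> +> r = \<mm> \<longleftrightarrow> r \<in> \<mm>"
   using that I.a_rcos_const I.a_rcos_self by blast
  then show ?thesis unfolding map unfolding residue_field_def max_ideal_eq FactRing_def by simp
 qed
 show "module R (residue_module R)" unfolding residue_module_def by (rule ring_as_module_module[OF is_cring l h])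
qed

lemma (in local_noetherian) chosen_residue_resolution:
 "free_resolution R (residue_module R) (fst (chosen_resolution R (residue_module R))) (snd (chosen_resolution R (residue_module R)))"
 unfolding residue_module_def
 by (rule chosen_resolution[OF free_resolution_ring_as_module[OF is_cring noetherian residue_field_facts(1-3)]])

definition lift_complex :: "('a, 'r) ring_scheme => ('a => 'u) => 'u free_complex => 'a free_complex" where
 "lift_complex R \<pi> G = \<lparr>rk = rk G, dif = (\<lambda>i r c. SOME a. a \<in> carrier R \<and> \<pi> a = dif G i r c)\<rparr>"

context local_noetherian
begin

context
 fixes U :: "('u, 'v) ring_scheme" and \<pi> :: "'a => 'u" and \<nn>
 assumes U: "local_noetherian U \<nn>" and \<pi>: "\<pi> \<in> ring_hom R U" and \<pi>_surj: "\<pi> ` carrier R = carrier U"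
  and \<pi>_max: "\<And>r. r \<in> carrier R ==> \<pi> r \<in> \<nn> \<longleftrightarrow> r \<in> \<mm>"
begin

interpretation U: local_noetherian U \<nn> by (rule U)

abbreviation (input) \<rho> where "\<rho> \<equiv> \<lambda>r. residue_map U (\<pi> r)"

lemma residue_reduction:
 shows "\<rho> \<in> ring_hom R (residue_field U)" and "\<rho> ` carrier R = carrier (residue_field U)"
  and "\<And>r. r \<in> carrier R ==> \<rho> r = \<zero>[residue_field U] \<longleftrightarrow> r \<in> \<mm>"
proof -
 show "\<rho> \<in> ring_hom R (residue_field U)"
  using ring_hom_trans[OF \<pi> U.residue_field_facts(2)] by (simp add: comp_def)
 show "\<rho> ` carrier R = carrier (residue_field U)"
  using U.residue_field_facts(3) \<pi>_surj by (simp add: image_image[symmetric])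
 show "\<rho> r = \<zero>[residue_field U] \<longleftrightarrow> r \<in> \<mm>" if "r \<in> carrier R" for r
  using U.residue_field_facts(4)[OF ring_hom_closed[OF \<pi> that]] \<pi>_max[OF that] by simp
qed

context
 fixes G :: "'u free_complex"
 assumes G: "\<And>i r c. r < rk G i ==> c < rk G (Suc i) ==> dif G (Suc i) r c \<in> carrier U"
begin

lemma lift_complex_simps:
 shows "rk (lift_complex R \<pi> G) = rk G"
  and "\<And>i r c. r < rk G i ==> c < rk G (Suc i) ==> dif (lift_complex R \<pi> G) (Suc i) r c \<in> carrier R"
  and "\<And>i r c. r < rk G i ==> c < rk G (Suc i) ==> \<pi> (dif (lift_complex R \<pi> G) (Suc i) r c) = dif G (Suc i) r c"
  and "matrices_over R (lift_complex R \<pi> G)"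
proof -
 show rk: "rk (lift_complex R \<pi> G) = rk G" unfolding lift_complex_def by simp
 have ex: "\<exists>a. a \<in> carrier R \<and> \<pi> a = dif G (Suc i) r c" if "r < rk G i" "c < rk G (Suc i)" for i r c
  using G[OF that] \<pi>_surj by (metis imageE)
 show 1: "dif (lift_complex R \<pi> G) (Suc i) r c \<in> carrier R" "\<pi> (dif (lift_complex R \<pi> G) (Suc i) r c) = dif G (Suc i) r c"
  if "r < rk G i" "c < rk G (Suc i)" for i r c
  using someI_ex[OF ex[OF that]] unfolding lift_complex_def by simp_all
 show "matrices_over R (lift_complex R \<pi> G)" unfolding matrices_over_def rk using 1(1) by blast
qed

lemma residue_complex_reduction:
 "reduction (residue_field U) \<rho> \<mm> (lift_complex R \<pi> G) (base_change (residue_map U) G)"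
 unfolding reduction_def lift_complex_simps(1) using U.residue_field_facts(1) residue_reduction ideal_\<mm> lift_complex_simps(2,3)
 by (simp add: base_change_def)

lemma vdim_homology:
 assumes cx: "complex_mod (lift_complex R \<pi> G) (reg R) \<mm> (carrier R)"
 defines "l \<equiv> residue_field U" and "kG \<equiv> base_change (residue_map U) G" and "X \<equiv> lift_complex R \<pi> G"
 shows "vdim l (homology (fmod l kG) (fdif l kG) i) = rbetti R X \<mm> i"
proof -
 let ?M = "reg R" and ?F = "fm l (rk G i)" and ?t = "tuple_map (rk G i) \<rho>"
 let ?Z = "cyc X ?M \<mm> (carrier R) i" and ?B = "bnd X ?M \<mm> (carrier R) i"
 have lc: "cring l" unfolding l_def by (rule U.residue_field_facts(1))
 interpret l: cring l by (rule lc)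
 have rkX: "rk X = rk G" unfolding X_def by (rule lift_complex_simps(1))
 have rkk: "rk kG = rk G" unfolding kG_def base_change_def by simp
 have red: "reduction l \<rho> \<mm> X kG"
  unfolding l_def kG_def X_def by (rule residue_complex_reduction)
 have mat: "matrices_over R X" unfolding X_def by (rule lift_complex_simps(4))
 note ms = ideal_submodule[OF ideal_\<mm>] and cs = carrier_sub
 have cx': "complex_mod X ?M \<mm> (carrier R)" using cx unfolding X_def .
 note hom = reduction_homology(1-4)[OF red, of i, unfolded rkk] reduction_homology(5)[OF red cx', of i]
 note Q = quot_module_facts[OF l.free_mod hom(3-5)]
 let ?V = "homology (fmod l kG) (fdif l kG) i"
 let ?cls = "\<lambda>x. boundaries (fmod l kG) (fdif l kG) i +>\<^bsub>?F\<^esub> ?t x"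
 have V: "?V = quot_module (?F\<lparr>carrier := cycles (fmod l kG) (fdif l kG) i\<rparr>) (boundaries (fmod l kG) (fdif l kG) i)"
  unfolding homology_def fmod_def rkk ..
 have Zs: "submodule ?Z R (fm R (rk G i))" and Bs: "submodule ?B R (fm R (rk G i))"
  using cyc_submodule[OF mat regular ms cs, of i] bnd_submodule[OF mat regular ms cs, of i] unfolding rkX free_pow .
 have BZ: "?B \<subseteq> ?Z"
  using \<mm>_carrier cx unfolding X_def[symmetric] by (intro bnd_subset_cyc[OF mat regular ms cs]) auto
 have Zt: "x \<in> vec R (rk G i)" if "x \<in> ?Z" for x using cyc_tuples[OF that] unfolding rkX .
 have tZ: "?t x \<in> cycles (fmod l kG) (fdif l kG) i" if "x \<in> ?Z" for x unfolding hom(1) by (rule imageI[OF that])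
 have mB: "w \<in> ?B" if "w \<in> tuples (rk G i) \<mm>" for w
  using bnd_lower[OF mat regular ms cs] that unfolding rkX by blast
 have "vdim l ?V = rdim R (fm R (rk G i)) ?B ?Z"
 proof (rule vdim_eq_rdim[OF lc residue_reduction[folded l_def] noetherian_free Bs Zs BZ, where q = ?cls])
  fix r x assume "r \<in> \<mm>" "x \<in> ?Z"
  then have "r \<odot>[fm R (rk G i)] x \<in> tuples (rk G i) \<mm>"
   using tuples_mem[OF Zt] ideal.I_r_closed[OF ideal_\<mm>] by auto
  then show "r \<odot>[fm R (rk G i)] x \<in> ?B" by (rule mB)
 next
  show "?cls ` ?Z = carrier ?V" unfolding V Q(1) unfolding hom(1) by (simp add: image_image)
 next
  fix x y assume xy: "x \<in> ?Z" "y \<in> ?Z"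
  show "?cls (x \<oplus>[fm R (rk G i)] y) = ?cls x \<oplus>[?V] ?cls y"
   unfolding V Q(3)[OF tZ[OF xy(1)] tZ[OF xy(2)]] reduction_add[OF red, OF Zt[OF xy(1)] Zt[OF xy(2)]] ..
  show "?cls x = ?cls y \<longleftrightarrow> (\<exists>a\<in>?B. x = y \<oplus>[fm R (rk G i)] a)"
  proof
   interpret F: module R "fm R (rk G i)" by (rule free_mod)
   interpret Fl: module l ?F by (rule l.free_mod)
   assume "?cls x = ?cls y"
   then obtain n where "n \<in> boundaries (fmod l kG) (fdif l kG) i" "?t x = ?t y \<oplus>[?F] n"
    using Q(5)[OF tZ[OF xy(1)] tZ[OF xy(2)]] by blast
   then obtain b where b: "b \<in> ?B" "?t x = ?t y \<oplus>[?F] ?t b" unfolding hom(2) by blast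
   have bZ: "b \<in> ?Z" using b(1) BZ by blast
   have yb: "y \<oplus>[fm R (rk G i)] b \<in> ?Z" by (rule submodule_add[OF Zs xy(2) bZ])
   obtain d where d: "d \<in> ?Z" "x = (y \<oplus>[fm R (rk G i)] b) \<oplus>[fm R (rk G i)] d"
    using F.ex_diff_mem[OF Zs xy(1) yb] by metis
   have "?t (y \<oplus>[fm R (rk G i)] b \<oplus>[fm R (rk G i)] d) = ?t (y \<oplus>[fm R (rk G i)] b)"
    using b(2) reduction_add[OF red, OF Zt[OF xy(2)] Zt[OF bZ]] d(2) by simp
   then have "d \<in> tuples (rk G i) \<mm>"
    using tuple_map_\<rho>_eq_iff[OF lc residue_reduction[folded l_def] Zt[OF yb] Zt[OF d(1)]] by blast
   then have "b \<oplus>[fm R (rk G i)] d \<in> ?B" using mB b(1) submodule_add[OF Bs] by blast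
   moreover have "x = y \<oplus>[fm R (rk G i)] (b \<oplus>[fm R (rk G i)] d)"
    unfolding d(2) using Zt xy bZ d(1) by (intro F.M.a_assoc) simp_all
   ultimately show "\<exists>a\<in>?B. x = y \<oplus>[fm R (rk G i)] a" by blast
  next
   assume "\<exists>a\<in>?B. x = y \<oplus>[fm R (rk G i)] a"
   then obtain a where a: "a \<in> ?B" "x = y \<oplus>[fm R (rk G i)] a" by blast
   have aZ: "a \<in> ?Z" using a(1) BZ by blast
   have "?t x = ?t y \<oplus>[?F] ?t a" unfolding a(2) by (rule reduction_add[OF red, OF Zt[OF xy(2)] Zt[OF aZ]])
   moreover have "?t a \<in> boundaries (fmod l kG) (fdif l kG) i" unfolding hom(2) using a(1) by (rule imageI)
   ultimately show "?cls x = ?cls y" using Q(5)[OF tZ[OF xy(1)] tZ[OF xy(2)]] by blast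
  qed
 next
  fix r x assume r: "r \<in> carrier R" and x: "x \<in> ?Z"
  show "?cls (r \<odot>[fm R (rk G i)] x) = \<rho> r \<odot>[?V] ?cls x"
   unfolding V using Q(4)[OF ring_hom_closed[OF residue_reduction(1) r, folded l_def] tZ[OF x]]
    reduction_smult[OF red, OF r Zt[OF x]] by simp
 qed
 then show ?thesis unfolding betti_def rkX free_pow .
qed

end

end

end

section \<open>Quotients of local rings\<close>

lemma local_noetherianI:
 assumes "local_ring R" "maximalideal \<mm> R"
 shows "local_noetherian R \<mm>"
proof -
 have R: "cring R" "noetherian_ring R" "\<exists>!M. maximalideal M R" using assms(1) unfolding local_ring_def by auto
 show ?thesis
  unfolding local_noetherian_def local_noetherian_axioms_def using R assms(2) by blast
qed

lemma (in local_noetherian) local_ring: "local_ring R"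
 unfolding local_ring_def using is_cring noetherian maximal unique by blast

lemma noetherian_ring_image:
 assumes R: "noetherian_ring R" and h: "ring_hom_ring R S h" and surj: "h ` carrier R = carrier S"
 shows "noetherian_ring S"
proof -
 interpret h: ring_hom_ring R S h by (rule h)
 show ?thesis
 proof (rule ring.noetherian_ringI[OF h.S.ring_axioms])
  fix Q assume Q: "ideal Q S"
  have P: "ideal {r \<in> carrier R. h r \<in> Q} R" by (rule h.ideal_vimage[OF Q])
  then obtain A where A: "A \<subseteq> carrier R" "finite A" "{r \<in> carrier R. h r \<in> Q} = Idl\<^bsub>R\<^esub> A"
   using noetherian_ring.finetely_gen[OF R] by blast
  have hA: "h ` A \<subseteq> carrier S" using A(1) surj by blast
  have AP: "A \<subseteq> {r \<in> carrier R. h r \<in> Q}" unfolding A(3) by (rule h.R.genideal_self[OF A(1)])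
  have G: "ideal (Idl\<^bsub>S\<^esub> (h ` A)) S" by (rule h.S.genideal_ideal[OF hA])
  have "Idl\<^bsub>R\<^esub> A \<subseteq> {r \<in> carrier R. h r \<in> Idl\<^bsub>S\<^esub> (h ` A)}"
   using A(1) h.S.genideal_self[OF hA] by (intro h.R.genideal_minimal[OF h.ideal_vimage[OF G]]) blast
  then have sub: "h r \<in> Idl\<^bsub>S\<^esub> (h ` A)" if "r \<in> carrier R" "h r \<in> Q" for r
   using that unfolding A(3)[symmetric] by blast
  have "Q \<subseteq> Idl\<^bsub>S\<^esub> (h ` A)"
  proof
   fix s assume s: "s \<in> Q"
   then have "s \<in> h ` carrier R" using ideal.Icarr[OF Q] surj by simp
   then show "s \<in> Idl\<^bsub>S\<^esub> (h ` A)" using sub s by (elim imageE) simp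
  qed
  moreover have "Idl\<^bsub>S\<^esub> (h ` A) \<subseteq> Q" using AP by (intro h.S.genideal_minimal[OF Q]) blast
  ultimately show "\<exists>B\<subseteq>carrier S. finite B \<and> Q = Idl\<^bsub>S\<^esub> B" using hA A(2) by blast
 qed
qed

lemma (in local_noetherian) local_noetherian_image:
 assumes S: "cring S" and h: "h \<in> ring_hom R S" and surj: "h ` carrier R = carrier S"
  and ker: "\<And>r. r \<in> carrier R ==> h r = \<zero>[S] ==> r \<in> \<mm>"
 shows "local_noetherian S (h ` \<mm>)" and "\<And>r. r \<in> carrier R ==> h r \<in> h ` \<mm> \<longleftrightarrow> r \<in> \<mm>"
proof -
 interpret S: cring S by (rule S)
 interpret h: ring_hom_ring R S h by (rule ring_hom_ringI2[OF ring_axioms S.ring_axioms h])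
 have N: "ideal (h ` \<mm>) S"
 proof (rule idealI[OF S.ring_axioms])
  show "subgroup (h ` \<mm>) (add_monoid S)"
   by (rule group_hom.subgroup_img_is_subgroup[OF h.a_group_hom additive_subgroup.a_subgroup[OF ideal.axioms(1)[OF ideal_\<mm>]]])
  fix a x assume "a \<in> h ` \<mm>" "x \<in> carrier S"
  then obtain m r where m: "m \<in> \<mm>" "a = h m" and r: "r \<in> carrier R" "x = h r" using surj by blast
  show "x \<otimes>\<^bsub>S\<^esub> a \<in> h ` \<mm>" "a \<otimes>\<^bsub>S\<^esub> x \<in> h ` \<mm>"
   unfolding m(2) r(2) ring_hom_mult[OF h r(1) \<mm>_carrier[OF m(1)], symmetric] ring_hom_mult[OF h \<mm>_carrier[OF m(1)] r(1), symmetric]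
   using ideal.I_l_closed[OF ideal_\<mm> m(1) r(1)] ideal.I_r_closed[OF ideal_\<mm> m(1) r(1)] by simp_all
 qed
 show mem: "h r \<in> h ` \<mm> \<longleftrightarrow> r \<in> \<mm>" if r: "r \<in> carrier R" for r
 proof
  assume "h r \<in> h ` \<mm>"
  then obtain m where m: "m \<in> \<mm>" "h r = h m" by blast
  have mc: "m \<in> carrier R" using \<mm>_carrier m(1) .
  have "h (r \<ominus> m) = \<zero>[S]" using r mc m(2) by (simp add: a_minus_def S.r_neg)
  then have "r \<ominus> m \<in> \<mm>" using ker r mc by simp
  moreover have "r = (r \<ominus> m) \<oplus> m" using r mc by (simp add: a_minus_def a_assoc l_neg)
  ultimately show "r \<in> \<mm>"
   using additive_subgroup.a_closed[OF ideal.axioms(1)[OF ideal_\<mm>] _ m(1)] by metis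
 qed (rule imageI)
 have proper: "Q \<subseteq> h ` \<mm>" if Q: "ideal Q S" "Q \<noteq> carrier S" for Q
 proof -
  have "ideal {r \<in> carrier R. h r \<in> Q} R" by (rule h.ideal_vimage[OF Q(1)])
  moreover have "{r \<in> carrier R. h r \<in> Q} \<noteq> carrier R"
  proof
   assume "{r \<in> carrier R. h r \<in> Q} = carrier R"
   then have "h \<one> \<in> Q" using one_closed by blast
   then show False using ideal.one_imp_carrier[OF Q(1)] Q(2) by simp
  qed
  ultimately have sub: "{r \<in> carrier R. h r \<in> Q} \<subseteq> \<mm>" by (rule proper_subset_\<mm>)
  show ?thesis
  proof
   fix s assume s: "s \<in> Q"
   then have "s \<in> h ` carrier R" using ideal.Icarr[OF Q(1)] surj by simp
   then obtain r where "r \<in> carrier R" "s = h r" by (elim imageE) simp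
   then show "s \<in> h ` \<mm>" using s sub by blast
  qed
 qed
 have ne: "h ` \<mm> \<noteq> carrier S"
  using mem[OF one_closed] one_notin_\<mm> S.one_closed h.hom_one by metis
 have max: "maximalideal (h ` \<mm>) S"
 proof (rule maximalidealI[OF N])
  show "carrier S \<noteq> h ` \<mm>" using ne by simp
  fix Q assume "ideal Q S" "h ` \<mm> \<subseteq> Q" "Q \<subseteq> carrier S"
  then show "Q = h ` \<mm> \<or> Q = carrier S" using proper by blast
 qed
 show "local_noetherian S (h ` \<mm>)"
 proof (intro local_noetherian.intro local_noetherian_axioms.intro S)
  show "noetherian_ring S" by (rule noetherian_ring_image[OF noetherian h.ring_hom_ring_axioms surj])
  show "maximalideal (h ` \<mm>) S" by (rule max)
  fix M assume M: "maximalideal M S"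
  then have "M \<subseteq> h ` \<mm>" using proper[of M] maximalideal.axioms(1)[OF M] maximalideal.I_notcarr[OF M] by blast
  moreover have "h ` \<mm> \<subseteq> carrier S" using ideal.Icarr[OF N] by blast
  ultimately have "h ` \<mm> = M \<or> h ` \<mm> = carrier S" by (rule maximalideal.I_maximal[OF M N])
  then show "M = h ` \<mm>" using ne by blast
 qed
qed

lemma (in local_noetherian) quotient_facts:
 assumes J: "ideal J R" "J \<subseteq> \<mm>"
 defines "\<pi> \<equiv> \<lambda>r. J +> r"
 shows "local_noetherian (R Quot J) (\<pi> ` \<mm>)" and "\<pi> \<in> ring_hom R (R Quot J)" and "\<pi> ` carrier R = carrier (R Quot J)"
  and "\<And>r. r \<in> carrier R ==> \<pi> r \<in> \<pi> ` \<mm> \<longleftrightarrow> r \<in> \<mm>"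
  and "\<And>r. r \<in> carrier R ==> \<pi> r = \<zero>[R Quot J] \<longleftrightarrow> r \<in> J"
  and "surj_local_hom R (R Quot J) \<pi>"
proof -
 interpret J: ideal J R by (rule J(1))
 show h: "\<pi> \<in> ring_hom R (R Quot J)" unfolding \<pi>_def by (rule J.rcos_ring_hom)
 show surj: "\<pi> ` carrier R = carrier (R Quot J)" unfolding \<pi>_def FactRing_def A_RCOSETS_def' by auto
 show ker: "\<pi> r = \<zero>[R Quot J] \<longleftrightarrow> r \<in> J" if "r \<in> carrier R" for r
  unfolding \<pi>_def FactRing_def using that J.a_rcos_const J.a_rcos_self by auto
 have loc: "local_noetherian (R Quot J) (\<pi> ` \<mm>)" "\<And>r. r \<in> carrier R ==> \<pi> r \<in> \<pi> ` \<mm> \<longleftrightarrow> r \<in> \<mm>"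
  using local_noetherian_image[OF J.quotient_is_cring[OF is_cring] h surj] ker J(2) by blast+
 show "local_noetherian (R Quot J) (\<pi> ` \<mm>)" "\<And>r. r \<in> carrier R ==> \<pi> r \<in> \<pi> ` \<mm> \<longleftrightarrow> r \<in> \<mm>" by (fact loc)+
 show "surj_local_hom R (R Quot J) \<pi>"
  unfolding surj_local_hom_def max_ideal_eq local_noetherian.max_ideal_eq[OF loc(1)]
  using local_ring local_noetherian.local_ring[OF loc(1)] h surj by simp
qed

section \<open>Residue resolutions over quotients\<close>

context local_noetherian
begin

context
 fixes U :: "('u, 'v) ring_scheme" and \<pi> :: "'a => 'u" and \<nn> and K
 assumes U: "local_noetherian U \<nn>" and \<pi>: "\<pi> \<in> ring_hom R U" and \<pi>_surj: "\<pi> ` carrier R = carrier U"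
  and \<pi>_max: "\<And>r. r \<in> carrier R ==> \<pi> r \<in> \<nn> \<longleftrightarrow> r \<in> \<mm>"
  and KI: "ideal K R" and \<pi>_ker: "\<And>r. r \<in> carrier R ==> \<pi> r = \<zero>[U] \<longleftrightarrow> r \<in> K"
begin

interpretation U: local_noetherian U \<nn> by (rule U)

lemma lift_complex_reduction:
 assumes "\<And>i r c. r < rk G i ==> c < rk G (Suc i) ==> dif G (Suc i) r c \<in> carrier U"
 shows "reduction U \<pi> K (lift_complex R \<pi> G) G"
 unfolding reduction_def using lift_complex_simps[OF U \<pi> \<pi>_surj \<pi>_max assms] U.is_cring \<pi> \<pi>_surj KI \<pi>_ker by blast

text \<open>A free resolution of a module over the quotient, lifted to \<open>R\<close>, is exact modulo \<open>K\<close>.\<close>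

lemma lift_free_resolution:
 assumes G: "free_resolution U M G \<eta>"
 defines "X \<equiv> lift_complex R \<pi> G"
 shows "reduction U \<pi> K X G" and "matrices_over R X" and "rk X = rk G"
  and "complex_mod X (reg R) K (carrier R)"
  and "\<And>x i. x \<in> rcyc R X K (Suc i) ==> x \<in> rbnd R X K (Suc i)"
  and "\<And>x. x \<in> vec R (rk X 0) ==> \<eta> (tuple_map (rk X 0) \<pi> x) = \<zero>[M] \<longleftrightarrow> x \<in> rbnd R X K 0"
  and "\<eta> \<in> linear_maps U (fm U (rk X 0)) M" and "\<eta> ` tuples (rk X 0) (carrier U) = carrier M"
proof -
 have Gm: "dif G (Suc i) r c \<in> carrier U" if "r < rk G i" "c < rk G (Suc i)" for i r c
  using G that unfolding free_resolution_def by simp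
 show red: "reduction U \<pi> K X G" unfolding X_def by (rule lift_complex_reduction[OF Gm])
 show rk: "rk X = rk G" by (rule red_rk[OF red])
 show "matrices_over R X" by (rule reduction_matrices[OF red])
 have ex: "cycles (fmod U G) (fdif U G) (Suc i) = boundaries (fmod U G) (fdif U G) (Suc i)" for i
  using G unfolding free_resolution_def by simp
 show "complex_mod X (reg R) K (carrier R)" by (rule reduction_exact(1)[OF red ex])
 show "x \<in> rcyc R X K (Suc i) ==> x \<in> rbnd R X K (Suc i)" for x i
  by (rule reduction_exact(2)[OF red ex])
 have ker: "{x \<in> tuples (rk G 0) (carrier U). \<eta> x = \<zero>[M]} = boundaries (fmod U G) (fdif U G) 0"
  using G unfolding free_resolution_def fmod_def by simp
 show "\<eta> (tuple_map (rk X 0) \<pi> x) = \<zero>[M] \<longleftrightarrow> x \<in> rbnd R X K 0"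
  if "x \<in> vec R (rk X 0)" for x
  using reduction_iff(2)[OF red that[unfolded rk]] reduction_closed[OF red that] ker unfolding rk by blast
 show "\<eta> \<in> linear_maps U (fm U (rk X 0)) M" "\<eta> ` tuples (rk X 0) (carrier U) = carrier M"
  using G unfolding free_resolution_def fmod_def rk by simp_all
qed

lemma residue_resolution_lift:
 assumes K\<mm>: "K \<subseteq> \<mm>" and G: "free_resolution U (residue_module U) G \<eta>"
 shows "\<exists>v. residue_resolution K (lift_complex R \<pi> G) v \<and>
  (\<forall>r\<in>carrier R. \<eta> (tuple_map (rk G 0) \<pi> (r \<odot>[fm R (rk G 0)] v)) = residue_map U (\<pi> r))"
proof -
 define X where "X = lift_complex R \<pi> G"
 note X = lift_free_resolution[OF G, folded X_def]
 note red = X(1) and rk = X(3)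
 let ?F = "fm R (rk X 0)" and ?B = "rbnd R X K 0" and ?f = "\<lambda>x. \<eta> (tuple_map (rk X 0) \<pi> x)"
 interpret F: module R ?F by (rule free_mod)
 have M: "module U (residue_module U)" by (rule U.residue_field_facts(5))
 interpret M: module U "residue_module U" by (rule M)
 interpret l: cring "residue_field U" by (rule U.residue_field_facts(1))
 have smult: "r \<odot>[residue_module U] x = residue_map U r \<otimes>\<^bsub>residue_field U\<^esub> x"
  and carrier: "carrier (residue_module U) = carrier (residue_field U)"
  and zero: "\<zero>[residue_module U] = \<zero>[residue_field U]" for r x
  unfolding residue_module_def ring_as_module_def by simp_all
 have "\<one>\<^bsub>residue_field U\<^esub> \<in> \<eta> ` tuples (rk X 0) (carrier U)" unfolding X(8) carrier by simp
 then obtain g where g: "g \<in> tuples (rk X 0) (carrier U)" "\<eta> g = \<one>\<^bsub>residue_field U\<^esub>" by auto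
 obtain v where v: "v \<in> vec R (rk X 0)" "g = tuple_map (rk X 0) \<pi> v" using reduction_lift[OF red g(1)] by blast
 note cl = reduction_closed[OF red]
 have f_add: "?f (x \<oplus>[?F] y) = ?f x \<oplus>[residue_module U] ?f y"
  if "x \<in> vec R (rk X 0)" "y \<in> vec R (rk X 0)" for x y
  unfolding reduction_add[OF red that] using cl that by (intro linear_mapsD(2)[OF X(7)]) simp_all
 have f_v: "?f (r \<odot>[?F] v) = residue_map U (\<pi> r)" if r: "r \<in> carrier R" for r
 proof -
  have "?f (r \<odot>[?F] v) = \<pi> r \<odot>[residue_module U] \<eta> g"
   unfolding reduction_smult[OF red r v(1)] v(2) using cl v(1) ring_hom_closed[OF \<pi> r] by (intro linear_mapsD(3)[OF X(7)]) simp_all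
  then show ?thesis unfolding g(2) smult
   using ring_hom_closed[OF U.residue_field_facts(2) ring_hom_closed[OF \<pi> r]] by simp
 qed
 have "residue_resolution K X v"
  unfolding residue_resolution_def
 proof (intro conjI ballI allI subsetI)
  show "ideal K R" by (rule KI)
  show "x \<in> \<mm>" if "x \<in> K" for x using K\<mm> that by blast
  show "matrices_over R X" "complex_mod X (reg R) K (carrier R)" by (rule X(2,4))+
  show "v \<in> vec R (rk X 0)" by (rule v(1))
  show "x \<in> rbnd R X K (Suc i)" if "x \<in> rcyc R X K (Suc i)" for x i
   by (rule X(5)[OF that])
  fix r assume r: "r \<in> carrier R"
  have rv: "r \<odot>[?F] v \<in> vec R (rk X 0)" using F.smult_closed[OF r, of v] v(1) by simp
  show "r \<odot>[?F] v \<in> ?B \<longleftrightarrow> r \<in> \<mm>"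
   unfolding X(6)[OF rv, symmetric] f_v[OF r] zero
   using U.residue_field_facts(4)[OF ring_hom_closed[OF \<pi> r]] \<pi>_max[OF r] by simp
 next
  fix z assume z: "z \<in> vec R (rk X 0)"
  have "?f z \<in> carrier (residue_field U)"
   using linear_mapsD(1)[OF X(7)] cl[OF z] unfolding carrier by simp
  then obtain r where r: "r \<in> carrier R" "?f z = residue_map U (\<pi> r)"
   using residue_reduction(2)[OF U \<pi> \<pi>_surj \<pi>_max] by blast
  have rv: "r \<odot>[?F] v \<in> vec R (rk X 0)" using F.smult_closed[OF r(1), of v] v(1) by simp
  obtain u where u: "u \<in> vec R (rk X 0)" "z = r \<odot>[?F] v \<oplus>[?F] u"
   using F.ex_diff[of z "r \<odot>[?F] v"] z rv unfolding free_module_simps(1) by metis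
  have c: "?f (r \<odot>[?F] v) \<in> carrier (residue_module U)" "?f u \<in> carrier (residue_module U)"
   using linear_mapsD(1)[OF X(7)] cl[OF rv] cl[OF u(1)] by simp_all
  have "?f (r \<odot>[?F] v) \<oplus>[residue_module U] ?f u = ?f (r \<odot>[?F] v) \<oplus>[residue_module U] \<zero>[residue_module U]"
   unfolding M.M.r_zero[OF c(1)] f_add[OF rv u(1), symmetric] using u(2) r(2) f_v[OF r(1)] by simp
  then have "?f u = \<zero>[residue_module U]" using c M.M.add.l_cancel M.M.zero_closed by metis
  then have "u \<in> ?B" using X(6)[OF u(1)] by blast
  then show "\<exists>r\<in>carrier R. \<exists>u\<in>?B. z = r \<odot>[?F] v \<oplus>[?F] u" using r(1) u(2) by blast
 qed
 then show ?thesis using f_v unfolding X_def[symmetric] rk[symmetric] by blast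
qed

text \<open>The Betti numbers of the lifted complex modulo \<open>\<mm>\<close> are the coefficients of the Poincare series.\<close>

lemma poincare_series_lift:
 assumes K\<mm>: "K \<subseteq> \<mm>" and M: "\<exists>F \<epsilon>. free_resolution U M F \<epsilon>"
 shows "poincare_series U M = Abs_fps (\<lambda>i. of_nat
  (rbetti R (lift_complex R \<pi> (fst (chosen_resolution U M))) \<mm> i))"
proof -
 let ?G = "fst (chosen_resolution U M)"
 note X = lift_free_resolution[OF chosen_resolution[OF M]]
 have G: "dif ?G (Suc i) r c \<in> carrier U" if "r < rk ?G i" "c < rk ?G (Suc i)" for i r c
  using chosen_resolution[OF M] that unfolding free_resolution_def by simp
 have "complex_mod (lift_complex R \<pi> ?G) (reg R) \<mm> (carrier R)"
  by (rule complex_mod_mono[OF X(4) K\<mm> subset_refl])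
 from vdim_homology[OF U \<pi> \<pi>_surj \<pi>_max G this] show ?thesis
  unfolding poincare_series_def Tor_k_def res_tensor_k_def by simp
qed

end

end

section \<open>Resolutions of a quotient ring\<close>

context local_noetherian
begin

lemma identity_reduction:
 "local_noetherian R \<mm>" "(\<lambda>r. r) \<in> ring_hom R R" "(\<lambda>r. r) ` carrier R = carrier R"
 "r \<in> \<mm> \<longleftrightarrow> r \<in> \<mm>" "ideal {\<zero>} R" "r = \<zero> \<longleftrightarrow> r \<in> {\<zero>}"
 using local_noetherian_axioms zeroideal by (auto simp: ring_hom_def)

lemma tuple_map_identity: "x \<in> tuples n C ==> tuple_map n (\<lambda>r. r) x = x"
 by (intro tuples_eqI[of _ _ UNIV x]) (auto simp: tuple_map_def)

lemma bnd_zero: "matrices_over R X ==> rbnd R X {\<zero>} i = syzygy X i"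
proof (intro equalityI subsetI)
 assume X: "matrices_over R X"
 interpret P: module R "fm R (rk X i)" by (rule free_mod)
 {
  fix z assume "z \<in> rbnd R X {\<zero>} i"
  then obtain y w where yw: "y \<in> vec R (rk X (Suc i))" "w \<in> tuples (rk X i) {\<zero>}"
   "z = cdif X (reg R) (Suc i) y \<oplus>[fm R (rk X i)] w"
   unfolding bnd_def free_pow by blast
  have "cdif X (reg R) (Suc i) y \<in> carrier (fm R (rk X i))"
   using cdif_tuples[OF X regular carrier_sub yw(1)] by simp
  then have "z = cdif X (reg R) (Suc i) y"
   using yw(2,3) P.M.r_zero unfolding zero_tuples_free by simp
  then show "z \<in> syzygy X i" unfolding syzygy_def using yw(1) by blast
 next
  fix z assume "z \<in> syzygy X i"
  then obtain y where "y \<in> vec R (rk X (Suc i))" "z = cdif X (reg R) (Suc i) y"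
   unfolding syzygy_def by blast
  then show "z \<in> rbnd R X {\<zero>} i"
   using bnd_image[OF X regular ideal_submodule[OF zeroideal] carrier_sub] by simp
 }
qed

lemma exact_complex_lift:
 assumes F: "free_resolution R M F \<epsilon>"
 defines "X \<equiv> lift_complex R (\<lambda>r. r) F"
 shows "exact_complex X" and "rk X = rk F"
  and "\<And>x i. x \<in> vec R (rk F (Suc i)) ==> fdif R F (Suc i) x = cdif X (reg R) (Suc i) x"
  and "\<And>x. x \<in> vec R (rk F 0) ==> \<epsilon> x = \<zero>[M] \<longleftrightarrow> x \<in> syzygy X 0"
proof -
 note X = lift_free_resolution[OF identity_reduction F, folded X_def]
 show rk: "rk X = rk F" by (rule X(3))
 show "\<epsilon> x = \<zero>[M] \<longleftrightarrow> x \<in> syzygy X 0" if "x \<in> vec R (rk F 0)" for x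
  using X(6)[of x] that unfolding rk tuple_map_identity[OF that] bnd_zero[OF X(2)] .
 show "fdif R F (Suc i) x = cdif X (reg R) (Suc i) x" if x: "x \<in> vec R (rk F (Suc i))" for x i
 proof -
  have "cdif X (reg R) (Suc i) x \<in> vec R (rk F i)"
   using cdif_tuples[OF X(2) regular carrier_sub, of x i] x unfolding rk by blast
  from tuple_map_identity[OF this] reduction_fdif[OF X(1) x] show ?thesis unfolding tuple_map_identity[OF x] by simp
 qed
 have "\<exists>y\<in>vec R (rk X (Suc (Suc i))). x = cdif X (reg R) (Suc (Suc i)) y"
  if x: "x \<in> vec R (rk X (Suc i))" "cdif X (reg R) (Suc i) x \<in> tuples (rk X i) {\<zero>}" for i x
 proof -
  have "x \<in> rcyc R X {\<zero>} (Suc i)" unfolding cyc_Suc using x by blast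
  then have "x \<in> syzygy X (Suc i)" using X(5) bnd_zero[OF X(2)] by blast
  then show ?thesis unfolding syzygy_def by blast
 qed
 then show "exact_complex X" unfolding exact_complex_def using X(2,4) by simp
qed

lemma linear_maps_agree:
 assumes M: "module R M" and g: "g \<in> linear_maps R (fm R n) M" and h: "h \<in> linear_maps R (fm R n) M"
  and eq: "\<And>j. j < n ==> g (unit_vector R n j) = h (unit_vector R n j)" and x: "x \<in> vec R n"
 shows "g x = h x"
proof -
 have "lin_comb M n (\<lambda>j. g (unit_vector R n j)) x = lin_comb M n (\<lambda>j. h (unit_vector R n j)) x"
  unfolding lin_comb_def
 proof (rule abelian_monoid.finsum_cong'[OF abelian_group.axioms(1)[OF module.axioms(2)[OF M]] refl])
  show "(\<lambda>j. x j \<odot>[M] h (unit_vector R n j)) \<in> {..<n} \<rightarrow> carrier M"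
   using module.smult_closed[OF M tuples_mem[OF x]] linear_mapsD(1)[OF h] unit_vector_tuples by simp
 qed (use eq in simp)
 then show ?thesis unfolding linear_map_free_eq[OF M g x] linear_map_free_eq[OF M h x] .
qed

lemma free_module_lift:
 assumes M: "module R M" and N: "module R N" and p: "p \<in> linear_maps R N M" "p ` carrier N = carrier M"
  and g: "g \<in> linear_maps R (fm R n) M"
 shows "\<exists>e\<in>linear_maps R (fm R n) N. \<forall>x\<in>vec R n. p (e x) = g x"
proof -
 have "\<forall>j. \<exists>s. j < n \<longrightarrow> s \<in> carrier N \<and> g (unit_vector R n j) = p s"
 proof
  fix j
  have "g (unit_vector R n j) \<in> p ` carrier N"
   unfolding p(2) using linear_mapsD(1)[OF g] unit_vector_tuples[of n j] by simp
  then show "\<exists>s. j < n \<longrightarrow> s \<in> carrier N \<and> g (unit_vector R n j) = p s" by blast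
 qed
 then obtain s where s: "\<And>j. j < n ==> s j \<in> carrier N" "\<And>j. j < n ==> g (unit_vector R n j) = p (s j)" by metis
 have e: "lin_comb N n s \<in> linear_maps R (fm R n) N" by (rule lin_comb_linear[OF N s(1)])
 have "p (lin_comb N n s x) = g x" if "x \<in> vec R n" for x
  using linear_maps_agree[OF M linear_map_comp[OF e p(1)] g _ that] s lin_comb_unit_vector[OF N s(1)] by simp
 then show ?thesis using e by blast
qed

text \<open>The augmentation \<open>F\<^sub>0 \<rightarrow> R / J\<close> of a free resolution factors through a linear form \<open>e\<close> on \<open>F\<^sub>0\<close>.\<close>

lemma augmentation_lift:
 assumes J: "ideal J R" "J \<subseteq> \<mm>" and F: "free_resolution R (ring_as_module (R Quot J) (\<lambda>r. J +> r)) F \<epsilon>"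
 defines "X \<equiv> lift_complex R (\<lambda>r. r) F"
 shows "\<exists>e. e \<in> linear_maps R (fm R (rk X 0)) (reg R) \<and>
  (\<forall>x\<in>vec R (rk X 0). e x \<in> J \<longleftrightarrow> x \<in> syzygy X 0) \<and>
  (\<forall>r\<in>carrier R. \<exists>x\<in>vec R (rk X 0). \<exists>a\<in>J. r = e x \<oplus> a)"
proof -
 let ?\<pi> = "\<lambda>r. J +> r" and ?n = "rk F 0" and ?M = "ring_as_module (R Quot J) (\<lambda>r. J +> r)"
 interpret J: ideal J R by (rule J(1))
 note Q = quotient_facts[OF J]
 note X = exact_complex_lift[OF F, folded X_def]
 have \<pi>: "?\<pi> \<in> linear_maps R (reg R) ?M" by (rule ring_hom_linear[OF Q(2)])
 have Qc: "cring (R Quot J)" by (rule J.quotient_is_cring[OF is_cring])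
 have M: "module R ?M" by (rule ring_as_module_module[OF is_cring Qc Q(2)])
 have \<epsilon>: "\<epsilon> \<in> linear_maps R (fm R ?n) ?M" "\<epsilon> ` vec R ?n = carrier ?M"
  using F unfolding free_resolution_def fmod_def by simp_all
 have "?\<pi> ` carrier (reg R) = carrier ?M" using Q(3) by simp
 from free_module_lift[OF M regular \<pi> this \<epsilon>(1)] obtain e where e: "e \<in> linear_maps R (fm R ?n) (reg R)"
  and \<pi>e: "\<And>x. x \<in> vec R ?n ==> ?\<pi> (e x) = \<epsilon> x" by blast
 have ec: "e x \<in> carrier R" if "x \<in> vec R ?n" for x using linear_mapsD(1)[OF e, of x] that by simp
 have "e x \<in> J \<longleftrightarrow> x \<in> syzygy X 0" if x: "x \<in> vec R ?n" for x
  using Q(5)[OF ec[OF x]] X(4)[OF x] unfolding \<pi>e[OF x] by simp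
 moreover have "\<exists>x\<in>vec R ?n. \<exists>a\<in>J. r = e x \<oplus> a" if r: "r \<in> carrier R" for r
 proof -
  have "?\<pi> r \<in> carrier ?M" using ring_hom_closed[OF Q(2) r] by simp
  then obtain x where x: "x \<in> vec R ?n" "?\<pi> r = \<epsilon> x" unfolding \<epsilon>(2)[symmetric] by (elim imageE) simp
  have "r \<in> J +> e x" using x(2) J.a_rcos_self[OF r] unfolding \<pi>e[OF x(1), symmetric] by simp
  then obtain a where "a \<in> J" "r = a \<oplus> e x" unfolding a_r_coset_def' by blast
  then have "r = e x \<oplus> a" "a \<in> J" using a_comm[OF J.Icarr ec[OF x(1)], of a] by simp_all
  then show ?thesis using x(1) by (intro bexI)
 qed
 ultimately show ?thesis using e unfolding X(2) by blast
qed

section \<open>The linear part\<close>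

text \<open>The powers of \<open>\<mm>\<close> applied to a free module consist of the tuples with entries in these powers.\<close>

lemma ideal_times_free:
 assumes J: "ideal J R"
 shows "ideal_times_module R J (fm R n) = tuples n J"
proof
 let ?F = "fm R n"
 have "a \<odot>[?F] x \<in> tuples n J" if "a \<in> J" "x \<in> vec R n" for a x
  using tuples_mem[OF that(2)] ideal.I_r_closed[OF J that(1)] by auto
 then show "ideal_times_module R J ?F \<subseteq> tuples n J"
  unfolding ideal_times_module_def using ideal_tuples[OF J] by (intro Inter_lower) simp
 show "tuples n J \<subseteq> ideal_times_module R J ?F"
  unfolding ideal_times_module_def
 proof (intro subsetI InterI)
  fix y N assume y: "y \<in> tuples n J" and "N \<in> {N. submodule N R ?F \<and> (\<forall>a\<in>J. \<forall>x\<in>carrier ?F. a \<odot>[?F] x \<in> N)}"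
  then have N: "submodule N R ?F" "\<And>a x. a \<in> J ==> x \<in> carrier ?F ==> a \<odot>[?F] x \<in> N" by auto
  interpret F: module R ?F by (rule free_mod)
  have "y \<in> vec R n" using y tuples_mono[of J "carrier R"] ideal.Icarr[OF J] by blast
  then have "y = lin_comb ?F n (unit_vector R n) y" using free_module_decomp[OF is_cring] by simp
  also have "\<dots> \<in> N" unfolding lin_comb_def
   using tuples_mem[OF y] unit_vector_tuples by (intro F.submodule_finsum[OF N(1)] N(2)) simp_all
  finally show "y \<in> N" .
 qed
qed

lemma max_ideal_powers:
 "max_ideal R [^]\<^bsub>ideals_set R\<^esub> (0::nat) = carrier R"
 "max_ideal R [^]\<^bsub>ideals_set R\<^esub> (1::nat) = \<mm>"
 "max_ideal R [^]\<^bsub>ideals_set R\<^esub> (2::nat) = \<mm> \<cdot>\<^bsub>R\<^esub> \<mm>"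
proof -
 interpret C: comm_monoid "ideals_set R" by (rule ideals_set_is_comm_monoid)
 have m: "\<mm> \<in> carrier (ideals_set R)" unfolding ideals_set_def using ideal_\<mm> by simp
 have e: "\<one>\<^bsub>ideals_set R\<^esub> = carrier R" "A \<otimes>\<^bsub>ideals_set R\<^esub> B = A \<cdot>\<^bsub>R\<^esub> B" for A B
  unfolding ideals_set_def by simp_all
 show "max_ideal R [^]\<^bsub>ideals_set R\<^esub> (0::nat) = carrier R" using e(1) by simp
 show one: "max_ideal R [^]\<^bsub>ideals_set R\<^esub> (1::nat) = \<mm>"
  unfolding max_ideal_eq using C.nat_pow_eone[OF m] .
 show "max_ideal R [^]\<^bsub>ideals_set R\<^esub> (2::nat) = \<mm> \<cdot>\<^bsub>R\<^esub> \<mm>"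
  using C.nat_pow_Suc[of \<mm> 1] one unfolding max_ideal_eq e(2) numeral_2_eq_2 by simp
qed

text \<open>An element \<open>x\<close> of \<open>F\<^sub>i\<close> with differential in \<open>\<mm>\<^sup>2 F\<^sub>i\<^sub>-\<^sub>1\<close> represents a cycle of the linear part in filtration degree
 \<open>p = i\<close>.  There the boundaries vanish, because the filtration is constant on \<open>F\<^sub>i\<^sub>+\<^sub>1\<close>.  Hence acyclicity forces
 \<open>x\<close> into \<open>\<mm> F\<^sub>i\<close>.\<close>

lemma linear_part_cycle:
 assumes F: "\<And>i. fdif R F (Suc i) \<in> linear_maps R (fm R (rk F (Suc i))) (fm R (rk F i))"
  and minimal: "\<And>i x. x \<in> vec R (rk F (Suc i)) ==> fdif R F (Suc i) x \<in> tuples (rk F i) \<mm>"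
  and H: "carrier (homology (lin_mod R F (Suc i)) (lin_dif R F (Suc i)) (Suc i)) =
   {\<zero>[homology (lin_mod R F (Suc i)) (lin_dif R F (Suc i)) (Suc i)]}"
  and x: "x \<in> vec R (rk F (Suc i))" "fdif R F (Suc i) x \<in> tuples (rk F i) (\<mm> \<cdot>\<^bsub>R\<^esub> \<mm>)"
 shows "x \<in> tuples (rk F (Suc i)) \<mm>"
proof -
 let ?p = "Suc i" and ?F = "\<lambda>i. fm R (rk F i)" and ?m2 = "\<mm> \<cdot>\<^bsub>R\<^esub> \<mm>"
 let ?L = "lin_mod R F ?p" and ?d = "lin_dif R F ?p"
 let ?N = "tuples (rk F (Suc i)) \<mm>" and ?R = "vec R (rk F (Suc i))"
 have m2: "ideal ?m2 R" by (rule ideal_prod_is_ideal[OF ideal_\<mm> ideal_\<mm>])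
 have m2\<mm>: "tuples n ?m2 \<subseteq> tuples n \<mm>" for n
  using ideal_prod_inter[OF ideal_\<mm> ideal_\<mm>] by (intro tuples_mono) auto
 have \<mm>R: "tuples n \<mm> \<subseteq> vec R n" for n using \<mm>_carrier by (intro tuples_mono) auto
 have filt: "filt R F ?p (Suc i) = ?R" "filt R F (?p + 1) (Suc i) = ?N"
  "filt R F ?p i = tuples (rk F i) \<mm>" "filt R F (?p + 1) i = tuples (rk F i) ?m2"
  "filt R F ?p (Suc (Suc i)) = vec R (rk F (Suc (Suc i)))"
  "filt R F (?p + 1) (Suc (Suc i)) = vec R (rk F (Suc (Suc i)))"
  unfolding filt_def fmod_def using ideal_times_free carrier_ideal ideal_\<mm> m2 max_ideal_powers
  by (simp_all add: numeral_2_eq_2)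
 have L: "?L (Suc i) = quot_module ((?F (Suc i))\<lparr>carrier := ?R\<rparr>) ?N"
  "?L i = quot_module ((?F i)\<lparr>carrier := tuples (rk F i) \<mm>\<rparr>) (tuples (rk F i) ?m2)"
  "?L (Suc (Suc i)) = quot_module ((?F (Suc (Suc i)))\<lparr>carrier := vec R (rk F (Suc (Suc i)))\<rparr>) (vec R (rk F (Suc (Suc i))))"
  unfolding lin_mod_def filt unfolding fmod_def by simp_all
 have d: "?d (Suc i) = coset_map (?F i) (tuples (rk F i) ?m2) (fdif R F (Suc i))"
  "?d (Suc (Suc i)) = coset_map (?F (Suc i)) ?N (fdif R F (Suc (Suc i)))"
  unfolding lin_dif_def diff_Suc_1 filt unfolding fmod_def by simp_all
 note s = free_sub ideal_tuples
 note Q1 = quot_module_facts[OF free_mod s(1) s(2)[OF ideal_\<mm>] \<mm>R[of "rk F (Suc i)"], folded L(1)]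
 note Q0 = quot_module_facts[OF free_mod s(2)[OF ideal_\<mm>] s(2)[OF m2] m2\<mm>[of "rk F i"], folded L(2)]
 note Q2 = quot_module_facts[OF free_mod s(1) s(1) subset_refl[of "vec R (rk F (Suc (Suc i)))"], folded L(3)]
 interpret F1: module R "?F (Suc i)" by (rule free_mod)
 let ?c = "\<lambda>x. ?N +>\<^bsub>?F (Suc i)\<^esub> x"
 have zR: "\<zero>[?F (Suc i)] \<in> ?R" by (rule submodule_zero[OF s(1)])
 have cz: "?c \<zero>[?F (Suc i)] = ?N" by (rule Q1(6)[OF submodule_zero[OF s(2)[OF ideal_\<mm>]]])
 have "{x \<in> ?R. fdif R F (Suc i) x \<in> tuples (rk F i) ?m2} \<in> {N. submodule N R (?F (Suc i)) \<and> (\<forall>a\<in>\<mm>. \<forall>x\<in>carrier (?F (Suc i)). a \<odot>[?F (Suc i)] x \<in> N)}"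
 proof (intro CollectI conjI ballI)
  show "submodule {x \<in> ?R. fdif R F (Suc i) x \<in> tuples (rk F i) ?m2} R (?F (Suc i))"
   by (rule submodule_vimage[OF free_mod free_mod F s(1) s(2)[OF m2]])
  fix a x assume a: "a \<in> \<mm>" and x: "x \<in> carrier (?F (Suc i))"
  have xR: "x \<in> ?R" using x by simp
  show "a \<odot>[?F (Suc i)] x \<in> ?R" using F1.smult_closed[OF \<mm>_carrier[OF a] x] by simp
  show "fdif R F (Suc i) (a \<odot>[?F (Suc i)] x) \<in> tuples (rk F i) ?m2"
   unfolding linear_mapsD(3)[OF F \<mm>_carrier[OF a] x]
   using tuples_mem[OF minimal[OF xR]] a by (auto intro!: ideal_prod.prod)
 qed
 then have \<mm>2: "fdif R F (Suc i) n \<in> tuples (rk F i) ?m2" if "n \<in> ?N" for n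
  using that unfolding ideal_times_free[OF ideal_\<mm>, symmetric] ideal_times_module_def by blast
 have mem: "y \<in> ?c x ==> \<exists>n\<in>?N. y = n \<oplus>[?F (Suc i)] x" for y unfolding a_r_coset_def' by blast
 have self: "x \<in> ?c x"
 proof -
  have "\<zero>[?F (Suc i)] \<oplus>[?F (Suc i)] x \<in> ?c x"
   unfolding a_r_coset_def' using submodule_zero[OF s(2)[OF ideal_\<mm>]] by blast
  then show ?thesis using F1.M.l_zero[of x] x(1) unfolding free_module_simps(1) by metis
 qed
 have "?d (Suc i) (?c x) = tuples (rk F i) ?m2" unfolding d
 proof (rule coset_map_eq)
  show "?c x \<noteq> {}" using self by blast
  fix y assume "y \<in> ?c x"
  then obtain n where n: "n \<in> ?N" "y = n \<oplus>[?F (Suc i)] x" using mem by blast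
  have nc: "n \<in> carrier (?F (Suc i))" "x \<in> carrier (?F (Suc i))" using n(1) \<mm>R x(1) unfolding free_module_simps(1) by blast+
  have "fdif R F (Suc i) y \<in> tuples (rk F i) ?m2"
   unfolding n(2) linear_mapsD(2)[OF F nc] by (rule submodule_add[OF s(2)[OF m2] \<mm>2[OF n(1)] x(2)])
  then show "tuples (rk F i) ?m2 +>\<^bsub>?F i\<^esub> fdif R F (Suc i) y = tuples (rk F i) ?m2" by (rule Q0(6))
 qed
 then have Z: "?c x \<in> cycles ?L ?d (Suc i)"
  unfolding cycles_def diff_Suc_1 Q0(2) Q1(1) using x(1) by blast
 have B: "boundaries ?L ?d (Suc i) = {?N}"
 proof -
  let ?A = "vec R (rk F (Suc (Suc i)))"
  have z: "\<zero>[?F (Suc (Suc i))] \<in> ?A" by (rule submodule_zero[OF s(1)])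
  have "carrier (?L (Suc (Suc i))) = {?A}"
   unfolding Q2(1) using Q2(6) z by blast
  moreover have "?d (Suc (Suc i)) ?A = ?N"
   unfolding d
  proof (rule coset_map_eq)
   show "?A \<noteq> {}" using z by blast
   fix y assume "y \<in> ?A"
   from Q1(6)[OF minimal[OF this]] show "?N +>\<^bsub>?F (Suc i)\<^esub> fdif R F (Suc (Suc i)) y = ?N" .
  qed
  ultimately show ?thesis unfolding boundaries_def by simp
 qed
 let ?H = "homology ?L ?d (Suc i)"
 have "boundaries ?L ?d (Suc i) +>\<^bsub>(?L (Suc i))\<lparr>carrier := cycles ?L ?d (Suc i)\<rparr>\<^esub> (?c x) \<in> carrier ?H"
  unfolding homology_def quot_module_def A_RCOSETS_def' using Z by auto
 moreover have "carrier ?H = {{?N}}" unfolding H unfolding homology_def quot_module_def B by simp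
 moreover have "{?N} +>\<^bsub>(?L (Suc i))\<lparr>carrier := cycles ?L ?d (Suc i)\<rparr>\<^esub> (?c x) = {?N \<oplus>[?L (Suc i)] ?c x}"
  unfolding a_r_coset_def' by simp
 moreover have "?N \<oplus>[?L (Suc i)] ?c x = ?c x"
  using Q1(3)[OF zR x(1)] F1.M.l_zero[of x] x(1) unfolding cz free_module_simps(1) by simp
 ultimately have "?c x = ?N" unfolding B by simp
 then show ?thesis using self by simp
qed

lemma koszul_linear_complex:
 assumes "koszul_module R M"
 obtains F \<epsilon> where "free_resolution R M F \<epsilon>" "linear_complex (lift_complex R (\<lambda>r. r) F)"
proof -
 obtain F \<epsilon> where F: "free_resolution R M F \<epsilon>" "minimal_complex R F"
  "\<And>i p. i \<ge> 1 ==> carrier (homology (lin_mod R F p) (lin_dif R F p) i) = {\<zero>[homology (lin_mod R F p) (lin_dif R F p) i]}"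
  using assms unfolding koszul_module_def Let_def by (elim exE conjE) (rule that; blast)
 define X where "X = lift_complex R (\<lambda>r. r) F"
 note X = exact_complex_lift[OF F(1), folded X_def]
 have minimal: "fdif R F (Suc i) x \<in> tuples (rk F i) \<mm>" if "x \<in> vec R (rk F (Suc i))" for i x
 proof -
  have "boundaries (fmod R F) (fdif R F) (Suc i - 1) \<subseteq> ideal_times_module R (max_ideal R) (fmod R F (Suc i - 1))"
   using F(2) unfolding minimal_complex_def by (elim allE[of _ "Suc i"]) simp
  then have "boundaries (fmod R F) (fdif R F) i \<subseteq> tuples (rk F i) \<mm>"
   unfolding max_ideal_eq fmod_def ideal_times_free[OF ideal_\<mm>] by simp
  moreover have "fdif R F (Suc i) x \<in> boundaries (fmod R F) (fdif R F) i"
   unfolding boundaries_def fmod_def using that by simp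
  ultimately show ?thesis by blast
 qed
 have Fd: "dif F (Suc i) r c \<in> carrier R" if "r < rk F i" "c < rk F (Suc i)" for i r c
  using F(1) that unfolding free_resolution_def by simp
 have "fdif R F (Suc i) \<in> linear_maps R (fm R (rk F (Suc i))) (fm R (rk F i))" for i
  unfolding fdif_def mat_apply_eq_matrix_map free_pow diff_Suc_1
  using Fd by (intro matrix_map_linear regular)
 from linear_part_cycle[OF this minimal F(3)]
 have "fdif R F (Suc i) x \<in> tuples (rk F i) (\<mm> \<cdot>\<^bsub>R\<^esub> \<mm>) ==> x \<in> tuples (rk F (Suc i)) \<mm>"
  if "x \<in> vec R (rk F (Suc i))" for i x using that by simp
 then have "linear_complex X"
  unfolding linear_complex_def X(2) using X(1,3) minimal by simp
 then show ?thesis using that F(1) unfolding X_def by blast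
qed

text \<open>Since the kernel of the augmentation lies in \<open>\<mm> F\<^sub>0\<close>, the module \<open>F\<^sub>0\<close> has rank one.\<close>

lemma linear_complex_augmentation:
 assumes F: "linear_complex X" and J: "ideal J R" "J \<subseteq> \<mm>" and e: "e \<in> linear_maps R (fm R (rk X 0)) (reg R)"
  and ker: "\<And>x. x \<in> vec R (rk X 0) ==> e x \<in> J \<longleftrightarrow> x \<in> syzygy X 0"
  and one: "\<exists>x\<in>vec R (rk X 0). \<exists>a\<in>J. \<one> = e x \<oplus> a"
 shows "x \<in> vec R (rk X 0) ==> e x = \<zero> ==> x \<in> tuples (rk X 0) {\<zero>}"
  and "r \<in> carrier R ==> \<exists>x\<in>vec R (rk X 0). r = e x"
proof -
 let ?n = "rk X 0" and ?u = "unit_vector R (rk X 0)"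
 let ?F = "fm R ?n"
 interpret F: module R ?F by (rule free_mod)
 have ec: "e x \<in> carrier R" if "x \<in> vec R ?n" for x using linear_mapsD(1)[OF e, of x] that by simp
 have e_smult: "e (r \<odot>[?F] x) = r \<otimes> e x" if "r \<in> carrier R" "x \<in> vec R ?n" for r x
  using linear_mapsD(3)[OF e that(1), of x] that(2) by simp
 obtain x0 a where x0: "x0 \<in> vec R ?n" "a \<in> J" "\<one> = e x0 \<oplus> a" using one by blast
 have "\<exists>j<?n. e (?u j) \<notin> \<mm>"
 proof (rule ccontr)
  assume "\<not> (\<exists>j<?n. e (?u j) \<notin> \<mm>)"
  then have "lin_comb (reg R) ?n (\<lambda>j. e (?u j)) x0 \<in> \<mm>"
   using x0(1) by (intro lin_comb_in_submodule[OF regular ideal_submodule[OF ideal_\<mm>]]) auto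
  then have "e x0 \<in> \<mm>" using linear_map_free_eq[OF regular e x0(1)] by simp
  then have "\<one> \<in> \<mm>" unfolding x0(3)
   using x0(2) J(2) by (intro additive_subgroup.a_closed[OF ideal.axioms(1)[OF ideal_\<mm>]]) auto
  then show False using one_notin_\<mm> by simp
 qed
 then obtain j where j: "j < ?n" "e (?u j) \<notin> \<mm>" by blast
 have sc: "e (?u j) \<in> carrier R" by (rule ec[OF unit_vector_tuples])
 obtain t where t: "t \<in> carrier R" "t \<otimes> e (?u j) = \<one>" using unit_of_notin_\<mm>[OF sc j(2)] by blast
 have ju: "?u j \<in> vec R ?n" by (rule unit_vector_tuples)
 have only: "l = j" if l: "l < ?n" for l
 proof (rule ccontr)
  assume "l \<noteq> j"
  have lc: "e (?u l) \<in> carrier R" by (rule ec[OF unit_vector_tuples])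
  let ?c = "\<ominus> (e (?u l) \<otimes> t)"
  let ?y = "?u l \<oplus>[?F] ?c \<odot>[?F] ?u j"
  have cc: "?c \<in> carrier R" using lc t(1) by simp
  have cj: "?c \<odot>[?F] ?u j \<in> vec R ?n" using F.smult_closed[OF cc, of "?u j"] ju by simp
  have lu: "?u l \<in> vec R ?n" by (rule unit_vector_tuples)
  have yc: "?y \<in> vec R ?n" using F.M.add.m_closed[of "?u l" "?c \<odot>[?F] ?u j"] lu cj by simp
  have "e ?y = e (?u l) \<oplus> ?c \<otimes> e (?u j)"
   using linear_mapsD(2)[OF e, of "?u l" "?c \<odot>[?F] ?u j"] lu cj e_smult[OF cc ju] by simp
  also have "?c \<otimes> e (?u j) = \<ominus> (e (?u l) \<otimes> (t \<otimes> e (?u j)))"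
   using lc t(1) sc by (simp add: l_minus m_assoc)
  also have "e (?u l) \<oplus> \<dots> = \<zero>" unfolding t(2) using lc by (simp add: r_neg)
  finally have "e ?y \<in> J" using ideal.axioms(1)[OF J(1)] additive_subgroup.zero_closed by metis
  then have "?y \<in> syzygy X 0" using ker[OF yc] by blast
  then have "?y \<in> tuples ?n \<mm>"
   unfolding syzygy_def using linear_complexD(2)[OF F] by (elim imageE) simp
  then have "?y l \<in> \<mm>" using l by (rule tuples_mem)
  moreover have "?y l = \<one>" using l \<open>l \<noteq> j\<close> cc unfolding unit_vector_def by simp
  ultimately show False using one_notin_\<mm> by simp
 qed
 show "\<exists>x\<in>vec R ?n. r = e x" if r: "r \<in> carrier R"
 proof
  have "e ((r \<otimes> t) \<odot>[?F] ?u j) = (r \<otimes> t) \<otimes> e (?u j)" using e_smult ju r t(1) by simp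
  also have "\<dots> = r" using r t sc by (simp add: m_assoc)
  finally show "r = e ((r \<otimes> t) \<odot>[?F] ?u j)" by simp
  show "(r \<otimes> t) \<odot>[?F] ?u j \<in> vec R ?n" using F.smult_closed[of "r \<otimes> t" "?u j"] r t(1) ju by simp
 qed
 show "x \<in> tuples ?n {\<zero>}" if x: "x \<in> vec R ?n" and ex: "e x = \<zero>"
 proof -
  have xj: "x j \<in> carrier R" using tuples_mem[OF x j(1)] .
  have "x = x j \<odot>[?F] ?u j"
  proof (rule tuples_eqI[OF x])
   show "x j \<odot>[?F] ?u j \<in> vec R ?n" using F.smult_closed[OF xj, of "?u j"] ju by simp
   fix l assume "l < ?n"
   then have "l = j" by (rule only)
   then show "x l = (x j \<odot>[?F] ?u j) l" using j(1) xj by (simp add: unit_vector_def)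
  qed
  then have p: "x j \<otimes> e (?u j) = \<zero>" using e_smult[OF xj ju] ex by simp
  have "t \<otimes> (x j \<otimes> e (?u j)) = \<zero>" unfolding p by (rule r_null[OF t(1)])
  then have "x j \<otimes> (t \<otimes> e (?u j)) = \<zero>" unfolding m_lcomm[OF t(1) xj sc] .
  then have "x j = \<zero>" unfolding t(2) r_one[OF xj] .
  then have "x l = \<zero>" if "l < ?n" for l using only[OF that] by simp
  then have "x = (\<lambda>l\<in>{..<?n}. \<zero>)" by (intro tuples_eqI[OF x, of _ UNIV]) simp_all
  then show ?thesis by simp
 qed
qed

end

section \<open>The Golod property\<close>

context local_noetherian
begin

text \<open>The resolution of the residue field that defines Tor over \<open>R / J\<close>, lifted to \<open>R\<close>.\<close>

definition residue_complex :: "'a set => 'a free_complex" where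
 "residue_complex J = lift_complex R (\<lambda>r. J +> r) (fst (chosen_resolution (R Quot J) (residue_module (R Quot J))))"

lemma residue_complex_facts:
 assumes J: "ideal J R" "J \<subseteq> \<mm>"
 shows "\<exists>v. residue_resolution J (residue_complex J) v"
  and "poincare_series (R Quot J) (residue_module (R Quot J)) =
   Abs_fps (\<lambda>i. of_nat (rbetti R (residue_complex J) \<mm> i))"
proof -
 note Q = quotient_facts[OF J]
 note G = local_noetherian.chosen_residue_resolution[OF Q(1)]
 from G have ex: "\<exists>G \<eta>. free_resolution (R Quot J) (residue_module (R Quot J)) G \<eta>" by (intro exI)
 show "\<exists>v. residue_resolution J (residue_complex J) v"
  using residue_resolution_lift[OF Q(1-4) J(1) Q(5) J(2) G] unfolding residue_complex_def by blast
 show "poincare_series (R Quot J) (residue_module (R Quot J)) =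
   Abs_fps (\<lambda>i. of_nat (rbetti R (residue_complex J) \<mm> i))"
  unfolding residue_complex_def by (rule poincare_series_lift[OF Q(1-4) J(1) Q(5) J(2) ex])
qed

definition base_residue_complex :: "'a free_complex" where
 "base_residue_complex = lift_complex R (\<lambda>r. r) (fst (chosen_resolution R (residue_module R)))"

lemma base_residue_complex_facts:
 shows "\<exists>v. residue_resolution {\<zero>} base_residue_complex v"
  and "poincare_series R (residue_module R) =
   Abs_fps (\<lambda>i. of_nat (rbetti R base_residue_complex \<mm> i))"
proof -
 note G = chosen_residue_resolution
 from G have ex: "\<exists>G \<eta>. free_resolution R (residue_module R) G \<eta>" by (intro exI)
 have z: "{\<zero>} \<subseteq> \<mm>" using submodule_zero[OF ideal_submodule[OF ideal_\<mm>]] by simp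
 show "\<exists>v. residue_resolution {\<zero>} base_residue_complex v"
  using residue_resolution_lift[OF identity_reduction z G] unfolding base_residue_complex_def by blast
 show "poincare_series R (residue_module R) =
   Abs_fps (\<lambda>i. of_nat (rbetti R base_residue_complex \<mm> i))"
  unfolding base_residue_complex_def by (rule poincare_series_lift[OF identity_reduction z ex])
qed

text \<open>The Poincare series of the \<open>R\<close>-module \<open>R / J\<close> can be computed from a resolution of the residue field, by
 the symmetry of Tor.\<close>

lemma poincare_series_quotient:
 assumes J: "ideal J R" "J \<subseteq> \<mm>" and res: "residue_resolution {\<zero>} X v"
 shows "poincare_series R (ring_as_module (R Quot J) (\<lambda>r. J +> r)) =
  Abs_fps (\<lambda>i. of_nat (rbetti R X J i))"
proof -
 let ?M = "ring_as_module (R Quot J) (\<lambda>r. J +> r)"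
 let ?F = "lift_complex R (\<lambda>r. r) (fst (chosen_resolution R ?M))"
 note Q = quotient_facts[OF J]
 have ex: "\<exists>F \<epsilon>. free_resolution R ?M F \<epsilon>"
  by (rule free_resolution_ring_as_module[OF is_cring noetherian ideal.quotient_is_cring[OF J(1) is_cring] Q(2,3)])
 note G = chosen_resolution[OF ex]
 have z: "{\<zero>} \<subseteq> \<mm>" using submodule_zero[OF ideal_submodule[OF ideal_\<mm>]] by simp
 obtain e where e: "e \<in> linear_maps R (fm R (rk ?F 0)) (reg R)"
  "\<And>x. x \<in> vec R (rk ?F 0) ==> e x \<in> J \<longleftrightarrow> x \<in> syzygy ?F 0"
  "\<And>r. r \<in> carrier R ==> \<exists>x\<in>vec R (rk ?F 0). \<exists>a\<in>J. r = e x \<oplus> a"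
  using augmentation_lift[OF J G] by metis
 have "rbetti R ?F \<mm> i = rbetti R X J i" for i
  by (rule betti_balance[OF res exact_complex_lift(1)[OF G] J(1) e])
 then show ?thesis unfolding poincare_series_lift[OF identity_reduction z ex] by simp
qed

context
 fixes I
 assumes I: "ideal I R" "I \<subseteq> \<mm>"
  and koszul: "koszul_module R (ring_as_module (R Quot I) (\<lambda>r. I +> r))"
begin

text \<open>The two consequences of the Koszul condition that the main results use: in the homology of the resolution of
 the residue field with coefficients, the inclusions of \<open>\<mm> / I\<close> into \<open>R / I\<close> and of \<open>\<mm>I\<close> into \<open>I\<close> are zero.\<close>

lemma koszul_null:
 assumes res: "residue_resolution {\<zero>} X v"
 shows "max_ideal_null I X"
  and "z \<in> cyc X (reg R) {\<zero>} (\<mm> \<cdot>\<^bsub>R\<^esub> I) i ==> z \<in> bnd X (reg R) {\<zero>} I i"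
proof -
 obtain F \<epsilon> where F: "free_resolution R (ring_as_module (R Quot I) (\<lambda>r. I +> r)) F \<epsilon>" "linear_complex (lift_complex R (\<lambda>r. r) F)"
  by (rule koszul_linear_complex[OF koszul]) (rule that)
 define L where "L = lift_complex R (\<lambda>r. r) F"
 have L: "linear_complex L" unfolding L_def by (rule F(2))
 have Lex: "exact_complex L" by (rule linear_complexD(1)[OF L])
 obtain e where e: "e \<in> linear_maps R (fm R (rk L 0)) (reg R)"
  and ker: "\<And>x. x \<in> vec R (rk L 0) ==> e x \<in> I \<longleftrightarrow> x \<in> syzygy L 0"
  and surj: "\<And>r. r \<in> carrier R ==> \<exists>x\<in>vec R (rk L 0). \<exists>a\<in>I. r = e x \<oplus> a"
  using augmentation_lift[OF I F(1)] unfolding L_def by metis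
 show "max_ideal_null I X"
  by (rule linear_complex_max_ideal_null[OF L res I(1) e ker surj[OF one_closed]])
 have aug1: "x \<in> vec R (rk L 0) ==> e x = \<zero> ==> x \<in> tuples (rk L 0) {\<zero>}" for x
  by (rule linear_complex_augmentation(1)[OF L I e ker surj[OF one_closed]])
 have aug2: "\<exists>x\<in>vec R (rk L 0). r = e x" if "r \<in> carrier R" for r
  using that by (rule linear_complex_augmentation(2)[OF L I e ker surj[OF one_closed], rotated])
 note D = dif_linear[OF Lex, of 0]
 have D0: "cdif L (reg R) (Suc 0) x \<in> vec R (rk L 0)" if "x \<in> vec R (rk L (Suc 0))" for x
  using linear_mapsD(1)[OF D, of x] that by simp
 let ?q = "\<lambda>x. e (cdif L (reg R) (Suc 0) x)"
 have q: "?q \<in> linear_maps R (fm R (rk L (Suc 0))) (reg R)" by (rule linear_map_comp[OF D e])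
 have e0: "e y = \<zero>" if "y \<in> tuples (rk L 0) {\<zero>}" for y
  using linear_map_zero[OF free_mod regular e] that unfolding zero_tuples_free by simp
 have "?q x = \<zero> \<longleftrightarrow> x \<in> syzygy L (Suc 0)" if x: "x \<in> vec R (rk L (Suc 0))" for x
  using aug1[OF D0[OF x]] e0 dif_zero_iff[OF Lex x] by blast
 moreover have "?q ` vec R (rk L (Suc 0)) = I"
 proof (intro equalityI subsetI)
  fix y assume "y \<in> ?q ` vec R (rk L (Suc 0))"
  then obtain x where x: "x \<in> vec R (rk L (Suc 0))" "y = ?q x" by blast
  then show "y \<in> I" using ker[OF D0[OF x(1)]] unfolding syzygy_def by blast
 next
  fix y assume y: "y \<in> I"
  then obtain x where x: "x \<in> vec R (rk L 0)" "y = e x" using aug2[OF ideal.Icarr[OF I(1) y]] by blast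
  then have "x \<in> syzygy L 0" using ker y by blast
  then show "y \<in> ?q ` vec R (rk L (Suc 0))" unfolding syzygy_def x(2) by blast
 qed
 ultimately show "z \<in> cyc X (reg R) {\<zero>} (\<mm> \<cdot>\<^bsub>R\<^esub> I) i ==> z \<in> bnd X (reg R) {\<zero>} I i"
  by (rule linear_complex_cycle_in_ideal[OF L res I(1) q])
qed

context
 assumes I\<mm>: "I \<inter> (\<mm> \<cdot>\<^bsub>R\<^esub> \<mm>) = \<mm> \<cdot>\<^bsub>R\<^esub> I"
begin

text \<open>Over \<open>R / \<mm>I\<close> the ideal generated by \<open>I\<close> is a direct summand of the maximal ideal, because
 \<open>I \<inter> \<mm>\<^sup>2 = \<mm>I\<close>.\<close>

lemma null_quotient:
 assumes res: "residue_resolution (\<mm> \<cdot>\<^bsub>R\<^esub> I) S w"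
 shows "max_ideal_null I S"
proof -
 have m2: "ideal (\<mm> \<cdot>\<^bsub>R\<^esub> \<mm>) R" and mI: "ideal (\<mm> \<cdot>\<^bsub>R\<^esub> I) R" using ideal_prod_is_ideal ideal_\<mm> I(1) by auto
 have sub: "\<mm> \<cdot>\<^bsub>R\<^esub> \<mm> \<subseteq> \<mm>" "\<mm> \<cdot>\<^bsub>R\<^esub> I \<subseteq> I" using ideal_prod_inter ideal_\<mm> I(1) by blast+
 have "r \<odot>[reg R] x \<in> \<mm> \<cdot>\<^bsub>R\<^esub> \<mm>" if "r \<in> \<mm>" "x \<in> \<mm>" for r x
  using that by (simp add: ideal_prod.prod)
 moreover have "\<mm> \<cdot>\<^bsub>R\<^esub> \<mm> \<inter> I \<subseteq> \<mm> \<cdot>\<^bsub>R\<^esub> I" using I\<mm> by blast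
 ultimately obtain W where W: "submodule W R (reg R)" "\<mm> \<cdot>\<^bsub>R\<^esub> \<mm> \<subseteq> W" "W \<subseteq> \<mm>" "W \<inter> I \<subseteq> \<mm> \<cdot>\<^bsub>R\<^esub> I"
  "\<And>x. x \<in> \<mm> ==> \<exists>n\<in>I. \<exists>w\<in>W. x = n \<oplus>[reg R] w"
  using complement[OF regular ideal_submodule[OF I(1)] ideal_submodule[OF ideal_\<mm>] ideal_submodule[OF m2] ideal_submodule[OF mI] I(2) sub(1)]
  by metis
 show ?thesis by (rule max_ideal_null_complement[OF res I(1) sub(2) W(1,3,4,5)])
qed

theorem golod_quotient:
 "golod_hom R (R Quot (\<mm> \<cdot>\<^bsub>R\<^esub> I)) (\<lambda>r. (\<mm> \<cdot>\<^bsub>R\<^esub> I) +> r)"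
proof -
 let ?J = "\<mm> \<cdot>\<^bsub>R\<^esub> I" and ?M = "reg R"
 have J: "ideal ?J R" "?J \<subseteq> I" using ideal_prod_is_ideal ideal_prod_inter ideal_\<mm> I(1) by blast+
 have J\<mm>: "?J \<subseteq> \<mm>" using J(2) I(2) by blast
 have z: "{\<zero>} \<subseteq> A" if "ideal A R" for A using submodule_zero[OF ideal_submodule[OF that]] by simp
 let ?X = base_residue_complex and ?Y = "residue_complex I" and ?S = "residue_complex ?J"
 obtain v where X: "residue_resolution {\<zero>} ?X v" using base_residue_complex_facts(1) by blast
 obtain w where Y: "residue_resolution I ?Y w" using residue_complex_facts(1)[OF I] by blast
 obtain s where S: "residue_resolution ?J ?S s" using residue_complex_facts(1)[OF J(1) J\<mm>] by blast
 note null = koszul_null[OF X]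
 obtain n where n: "betti R ?X ?M I (carrier R) 1 = n"
  "\<And>i. n * betti R ?X ?M \<mm> (carrier R) (Suc i) = betti R ?X ?M I (carrier R) (Suc (Suc i)) + betti R ?X ?M ?J (carrier R) (Suc i)"
  "\<And>i. betti R ?S ?M I (carrier R) (Suc i) = n * betti R ?S ?M \<mm> (carrier R) i"
  by (rule betti_relations[OF I X null(2) S]) (assumption, rule that)
 have "Abs_fps (\<lambda>i. of_nat (betti R ?S ?M \<mm> (carrier R) i) :: rat) = Abs_fps (\<lambda>i. of_nat (betti R ?X ?M \<mm> (carrier R) i)) /
  (1 - fps_X * (Abs_fps (\<lambda>i. of_nat (betti R ?X ?M ?J (carrier R) i)) - 1))"
 proof (rule golod_series)
  show "betti R ?X ?M \<mm> (carrier R) i = (\<Sum>j\<le>i. betti R ?Y ?M \<mm> (carrier R) j * betti R ?X ?M I (carrier R) (i - j))" for i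
   by (rule betti_product_regular[OF X Y z[OF I(1)] null(1)])
  show "betti R ?S ?M \<mm> (carrier R) i = (\<Sum>j\<le>i. betti R ?Y ?M \<mm> (carrier R) j * betti R ?S ?M I (carrier R) (i - j))" for i
   by (rule betti_product_regular[OF S Y J(2) null_quotient[OF S]])
  show "betti R ?S ?M I (carrier R) 0 = 1" by (rule betti_regular_0[OF S I(1) J(2) I(2)])
  show "betti R ?X ?M I (carrier R) 0 = 1" by (rule betti_regular_0[OF X I(1) z[OF I(1)] I(2)])
  show "betti R ?X ?M ?J (carrier R) 0 = 1" by (rule betti_regular_0[OF X J(1) z[OF J(1)] J\<mm>])
  show "betti R ?X ?M \<mm> (carrier R) 0 = 1" by (rule betti_regular_0[OF X ideal_\<mm> z[OF ideal_\<mm>] subset_refl])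
 qed (fact n)+
 then show ?thesis
  unfolding golod_hom_def residue_complex_facts(2)[OF J(1) J\<mm>] base_residue_complex_facts(2) poincare_series_quotient[OF J(1) J\<mm> X]
  using quotient_facts(6)[OF J(1) J\<mm>] by simp
qed

end

end

end

section \<open>Chain maps between resolutions of the residue field\<close>

context local_noetherian
begin

lemma linear_maps_agree_mod:
 assumes M: "module R M" and N: "submodule N R M"
  and g: "g \<in> linear_maps R (fm R n) M" and h: "h \<in> linear_maps R (fm R n) M"
  and eq: "\<And>j. j < n ==> \<exists>u\<in>N. g (unit_vector R n j) = h (unit_vector R n j) \<oplus>[M] u" and x: "x \<in> vec R n"
 shows "\<exists>u\<in>N. g x = h x \<oplus>[M] u"
proof -
 interpret M: module R M by (rule M)
 have "\<forall>j. \<exists>u. j < n \<longrightarrow> u \<in> N \<and> g (unit_vector R n j) = h (unit_vector R n j) \<oplus>[M] u" using eq by blast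
 then obtain u where u: "\<And>j. j < n ==> u j \<in> N" "\<And>j. j < n ==> g (unit_vector R n j) = h (unit_vector R n j) \<oplus>[M] u j" by metis
 have uc: "u j \<in> carrier M" if "j < n" for j by (rule submodule_carrier[OF N u(1)[OF that]])
 have k: "lin_comb M n u \<in> linear_maps R (fm R n) M" by (rule lin_comb_linear[OF M uc])
 note hc = linear_mapsD(1)[OF h] and kc = linear_mapsD(1)[OF k]
 have hk: "(\<lambda>x. h x \<oplus>[M] lin_comb M n u x) \<in> linear_maps R (fm R n) M"
 proof (rule linear_mapsI)
  fix x y assume xy: "x \<in> carrier (fm R n)" "y \<in> carrier (fm R n)"
  show "h (x \<oplus>[fm R n] y) \<oplus>[M] lin_comb M n u (x \<oplus>[fm R n] y) =
   (h x \<oplus>[M] lin_comb M n u x) \<oplus>[M] (h y \<oplus>[M] lin_comb M n u y)"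
   unfolding linear_mapsD(2)[OF h xy] linear_mapsD(2)[OF k xy]
   using hc[OF xy(1)] hc[OF xy(2)] kc[OF xy(1)] kc[OF xy(2)] by (simp only: M.M.a_ac M.M.a_closed)
 next
  fix r x assume r: "r \<in> carrier R" and x: "x \<in> carrier (fm R n)"
  show "h (r \<odot>[fm R n] x) \<oplus>[M] lin_comb M n u (r \<odot>[fm R n] x) = r \<odot>[M] (h x \<oplus>[M] lin_comb M n u x)"
   unfolding linear_mapsD(3)[OF h r x] linear_mapsD(3)[OF k r x] by (rule M.smult_r_distr[OF r hc[OF x] kc[OF x], symmetric])
 qed (use hc kc in blast)
 have "g x = h x \<oplus>[M] lin_comb M n u x"
  using u(2) lin_comb_unit_vector[OF M uc] by (intro linear_maps_agree[OF M g hk _ x]) simp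
 moreover have "lin_comb M n u x \<in> N" by (rule lin_comb_in_submodule[OF M N u(1) x])
 ultimately show ?thesis by blast
qed

lemma matrix_of_columns:
 assumes "\<And>j. j < q ==> s j \<in> vec R p"
 shows "matrix_map (reg R) p q (\<lambda>r c. s c r) \<in> linear_maps R (fm R q) (fm R p)"
  and "j < q ==> matrix_map (reg R) p q (\<lambda>r c. s c r) (unit_vector R q j) = s j"
proof -
 have sc: "\<And>j. j < q ==> s j \<in> carrier (fm R p)" using assms by simp
 show "matrix_map (reg R) p q (\<lambda>r c. s c r) \<in> linear_maps R (fm R q) (fm R p)"
  unfolding free_pow using tuples_mem[OF assms] by (intro matrix_map_linear regular)
 show "j < q ==> matrix_map (reg R) p q (\<lambda>r c. s c r) (unit_vector R q j) = s j"
  using mat_apply_eq_lin_comb[OF sc unit_vector_tuples] lin_comb_unit_vector[OF free_mod sc]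
  unfolding mat_apply_eq_matrix_map by simp
qed

context
 fixes I X v Y w
 assumes I: "ideal I R" and resX: "residue_resolution {\<zero>} X v" and resY: "residue_resolution I Y w"
begin

text \<open>The comparison map is constructed degree by degree.  The condition that it maps the boundaries of \<open>X\<close> to
 boundaries of \<open>Y\<close> modulo \<open>I\<close> allows the next step, and is inherited because \<open>Y\<close> is exact modulo \<open>I\<close>.\<close>

lemma chain_step:
 assumes A: "\<And>r c. r < rk Y i ==> c < rk X i ==> A r c \<in> carrier R"
  and inv: "\<And>x. x \<in> vec R (rk X (Suc i)) ==>
   matrix_map (reg R) (rk Y i) (rk X i) A (cdif X (reg R) (Suc i) x) \<in> rbnd R Y I i"
 shows "\<exists>B. (\<forall>r<rk Y (Suc i). \<forall>c<rk X (Suc i). B r c \<in> carrier R) \<and>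
  (\<forall>x\<in>vec R (rk X (Suc (Suc i))).
   matrix_map (reg R) (rk Y (Suc i)) (rk X (Suc i)) B (cdif X (reg R) (Suc (Suc i)) x)
    \<in> rbnd R Y I (Suc i)) \<and>
  (\<forall>x\<in>vec R (rk X (Suc i)). \<exists>u\<in>tuples (rk Y i) I.
   matrix_map (reg R) (rk Y i) (rk X i) A (cdif X (reg R) (Suc i) x) =
   cdif Y (reg R) (Suc i) (matrix_map (reg R) (rk Y (Suc i)) (rk X (Suc i)) B x)
    \<oplus>[pow (reg R) (rk Y i)] u)"
proof -
 let ?M = "reg R" and ?q = "rk X (Suc i)" and ?Q = "fm R (rk Y i)"
 let ?A = "matrix_map ?M (rk Y i) (rk X i) A"
 note mX = matrices[OF resX] and mY = matrices[OF resY] and FM = free_mod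
 interpret Q: module R ?Q by (rule FM)
 have Al: "?A \<in> linear_maps R (fm R (rk X i)) ?Q"
  unfolding free_pow using A by (intro matrix_map_linear regular)
 have dX: "cdif X ?M (Suc j) \<in> linear_maps R (fm R (rk X (Suc j))) (fm R (rk X j))"
  and dY: "cdif Y ?M (Suc j) \<in> linear_maps R (fm R (rk Y (Suc j))) (fm R (rk Y j))" for j
  using cdif_linear[OF mX regular] cdif_linear[OF mY regular] unfolding free_pow .
 have "\<forall>j. \<exists>y. j < ?q \<longrightarrow> y \<in> vec R (rk Y (Suc i)) \<and>
  (\<exists>u\<in>tuples (rk Y i) I. ?A (cdif X ?M (Suc i) (unit_vector R ?q j)) = cdif Y ?M (Suc i) y \<oplus>[?Q] u)"
  using inv[OF unit_vector_tuples] unfolding bnd_def free_pow[symmetric] by blast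
 then obtain s where s: "\<And>j. j < ?q ==> s j \<in> vec R (rk Y (Suc i))"
  "\<And>j. j < ?q ==> \<exists>u\<in>tuples (rk Y i) I. ?A (cdif X ?M (Suc i) (unit_vector R ?q j)) = cdif Y ?M (Suc i) (s j) \<oplus>[?Q] u"
  by metis
 let ?B = "matrix_map ?M (rk Y (Suc i)) ?q (\<lambda>r c. s c r)"
 have B1: "?B \<in> linear_maps R (fm R ?q) (fm R (rk Y (Suc i)))" by (rule matrix_of_columns(1)[OF s(1)])
 have B2: "?B (unit_vector R ?q j) = s j" if "j < ?q" for j by (rule matrix_of_columns(2)[OF s(1) that])
 have chain: "\<exists>u\<in>tuples (rk Y i) I. ?A (cdif X ?M (Suc i) x) = cdif Y ?M (Suc i) (?B x) \<oplus>[?Q] u"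
  if x: "x \<in> vec R ?q" for x
 proof (rule linear_maps_agree_mod[OF FM ideal_tuples[OF I] linear_map_comp[OF dX Al] linear_map_comp[OF B1 dY] _ x])
  fix j assume j: "j < ?q"
  show "\<exists>u\<in>tuples (rk Y i) I. ?A (cdif X ?M (Suc i) (unit_vector R ?q j)) = cdif Y ?M (Suc i) (?B (unit_vector R ?q j)) \<oplus>[?Q] u"
   unfolding B2[OF j] by (rule s(2)[OF j])
 qed
 have "?B (cdif X ?M (Suc (Suc i)) x) \<in> bnd Y ?M I (carrier R) (Suc i)" if x: "x \<in> vec R (rk X (Suc (Suc i)))" for x
 proof -
  let ?y = "cdif X ?M (Suc (Suc i)) x"
  have y: "?y \<in> vec R ?q" using linear_mapsD(1)[OF dX, of x] x by simp
  have By: "?B ?y \<in> vec R (rk Y (Suc i))" using linear_mapsD(1)[OF B1, of ?y] y by simp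
  have "cdif X ?M (Suc i) ?y \<in> tuples (rk X i) {\<zero>}" using complex[OF resX] x unfolding complex_mod_def by blast
  then have "?A (cdif X ?M (Suc i) ?y) = \<zero>[?Q]"
   using linear_map_zero[OF FM FM Al] unfolding zero_tuples_free by simp
  then obtain u where u: "u \<in> tuples (rk Y i) I" "cdif Y ?M (Suc i) (?B ?y) \<oplus>[?Q] u = \<zero>[?Q]" using chain[OF y] by metis
  have "cdif Y ?M (Suc i) (?B ?y) \<in> tuples (rk Y i) I"
  proof (rule Q.submodule_cancel2[OF ideal_tuples[OF I] u(1)])
   show "cdif Y ?M (Suc i) (?B ?y) \<in> carrier ?Q" using linear_mapsD(1)[OF dY, of "?B ?y"] By by simp
   show "cdif Y ?M (Suc i) (?B ?y) \<oplus>[?Q] u \<in> tuples (rk Y i) I"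
    unfolding u(2) by (rule submodule_zero[OF ideal_tuples[OF I]])
  qed
  then have "?B ?y \<in> cyc Y ?M I (carrier R) (Suc i)" unfolding cyc_Suc using By by blast
  then show ?thesis by (rule exact[OF resY])
 qed
 moreover have "\<forall>r<rk Y (Suc i). \<forall>c<?q. s c r \<in> carrier R" using tuples_mem[OF s(1)] by blast
 ultimately show ?thesis
  using chain unfolding free_pow by (intro exI[of _ "\<lambda>r c. s c r"] conjI ballI)
qed

lemma chain_map_exists:
 assumes A: "\<And>r c. r < rk Y 0 ==> c < rk X 0 ==> A r c \<in> carrier R"
  and inv: "\<And>x. x \<in> vec R (rk X (Suc 0)) ==>
   matrix_map (reg R) (rk Y 0) (rk X 0) A (cdif X (reg R) (Suc 0) x) \<in> rbnd R Y I 0"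
 shows "\<exists>\<Phi>. \<Phi> 0 = A \<and> (\<forall>i. \<forall>r<rk Y i. \<forall>c<rk X i. \<Phi> i r c \<in> carrier R) \<and>
  (\<forall>i. \<forall>x\<in>vec R (rk X (Suc i)). \<exists>u\<in>tuples (rk Y i) I.
   matrix_map (reg R) (rk Y i) (rk X i) (\<Phi> i) (cdif X (reg R) (Suc i) x) =
   cdif Y (reg R) (Suc i) (matrix_map (reg R) (rk Y (Suc i)) (rk X (Suc i)) (\<Phi> (Suc i)) x)
    \<oplus>[pow (reg R) (rk Y i)] u)"
proof -
 let ?M = "reg R"
 let ?P = "\<lambda>i B. (i = 0 \<longrightarrow> B = A) \<and> (\<forall>r<rk Y i. \<forall>c<rk X i. B r c \<in> carrier R) \<and>
  (\<forall>x\<in>vec R (rk X (Suc i)). matrix_map ?M (rk Y i) (rk X i) B (cdif X ?M (Suc i) x) \<in> bnd Y ?M I (carrier R) i)"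
 let ?C = "\<lambda>i B B'. \<forall>x\<in>vec R (rk X (Suc i)). \<exists>u\<in>tuples (rk Y i) I.
   matrix_map ?M (rk Y i) (rk X i) B (cdif X ?M (Suc i) x) =
   cdif Y ?M (Suc i) (matrix_map ?M (rk Y (Suc i)) (rk X (Suc i)) B' x) \<oplus>[pow ?M (rk Y i)] u"
 have "\<exists>\<Phi>. \<forall>i. ?P i (\<Phi> i) \<and> ?C i (\<Phi> i) (\<Phi> (Suc i))"
 proof (rule dependent_nat_choice)
  show "\<exists>B. ?P 0 B" using A inv by (intro exI[of _ A]) simp
  fix B i assume "?P i B"
  then have "\<And>r c. r < rk Y i ==> c < rk X i ==> B r c \<in> carrier R"
   "\<And>x. x \<in> vec R (rk X (Suc i)) ==> matrix_map ?M (rk Y i) (rk X i) B (cdif X ?M (Suc i) x) \<in> bnd Y ?M I (carrier R) i"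
   by auto
  then have "\<exists>B'. (\<forall>r<rk Y (Suc i). \<forall>c<rk X (Suc i). B' r c \<in> carrier R) \<and>
   (\<forall>x\<in>vec R (rk X (Suc (Suc i))). matrix_map ?M (rk Y (Suc i)) (rk X (Suc i)) B' (cdif X ?M (Suc (Suc i)) x) \<in> bnd Y ?M I (carrier R) (Suc i)) \<and>
   ?C i B B'" by (rule chain_step)
  then obtain B' where "\<forall>r<rk Y (Suc i). \<forall>c<rk X (Suc i). B' r c \<in> carrier R"
   "\<forall>x\<in>vec R (rk X (Suc (Suc i))). matrix_map ?M (rk Y (Suc i)) (rk X (Suc i)) B' (cdif X ?M (Suc (Suc i)) x) \<in> bnd Y ?M I (carrier R) (Suc i)"
   "?C i B B'" by (elim exE conjE) (rule that)
  then show "\<exists>B'. ?P (Suc i) B' \<and> ?C i B B'" by (intro exI[of _ B'] conjI impI) simp_all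
 qed
 then obtain \<Phi> where \<Phi>: "\<forall>i. ?P i (\<Phi> i) \<and> ?C i (\<Phi> i) (\<Phi> (Suc i))" by (rule exE)
 note P = conjunct1[OF spec[OF \<Phi>]] and C = conjunct2[OF spec[OF \<Phi>]]
 show ?thesis
 proof (intro exI[of _ \<Phi>] conjI)
  show "\<Phi> 0 = A" using P[of 0] by simp
  show "\<forall>i. \<forall>r<rk Y i. \<forall>c<rk X i. \<Phi> i r c \<in> carrier R" using P by blast
 qed (rule allI, rule C)
qed

text \<open>The chain map starts with multiplication of \<open>w\<close> by a linear form \<open>e\<close> that lifts the augmentation
 of \<open>X\<close>.\<close>

context
 fixes e
 assumes e: "e \<in> linear_maps R (fm R (rk X 0)) (reg R)"
  and e_bnd: "\<And>x. x \<in> vec R (rk X 0) ==> x \<in> rbnd R X {\<zero>} 0 ==> e x \<in> \<mm>"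
  and e_v: "\<exists>m\<in>\<mm>. \<one> = e v \<oplus> m"
begin

abbreviation (input) start :: "nat => nat => 'a" where
 "start \<equiv> \<lambda>r c. e (unit_vector R (rk X 0) c) \<otimes> w r"

lemma start_apply:
 assumes x: "x \<in> vec R (rk X 0)"
 shows "matrix_map (reg R) (rk Y 0) (rk X 0) start x = e x \<odot>[fm R (rk Y 0)] w"
proof -
 let ?q = "rk X 0" and ?Q = "fm R (rk Y 0)"
 interpret Q: module R ?Q by (rule free_mod)
 have wc: "w \<in> carrier ?Q" using v[OF resY] by simp
 have ec: "e x \<in> carrier R" if "x \<in> vec R ?q" for x using linear_mapsD(1)[OF e, of x] that by simp
 let ?s = "\<lambda>c. e (unit_vector R ?q c) \<odot>[?Q] w"
 have s: "?s c \<in> vec R (rk Y 0)" for c using Q.smult_closed[OF ec[OF unit_vector_tuples] wc] by simp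
 note S = matrix_of_columns[of ?q ?s "rk Y 0", OF s]
 have "matrix_map (reg R) (rk Y 0) ?q start x = matrix_map (reg R) (rk Y 0) ?q (\<lambda>r c. ?s c r) x"
  unfolding matrix_map_def by (intro restrict_ext) simp
 also have "\<dots> = e x \<odot>[?Q] w"
 proof (rule linear_maps_agree[OF free_mod S(1) _ S(2) x])
  show "(\<lambda>x. e x \<odot>[?Q] w) \<in> linear_maps R (fm R ?q) ?Q"
  proof (rule linear_mapsI)
   fix x y assume xy: "x \<in> carrier (fm R ?q)" "y \<in> carrier (fm R ?q)"
   show "e x \<odot>[?Q] w \<in> carrier ?Q" using Q.smult_closed[OF ec wc] xy(1) by simp
   show "e (x \<oplus>[fm R ?q] y) \<odot>[?Q] w = e x \<odot>[?Q] w \<oplus>[?Q] e y \<odot>[?Q] w"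
    unfolding linear_mapsD(2)[OF e xy] using Q.smult_l_distr[OF ec ec wc] xy by simp
  next
   fix r x assume r: "r \<in> carrier R" and x: "x \<in> carrier (fm R ?q)"
   show "e (r \<odot>[fm R ?q] x) \<odot>[?Q] w = r \<odot>[?Q] (e x \<odot>[?Q] w)"
    unfolding linear_mapsD(3)[OF e r x] using Q.smult_assoc1[OF r ec wc] x by simp
  qed
 qed
 finally show ?thesis .
qed

lemma residue_chain_map:
 shows "\<exists>\<Phi>. (\<forall>x\<in>vec R (rk X 0).
   matrix_map (reg R) (rk Y 0) (rk X 0) (\<Phi> 0) x = e x \<odot>[fm R (rk Y 0)] w) \<and>
  (\<forall>i. \<forall>r<rk Y i. \<forall>c<rk X i. \<Phi> i r c \<in> carrier R) \<and>
  (\<forall>i. \<forall>x\<in>vec R (rk X (Suc i)). \<exists>u\<in>tuples (rk Y i) I.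
   matrix_map (reg R) (rk Y i) (rk X i) (\<Phi> i) (cdif X (reg R) (Suc i) x) =
   cdif Y (reg R) (Suc i) (matrix_map (reg R) (rk Y (Suc i)) (rk X (Suc i)) (\<Phi> (Suc i)) x)
    \<oplus>[pow (reg R) (rk Y i)] u)"
proof -
 let ?M = "reg R"
 have ec: "e x \<in> carrier R" if "x \<in> vec R (rk X 0)" for x using linear_mapsD(1)[OF e, of x] that by simp
 have "start r c \<in> carrier R" if "r < rk Y 0" for r c
  using ec[OF unit_vector_tuples] tuples_mem[OF v[OF resY] that] by simp
 moreover have "matrix_map ?M (rk Y 0) (rk X 0) start (cdif X ?M (Suc 0) x) \<in> bnd Y ?M I (carrier R) 0"
  if x: "x \<in> vec R (rk X (Suc 0))" for x
 proof -
  have dx: "cdif X ?M (Suc 0) x \<in> vec R (rk X 0)"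
   by (rule cdif_tuples[OF matrices[OF resX] regular carrier_sub x])
  have "cdif X ?M (Suc 0) x \<in> bnd X ?M {\<zero>} (carrier R) 0"
   by (rule bnd_image[OF matrices[OF resX] regular ideal_submodule[OF zeroideal] carrier_sub x])
  from e_bnd[OF dx this] show ?thesis unfolding start_apply[OF dx] using aug_iff[OF resY ec[OF dx]] by blast
 qed
 ultimately obtain \<Phi> where \<Phi>: "\<Phi> 0 = start" "\<forall>i. \<forall>r<rk Y i. \<forall>c<rk X i. \<Phi> i r c \<in> carrier R"
  "\<forall>i. \<forall>x\<in>vec R (rk X (Suc i)). \<exists>u\<in>tuples (rk Y i) I.
   matrix_map ?M (rk Y i) (rk X i) (\<Phi> i) (cdif X ?M (Suc i) x) =
   cdif Y ?M (Suc i) (matrix_map ?M (rk Y (Suc i)) (rk X (Suc i)) (\<Phi> (Suc i)) x) \<oplus>[pow ?M (rk Y i)] u"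
  using chain_map_exists[of start] by auto
 show ?thesis using \<Phi>(2,3) start_apply unfolding \<Phi>(1)[symmetric] by (intro exI[of _ \<Phi>] conjI ballI)
qed

lemma start_surj:
 assumes y: "y \<in> vec R (rk Y 0)"
 shows "\<exists>x\<in>vec R (rk X 0). \<exists>u\<in>rbnd R Y I 0.
  y = e x \<odot>[fm R (rk Y 0)] w \<oplus>[fm R (rk Y 0)] u"
proof -
 let ?M = "reg R" and ?Q = "fm R (rk Y 0)" and ?F = "fm R (rk X 0)"
 interpret Q: module R ?Q by (rule free_mod)
 interpret F: module R ?F by (rule free_mod)
 have wc: "w \<in> carrier ?Q" and vc: "v \<in> carrier ?F" using v[OF resY] v[OF resX] by simp_all
 have evc: "e v \<in> carrier R" using linear_mapsD(1)[OF e vc] by simp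
 obtain r u where r: "r \<in> carrier R" "u \<in> bnd Y ?M I (carrier R) 0" "y = r \<odot>[?Q] w \<oplus>[?Q] u"
  using aug[OF resY y] by blast
 obtain m where m: "m \<in> \<mm>" "\<one> = e v \<oplus> m" using e_v by blast
 have mc: "m \<in> carrier R" using \<mm>_carrier m(1) .
 let ?x = "r \<odot>[?F] v"
 have B: "submodule (bnd Y ?M I (carrier R) 0) R ?Q"
  unfolding free_pow
  by (rule bnd_submodule[OF matrices[OF resY] regular ideal_submodule[OF I] carrier_sub])
 have ex: "e ?x = r \<otimes> e v" using linear_mapsD(3)[OF e r(1) vc] by simp
 have rm: "r \<otimes> m \<in> \<mm>" by (rule ideal.I_l_closed[OF ideal_\<mm> m(1) r(1)])
 have "r = r \<otimes> e v \<oplus> r \<otimes> m" using r_distr[OF evc mc r(1)] m(2) r_one[OF r(1)] by simp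
 then have "r \<odot>[?Q] w = e ?x \<odot>[?Q] w \<oplus>[?Q] (r \<otimes> m) \<odot>[?Q] w"
  unfolding ex using Q.smult_l_distr[of "r \<otimes> e v" "r \<otimes> m" w] r(1) evc mc wc by simp
 then have "y = e ?x \<odot>[?Q] w \<oplus>[?Q] ((r \<otimes> m) \<odot>[?Q] w \<oplus>[?Q] u)"
  unfolding r(3) using Q.smult_closed[OF _ wc] r(1) evc mc submodule_carrier[OF B r(2)] ex by (simp only: Q.M.a_assoc m_closed)
 moreover have "(r \<otimes> m) \<odot>[?Q] w \<in> bnd Y ?M I (carrier R) 0" using aug_iff[OF resY] rm \<mm>_carrier by blast
 moreover have "?x \<in> vec R (rk X 0)" using F.smult_closed[OF r(1) vc] by simp
 ultimately show ?thesis using submodule_add[OF B _ r(2)] by blast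
qed

end

end

end

section \<open>Large homomorphisms\<close>

context local_noetherian
begin

lemma residue_map_eq_iff:
 assumes "r \<in> carrier R" "s \<in> carrier R"
 shows "residue_map R r = residue_map R s \<longleftrightarrow> (\<exists>m\<in>\<mm>. r = s \<oplus> m)"
proof -
 have "\<mm> +> r = \<mm> +> s \<longleftrightarrow> (\<exists>m\<in>\<mm>. r = s \<oplus>[reg R] m)"
  using quot_module_facts(5)[OF regular carrier_sub ideal_submodule[OF ideal_\<mm>], of r s] \<mm>_carrier assms
  by (simp add: a_r_coset_def' subset_iff)
 then show ?thesis unfolding residue_map_def max_ideal_eq by simp
qed

text \<open>The map of residue fields induced by a quotient map sends classes to classes.\<close>

lemma residue_field_map_class:
 assumes J: "ideal J R" "J \<subseteq> \<mm>" and r: "r \<in> carrier R"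
 shows "residue_field_map (R Quot J) (\<lambda>r. J +> r) (residue_map R r) = residue_map (R Quot J) (J +> r)"
 unfolding residue_field_map_def
proof (rule coset_map_eq)
 let ?\<pi> = "\<lambda>r. J +> r" and ?\<rho> = "\<lambda>r. residue_map (R Quot J) (J +> r)"
 note Q = quotient_facts[OF J]
 note red = residue_reduction[OF Q(1-4)]
 have \<mm>r: "residue_map R r = {m \<oplus> r | m. m \<in> \<mm>}" unfolding residue_map_def max_ideal_eq a_r_coset_def' by blast
 show "residue_map R r \<noteq> {}" unfolding \<mm>r using submodule_zero[OF ideal_submodule[OF ideal_\<mm>]] by blast
 fix x assume "x \<in> residue_map R r"
 then obtain m where m: "m \<in> \<mm>" "x = m \<oplus> r" unfolding \<mm>r by blast
 have mc: "m \<in> carrier R" by (rule \<mm>_carrier[OF m(1)])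
 have "?\<rho> m = \<zero>[residue_field (R Quot J)] \<longleftrightarrow> m \<in> \<mm>" using mc by (rule residue_reduction(3)[OF Q(1-4), rotated])
 then have \<rho>m: "?\<rho> m = \<zero>[residue_field (R Quot J)]" using m(1) by blast
 interpret l: cring "residue_field (R Quot J)" by (rule local_noetherian.residue_field_facts(1)[OF Q(1)])
 have "?\<rho> x = ?\<rho> m \<oplus>[residue_field (R Quot J)] ?\<rho> r" unfolding m(2) by (rule ring_hom_add[OF red(1) mc r])
 also have "\<dots> = ?\<rho> r" unfolding \<rho>m using ring_hom_closed[OF red(1) r] by simp
 finally show "max_ideal (R Quot J) +>\<^bsub>R Quot J\<^esub> (J +> x) = residue_map (R Quot J) (J +> r)" unfolding residue_map_def .
qed

text \<open>A chain map over \<open>R\<close> between the lifted resolutions reduces to a chain map that computes the map on Tor.\<close>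

context
 fixes I \<Phi>
 assumes I: "ideal I R" "I \<subseteq> \<mm>"
  and \<Phi>: "\<And>i r c. r < rk (residue_complex I) i ==> c < rk base_residue_complex i ==> \<Phi> i r c \<in> carrier R"
begin

abbreviation (input) \<pi> where "\<pi> \<equiv> \<lambda>r. I +> r"
abbreviation (input) F where "F \<equiv> fst (chosen_resolution R (residue_module R))"
abbreviation (input) G where "G \<equiv> fst (chosen_resolution (R Quot I) (residue_module (R Quot I)))"
abbreviation (input) A where "A \<equiv> \<lambda>i r c. \<pi> (\<Phi> i r c)"
abbreviation (input) k where "k \<equiv> residue_field R"
abbreviation (input) l where "l \<equiv> residue_field (R Quot I)"
abbreviation (input) \<sigma> where "\<sigma> \<equiv> \<lambda>r. residue_map (R Quot I) (\<pi> r)"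
abbreviation (input) \<phi> where
 "\<phi> i \<equiv> matrix_map (reg R) (rk (residue_complex I) i) (rk base_residue_complex i) (\<Phi> i)"

lemma resolution_facts:
 shows "rk base_residue_complex = rk F" and "rk (residue_complex I) = rk G"
  and "reduction (R Quot I) \<pi> I (residue_complex I) G"
  and "reduction k (\<lambda>r. residue_map R r) \<mm> base_residue_complex (base_change (residue_map R) F)"
  and "reduction l \<sigma> \<mm> (residue_complex I) (base_change (residue_map (R Quot I)) G)"
proof -
 note Q = quotient_facts[OF I]
 note F = chosen_residue_resolution and G = local_noetherian.chosen_residue_resolution[OF Q(1)]
 show "rk base_residue_complex = rk F" "rk (residue_complex I) = rk G"
  unfolding base_residue_complex_def residue_complex_def lift_complex_def by simp_all
 show "reduction (R Quot I) \<pi> I (residue_complex I) G"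
  unfolding residue_complex_def by (rule lift_free_resolution(1)[OF Q(1-4) I(1) Q(5) G])
 have "dif F (Suc i) r c \<in> carrier R" if "r < rk F i" "c < rk F (Suc i)" for i r c
  using F that unfolding free_resolution_def by simp
 from residue_complex_reduction[OF identity_reduction(1-4) this]
 show "reduction k (\<lambda>r. residue_map R r) \<mm> base_residue_complex (base_change (residue_map R) F)"
  unfolding base_residue_complex_def .
 have "dif G (Suc i) r c \<in> carrier (R Quot I)" if "r < rk G i" "c < rk G (Suc i)" for i r c
  using G that unfolding free_resolution_def by simp
 from residue_complex_reduction[OF Q(1-4) this]
 show "reduction l \<sigma> \<mm> (residue_complex I) (base_change (residue_map (R Quot I)) G)"
  unfolding residue_complex_def .
qed

lemma \<phi>_tuples: "x \<in> vec R (rk F i) ==> \<phi> i x \<in> vec R (rk G i)"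
 using matrix_map_tuples[OF regular carrier_sub \<Phi>] unfolding resolution_facts(1,2) .

lemma semilin_apply_quotient:
 assumes x: "x \<in> vec R (rk F i)"
 shows "semilin_apply (R Quot I) (rk G i) (rk F i) (A i) \<pi> x = tuple_map (rk G i) \<pi> (\<phi> i x)"
 unfolding semilin_apply_def tuple_map_def[of "rk F i" \<pi>, symmetric] resolution_facts(1,2)
 using \<Phi> unfolding resolution_facts(1,2)
 by (intro mat_apply_tuple_map[OF is_cring ideal.quotient_is_cring[OF I(1) is_cring] quotient_facts(2)[OF I] _ _ x]) simp_all

lemma semilin_apply_residue:
 assumes x: "x \<in> vec R (rk F i)"
 shows "semilin_apply l (rk G i) (rk F i) (\<lambda>r c. residue_map (R Quot I) (A i r c)) (residue_field_map (R Quot I) \<pi>)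
  (tuple_map (rk F i) (\<lambda>r. residue_map R r) x) = tuple_map (rk G i) \<sigma> (\<phi> i x)"
proof -
 note Q = quotient_facts[OF I]
 have "(\<lambda>j\<in>{..<rk F i}. residue_field_map (R Quot I) \<pi> (tuple_map (rk F i) (\<lambda>r. residue_map R r) x j)) = tuple_map (rk F i) \<sigma> x"
  unfolding tuple_map_def using residue_field_map_class[OF I tuples_mem[OF x]] by (intro restrict_ext) simp
 then show ?thesis
  unfolding semilin_apply_def resolution_facts(1,2) using \<Phi> unfolding resolution_facts(1,2)
  using mat_apply_tuple_map[OF is_cring local_noetherian.residue_field_facts(1)[OF Q(1)] residue_reduction(1)[OF Q(1-4)] _ _ x, of "rk G i" "\<Phi> i"]
  by simp
qed

context
 fixes v w
 assumes resX: "residue_resolution {\<zero>} base_residue_complex v" and resY: "residue_resolution I (residue_complex I) w"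
  and cyc: "\<And>i x. x \<in> rcyc R base_residue_complex \<mm> i ==>
   \<phi> i x \<in> rcyc R (residue_complex I) \<mm> i"
  and bnd: "\<And>i x. x \<in> rbnd R base_residue_complex \<mm> i ==>
   \<phi> i x \<in> rbnd R (residue_complex I) \<mm> i"
  and surj: "\<And>i y. y \<in> rcyc R (residue_complex I) \<mm> i ==>
   \<exists>x\<in>rcyc R base_residue_complex \<mm> i. \<exists>u\<in>rbnd R (residue_complex I) \<mm> i.
    y = \<phi> i x \<oplus>[fm R (rk (residue_complex I) i)] u"
begin

lemma Tor_map_surjective:
 "Tor_kk_map R (R Quot I) \<pi> A i ` carrier (Tor_k R (residue_module R) i) = carrier (Tor_k (R Quot I) (residue_module (R Quot I)) i)"
proof -
 let ?X = base_residue_complex and ?Y = "residue_complex I" and ?M = "reg R"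
 let ?kF = "base_change (residue_map R) F" and ?kG = "base_change (residue_map (R Quot I)) G"
 let ?Fi = "fm k (rk F i)" and ?Gi = "fm l (rk G i)"
 let ?t = "tuple_map (rk F i) (\<lambda>r. residue_map R r)" and ?s = "tuple_map (rk G i) \<sigma>"
 let ?ZX = "cyc ?X ?M \<mm> (carrier R) i" and ?BX = "bnd ?X ?M \<mm> (carrier R) i"
 let ?ZY = "cyc ?Y ?M \<mm> (carrier R) i" and ?BY = "bnd ?Y ?M \<mm> (carrier R) i"
 note rks = resolution_facts(1,2)
 have rkk: "rk ?kF = rk F" "rk ?kG = rk G" unfolding base_change_def by simp_all
 note rX = resolution_facts(4) and rY = resolution_facts(5)
 have z: "{\<zero>} \<subseteq> \<mm>" using submodule_zero[OF ideal_submodule[OF ideal_\<mm>]] by simp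
 have cX: "complex_mod ?X ?M \<mm> (carrier R)" by (rule complex_mod_mono[OF complex[OF resX] z subset_refl])
 have cY: "complex_mod ?Y ?M \<mm> (carrier R)" by (rule complex_mod_mono[OF complex[OF resY] I(2) subset_refl])
 note hX = reduction_homology(1-4)[OF rX, of i, unfolded rkk] reduction_homology(5)[OF rX cX, of i]
 note hY = reduction_homology(1-4)[OF rY, of i, unfolded rkk] reduction_homology(5)[OF rY cY, of i]
 interpret k: cring k by (rule residue_field_facts(1))
 interpret l: cring l by (rule red_T[OF rY])
 interpret Fi: module k ?Fi by (rule k.free_mod)
 note QX = quot_module_facts[OF k.free_mod hX(3-5)] and QY = quot_module_facts[OF l.free_mod hY(3-5)]
 let ?BF = "boundaries (fmod k ?kF) (fdif k ?kF) i" and ?BG = "boundaries (fmod l ?kG) (fdif l ?kG) i"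
 have TX: "carrier (Tor_k R (residue_module R) i) = (\<lambda>x. ?BF +>\<^bsub>?Fi\<^esub> ?t x) ` ?ZX"
  unfolding Tor_k_def res_tensor_k_def homology_def fmod_def[of k ?kF i] rkk QX(1) unfolding hX(1) image_image ..
 have TY: "carrier (Tor_k (R Quot I) (residue_module (R Quot I)) i) = (\<lambda>y. ?BG +>\<^bsub>?Gi\<^esub> ?s y) ` ?ZY"
  unfolding Tor_k_def res_tensor_k_def homology_def fmod_def[of l ?kG i] rkk QY(1) unfolding hY(1) image_image ..
 have ZXt: "x \<in> vec R (rk F i)" if "x \<in> ?ZX" for x using cyc_tuples[OF that] unfolding rks .
 have ZYt: "y \<in> vec R (rk G i)" if "y \<in> ?ZY" for y using cyc_tuples[OF that] unfolding rks .
 have sZ: "?s y \<in> cycles (fmod l ?kG) (fdif l ?kG) i" if "y \<in> ?ZY" for y unfolding hY(1) using that by (rule imageI)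
 note ms = ideal_submodule[OF ideal_\<mm>] and cs = carrier_sub
 have BXs: "submodule ?BX R (fm R (rk F i))" and ZXs: "submodule ?ZX R (fm R (rk F i))"
  using bnd_submodule[OF matrices[OF resX] regular ms cs, of i] cyc_submodule[OF matrices[OF resX] regular ms cs, of i]
  unfolding rks free_pow .
 have ZYs: "submodule ?ZY R (fm R (rk G i))"
  using cyc_submodule[OF matrices[OF resY] regular ms cs, of i] unfolding rks free_pow .
 have BXZ: "?BX \<subseteq> ?ZX" and BYZ: "?BY \<subseteq> ?ZY"
  using \<mm>_carrier by (intro bnd_subset_cyc[OF _ regular ms cs _ cX] bnd_subset_cyc[OF _ regular ms cs _ cY] matrices[OF resX] matrices[OF resY] subsetI; simp)+
 have \<phi>l: "\<phi> i \<in> linear_maps R (fm R (rk F i)) (fm R (rk G i))"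
 proof -
  have "\<phi> i \<in> linear_maps R (pow ?M (rk ?X i)) (pow ?M (rk ?Y i))"
   by (rule matrix_map_linear[OF regular \<Phi>])
  then show ?thesis unfolding rks free_pow .
 qed
 \<comment> \<open>the class in the target depends only on the class modulo boundaries\<close>
 have same: "?BG +>\<^bsub>?Gi\<^esub> ?s (y \<oplus>[fm R (rk G i)] u) = ?BG +>\<^bsub>?Gi\<^esub> ?s y" if y: "y \<in> ?ZY" and u: "u \<in> ?BY" for y u
 proof -
  have uZ: "u \<in> ?ZY" using u BYZ by blast
  have yu: "y \<oplus>[fm R (rk G i)] u \<in> ?ZY" by (rule submodule_add[OF ZYs y uZ])
  have "?s (y \<oplus>[fm R (rk G i)] u) = ?s y \<oplus>[?Gi] ?s u" by (rule reduction_add[OF rY ZYt[OF y] ZYt[OF uZ]])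
  moreover have "?s u \<in> ?BG" unfolding hY(2) using u by (rule imageI)
  ultimately show ?thesis using QY(5)[OF sZ[OF yu] sZ[OF y]] by blast
 qed
 have cls: "Tor_kk_map R (R Quot I) \<pi> A i (?BF +>\<^bsub>?Fi\<^esub> ?t x) = ?BG +>\<^bsub>?Gi\<^esub> ?s (\<phi> i x)" if x: "x \<in> ?ZX" for x
  unfolding Tor_kk_map_def Let_def res_tensor_k_def fmod_def[of l ?kG i] rkk
 proof (rule coset_map_eq)
  show "?BF +>\<^bsub>?Fi\<^esub> ?t x \<noteq> {}"
   using submodule_zero[OF hX(4)] unfolding a_r_coset_def' by blast
  fix c assume "c \<in> ?BF +>\<^bsub>?Fi\<^esub> ?t x"
  then obtain b where b: "b \<in> ?BX" "c = ?t b \<oplus>[?Fi] ?t x" unfolding a_r_coset_def' hX(2) by blast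
  have bZ: "b \<in> ?ZX" using b(1) BXZ by blast
  have bc: "b \<in> carrier (fm R (rk F i))" "x \<in> carrier (fm R (rk F i))" using ZXt bZ x by simp_all
  interpret FR: module R "fm R (rk F i)" by (rule free_mod)
  have xb: "x \<oplus>[fm R (rk F i)] b \<in> vec R (rk F i)" by (rule ZXt[OF submodule_add[OF ZXs x bZ]])
  have "c = ?t (x \<oplus>[fm R (rk F i)] b)"
   unfolding b(2) FR.M.a_comm[OF bc(2,1)] by (rule reduction_add[OF rX ZXt[OF bZ] ZXt[OF x], symmetric])
  then have "semilin_apply l (rk G i) (rk F i) (\<lambda>r c. residue_map (R Quot I) (A i r c)) (residue_field_map (R Quot I) \<pi>) c =
    ?s (\<phi> i x \<oplus>[fm R (rk G i)] \<phi> i b)"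
   using semilin_apply_residue[OF xb] linear_mapsD(2)[OF \<phi>l bc(2,1)] by simp
  then show "?BG +>\<^bsub>?Gi\<^esub> semilin_apply l (rk G i) (rk F i) (\<lambda>r c. residue_map (R Quot I) (A i r c)) (residue_field_map (R Quot I) \<pi>) c =
    ?BG +>\<^bsub>?Gi\<^esub> ?s (\<phi> i x)"
   using same[OF cyc[OF x] bnd[OF b(1)]] by simp
 qed
 show ?thesis
 proof (intro equalityI subsetI)
  fix c assume "c \<in> Tor_kk_map R (R Quot I) \<pi> A i ` carrier (Tor_k R (residue_module R) i)"
  then obtain x where x: "x \<in> ?ZX" "c = Tor_kk_map R (R Quot I) \<pi> A i (?BF +>\<^bsub>?Fi\<^esub> ?t x)" unfolding TX by (elim imageE) simp
  show "c \<in> carrier (Tor_k (R Quot I) (residue_module (R Quot I)) i)"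
   unfolding x(2) cls[OF x(1)] TY by (rule imageI[OF cyc[OF x(1)]])
 next
  fix c assume "c \<in> carrier (Tor_k (R Quot I) (residue_module (R Quot I)) i)"
  then obtain y where y: "y \<in> ?ZY" "c = ?BG +>\<^bsub>?Gi\<^esub> ?s y" unfolding TY by (elim imageE) simp
  obtain x u where xu: "x \<in> ?ZX" "u \<in> ?BY" "y = \<phi> i x \<oplus>[fm R (rk G i)] u" using surj[OF y(1)] unfolding rks by blast
  have "c = Tor_kk_map R (R Quot I) \<pi> A i (?BF +>\<^bsub>?Fi\<^esub> ?t x)"
   unfolding y(2) xu(3) same[OF cyc[OF xu(1)] xu(2)] cls[OF xu(1)] ..
  then show "c \<in> Tor_kk_map R (R Quot I) \<pi> A i ` carrier (Tor_k R (residue_module R) i)"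
   unfolding TX using xu(1) by blast
 qed
qed

end

end

end

context local_noetherian
begin

theorem large_quotient:
 assumes I: "ideal I R" "I \<subseteq> \<mm>" and koszul: "koszul_module R (ring_as_module (R Quot I) (\<lambda>r. I +> r))"
 shows "large_hom R (R Quot I) (\<lambda>r. I +> r)"
proof -
 let ?\<pi> = "\<lambda>r. I +> r" and ?X = base_residue_complex and ?Y = "residue_complex I" and ?M = "reg R"
 let ?F = "fst (chosen_resolution R (residue_module R))" and ?\<epsilon> = "snd (chosen_resolution R (residue_module R))"
 let ?G = "fst (chosen_resolution (R Quot I) (residue_module (R Quot I)))" and ?\<eta> = "snd (chosen_resolution (R Quot I) (residue_module (R Quot I)))"
 note Q = quotient_facts[OF I]
 have z: "{\<zero>} \<subseteq> \<mm>" using submodule_zero[OF ideal_submodule[OF ideal_\<mm>]] by simp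
 have rkX: "rk ?X = rk ?F" and rkY: "rk ?Y = rk ?G" unfolding base_residue_complex_def residue_complex_def lift_complex_def by simp_all
 note GF = chosen_residue_resolution and GG = local_noetherian.chosen_residue_resolution[OF Q(1)]
 note XF = exact_complex_lift[OF GF, folded base_residue_complex_def]
 note YG = lift_free_resolution[OF Q(1-4) I(1) Q(5) GG, folded residue_complex_def]
 obtain v where resX: "residue_resolution {\<zero>} ?X v"
  and \<epsilon>v: "\<And>r. r \<in> carrier R ==> ?\<epsilon> (tuple_map (rk ?F 0) (\<lambda>r. r) (r \<odot>[fm R (rk ?F 0)] v)) = residue_map R r"
  using residue_resolution_lift[OF identity_reduction z GF] unfolding base_residue_complex_def by blast
 obtain w where resY: "residue_resolution I ?Y w"
  and \<eta>w: "\<And>r. r \<in> carrier R ==> ?\<eta> (tuple_map (rk ?G 0) ?\<pi> (r \<odot>[fm R (rk ?G 0)] w)) = residue_map (R Quot I) (?\<pi> r)"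
  using residue_resolution_lift[OF Q(1-4) I(1) Q(5) I(2) GG] unfolding residue_complex_def by blast
 interpret F0: module R "fm R (rk ?X 0)" by (rule free_mod)
 have \<epsilon>: "?\<epsilon> \<in> linear_maps R (fm R (rk ?X 0)) (residue_module R)"
  using GF unfolding free_resolution_def fmod_def rkX by simp
 have \<rho>: "residue_map R \<in> linear_maps R ?M (residue_module R)" "residue_map R ` carrier ?M = carrier (residue_module R)"
  unfolding residue_module_def using ring_hom_linear[OF residue_field_facts(2)] residue_field_facts(3) by simp_all
 obtain e where e: "e \<in> linear_maps R (fm R (rk ?X 0)) ?M"
  and \<rho>e: "\<And>x. x \<in> vec R (rk ?X 0) ==> residue_map R (e x) = ?\<epsilon> x"
  using free_module_lift[OF residue_field_facts(5) regular \<rho> \<epsilon>] by blast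
 have ec: "e x \<in> carrier R" if "x \<in> vec R (rk ?X 0)" for x using linear_mapsD(1)[OF e, of x] that by simp
 have zero: "\<zero>[residue_module R] = \<zero>[residue_field R]" unfolding residue_module_def ring_as_module_def by simp
 have e_bnd: "e x \<in> \<mm>" if x: "x \<in> vec R (rk ?X 0)" and b: "x \<in> bnd ?X ?M {\<zero>} (carrier R) 0" for x
 proof -
  have "?\<epsilon> x = \<zero>[residue_module R]"
   using XF(4) x b unfolding rkX bnd_zero[OF matrices[OF resX]] by blast
  then show ?thesis using residue_field_facts(4)[OF ec[OF x]] unfolding \<rho>e[OF x] zero by blast
 qed
 have vt: "v \<in> vec R (rk ?X 0)" by (rule v[OF resX])
 have "\<one> \<odot>[fm R (rk ?X 0)] v = v" using F0.smult_one[of v] vt by simp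
 then have "?\<epsilon> v = residue_map R \<one>"
  using \<epsilon>v[OF one_closed] tuple_map_identity[OF vt] unfolding rkX by simp
 then have "residue_map R \<one> = residue_map R (e v)" using \<rho>e[OF vt] by simp
 then have e_v: "\<exists>m\<in>\<mm>. \<one> = e v \<oplus> m" using residue_map_eq_iff[OF one_closed ec[OF vt]] by blast
 note null = koszul_null(1)[OF I koszul resX]
 obtain \<Phi> where \<Phi>0: "\<And>x. x \<in> vec R (rk ?X 0) ==>
   matrix_map ?M (rk ?Y 0) (rk ?X 0) (\<Phi> 0) x = e x \<odot>[fm R (rk ?Y 0)] w"
  and \<Phi>: "\<And>i r c. r < rk ?Y i ==> c < rk ?X i ==> \<Phi> i r c \<in> carrier R"
  and chain: "\<And>i x. x \<in> vec R (rk ?X (Suc i)) ==> \<exists>u\<in>tuples (rk ?Y i) I.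
   matrix_map ?M (rk ?Y i) (rk ?X i) (\<Phi> i) (cdif ?X ?M (Suc i) x) =
   cdif ?Y ?M (Suc i) (matrix_map ?M (rk ?Y (Suc i)) (rk ?X (Suc i)) (\<Phi> (Suc i)) x) \<oplus>[pow ?M (rk ?Y i)] u"
 proof -
  have "\<exists>\<Phi>. (\<forall>x\<in>vec R (rk ?X 0). matrix_map ?M (rk ?Y 0) (rk ?X 0) (\<Phi> 0) x = e x \<odot>[fm R (rk ?Y 0)] w) \<and>
   (\<forall>i. \<forall>r<rk ?Y i. \<forall>c<rk ?X i. \<Phi> i r c \<in> carrier R) \<and>
   (\<forall>i. \<forall>x\<in>vec R (rk ?X (Suc i)). \<exists>u\<in>tuples (rk ?Y i) I.
    matrix_map ?M (rk ?Y i) (rk ?X i) (\<Phi> i) (cdif ?X ?M (Suc i) x) =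
    cdif ?Y ?M (Suc i) (matrix_map ?M (rk ?Y (Suc i)) (rk ?X (Suc i)) (\<Phi> (Suc i)) x) \<oplus>[pow ?M (rk ?Y i)] u)" (is "\<exists>\<Phi>. ?P \<Phi>")
   by (rule residue_chain_map[OF I(1) resX resY e e_bnd e_v])
  then obtain \<Phi> where P: "?P \<Phi>" by (rule exE)
  have P2: "\<Phi> i r c \<in> carrier R" if "r < rk ?Y i" "c < rk ?X i" for i r c
   using conjunct1[OF conjunct2[OF P]] that by blast
  show thesis
   by (rule that[OF bspec[OF conjunct1[OF P]] P2 bspec[OF spec[OF conjunct2[OF conjunct2[OF P]]]]])
 qed
 have aug_surj: "\<exists>x\<in>vec R (rk ?X 0). \<exists>u\<in>bnd ?Y ?M I (carrier R) 0.
   y = matrix_map ?M (rk ?Y 0) (rk ?X 0) (\<Phi> 0) x \<oplus>[pow ?M (rk ?Y 0)] u" if y: "y \<in> vec R (rk ?Y 0)" for y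
 proof -
  have "\<exists>x\<in>vec R (rk ?X 0). \<exists>u\<in>bnd ?Y ?M I (carrier R) 0.
   y = e x \<odot>[fm R (rk ?Y 0)] w \<oplus>[fm R (rk ?Y 0)] u"
   by (rule start_surj[OF I(1) resX resY e e_bnd e_v y])
  then show ?thesis using \<Phi>0 unfolding free_pow by (elim bexE) (intro bexI; simp)
 qed
 let ?A = "\<lambda>i r c. ?\<pi> (\<Phi> i r c)" and ?\<phi> = "\<lambda>i. matrix_map ?M (rk ?Y i) (rk ?X i) (\<Phi> i)"
 have \<phi>t: "?\<phi> i x \<in> vec R (rk ?G i)" if x: "x \<in> vec R (rk ?F i)" for i x
  by (rule \<phi>_tuples[OF I \<Phi> x])
 have semi: "semilin_apply (R Quot I) (rk ?G i) (rk ?F i) (?A i) ?\<pi> x = tuple_map (rk ?G i) ?\<pi> (?\<phi> i x)"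
  if x: "x \<in> vec R (rk ?F i)" for i x by (rule semilin_apply_quotient[OF I \<Phi> x])
 have "chain_lift R (R Quot I) ?\<pi> (residue_field_map (R Quot I) ?\<pi>)
   (chosen_resolution R (residue_module R)) (chosen_resolution (R Quot I) (residue_module (R Quot I))) ?A"
  unfolding chain_lift_def Let_def
 proof (intro conjI allI impI ballI)
  fix i r c assume "r < rk ?G i" "c < rk ?F i"
  then show "?A i r c \<in> carrier (R Quot I)" using \<Phi> ring_hom_closed[OF Q(2)] unfolding rkX rkY by simp
 next
  fix i :: nat and x assume "1 \<le> i" and x: "x \<in> carrier (fmod R ?F i)"
  then obtain j where j: "i = Suc j" by (cases i) auto
  have xt: "x \<in> vec R (rk ?F (Suc j))" using x unfolding j fmod_def by simp
  let ?d = "cdif ?X ?M (Suc j) x" and ?z = "cdif ?Y ?M (Suc j) (?\<phi> (Suc j) x)"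
  have dt: "?d \<in> vec R (rk ?F j)"
   using cdif_tuples[OF matrices[OF resX] regular carrier_sub, of x j] xt unfolding rkX by blast
  have zt: "?z \<in> vec R (rk ?G j)"
   using cdif_tuples[OF matrices[OF resY] regular carrier_sub, of "?\<phi> (Suc j) x" j] \<phi>t[OF xt] unfolding rkY by blast
  obtain u where u: "u \<in> tuples (rk ?G j) I" "?\<phi> j ?d = ?z \<oplus>[fm R (rk ?G j)] u"
   using chain[of x j] xt unfolding rkX rkY free_pow by blast
  have ut: "u \<in> vec R (rk ?G j)" using u(1) tuples_mono[of I "carrier R"] ideal.Icarr[OF I(1)] by blast
  interpret S: module "R Quot I" "fm (R Quot I) (rk ?G j)" by (rule cring.free_mod[OF red_T[OF YG(1)]])
  have u0: "tuple_map (rk ?G j) ?\<pi> u = \<zero>[fm (R Quot I) (rk ?G j)]"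
   using reduction_zero[OF YG(1) ut] u(1) by blast
  have "tuple_map (rk ?G j) ?\<pi> ?z \<in> carrier (fm (R Quot I) (rk ?G j))"
   using reduction_closed[OF YG(1) zt] unfolding free_module_simps(1) .
  then have "tuple_map (rk ?G j) ?\<pi> (?\<phi> j ?d) = tuple_map (rk ?G j) ?\<pi> ?z"
   using reduction_add[OF YG(1) zt ut] S.M.r_zero unfolding u(2) u0 by metis
  moreover have "fdif (R Quot I) ?G (Suc j) (tuple_map (rk ?G (Suc j)) ?\<pi> (?\<phi> (Suc j) x)) = tuple_map (rk ?G j) ?\<pi> ?z"
   by (rule reduction_fdif[OF YG(1) \<phi>t[OF xt]])
  ultimately show "semilin_apply (R Quot I) (rk ?G (i - 1)) (rk ?F (i - 1)) (?A (i - 1)) ?\<pi> (fdif R ?F i x) =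
   fdif (R Quot I) ?G i (semilin_apply (R Quot I) (rk ?G i) (rk ?F i) (?A i) ?\<pi> x)"
   unfolding j diff_Suc_1 XF(3)[OF xt] semi[OF dt] semi[OF xt] by (rule trans[OF _ sym])
 next
  fix x assume "x \<in> carrier (fmod R ?F 0)"
  then have x: "x \<in> vec R (rk ?F 0)" "x \<in> vec R (rk ?X 0)" unfolding fmod_def rkX by simp_all
  show "?\<eta> (semilin_apply (R Quot I) (rk ?G 0) (rk ?F 0) (?A 0) ?\<pi> x) = residue_field_map (R Quot I) ?\<pi> (?\<epsilon> x)"
   unfolding semi[OF x(1)] \<Phi>0[OF x(2)] \<rho>e[OF x(2), symmetric] residue_field_map_class[OF I ec[OF x(2)]]
   unfolding rkY by (rule \<eta>w[OF ec[OF x(2)]])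
 qed
 moreover have "Tor_kk_map R (R Quot I) ?\<pi> ?A i ` carrier (Tor_k R (residue_module R) i) =
   carrier (Tor_k (R Quot I) (residue_module (R Quot I)) i)" for i
 proof (rule Tor_map_surjective[OF I \<Phi> resX resY])
  fix i x assume c: "x \<in> cyc ?X ?M \<mm> (carrier R) i"
  show "?\<phi> i x \<in> cyc ?Y ?M \<mm> (carrier R) i" by (rule residue_chain_cyc[OF I(1) resX resY null \<Phi> chain aug_surj c])
 next
  fix i x assume c: "x \<in> bnd ?X ?M \<mm> (carrier R) i"
  show "?\<phi> i x \<in> bnd ?Y ?M \<mm> (carrier R) i" by (rule residue_chain_bnd[OF I(1) resX resY null \<Phi> chain aug_surj c])
 next
  fix i y assume c: "y \<in> cyc ?Y ?M \<mm> (carrier R) i"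
  show "\<exists>x\<in>cyc ?X ?M \<mm> (carrier R) i. \<exists>u\<in>bnd ?Y ?M \<mm> (carrier R) i. y = ?\<phi> i x \<oplus>[fm R (rk ?Y i)] u"
   by (rule residue_homology_surjective[OF I(1) resX resY null \<Phi> chain aug_surj c])
 qed
 ultimately show ?thesis unfolding large_hom_def using Q(6) by blast
qed

end

theorem corollary3p5:
  fixes R :: "('a, 'r) ring_scheme" (structure)
    and \<mm> I :: "'a set"
  assumes "local_ring R"
    and "maximalideal \<mm> R"
    and "ideal I R"
    and "I \<noteq> carrier R"
    and "I \<inter> (\<mm> \<cdot>\<^bsub>R\<^esub> \<mm>) = \<mm> \<cdot>\<^bsub>R\<^esub> I"
    and "koszul_module R (ring_as_module (R Quot I) (\<lambda>r. I +>\<^bsub>R\<^esub> r))"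
  shows "large_hom R (R Quot I) (\<lambda>r. I +>\<^bsub>R\<^esub> r) \<and>
         golod_hom R (R Quot (\<mm> \<cdot>\<^bsub>R\<^esub> I)) (\<lambda>r. (\<mm> \<cdot>\<^bsub>R\<^esub> I) +>\<^bsub>R\<^esub> r)"
proof -
  interpret local_noetherian R \<mm> by (rule local_noetherianI[OF assms(1,2)])
  have "I \<subseteq> \<mm>" by (rule proper_subset_\<mm>[OF assms(3,4)])
  then show ?thesis using large_quotient golod_quotient assms(3,5,6) by blast
qed

end
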